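(* Let $k\ge0$, $p,q\in\mathbb N_0$, $\mu\in\mathbb C^p$, $\nu\in\mathbb C^q$ with $\nu_i\notin\{0,k,\dots,k(n-1)\}-\mathbb N_0$ for all $i=1,\dots,q$, and $\mu'\in\mathbb C$ with $\mathrm{Re}\,\mu'>\mu_0$. (1) If $p<q$, then for all $z,w\in\mathbb C^n$ with $\mathrm{Re}\,z>0$, $$\int_{\mathbb R_+^n}E(-z,x)\,{}_pK_q(\mu;\nu;w,x)\,\Delta(x)^{\mu'-\mu_0-1}\omega(x)\,dx=\Gamma_n(\mu')\,\Delta(z)^{-\mu'}\,{}_{p+1}K_q\bigl((\mu',\mu);\nu;w,\tfrac1z\bigr).$$ (2) If $p=q$, the identity of (1) holds for all $z,w\in\mathbb C^n$ with $\mathrm{Re}\,z>0$ and $\|w\|_\infty\,\|\tfrac1{\mathrm{Re}\,z}\|_\infty<\tfrac1n$. Both statements remain valid when ${}_pK_q$ and ${}_{p+1}K_q$ are replaced by ${}_pF_q$ and ${}_{p+1}F_q$.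
   Context: Notation: $\langle z,w\rangle=\sum z_iw_i$; $\underline s=(s,\dots,s)$; $\mathbb R_+=(0,\infty)$; vector inequalities, $1/z$, $1/\mathrm{Re}\,z$ componentwise; $s_{ij}$ transposition of coordinates; $T_\xi f(x)=\partial_\xi f(x)+k\sum_{i<j}(\xi_i-\xi_j)\frac{f(x)-f(s_{ij}x)}{x_i-x_j}$, $T_j=T_{e_j}$. Dunkl kernel $E(\lambda,z)$: unique holomorphic function on $\mathbb C^n\times\mathbb C^n$ with $T_\xi E(\lambda,\cdot)=\langle\lambda,\xi\rangle E(\lambda,\cdot)$, $E(\lambda,0)=1$. $\omega(x)=\prod_{i<j}|x_i-x_j|^{2k}$, $\Delta(z)=\prod z_j$, $\Delta(z)^s=\exp(s\sum\mathrm{Log}\,z_j)$ for $\mathrm{Re}\,z>0$, $\mu_0=k(n-1)$, $\Gamma_n(\mu)=d_n(k)\prod_{j=1}^n\Gamma(\mu-k(j-1))$ with $d_n(k)=\prod_{j=1}^n\Gamma(1+jk)/\Gamma(1+k)$, $[\mu]_\eta=\prod_{j=1}^n(\mu-k(j-1))_{\eta_j}$ (Pochhammer symbols). Jack polynomials: $\Lambda_n^+$ = partitions of length $\le n$; $\eta_+$ decreasing rearrangement; $|\eta|=\sum\eta_i$. Order $\prec$ on $\mathbb N_0^n$: $\kappa\prec\eta$ iff $\kappa_+$ is strictly below $\eta_+$ in dominance order ($|\kappa|=|\eta|$, partial sums of $\kappa_+$ $\le$ those of $\eta_+$), or $\kappa_+=\eta_+$ and $w_\eta<w_\kappa$ in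 Bruhat order ($w_\eta$ the shortest permutation with $w_\eta\eta_+=\eta$). With $\mathcal D_j=x_jT_j+k(1-n)+k\sum_{i>j}s_{ij}$ and $\overline\eta_j=\eta_j-k\#\{i<j:\eta_i\ge\eta_j\}-k\#\{i>j:\eta_i>\eta_j\}$, $E_\eta$ is the unique polynomial $x^\eta+\sum_{\kappa\prec\eta}c_{\eta\kappa}x^\kappa$ with $\mathcal D_jE_\eta=\overline\eta_jE_\eta$ for all $j$. Let $c_\eta$ be the unique scalars with $(z_1+\dots+z_n)^m=\sum_{|\eta|=m}c_\eta E_\eta(z)$ for all $m\in\mathbb N_0$ (they are positive); $L_\eta=c_\eta E_\eta$, and $C_\lambda=\sum_{\eta\in\mathcal S_n\lambda}L_\eta$ for $\lambda\in\Lambda_n^+$ (sum over distinct rearrangements). Hypergeometric series: for $\mu\in\mathbb C^p,\nu\in\mathbb C^q$, $[\mu]_\lambda=\prod_{i=1}^p[\mu_i]_\lambda$, $[\nu]_\lambda=\prod_{i=1}^q[\nu_i]_\lambda$ (empty product $=1$), ${}_pK_q(\mu;\nu;z,w)=\sum_{\eta\in\mathbb N_0^n}\frac{[\mu]_{\eta_+}}{[\nu]_{\eta_+}}\frac{L_\eta(z)L_\eta(w)}{|\eta|!\,L_\eta(\underline1)}$ and ${}_pF_q(\mu;\nu;z,w)=\sum_{\lambda\in\Lambda_n^+}\frac{[\mu]_\lambda}{[\nu]_\lambda}\frac{C_\lambda(z)C_\lambda(w)}{|\lambda|!\,C_\lambda(\underline1)}$; $(\mu',\mu)\in\mathbb C^{p+1}$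 denotes the concatenation. *)

theory Defs
  imports "HOL-Analysis.Analysis" "HOL-Combinatorics.Permutations"
begin

text \<open>Index set of coordinates: a finite linearly ordered type 'n, with n = CARD('n).
  Vectors in C^n are complex^'n, multi-indices in N_0^n are 'n \<Rightarrow> nat.\<close>

definition ipos :: "('n::{finite,linorder}) \<Rightarrow> nat" where
  "ipos j = card {i. i < j}"   (* j-1 in 1-based indexing *)

definition bil :: "complex^('n::finite) \<Rightarrow> complex^('n::finite) \<Rightarrow> complex" where
  "bil z w = (\<Sum>i\<in>UNIV. z$i * w$i)"

definition swapc :: "('n::finite) \<Rightarrow> ('n::finite) \<Rightarrow> complex^('n::finite) \<Rightarrow> complex^('n::finite)" where
  "swapc i j x = (\<chi> l. x $ (if l = i then j else if l = j then i else l))"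

definition dderiv :: "(complex^('n::finite) \<Rightarrow> complex) \<Rightarrow> complex^('n::finite) \<Rightarrow> complex^('n::finite) \<Rightarrow> complex" where
  "dderiv f \<xi> x = deriv (\<lambda>t. f (x + t *s \<xi>)) 0"

(* (f(x) - f(s_ij x))/(x_i - x_j), extended continuously to x_i = x_j *)
definition divdiff :: "(complex^('n::finite) \<Rightarrow> complex) \<Rightarrow> ('n::finite) \<Rightarrow> ('n::finite) \<Rightarrow> complex^('n::finite) \<Rightarrow> complex" where
  "divdiff f i j x = (if x$i = x$j then dderiv f (axis i 1 - axis j 1) x
                      else (f x - f (swapc i j x)) / (x$i - x$j))"

definition dunkl_op :: "real \<Rightarrow> complex^('n::{finite,linorder}) \<Rightarrow> (complex^('n::{finite,linorder}) \<Rightarrow> complex) \<Rightarrow> complex^('n::{finite,linorder}) \<Rightarrow> complex" where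
  "dunkl_op k \<xi> f x = dderiv f \<xi> x
     + of_real k * (\<Sum>i\<in>UNIV. \<Sum>j\<in>{j. i < j}. (\<xi>$i - \<xi>$j) * divdiff f i j x)"

(* holomorphy on C^n \<times> C^n: complex Frechet differentiability everywhere *)
definition holo2 :: "(complex^('n::finite) \<Rightarrow> complex^('n::finite) \<Rightarrow> complex) \<Rightarrow> bool" where
  "holo2 F \<longleftrightarrow> (\<forall>a b. \<exists>d e. ((\<lambda>p. F (fst p) (snd p)) has_derivative
        (\<lambda>h. bil d (fst h) + bil e (snd h))) (at (a, b)))"

definition dunkl_kernel :: "real \<Rightarrow> complex^('n::{finite,linorder}) \<Rightarrow> complex^('n::{finite,linorder}) \<Rightarrow> complex" where
  "dunkl_kernel k = (THE F. holo2 F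
      \<and> (\<forall>lam \<xi> z. dunkl_op k \<xi> (F lam) z = bil lam \<xi> * F lam z)
      \<and> (\<forall>lam. F lam 0 = 1))"

definition mdeg :: "(('n::finite) \<Rightarrow> nat) \<Rightarrow> nat" where
  "mdeg \<eta> = (\<Sum>i\<in>UNIV. \<eta> i)"

definition monom :: "(('n::finite) \<Rightarrow> nat) \<Rightarrow> complex^('n::finite) \<Rightarrow> complex" where
  "monom \<eta> x = (\<Prod>i\<in>UNIV. (x$i) ^ \<eta> i)"

definition is_partition :: "(('n::{finite,linorder}) \<Rightarrow> nat) \<Rightarrow> bool" where
  "is_partition lam \<longleftrightarrow> (\<forall>i j. i \<le> j \<longrightarrow> lam j \<le> lam i)"

definition pact :: "('n \<Rightarrow> 'n) \<Rightarrow> ('n \<Rightarrow> nat) \<Rightarrow> ('n \<Rightarrow> nat)" where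
  "pact w \<eta> = \<eta> \<circ> inv w"

definition dec_rearr :: "(('n::{finite,linorder}) \<Rightarrow> nat) \<Rightarrow> (('n::{finite,linorder}) \<Rightarrow> nat)" where
  "dec_rearr \<eta> = (THE \<rho>. is_partition \<rho> \<and> (\<exists>w. w permutes UNIV \<and> \<rho> = pact w \<eta>))"

definition rearrs :: "(('n::finite) \<Rightarrow> nat) \<Rightarrow> (('n::finite) \<Rightarrow> nat) set" where
  "rearrs lam = {\<eta>. \<exists>w. w permutes UNIV \<and> \<eta> = pact w lam}"

definition dom_less :: "(('n::{finite,linorder}) \<Rightarrow> nat) \<Rightarrow> (('n::{finite,linorder}) \<Rightarrow> nat) \<Rightarrow> bool" where
  "dom_less \<rho> \<sigma> \<longleftrightarrow> mdeg \<rho> = mdeg \<sigma> \<and> \<rho> \<noteq> \<sigma>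
      \<and> (\<forall>j. (\<Sum>i\<in>{i. i \<le> j}. \<rho> i) \<le> (\<Sum>i\<in>{i. i \<le> j}. \<sigma> i))"

(* Coxeter length of a permutation = number of inversions *)
definition plen :: "(('n::{finite,linorder}) \<Rightarrow> ('n::{finite,linorder})) \<Rightarrow> nat" where
  "plen w = card {(i, j). i < j \<and> w j < w i}"

definition bruhat_less :: "(('n::{finite,linorder}) \<Rightarrow> ('n::{finite,linorder})) \<Rightarrow> (('n::{finite,linorder}) \<Rightarrow> ('n::{finite,linorder})) \<Rightarrow> bool" where
  "bruhat_less = tranclp (\<lambda>u v. u permutes UNIV \<and>
      (\<exists>a b. a \<noteq> b \<and> v = Transposition.transpose a b \<circ> u) \<and> plen u < plen v)"

definition wperm :: "(('n::{finite,linorder}) \<Rightarrow> nat) \<Rightarrow> (('n::{finite,linorder}) \<Rightarrow> ('n::{finite,linorder}))" where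
  "wperm \<eta> = (THE w. w permutes UNIV \<and> pact w (dec_rearr \<eta>) = \<eta>
      \<and> (\<forall>v. v permutes UNIV \<and> pact v (dec_rearr \<eta>) = \<eta> \<longrightarrow> plen w \<le> plen v))"

definition jprec :: "(('n::{finite,linorder}) \<Rightarrow> nat) \<Rightarrow> (('n::{finite,linorder}) \<Rightarrow> nat) \<Rightarrow> bool" where
  "jprec \<kappa> \<eta> \<longleftrightarrow> mdeg \<kappa> = mdeg \<eta> \<and>
     (dom_less (dec_rearr \<kappa>) (dec_rearr \<eta>)
      \<or> (dec_rearr \<kappa> = dec_rearr \<eta> \<and> bruhat_less (wperm \<eta>) (wperm \<kappa>)))"

definition cher_op :: "real \<Rightarrow> ('n::{finite,linorder}) \<Rightarrow> (complex^('n::{finite,linorder}) \<Rightarrow> complex) \<Rightarrow> complex^('n::{finite,linorder}) \<Rightarrow> complex" where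
  "cher_op k j f x = x$j * dunkl_op k (axis j 1) f x
     + of_real (k * (1 - real CARD('n))) * f x
     + of_real k * (\<Sum>i\<in>{i. j < i}. f (swapc i j x))"

definition etabar :: "real \<Rightarrow> (('n::{finite,linorder}) \<Rightarrow> nat) \<Rightarrow> ('n::{finite,linorder}) \<Rightarrow> real" where
  "etabar k \<eta> j = real (\<eta> j) - k * real (card {i. i < j \<and> \<eta> j \<le> \<eta> i})
                    - k * real (card {i. j < i \<and> \<eta> j < \<eta> i})"

definition jackE :: "real \<Rightarrow> (('n::{finite,linorder}) \<Rightarrow> nat) \<Rightarrow> complex^('n::{finite,linorder}) \<Rightarrow> complex" where
  "jackE k \<eta> = (THE f. (\<exists>c. f = (\<lambda>x. monom \<eta> x + (\<Sum>\<kappa>\<in>{\<kappa>. jprec \<kappa> \<eta>}. c \<kappa> * monom \<kappa> x)))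
        \<and> (\<forall>j x. cher_op k j f x = of_real (etabar k \<eta> j) * f x))"

definition jack_c :: "real \<Rightarrow> (('n::{finite,linorder}) \<Rightarrow> nat) \<Rightarrow> complex" where
  "jack_c k = (THE c. \<forall>m z. (\<Sum>i\<in>UNIV. z$i) ^ m = (\<Sum>\<eta>\<in>{\<eta>. mdeg \<eta> = m}. c \<eta> * jackE k \<eta> z))"

definition jackL :: "real \<Rightarrow> (('n::{finite,linorder}) \<Rightarrow> nat) \<Rightarrow> complex^('n::{finite,linorder}) \<Rightarrow> complex" where
  "jackL k \<eta> z = jack_c k \<eta> * jackE k \<eta> z"

definition jackC :: "real \<Rightarrow> (('n::{finite,linorder}) \<Rightarrow> nat) \<Rightarrow> complex^('n::{finite,linorder}) \<Rightarrow> complex" where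
  "jackC k lam z = (\<Sum>\<eta>\<in>rearrs lam. jackL k \<eta> z)"

definition gpoch :: "real \<Rightarrow> complex \<Rightarrow> (('n::{finite,linorder}) \<Rightarrow> nat) \<Rightarrow> complex" where
  "gpoch k \<mu> lam = (\<Prod>j\<in>UNIV. pochhammer (\<mu> - of_real (k * real (ipos j))) (lam j))"

definition gpochs :: "real \<Rightarrow> complex list \<Rightarrow> (('n::{finite,linorder}) \<Rightarrow> nat) \<Rightarrow> complex" where
  "gpochs k \<mu>s lam = prod_list (map (\<lambda>m. gpoch k m lam) \<mu>s)"

definition ones :: "complex^('n::finite)" where "ones = (\<chi> i. 1)"

definition hypK :: "real \<Rightarrow> complex list \<Rightarrow> complex list \<Rightarrow> complex^('n::{finite,linorder}) \<Rightarrow> complex^('n::{finite,linorder}) \<Rightarrow> complex" where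
  "hypK k \<mu>s \<nu>s z w = (\<Sum>m. \<Sum>\<eta>\<in>{\<eta>. mdeg \<eta> = m}.
      gpochs k \<mu>s (dec_rearr \<eta>) / gpochs k \<nu>s (dec_rearr \<eta>)
      * (jackL k \<eta> z * jackL k \<eta> w / (fact m * jackL k \<eta> ones)))"

definition hypF :: "real \<Rightarrow> complex list \<Rightarrow> complex list \<Rightarrow> complex^('n::{finite,linorder}) \<Rightarrow> complex^('n::{finite,linorder}) \<Rightarrow> complex" where
  "hypF k \<mu>s \<nu>s z w = (\<Sum>m. \<Sum>lam\<in>{lam. is_partition lam \<and> mdeg lam = m}.
      gpochs k \<mu>s lam / gpochs k \<nu>s lam
      * (jackC k lam z * jackC k lam w / (fact m * jackC k lam ones)))"

definition mGamma :: "real \<Rightarrow> complex \<Rightarrow> ('n::{finite,linorder}) itself \<Rightarrow> complex" where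
  "mGamma k \<mu> _ = (\<Prod>j\<in>{1..CARD('n)}. Gamma (of_real (1 + real j * k)) / Gamma (of_real (1 + k)))
                  * (\<Prod>j\<in>(UNIV::'n set). Gamma (\<mu> - of_real (k * real (ipos j))))"

definition Delta_pow :: "complex^('n::finite) \<Rightarrow> complex \<Rightarrow> complex" where
  "Delta_pow z s = exp (s * (\<Sum>j\<in>UNIV. Ln (z$j)))"

definition rpow0 :: "real \<Rightarrow> real \<Rightarrow> real" where
  "rpow0 t a = (if t = 0 \<and> a = 0 then 1 else t powr a)"

definition weight :: "real \<Rightarrow> real^('n::{finite,linorder}) \<Rightarrow> real" where
  "weight k x = (\<Prod>i\<in>UNIV. \<Prod>j\<in>{j. i < j}. rpow0 \<bar>x$i - x$j\<bar> (2 * k))"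

definition cvec :: "real^('n::finite) \<Rightarrow> complex^('n::finite)" where
  "cvec x = (\<chi> i. complex_of_real (x$i))"

definition posorth :: "(real^('n::finite)) set" where
  "posorth = {x. \<forall>i. 0 < x$i}"

definition cinv :: "complex^('n::finite) \<Rightarrow> complex^('n::finite)" where
  "cinv z = (\<chi> i. 1 / z$i)"

end

theory Submission
  imports Defs "HOL-Complex_Analysis.Complex_Analysis"
begin

text \<open>
  The nonsymmetric Jack polynomials are generated from \<open>1\<close> by multiplication with a coordinate and by transpositions
  (with a correction term), where the order of the coordinates that enters the Cherednik operators may vary.
  They are orthogonal for the pairing \<open>p(T) q (0)\<close>, so the Dunkl kernel is \<open>\<Sum>\<eta>. f\<^sub>\<eta>(z) f\<^sub>\<eta>(w) / h\<^sub>\<eta>\<close>.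
  For the Laplace transform \<open>J\<^sub>q(z)\<close> of \<open>q \<Delta>\<^bsup>s\<^esup> \<omega>\<close>, multiplying \<open>q\<close> by \<open>x\<^sub>a\<close> amounts to \<open>-T\<^sub>a\<close> in \<open>z\<close>, and
  inversion of the argument turns \<open>-z\<^sub>a T\<^sub>a\<close> into a Cherednik operator; hence each step of the recursion only
  contributes a factor \<open>\<mu> +\<close> eigenvalue, and these build up the generalized Pochhammer symbol. The constant \<open>J\<^sub>1\<close> comes
  from an integration by parts in \<open>x\<close> and from Selberg's integral, which is evaluated by Aomoto's recursion and
  logarithmic convexity. Summing over \<open>\<eta>\<close> under the integral is justified by the Cauchy--Schwarz bound
  \<open>\<Sum>|f\<^sub>\<eta>(w) f\<^sub>\<eta>(x)| / h\<^sub>\<eta> \<le> (|w| |x|)\<^sup>m / m!\<close>.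
\<close>

section \<open>Dunkl operators on differentiable functions\<close>

text \<open>The Dunkl kernel, the \<open>jackE k \<eta>\<close> and the coefficients
  \<open>jack_c k\<close> are given by definite descriptions, so existence and uniqueness come
  before any computation. One orthogonal basis \<open>jf\<close> serves all three: it spans the
  homogeneous polynomials, the reproducing kernel it defines is the homogeneous component of the
  Dunkl kernel, and the value of that component at \<open>ones\<close> is the expansion of (z_1 +
  ... + z_n)^m. Letting the order vary removes the cyclic shift from the usual raising operator:
  what remains is multiplication by a single coordinate, which under the Laplace transform is a
  single Dunkl operator. The domain in the case p = q comes from comparing growth with decay. With c
  = min Re z_i the kernel decays like exp (- c \<Sum> x_l), while the series grows at most like exp
  (\<delta> |w| \<Sum> x_l), where \<delta> bounds the growth of the quotients of Pochhammer
  symbols: any \<delta> > 0 is possible for p < q, any \<delta> > 1 for p = q. The factor 1/n is the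
  price of |w| \<le> n max |w_i|.\<close>

definition cdiff :: "(complex^('n::finite) => complex) => complex^('n::finite) => bool" where
  "cdiff f x \<longleftrightarrow> (\<exists>d. (f has_derivative bil d) (at x))"

lemma bil_axis [simp]: "bil d (axis i 1) = d $ i" "bil (axis i 1) d = d $ i"
proof -
  have "bil d (axis i 1) = (\<Sum>j\<in>UNIV. if j = i then d $ j else 0)"
    unfolding bil_def by (intro sum.cong refl) (auto simp: axis_def)
  then show "bil d (axis i 1) = d $ i" by simp
  have "bil (axis i 1) d = (\<Sum>j\<in>UNIV. if j = i then d $ j else 0)"
    unfolding bil_def by (intro sum.cong refl) (auto simp: axis_def)
  then show "bil (axis i 1) d = d $ i" by simp
qed

lemma axis_component: "axis i (1::complex) $ l = (if l = i then 1 else 0)"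
  by (simp add: axis_def)

lemma bil_commute: "bil z w = bil w z"
  by (simp add: bil_def mult.commute)

lemma bil_simps [simp]:
  "bil d (x + y) = bil d x + bil d y" "bil d (x - y) = bil d x - bil d y"
  "bil d (- x) = - bil d x" "bil d (c *s x) = c * bil d x" "bil d 0 = 0"
  "bil (x + y) d = bil x d + bil y d" "bil (x - y) d = bil x d - bil y d"
  "bil (- x) d = - bil x d" "bil (c *s x) d = c * bil x d" "bil 0 d = 0"
  by (simp_all add: bil_def algebra_simps sum.distrib sum_subtractf sum_negf sum_distrib_left)

abbreviation tsp :: "'a => 'a => 'a => 'a" where
  "tsp \<equiv> Transposition.transpose"

lemmas tsp_def = Transposition.transpose_def

abbreviation mon :: "('n::finite => nat) => complex^('n::finite) => complex" where
  "mon \<equiv> Defs.monom"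

abbreviation mi :: "nat => ('n::finite => nat) set" where
  "mi m \<equiv> {\<eta>. mdeg \<eta> = m}"

abbreviation jlow :: "('n::{finite,linorder} => nat) => ('n => nat) set" where
  "jlow \<eta> \<equiv> {ka. jprec ka \<eta>}"

lemma swapc_nth: "swapc a b x $ l = x $ tsp a b l"
  by (simp add: swapc_def tsp_def)

lemma swapc_simps [simp]:
  "swapc a b (swapc a b x) = x" "swapc a a x = x" "swapc a b 0 = 0"
  "swapc a b (x + y) = swapc a b x + swapc a b y"
  "swapc a b (x - y) = swapc a b x - swapc a b y"
  "swapc a b (- y) = - swapc a b y"
  "swapc a b (c *s x) = c *s swapc a b x"
  by (simp_all add: vec_eq_iff swapc_nth)

lemma swapc_commute: "swapc a b x = swapc b a x"
  by (simp add: vec_eq_iff swapc_nth transpose_commute)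

lemma swapc_axis: "swapc a b (axis i c) = axis (tsp a b i) c"
  by (auto simp: vec_eq_iff swapc_nth axis_def tsp_def)

lemma swapc_conj:
  "swapc a b (swapc i j x) = swapc (tsp a b i) (tsp a b j) (swapc a b x)"
  by (simp add: vec_eq_iff swapc_nth tsp_def)

lemma swapc_eq_self: "x $ i = x $ j ==> swapc i j x = x"
  by (simp add: vec_eq_iff swapc_def)

lemma bil_swapc: "bil (swapc a b z) w = bil z (swapc a b w)"
proof -
  have "bil (swapc a b z) w = (\<Sum>i\<in>UNIV. z $ tsp a b i * w $ i)"
    by (simp add: bil_def swapc_nth)
  also have "... = (\<Sum>i\<in>UNIV. z $ i * w $ tsp a b i)"
    by (rule sum.reindex_bij_witness[of _ "tsp a b" "tsp a b"]) auto
  finally show ?thesis by (simp add: bil_def swapc_nth)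
qed

lemma bounded_linear_swapc: "bounded_linear (swapc a b)"
proof -
  have "linear (swapc a b)"
    by (rule linearI) (simp_all add: vec_eq_iff swapc_nth)
  then show ?thesis by (simp add: linear_conv_bounded_linear)
qed

section \<open>Directional derivatives along complex lines\<close>

lemma bounded_linear_smult_vec: "bounded_linear (%t::complex. t *s (\<xi>::complex^'n::finite))"
proof -
  have "linear (%t::complex. t *s \<xi>)"
    by (rule linearI) (simp_all add: vec_eq_iff algebra_simps)
  then show ?thesis by (simp add: linear_conv_bounded_linear)
qed

lemma bounded_linear_bil: "bounded_linear (bil d)"
proof -
  have "linear (bil d)"
    by (rule linearI) (simp_all add: bil_def algebra_simps sum.distrib scaleR_sum_right)
  then show ?thesis by (simp add: linear_conv_bounded_linear)
qed

text \<open>A derivative of the form \<open>bil d\<close> is complex linear, so composition with a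
  complex line is holomorphic in its parameter. This links \<open>cdiff\<close> to the one-variable
  \<open>deriv\<close> inside \<open>dderiv\<close>.\<close>

lemma has_field_derivative_line:
  assumes "(f has_derivative bil d) (at x)"
  shows "((%t. f (x + t *s \<xi>)) has_field_derivative bil d \<xi>) (at 0)"
proof -
  have 1: "((%t::complex. x + t *s \<xi>) has_derivative (%t. t *s \<xi>)) (at 0)"
    using bounded_linear.has_derivative[OF bounded_linear_smult_vec[of \<xi>] has_derivative_ident]
    by (auto intro!: derivative_eq_intros)
  have "((%t. f (x + t *s \<xi>)) has_derivative (%t. bil d (t *s \<xi>))) (at 0)"
    using has_derivative_compose[OF 1, of f "bil d"] assms by simp
  then show ?thesis
    by (simp add: has_field_derivative_def mult_commute_abs)
qed

lemma dderiv_eq: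
  assumes "(f has_derivative bil d) (at x)"
  shows "dderiv f \<xi> x = bil d \<xi>"
  unfolding dderiv_def using has_field_derivative_line[OF assms] by (rule DERIV_imp_deriv)

lemma cdiff_dderiv:
  assumes "cdiff f x"
  obtains d where "(f has_derivative bil d) (at x)" "\<And>\<xi>. dderiv f \<xi> x = bil d \<xi>"
  using assms unfolding cdiff_def using dderiv_eq by metis

lemma has_derivative_coord: "((%x::complex^'n::finite. x $ l) has_derivative bil (axis l 1)) (at x)"
  using bounded_linear.has_derivative[OF bounded_linear_vec_nth has_derivative_ident, of l "at x"]
  by (simp add: has_derivative_def bounded_linear_bil)

lemma has_derivative_bil_mult:
  assumes "(f has_derivative bil d) (at x)" "(g has_derivative bil e) (at x)"
  shows "((%x. f x * g x) has_derivative bil (f x *s e + g x *s d)) (at x)"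
  by (rule has_derivative_eq_rhs[OF has_derivative_mult[OF assms]]) (auto simp: fun_eq_iff)

lemma has_derivative_bil_add:
  assumes "(f has_derivative bil d) (at x)" "(g has_derivative bil e) (at x)"
  shows "((%x. f x + g x) has_derivative bil (d + e)) (at x)"
  by (rule has_derivative_eq_rhs[OF has_derivative_add[OF assms]]) (auto simp: fun_eq_iff)

lemma has_derivative_bil_const: "((%x. c) has_derivative bil 0) (at x)"
  by (rule has_derivative_eq_rhs[OF has_derivative_const]) (auto simp: fun_eq_iff)

lemma has_derivative_bil_swapc:
  assumes "(f has_derivative bil d) (at (swapc a b x))"
  shows "((%x. f (swapc a b x)) has_derivative bil (swapc a b d)) (at x)"
proof -
  have "((%x. f (swapc a b x)) has_derivative (%h. bil d (swapc a b h))) (at x)"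
    using has_derivative_compose[OF bounded_linear.has_derivative[OF bounded_linear_swapc has_derivative_ident] assms]
    by simp
  then show ?thesis by (simp add: bil_swapc[symmetric])
qed

lemma cdiff_const [intro, simp]: "cdiff (%x. c) x"
  unfolding cdiff_def using has_derivative_bil_const by blast

lemma cdiff_coord [intro, simp]: "cdiff (%x. x $ l) x"
  unfolding cdiff_def using has_derivative_coord by blast

lemma cdiff_add [intro]: "cdiff f x ==> cdiff g x ==> cdiff (%x. f x + g x) x"
  unfolding cdiff_def using has_derivative_bil_add by blast

lemma cdiff_mult [intro]: "cdiff f x ==> cdiff g x ==> cdiff (%x. f x * g x) x"
  unfolding cdiff_def using has_derivative_bil_mult by blast

lemma cdiff_swapc: "cdiff f (swapc a b x) ==> cdiff (%x. f (swapc a b x)) x"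
  unfolding cdiff_def using has_derivative_bil_swapc by blast

lemma cdiff_isCont: "cdiff f x ==> isCont f x"
  unfolding cdiff_def using has_derivative_continuous by blast

lemma dderiv_const [simp]: "dderiv (%x. c) \<xi> x = 0"
  using dderiv_eq[OF has_derivative_bil_const] by simp

lemma dderiv_add:
  assumes "cdiff f x" "cdiff g x"
  shows "dderiv (%x. f x + g x) \<xi> x = dderiv f \<xi> x + dderiv g \<xi> x"
  using assms by (elim cdiff_dderiv) (simp add: dderiv_eq[OF has_derivative_bil_add])

lemma dderiv_mult:
  assumes "cdiff f x" "cdiff g x"
  shows "dderiv (%x. f x * g x) \<xi> x = f x * dderiv g \<xi> x + g x * dderiv f \<xi> x"
  using assms by (elim cdiff_dderiv) (simp add: dderiv_eq[OF has_derivative_bil_mult])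

lemma dderiv_coord [simp]: "dderiv (%x. x $ l) \<xi> x = \<xi> $ l"
  by (simp add: dderiv_eq[OF has_derivative_coord])

lemma dderiv_cmult:
  assumes "cdiff f x"
  shows "dderiv (%x. c * f x) \<xi> x = c * dderiv f \<xi> x"
  using dderiv_mult[OF cdiff_const[of c] assms] by simp

lemma dderiv_swapc:
  "dderiv (%x. f (swapc a b x)) \<xi> x = dderiv f (swapc a b \<xi>) (swapc a b x)"
  by (simp add: dderiv_def)

lemma dderiv_linear:
  assumes "cdiff f x"
  shows "dderiv f (\<xi> + \<zeta>) x = dderiv f \<xi> x + dderiv f \<zeta> x"
    "dderiv f (\<xi> - \<zeta>) x = dderiv f \<xi> x - dderiv f \<zeta> x"
    "dderiv f (- \<zeta>) x = - dderiv f \<zeta> x"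
    "dderiv f \<xi> x = (\<Sum>j\<in>UNIV. \<xi> $ j * dderiv f (axis j 1) x)"
proof -
  obtain d where d: "\<And>\<xi>. dderiv f \<xi> x = bil d \<xi>" using assms by (rule cdiff_dderiv) auto
  show "dderiv f (\<xi> + \<zeta>) x = dderiv f \<xi> x + dderiv f \<zeta> x"
    "dderiv f (\<xi> - \<zeta>) x = dderiv f \<xi> x - dderiv f \<zeta> x"
    "dderiv f (- \<zeta>) x = - dderiv f \<zeta> x" by (simp_all add: d)
  show "dderiv f \<xi> x = (\<Sum>j\<in>UNIV. \<xi> $ j * dderiv f (axis j 1) x)"
    unfolding d bil_axis by (subst bil_commute) (simp add: bil_def)
qed

section \<open>Divided differences\<close>

lemma divdiff_const [simp]: "divdiff (%x. c) i j x = 0"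
  by (simp add: divdiff_def)

lemma divdiff_add:
  assumes "cdiff f x" "cdiff g x"
  shows "divdiff (%x. f x + g x) i j x = divdiff f i j x + divdiff g i j x"
  using assms by (auto simp: divdiff_def dderiv_add add_divide_distrib diff_divide_distrib)

lemma divdiff_cmult:
  assumes "cdiff f x"
  shows "divdiff (%x. c * f x) i j x = c * divdiff f i j x"
  using assms by (auto simp: divdiff_def dderiv_cmult right_diff_distrib)

text \<open>The coordinate changes by ([l = i] - [l = j]) (x_i - x_j) under the transposition, and
  the division leaves only the sign. On the diagonal the same formula is the Leibniz rule, since x
  is then fixed by the transposition.\<close>

lemma divdiff_coord_mult:
  assumes "cdiff f x" "i ~= j"
  shows "divdiff (%x. x $ l * f x) i j x =
    x $ l * divdiff f i j x + (of_bool (l = i) - of_bool (l = j)) * f (swapc i j x)"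
proof (cases "x $ i = x $ j")
  case True
  then show ?thesis using assms
    by (auto simp: divdiff_def dderiv_mult swapc_eq_self axis_def algebra_simps)
next
  case False
  then show ?thesis using assms
    by (auto simp: divdiff_def swapc_nth tsp_def divide_simps) (simp_all add: algebra_simps)
qed

lemma divdiff_swapc:
  "divdiff (%x. f (swapc a b x)) i j x =
    divdiff f (tsp a b i) (tsp a b j) (swapc a b x)"
proof -
  have 1: "swapc a b x $ tsp a b l = x $ l" for l
    by (simp add: swapc_nth)
  show ?thesis
    unfolding divdiff_def 1 by (simp add: dderiv_swapc swapc_conj[of a b i j x] swapc_axis)
qed

lemma divdiff_antisym:
  assumes "cdiff f x"
  shows "divdiff f j i x = - divdiff f i j x"
proof (cases "x $ i = x $ j")
  case True
  then show ?thesis using assms dderiv_linear(3)[OF assms, of "axis i 1 - axis j 1"]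
    by (simp add: divdiff_def)
next
  case False
  then have "x $ i - x $ j ~= 0" "x $ j - x $ i ~= 0" by auto
  then show ?thesis using False by (simp add: divdiff_def swapc_commute[of j i] field_simps)
qed

section \<open>Dunkl operators in coordinate directions\<close>

abbreviation dT :: "real => 'n::{finite,linorder} => (complex^('n::{finite,linorder}) => complex) => complex^('n::{finite,linorder}) => complex" where
  "dT k i f \<equiv> dunkl_op k (axis i 1) f"

text \<open>Every pair occurs once in \<open>dunkl_op\<close>, smaller index first;
  \<open>divdiff_antisym\<close> turns round the pairs in which j comes second. In the resulting
  form the order of the index type no longer appears.\<close>

lemma dunkl_axis:
  fixes f :: "complex^'n::{finite,linorder} => complex"
  assumes "cdiff f x"
  shows "dT k j f x = dderiv f (axis j 1) x + of_real k * (\<Sum>a\<in>-{j}. divdiff f j a x)"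
proof -
  let ?g = "%i l. divdiff f i l x"
  have "(\<Sum>i\<in>UNIV. \<Sum>l\<in>{l. i < l}. (axis j 1 $ i - axis j 1 $ l) * ?g i l)
      = (\<Sum>i\<in>UNIV. \<Sum>l\<in>{l. i < l}. if i = j then ?g i l else 0)
       - (\<Sum>i\<in>UNIV. \<Sum>l\<in>{l. i < l}. if l = j then ?g i l else 0)"
    unfolding sum_subtractf[symmetric] by (intro sum.cong refl) (auto simp: axis_def)
  also have "(\<Sum>i\<in>UNIV. \<Sum>l\<in>{l. i < l}. if i = j then ?g i l else 0) =
     (\<Sum>i\<in>UNIV. if i = j then (\<Sum>l\<in>{l. i < l}. ?g i l) else 0)"
    by (intro sum.cong refl) auto
  also have "... = (\<Sum>l\<in>{l. j < l}. ?g j l)" by simp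
  also have "(\<Sum>i\<in>UNIV. \<Sum>l\<in>{l. i < l}. if l = j then ?g i l else 0)
     = (\<Sum>i\<in>UNIV. if i < j then ?g i j else 0)"
    by (intro sum.cong refl) (simp add: sum.delta)
  also have "... = (\<Sum>i\<in>{i. i < j}. - ?g j i)"
    by (simp add: sum.inter_filter[symmetric] divdiff_antisym[OF assms, of j])
  also have "(\<Sum>l\<in>{l. j < l}. ?g j l) - (\<Sum>i\<in>{i. i < j}. - ?g j i) = (\<Sum>l\<in>{l. j < l} \<union> {i. i < j}. ?g j l)"
    by (subst sum.union_disjoint) (auto simp: sum_negf)
  also have "{l. j < l} \<union> {i. i < j} = -{j}" by auto
  finally show ?thesis by (simp add: dunkl_op_def)
qed

lemma dunkl_op_linear:
  fixes f :: "complex^'n::{finite,linorder} => complex"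
  assumes "cdiff f x"
  shows "dunkl_op k \<xi> f x = (\<Sum>j\<in>UNIV. \<xi> $ j * dT k j f x)"
proof -
  have d: "\<xi> $ i - \<xi> $ l = (\<Sum>j\<in>UNIV. \<xi> $ j * (axis j 1 $ i - axis j 1 $ l))" for i l :: 'n
    using bil_axis(1)[of \<xi> i] bil_axis(1)[of \<xi> l]
    by (simp add: bil_def axis_def right_diff_distrib sum_subtractf eq_commute)
  have "(\<Sum>i\<in>UNIV. \<Sum>l\<in>{l. i < l}. (\<xi> $ i - \<xi> $ l) * divdiff f i l x)
    = (\<Sum>i\<in>UNIV. \<Sum>l\<in>{l. i < l}. \<Sum>j\<in>UNIV. \<xi> $ j * ((axis j 1 $ i - axis j 1 $ l) * divdiff f i l x))"
    by (intro sum.cong refl) (subst d, simp add: sum_distrib_right mult.assoc)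
  also have "... = (\<Sum>i\<in>UNIV. \<Sum>j\<in>UNIV. \<Sum>l\<in>{l. i < l}. \<xi> $ j * ((axis j 1 $ i - axis j 1 $ l) * divdiff f i l x))"
    by (rule sum.cong[OF refl], rule sum.swap)
  also have "... = (\<Sum>j\<in>UNIV. \<Sum>i\<in>UNIV. \<Sum>l\<in>{l. i < l}. \<xi> $ j * ((axis j 1 $ i - axis j 1 $ l) * divdiff f i l x))"
    by (rule sum.swap)
  also have "... = (\<Sum>j\<in>UNIV. \<xi> $ j * (\<Sum>i\<in>UNIV. \<Sum>l\<in>{l. i < l}. (axis j 1 $ i - axis j 1 $ l) * divdiff f i l x))"
    by (simp add: sum_distrib_left)
  finally show ?thesis
    unfolding dunkl_op_def
    by (subst dderiv_linear(4)[OF assms]) (simp add: sum_distrib_left sum.distrib[symmetric] algebra_simps)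
qed

lemma dunkl_const [simp]: "dunkl_op k \<xi> (%x. c) x = 0"
  by (simp add: dunkl_op_def)

lemma dunkl_add:
  assumes "cdiff f x" "cdiff g x"
  shows "dunkl_op k \<xi> (%x. f x + g x) x = dunkl_op k \<xi> f x + dunkl_op k \<xi> g x"
  using assms by (simp add: dunkl_op_def dderiv_add divdiff_add distrib_left sum.distrib)

lemma dunkl_cmult:
  assumes "cdiff f x"
  shows "dunkl_op k \<xi> (%x. c * f x) x = c * dunkl_op k \<xi> f x"
  using assms by (simp add: dunkl_op_def dderiv_cmult divdiff_cmult distrib_left sum_distrib_left mult_ac)

text \<open>The commutator of \<open>dT k i\<close> with multiplication by \<open>x $ l\<close>. It
  consists of transpositions and contains no derivative, so identities between Dunkl operators can
  be proved by induction along products with coordinates.\<close>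

definition RR :: "real => 'n::finite => 'n => (complex^('n::finite) => complex) => complex^('n::finite) => complex" where
  "RR k i l f x = (if l = i then f x + of_real k * (\<Sum>a\<in>-{i}. f (swapc i a x)) else - of_real k * f (swapc i l x))"

lemma dunkl_coord_mult:
  fixes f :: "complex^'n::{finite,linorder} => complex"
  assumes "cdiff f x"
  shows "dT k i (%x. x $ l * f x) x = x $ l * dT k i f x + RR k i l f x"
proof -
  have "dT k i (%x. x $ l * f x) x = dderiv (%x. x $ l * f x) (axis i 1) x
      + of_real k * (\<Sum>a\<in>-{i}. divdiff (%x. x $ l * f x) i a x)"
    by (rule dunkl_axis) (use assms in auto)
  also have "(\<Sum>a\<in>-{i}. divdiff (%x. x $ l * f x) i a x) =
     x $ l * (\<Sum>a\<in>-{i}. divdiff f i a x) + (\<Sum>a\<in>-{i}. (of_bool (l = i) - of_bool (l = a)) * f (swapc i a x))"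
    unfolding sum_distrib_left sum.distrib[symmetric]
    by (intro sum.cong refl divdiff_coord_mult) (use assms in auto)
  also have "(\<Sum>a\<in>-{i}. (of_bool (l = i) - of_bool (l = a)) * f (swapc i a x)) =
     (if l = i then (\<Sum>a\<in>-{i}. f (swapc i a x)) else - f (swapc i l x))"
  proof (cases "l = i")
    case True then show ?thesis by (auto intro!: sum.cong)
  next
    case False
    then have "(\<Sum>a\<in>-{i}. (of_bool (l = i) - of_bool (l = a)) * f (swapc i a x)) =
       (\<Sum>a\<in>-{i}. if a = l then - f (swapc i a x) else 0)"
      by (intro sum.cong refl) auto
    then show ?thesis using False by simp
  qed
  finally show ?thesis using assms
    by (auto simp: dderiv_mult dunkl_axis RR_def axis_component algebra_simps)
qed

lemma dunkl_swapc:
  fixes f :: "complex^'n::{finite,linorder} => complex"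
  assumes "cdiff f (swapc a b x)"
  shows "dT k i (%x. f (swapc a b x)) x = dT k (tsp a b i) f (swapc a b x)"
proof -
  let ?s = "tsp a b"
  have "(\<Sum>c\<in>-{i}. divdiff f (?s i) (?s c) (swapc a b x)) = (\<Sum>c\<in>-{?s i}. divdiff f (?s i) c (swapc a b x))"
    by (rule sum.reindex_bij_witness[of _ ?s ?s]) (auto simp: transpose_eq_iff)
  then show ?thesis
    using assms by (simp add: dunkl_axis cdiff_swapc dderiv_swapc divdiff_swapc swapc_axis)
qed

section \<open>Homogeneous polynomials\<close>

text \<open>Generated by products with coordinates rather than given by coefficients: a linear
  identity then follows by rule induction once its behaviour under multiplication by a coordinate is
  known. The zero function has every degree.\<close>

inductive hom :: "nat => (complex^('n::finite) => complex) => bool" where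
  hom_const: "hom 0 (%x. c)"
| hom_coord: "hom m f ==> hom (Suc m) (%x. x $ i * f x)"
| hom_add: "hom m f ==> hom m g ==> hom m (%x. f x + g x)"

lemma hom_zero: "hom m (%x. 0)"
proof (induction m)
  case 0 then show ?case by (rule hom_const)
next
  case (Suc m) then show ?case using hom_coord[OF Suc] by simp
qed

lemma hom_0D: "hom 0 f ==> \<exists>c. f = (%x. c)"
  by (induction "0::nat" f rule: hom.induct) auto

lemma hom_cmult: "hom m f ==> hom m (%x. c * f x)"
proof (induction rule: hom.induct)
  case (hom_const d) show ?case by (rule hom.hom_const)
next
  case (hom_coord m f i)
  from hom.hom_coord[OF hom_coord.IH, of i] show ?case by (simp add: mult_ac)
next
  case (hom_add m f g)
  from hom.hom_add[OF hom_add.IH] show ?case by (simp add: distrib_left)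
qed

lemma hom_sum: "finite A ==> (\<And>a. a \<in> A ==> hom m (f a)) ==> hom m (%x. \<Sum>a\<in>A. f a x)"
  by (induction A rule: finite_induct) (auto intro: hom_zero hom_add)

lemma hom_diff: "hom m f ==> hom m g ==> hom m (%x. f x - g x)"
  using hom_add[of m f "%x. (-1) * g x"] hom_cmult[of m g "-1"] by simp

lemma hom_swapc: "hom m f ==> hom m (%x. f (swapc a b x))"
  by (induction rule: hom.induct) (auto intro: hom.intros simp: swapc_nth)

lemma hom_cdiff: "hom m f ==> cdiff f x"
  by (induction rule: hom.induct) auto

lemma hom_RR: "hom m f ==> hom m (RR k i l f)"
  using hom_cmult[OF hom_swapc, of m f "- of_real k" i l]
  by (cases "l = i") (auto simp: RR_def[abs_def] intro!: hom_add hom_cmult hom_sum hom_swapc)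

lemma dunkl_coord_mult_hom: "hom m f ==>
  dT k i (%x. x $ l * f x) = (%x. x $ l * dT k i f x + RR k i l f x)"
  using dunkl_coord_mult hom_cdiff by blast

lemma dunkl_add_hom: "hom m f ==> hom m g ==>
  dunkl_op k \<xi> (%x. f x + g x) = (%x. dunkl_op k \<xi> f x + dunkl_op k \<xi> g x)"
  using dunkl_add hom_cdiff by blast

lemma dunkl_cmult_hom: "hom m f ==> dunkl_op k \<xi> (%x. c * f x) = (%x. c * dunkl_op k \<xi> f x)"
  using dunkl_cmult hom_cdiff by blast

lemma dunkl_diff_hom: "hom m f ==> hom m g ==>
  dunkl_op k \<xi> (%x. f x - g x) = (%x. dunkl_op k \<xi> f x - dunkl_op k \<xi> g x)"
  using dunkl_add_hom[of m f "%x. (-1) * g x"] hom_cmult[of m g "-1"] dunkl_cmult_hom[of m g k \<xi> "-1"] by simp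

lemma dunkl_sum_hom: "finite A ==> (\<And>a. a \<in> A ==> hom m (f a)) ==>
   dunkl_op k \<xi> (%x. \<Sum>a\<in>A. f a x) = (%x. \<Sum>a\<in>A. dunkl_op k \<xi> (f a) x)"
proof (induction A rule: finite_induct)
  case empty then show ?case by simp
next
  case (insert a A)
  then show ?case using dunkl_add_hom[of m "f a" "%x. \<Sum>a\<in>A. f a x" k \<xi>] hom_sum[of A m f] by simp
qed

lemma dunkl_swapc_hom: "hom m f ==>
  dT k i (%x. f (swapc a b x)) = (%x. dT k (tsp a b i) f (swapc a b x))"
  using dunkl_swapc hom_cdiff by blast

lemma dunkl_hom_0: "hom 0 f ==> dunkl_op k \<xi> f = (%x. 0)"
  using hom_0D by fastforce

lemma hom_dT: "hom (Suc m) f ==> hom m (dT k i f)"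
proof (induction "Suc m" f arbitrary: m rule: hom.induct)
  case (hom_coord m f l)
  show ?case
  proof (cases m)
    case 0
    then show ?thesis using hom_coord hom_RR[of m f k i l] by (auto simp: dunkl_coord_mult_hom dunkl_hom_0)
  next
    case (Suc m')
    then show ?thesis using hom_coord
      by (auto simp: dunkl_coord_mult_hom intro!: hom_add hom_RR hom.hom_coord)
  qed
next
  case (hom_add f g)
  then show ?case using dunkl_add_hom[of "Suc m" f g] by (auto intro: hom.hom_add)
qed

lemma hom_dT': "hom m f ==> hom (m - 1) (dT k i f)"
  by (cases m) (auto simp: dunkl_hom_0 hom_zero hom_dT)

lemma hom_dunkl: "hom (Suc m) f ==> hom m (dunkl_op k \<xi> f)"
proof -
  assume f: "hom (Suc m) f"
  have "dunkl_op k \<xi> f = (%x. \<Sum>j\<in>UNIV. \<xi> $ j * dT k j f x)"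
    using dunkl_op_linear hom_cdiff[OF f] by blast
  then show ?thesis by (auto intro!: hom_sum hom_cmult hom_dT f)
qed

lemma dunkl_RR_hom:
  assumes "hom m f"
  shows "dT k j (RR k i l f) x = (if l = i then dT k j f x + of_real k * (\<Sum>a\<in>-{i}. dT k (tsp i a j) f (swapc i a x))
     else - of_real k * dT k (tsp i l j) f (swapc i l x))"
proof (cases "l = i")
  case True
  have "RR k i l f = (%x. f x + of_real k * (\<Sum>a\<in>-{i}. f (swapc i a x)))"
    using True by (simp add: RR_def[abs_def])
  moreover have "dT k j ... = (%x. dT k j f x + of_real k * (\<Sum>a\<in>-{i}. dT k (tsp i a j) f (swapc i a x)))"
    using assms
    by (simp add: dunkl_add_hom[where m=m] dunkl_cmult_hom[where m=m] hom_cmult hom_sum hom_swapc dunkl_swapc_hom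
      dunkl_sum_hom[where m=m])
  ultimately show ?thesis using True by simp
next
  case False
  have "RR k i l f = (%x. - of_real k * f (swapc i l x))"
    using False by (simp add: RR_def[abs_def])
  moreover have "dT k j ... = (%x. - of_real k * dT k (tsp i l j) f (swapc i l x))"
    using assms dunkl_cmult_hom[where m=m and f="%x. f (swapc i l x)" and c="- of_real k" and k=k and \<xi>="axis j 1"]
    by (simp add: hom_swapc dunkl_swapc_hom[OF assms])
  ultimately show ?thesis using False by simp
qed

text \<open>The commutator of two Dunkl operators commutes with multiplication by every coordinate
  and kills the constants.\<close>

lemma dunkl_commute:
  fixes f :: "complex^'n::{finite,linorder} => complex"
  assumes "hom m f"
  shows "dT k i (dT k j f) = dT k j (dT k i f)"
  using assms
proof (induction rule: hom.induct)
  case (hom_const c) then show ?case by simp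
next
  case (hom_add m f g)
  show ?case
  proof (cases m)
    case 0
    then show ?thesis using hom_add by (simp add: dunkl_hom_0 dunkl_add_hom[where m=0])
  next
    case (Suc m')
    then have "hom m' (dT k l f)" "hom m' (dT k l g)" for l using hom_add hom_dT by blast+
    then show ?thesis using hom_add by (simp add: dunkl_add_hom[where m=m] dunkl_add_hom[where m=m'])
  qed
next
  case (hom_coord m f l)
  have h: "hom (m-1) (dT k a f)" for a using hom_coord.hyps by (rule hom_dT')
  have hh: "hom m (%x. x $ l * dT k a f x)" for a
  proof (cases m)
    case 0
    then show ?thesis using hom_coord.hyps by (simp add: dunkl_hom_0 hom_zero)
  next
    case (Suc m')
    then show ?thesis using hom.hom_coord[OF h[of a], of l] by simp
  qed
  have *: "dT k i (dT k j (%x. x $ l * f x)) x = x $ l * dT k i (dT k j f) x + RR k i l (dT k j f) x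
         + dT k i (RR k j l f) x" for i j x
    using hom_coord.hyps dunkl_add_hom[OF hh[of j] hom_RR[OF hom_coord.hyps], of k "axis i 1" k j l]
      dunkl_coord_mult_hom[OF h[of j], of k i l]
    by (simp add: dunkl_coord_mult_hom)
  \<comment> \<open>This says that the commutator of the two Dunkl operators commutes with
    multiplication by \<open>x $ l\<close>. In the sums over transpositions the index of the inner
    operator is moved only where the transposition involves it, hence the cases for l and the
    summand that is split off.\<close>
  have **: "RR k i l (dT k j f) x + dT k i (RR k j l f) x = RR k j l (dT k i f) x + dT k j (RR k i l f) x" for x
  proof -
    have tr: "tsp i a j = j" if "a ~= j" "i ~= j" for i j a :: 'n
      using that by (simp add: tsp_def)
    have sp: "(\<Sum>a\<in>-{i}. g a) = g j + (\<Sum>a\<in>-{i}-{j}. g a)" if "i ~= j" for i j :: 'n and g :: "'n => complex"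
      using that by (intro sum.remove) auto
    have st: "(\<Sum>a\<in>-{i}-{j}. dT k (tsp i a j) f (swapc i a x)) = (\<Sum>a\<in>-{i}-{j}. dT k j f (swapc i a x))"
      if "i ~= j" for i j :: 'n
      using that by (intro sum.cong refl) (auto simp: tr)
    consider "i = j" | "i ~= j" "l ~= i" "l ~= j" | "i ~= j" "l = i" | "i ~= j" "l = j" by blast
    then show ?thesis
    proof cases
      case 1 then show ?thesis by simp
    next
      case 2 then show ?thesis
        by (simp add: dunkl_RR_hom[OF hom_coord.hyps], simp add: RR_def tr)
    next
      case 3
      then show ?thesis
        by (simp add: dunkl_RR_hom[OF hom_coord.hyps])
          (simp add: RR_def sp[OF \<open>i ~= j\<close>] st[OF \<open>i ~= j\<close>] swapc_commute[of j i] algebra_simps)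
    next
      case 4
      then have "j ~= i" by simp
      then show ?thesis using 4
        by (simp add: dunkl_RR_hom[OF hom_coord.hyps])
          (simp add: RR_def sp[OF \<open>j ~= i\<close>] st[OF \<open>j ~= i\<close>] swapc_commute[of i j] algebra_simps)
    qed
  qed
  show ?case
    by (rule ext) (use *[of i j] *[of j i] ** hom_coord.IH in \<open>simp add: algebra_simps\<close>)
qed

section \<open>The Fischer form\<close>

text \<open>This is the pairing \<open>p(T) q (0)\<close>; Euler's identity \<open>m p = \<Sum> x\<^sub>i \<partial>\<^sub>i p\<close> lets one define it
  by recursion on the degree without reference to coefficients of \<open>p\<close>.\<close>

primrec fform :: "real => nat => (complex^('n::{finite,linorder}) => complex) => (complex^('n::{finite,linorder}) => complex) => complex" where
  "fform k 0 p q = p 0 * q 0"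
| "fform k (Suc m) p q = (\<Sum>i\<in>UNIV. fform k m (dT 0 i p) (dT k i q)) / of_nat (Suc m)"

lemma fform_add_left: "hom m p ==> hom m p' ==>
  fform k m (%x. p x + p' x) q = fform k m p q + fform k m p' q"
proof (induction m arbitrary: p p' q)
  case (Suc m)
  then show ?case
    by (simp add: dunkl_add_hom[where m="Suc m"] hom_dT sum.distrib add_divide_distrib)
qed (simp add: algebra_simps)

lemma fform_cmult_left: "hom m p ==> fform k m (%x. c * p x) q = c * fform k m p q"
proof (induction m arbitrary: p q)
  case (Suc m)
  then show ?case
    by (simp add: dunkl_cmult_hom[where m="Suc m"] hom_dT sum_distrib_left)
qed simp

lemma fform_zero_left: "fform k m (%x. 0) q = 0"
  using fform_cmult_left[OF hom_zero, of k m 0 q] by simp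

text \<open>Induction on the degree with the Leibniz rule for \<partial>_i (x_l p) and commutativity
  of the Dunkl operators. The terms containing x_l add up to \<open>Suc m\<close> copies of the
  right-hand side, the term i = l gives one more, and together they cancel the denominator
  \<open>Suc (Suc m)\<close>.\<close>

lemma fform_coord_left:
  fixes p :: "complex^'n::{finite,linorder} => complex"
  shows "hom m p ==> hom (Suc m) q ==> fform k (Suc m) (%x. x $ l * p x) q = fform k m p (dT k l q)"
proof (induction m arbitrary: p q)
  case 0
  then obtain c where p: "p = (%x. c)" using hom_0D by blast
  have "fform k (Suc 0) (%x. x $ l * p x) q = (\<Sum>i\<in>UNIV. RR 0 i l p 0 * dT k i q 0)"
    using dunkl_coord_mult_hom[OF 0(1)] by (simp add: p)
  also have "... = (\<Sum>i\<in>UNIV. if i = l then c * dT k i q 0 else 0)"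
    by (intro sum.cong refl) (auto simp: RR_def p)
  finally show ?case by (simp add: p)
next
  case (Suc m)
  have d: "dT 0 i (%x. x $ l * p x) = (%x. x $ l * dT 0 i p x + of_bool (i = l) * p x)" for i
    using dunkl_coord_mult_hom[OF Suc.prems(1), of 0 i l] by (auto simp: RR_def)
  have IH: "fform k (Suc m) (%x. x $ l * dT 0 i p x) (dT k i q) = fform k m (dT 0 i p) (dT k i (dT k l q))" for i
    using Suc.IH[OF hom_dT[OF Suc.prems(1)] hom_dT[OF Suc.prems(2)]] dunkl_commute[OF Suc.prems(2), of k l i]
    by (simp del: fform.simps)
  have "fform k (Suc (Suc m)) (%x. x $ l * p x) q =
     (\<Sum>i\<in>UNIV. fform k (Suc m) (%x. x $ l * dT 0 i p x) (dT k i q) + of_bool (i = l) * fform k (Suc m) p (dT k i q)) / of_nat (Suc (Suc m))"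
    unfolding fform.simps(2)[of k "Suc m"] d
    by (simp only: fform_add_left[OF hom_coord[OF hom_dT[OF Suc.prems(1)]] hom_cmult[OF Suc.prems(1)]]
      fform_cmult_left[OF Suc.prems(1)])
  also have "(\<Sum>i\<in>UNIV. fform k (Suc m) (%x. x $ l * dT 0 i p x) (dT k i q) + of_bool (i = l) * fform k (Suc m) p (dT k i q))
     = (\<Sum>i\<in>UNIV. fform k m (dT 0 i p) (dT k i (dT k l q))) + (\<Sum>i\<in>UNIV. if i = l then fform k (Suc m) p (dT k i q) else 0)"
    unfolding sum.distrib[symmetric] by (intro sum.cong refl) (auto simp: IH simp del: fform.simps)
  also have "(\<Sum>i\<in>UNIV. fform k m (dT 0 i p) (dT k i (dT k l q))) = of_nat (Suc m) * fform k (Suc m) p (dT k l q)"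
    by (simp del: of_nat_Suc)
  finally have F: "fform k (Suc (Suc m)) (%x. x $ l * p x) q =
      (of_nat (Suc m) * fform k (Suc m) p (dT k l q) + fform k (Suc m) p (dT k l q)) / of_nat (Suc (Suc m))"
    by (simp del: fform.simps of_nat_Suc)
  have G: "of_nat (Suc m) * X + X = of_nat (Suc (Suc m)) * X" for X :: complex
    by (simp add: algebra_simps)
  show ?case unfolding F G by (simp del: fform.simps of_nat_Suc)
qed

lemma fform_add_right: "hom m q ==> hom m q' ==>
  fform k m p (%x. q x + q' x) = fform k m p q + fform k m p q'"
proof (induction m arbitrary: p q q')
  case (Suc m)
  then show ?case
    by (simp add: dunkl_add_hom[where m="Suc m"] hom_dT sum.distrib add_divide_distrib)
qed (simp add: algebra_simps)

lemma fform_cmult_right: "hom m q ==> fform k m p (%x. c * q x) = c * fform k m p q"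
proof (induction m arbitrary: p q)
  case (Suc m)
  then show ?case
    by (simp add: dunkl_cmult_hom[where m="Suc m"] hom_dT sum_distrib_left)
qed simp

lemma fform_sum_right: "finite A ==> (\<And>a. a \<in> A ==> hom m (q a)) ==>
  fform k m p (%x. \<Sum>a\<in>A. q a x) = (\<Sum>a\<in>A. fform k m p (q a))"
proof (induction A rule: finite_induct)
  case empty
  then show ?case using fform_cmult_right[OF hom_zero, of k m p 0] by simp
next
  case (insert a A)
  then show ?case using fform_add_right[of m "q a" "%x. \<Sum>a\<in>A. q a x" k p] hom_sum[of A m q] by simp
qed

lemma fform_sum_left: "finite A ==> (\<And>a. a \<in> A ==> hom m (q a)) ==>
  fform k m (%x. \<Sum>a\<in>A. q a x) p = (\<Sum>a\<in>A. fform k m (q a) p)"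
proof (induction A rule: finite_induct)
  case empty
  then show ?case by (simp add: fform_zero_left)
next
  case (insert a A)
  then show ?case using fform_add_left[of m "q a" "%x. \<Sum>a\<in>A. q a x" k p] hom_sum[of A m q] by simp
qed

lemma fform_swapc: "hom m p ==> hom m q ==>
  fform k m (%x. p (swapc a b x)) (%x. q (swapc a b x)) = fform k m p q"
proof (induction m arbitrary: p q)
  case (Suc m)
  let ?s = "tsp a b"
  have "(\<Sum>i\<in>UNIV. fform k m (dT 0 (?s i) p) (dT k (?s i) q)) = (\<Sum>i\<in>UNIV. fform k m (dT 0 i p) (dT k i q))"
    by (rule sum.reindex_bij_witness[of _ ?s ?s]) auto
  then show ?case using Suc by (simp add: dunkl_swapc_hom[where m="Suc m"] hom_dT)
qed simp

lemma fform_swapc_left: "hom m p ==> hom m q ==>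
  fform k m (%x. p (swapc a b x)) q = fform k m p (%x. q (swapc a b x))"
  using fform_swapc[of m p "%x. q (swapc a b x)" k a b] by (simp add: hom_swapc)

lemma fform_RR: 
  assumes "hom m p" "hom m q"
  shows "fform k m (RR k i l p) q = fform k m p (RR k i l q)"
proof (cases "l = i")
  case True
  have "RR k i l f = (%x. f x + of_real k * (\<Sum>a\<in>-{i}. f (swapc i a x)))" for f
    using True by (simp add: RR_def[abs_def])
  then show ?thesis using assms
    by (simp add: fform_add_left fform_add_right fform_cmult_left fform_cmult_right hom_cmult hom_sum hom_swapc
       fform_sum_left fform_sum_right fform_swapc_left)
next
  case False
  have "RR k i l f = (%x. (- of_real k) * f (swapc i l x))" for f
    using False by (simp add: RR_def[abs_def])
  then show ?thesis using assms
    by (simp only: fform_cmult_left fform_cmult_right hom_swapc fform_swapc_left)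
qed

lemma RR_sym: "RR k i l f = RR k l i f"
  by (auto simp: RR_def fun_eq_iff swapc_commute[of i l])

text \<open>After \<open>x $ i\<close> has been moved off the left argument by
  \<open>fform_coord_left\<close>, what remains to be compared are the commutators of T_i with x_l
  and of T_l with x_i; they agree in the form because \<open>RR\<close> is self-adjoint and
  symmetric in its two indices.\<close>

lemma fform_coord_right:
  fixes p :: "complex^'n::{finite,linorder} => complex"
  shows "hom (Suc m) p ==> hom m q ==> fform k (Suc m) p (%x. x $ l * q x) = fform k m (dT k l p) q"
proof (induction "Suc m" p arbitrary: m q rule: hom.induct)
  case (hom_add f g)
  then show ?case using fform_add_left[of "Suc m" f g k "%x. x $ l * q x"] fform_add_left[OF hom_dT hom_dT, of m f g k k l k l q]
    by (simp add: dunkl_add_hom[where m="Suc m"] del: fform.simps)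
next
  case (hom_coord m p i)
  have h0: "hom m (%x. x $ l * dT k i q x)" if "hom m q" for l i q
  proof (cases m)
    case 0 with that show ?thesis by (simp add: dunkl_hom_0 hom_zero)
  next
    case (Suc m') with that show ?thesis using hom_dT hom.hom_coord by blast
  qed
  note h = h0[OF hom_coord.prems] h0[OF hom_coord.hyps(1)]
  have 1: "fform k m p (%x. x $ l * dT k i q x) = fform k m (%x. x $ i * dT k l p x) q"
  proof (cases m)
    case 0
    then show ?thesis by simp
  next
    case (Suc m')
    have q: "hom (Suc m') q" "hom (Suc m') p" using hom_coord.prems hom_coord.hyps(1) Suc by simp_all
    show ?thesis
      using hom_coord.hyps(2)[OF Suc hom_dT[OF q(1)], of k i] fform_coord_left[OF hom_dT[OF q(2)] q(1), of k i k l]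
      by (simp add: Suc del: fform.simps)
  qed
  have "fform k (Suc m) (%x. x $ i * p x) (%x. x $ l * q x) = fform k m p (dT k i (%x. x $ l * q x))"
    by (rule fform_coord_left) (use hom_coord in \<open>auto intro: hom.hom_coord\<close>)
  also have "... = fform k m p (%x. x $ l * dT k i q x) + fform k m p (RR k i l q)"
    using hom_coord.prems h(1) by (simp add: dunkl_coord_mult_hom fform_add_right hom_RR)
  also have "... = fform k m (%x. x $ i * dT k l p x) q + fform k m (RR k l i p) q"
    using hom_coord 1 by (simp add: fform_RR[symmetric] RR_sym[of k i l])
  also have "... = fform k m (dT k l (%x. x $ i * p x)) q"
    using hom_coord.hyps h(2) by (simp add: dunkl_coord_mult_hom fform_add_left hom_RR)
  finally show ?case .
qed

text \<open>Both adjunctions together: a coordinate of p, whether it stands on the left or on the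
  right, turns into the same operator on q, and the degree drops.\<close>

lemma fform_sym: "hom m p ==> hom m q ==> fform k m p q = fform k m q p"
proof (induction arbitrary: q rule: hom.induct)
  case (hom_const c)
  then show ?case by simp
next
  case (hom_add m f g)
  then show ?case by (simp add: fform_add_left fform_add_right)
next
  case (hom_coord m p i)
  then show ?case using fform_coord_left[of m p q k i] fform_coord_right[of m q p k i] hom_dT by metis
qed

section \<open>Cherednik operators for an arbitrary ordering of the coordinates\<close>

primrec aft :: "'a list => 'a => 'a set" where
  "aft [] j = {}"
| "aft (x # xs) j = (if x = j then set xs else aft xs j)"

lemma aft_append: "aft (xs @ ys) j = (if j \<in> set xs then aft xs j \<union> set ys else aft ys j)"
  by (induction xs) auto

lemma aft_subset: "aft xs j \<subseteq> set xs"
  by (induction xs) auto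

definition cord :: "'n list => bool" where
  "cord xs \<longleftrightarrow> distinct xs \<and> set xs = UNIV"

text \<open>The order of the coordinates is a list, so that the steps of the recursion are list
  surgery: the head goes to the end, or two neighbours change places. For the increasing list this
  is \<open>cher_op\<close>.\<close>

definition DD :: "real => 'n list => 'n => (complex^('n::{finite,linorder}) => complex) => complex^('n::{finite,linorder}) => complex" where
  "DD k xs j f x = x$j * dT k j f x + of_real (k * (1 - real CARD('n))) * f x
     + of_real k * (\<Sum>i\<in>aft xs j. f (swapc i j x))"

text \<open>The position, counted from 0, of j when the coordinates are sorted by decreasing entry
  and ties are broken by the order \<open>xs\<close>. With it \<open>ev\<close> extends
  \<open>etabar\<close> to arbitrary orders.\<close>

definition rk :: "'n list => ('n => nat) => 'n => nat" where
  "rk xs \<eta> j = card {i. i ~= j \<and> (if i \<in> aft xs j then \<eta> j < \<eta> i else \<eta> j <= \<eta> i)}"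

definition ev :: "real => 'n list => ('n => nat) => 'n => real" where
  "ev k xs \<eta> j = real (\<eta> j) - k * real (rk xs \<eta> j)"

lemma rk_le: "rk xs (\<eta>::'n::finite => nat) j <= CARD('n) - 1"
proof -
  have "rk xs \<eta> j <= card (UNIV - {j})"
    unfolding rk_def by (rule card_mono) auto
  then show ?thesis by simp
qed

lemma hom_coord_dT: "hom m f ==> hom m (%x. x $ l * dT k i f x)"
proof -
  assume f: "hom m f"
  show ?thesis
  proof (cases m)
    case 0 with f show ?thesis by (simp add: dunkl_hom_0 hom_zero)
  next
    case (Suc m') with f show ?thesis using hom_dT hom.hom_coord by blast
  qed
qed

text \<open>The two factors of x_j T_j are adjoint to each other and transpositions are
  self-adjoint. Consequently joint eigenfunctions with different eigenvalues will be
  orthogonal.\<close>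

lemma fform_DD:
  assumes "hom m p" "hom m q"
  shows "fform k m (DD k xs j p) q = fform k m p (DD k xs j q)"
proof -
  have "fform k m (%x. x $ j * dT k j p x) q = fform k m p (%x. x $ j * dT k j q x)"
  proof (cases m)
    case 0 then show ?thesis by simp
  next
    case (Suc m')
    then show ?thesis
      using assms fform_coord_left[OF hom_dT, of m' p q k j k j] fform_coord_right[OF _ hom_dT, of m' p q k j k j] by simp
  qed
  then show ?thesis using assms unfolding DD_def[abs_def]
    by (simp add: fform_add_left fform_add_right fform_cmult_left fform_cmult_right fform_sum_left fform_sum_right
       hom_add hom_coord_dT hom_cmult hom_sum hom_swapc fform_swapc_left)
qed

lemma cord_swap: "cord (ys @ a # b # zs) ==> cord (ys @ b # a # zs)"
  by (auto simp: cord_def)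

lemma aft_swap:
  assumes "cord (ys @ a # b # zs)"
  shows "aft (ys @ a # b # zs) a = insert b (set zs)" "aft (ys @ a # b # zs) b = set zs"
    "aft (ys @ b # a # zs) a = set zs" "aft (ys @ b # a # zs) b = insert a (set zs)"
    "a ~= b" "a \<notin> set zs" "b \<notin> set zs"
    "\<And>j. j ~= a ==> j ~= b ==> aft (ys @ b # a # zs) j = aft (ys @ a # b # zs) j"
    "\<And>j. j ~= a ==> j ~= b ==> a \<in> aft (ys @ a # b # zs) j \<longleftrightarrow> b \<in> aft (ys @ a # b # zs) j"
  using assms aft_subset[of zs] by (auto simp: cord_def aft_append)

text \<open>Exchanging two neighbours changes \<open>aft\<close> only at these two: a single
  transposition passes from the operator of a to that of b.\<close>

lemma DD_swap:
  fixes f :: "complex^'n::{finite,linorder} => complex"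
  assumes "cord (ys @ a # b # zs)"
  shows "DD k (ys @ b # a # zs) a f x = DD k (ys @ a # b # zs) a f x - of_real k * f (swapc a b x)"
    "DD k (ys @ b # a # zs) b f x = DD k (ys @ a # b # zs) b f x + of_real k * f (swapc a b x)"
    "\<And>j. j ~= a ==> j ~= b ==> DD k (ys @ b # a # zs) j f x = DD k (ys @ a # b # zs) j f x"
  using aft_swap[OF assms] by (simp_all add: DD_def algebra_simps swapc_commute[of b a])

text \<open>The relations of the degenerate affine Hecke algebra, for the transposition of two
  neighbours in the order. Neighbours are essential: the sets \<open>aft\<close> of the other
  coordinates contain both or neither.\<close>

lemma DD_swapc:
  fixes f :: "complex^'n::{finite,linorder} => complex"
  assumes c: "cord (ys @ a # b # zs)" and f: "hom m f"
  defines "xs \<equiv> ys @ a # b # zs"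
  shows "DD k xs a (%x. f (swapc a b x)) x = DD k xs b f (swapc a b x) + of_real k * f x"
    "DD k xs b (%x. f (swapc a b x)) x = DD k xs a f (swapc a b x) - of_real k * f x"
    "\<And>j. j ~= a ==> j ~= b ==> DD k xs j (%x. f (swapc a b x)) x = DD k xs j f (swapc a b x)"
proof -
  note A = aft_swap[OF c, folded xs_def]
  let ?s = "tsp a b"
  have sa: "swapc a b (swapc i a x) = swapc i b (swapc a b x)" if "i \<in> set zs" for i
    using that A(6,7) by (subst swapc_conj) (auto simp: tsp_def)
  have sb: "swapc a b (swapc i b x) = swapc i a (swapc a b x)" if "i \<in> set zs" for i
    using that A(6,7) by (subst swapc_conj) (auto simp: tsp_def)
  have nth: "swapc a b x $ b = x $ a" "swapc a b x $ a = x $ b" "j ~= a ==> j ~= b ==> swapc a b x $ j = x $ j" for j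
    by (auto simp: swapc_def)
  have "(\<Sum>i\<in>set zs. f (swapc a b (swapc i a x))) = (\<Sum>i\<in>set zs. f (swapc i b (swapc a b x)))"
    by (intro sum.cong refl) (simp add: sa)
  then show "DD k xs a (%x. f (swapc a b x)) x = DD k xs b f (swapc a b x) + of_real k * f x"
    using A(5-7) unfolding DD_def A(1,2) by (simp add: dunkl_swapc_hom[OF f] nth swapc_commute[of b a] distrib_left)
  have "(\<Sum>i\<in>set zs. f (swapc a b (swapc i b x))) = (\<Sum>i\<in>set zs. f (swapc i a (swapc a b x)))"
    by (intro sum.cong refl) (simp add: sb)
  then show "DD k xs b (%x. f (swapc a b x)) x = DD k xs a f (swapc a b x) - of_real k * f x"
    using A(5-7) unfolding DD_def A(1,2) by (simp add: dunkl_swapc_hom[OF f] nth swapc_commute[of b a] distrib_left)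
  fix j assume j: "j ~= a" "j ~= b"
  have sj: "swapc a b (swapc i j x) = swapc (?s i) j (swapc a b x)" for i
    using j by (subst swapc_conj) (simp add: tsp_def)
  have mem: "?s i \<in> aft xs j" if "i \<in> aft xs j" for i
  proof -
    consider "i = a" | "i = b" | "?s i = i" by (metis transpose_apply_other)
    then show ?thesis
    proof cases
      case 1 then show ?thesis using that A(9)[OF j] by (metis transpose_apply_first)
    next
      case 2 then show ?thesis using that A(9)[OF j] by (metis transpose_apply_second)
    next
      case 3 then show ?thesis using that by metis
    qed
  qed
  have "(\<Sum>i\<in>aft xs j. f (swapc a b (swapc i j x))) = (\<Sum>i\<in>aft xs j. f (swapc (?s i) j (swapc a b x)))"
    by (simp only: sj)
  also have "... = (\<Sum>i\<in>aft xs j. f (swapc i j (swapc a b x)))"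
    by (rule sum.reindex_bij_witness[of _ ?s ?s]) (simp_all add: mem)
  finally have "(\<Sum>i\<in>aft xs j. f (swapc a b (swapc i j x))) = (\<Sum>i\<in>aft xs j. f (swapc i j (swapc a b x)))" .
  then show "DD k xs j (%x. f (swapc a b x)) x = DD k xs j f (swapc a b x)"
    using j by (simp add: DD_def dunkl_swapc_hom[OF f] nth)
qed

lemma rk_swap_neq:
  assumes "cord (ys @ a # b # zs)" "\<eta> a ~= \<eta> b"
  shows "rk (ys @ b # a # zs) \<eta> j = rk (ys @ a # b # zs) \<eta> j"
proof -
  note A = aft_swap[OF assms(1)]
  consider "j = a" | "j = b" | "j ~= a" "j ~= b" by blast
  then show ?thesis
  proof cases
    case 1
    show ?thesis unfolding rk_def 1 A(1,3) using A(5-7) assms(2) by (intro arg_cong[where f=card]) auto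
  next
    case 2
    show ?thesis unfolding rk_def 2 A(2,4) using A(5-7) assms(2) by (intro arg_cong[where f=card]) auto
  next
    case 3
    show ?thesis unfolding rk_def A(8)[OF 3] ..
  qed
qed

text \<open>In a tie the coordinate that comes earlier has the smaller rank, so changing the order
  of two tied neighbours exchanges their ranks.\<close>

lemma rk_swap_eq:
  fixes \<eta> :: "'n::finite => nat"
  assumes c: "cord (ys @ a # b # zs)" and e: "\<eta> a = \<eta> b"
  shows "rk (ys @ b # a # zs) \<eta> j = rk (ys @ a # b # zs) \<eta> (tsp a b j)"
proof -
  note A = aft_swap[OF c]
  consider "j = a" | "j = b" | "j ~= a" "j ~= b" by blast
  then show ?thesis
  proof cases
    case 1
    let ?X = "{i. i ~= a \<and> i ~= b \<and> (if i \<in> set zs then \<eta> a < \<eta> i else \<eta> a <= \<eta> i)}"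
    have "{i. i ~= a \<and> (if i \<in> set zs then \<eta> a < \<eta> i else \<eta> a <= \<eta> i)} = insert b ?X"
      "{i. i ~= b \<and> (if i \<in> set zs then \<eta> b < \<eta> i else \<eta> b <= \<eta> i)} = insert a ?X"
      using A e by auto
    moreover have t: "tsp a b a = b" by simp
    ultimately show ?thesis unfolding rk_def 1 t A(2,3) by simp
  next
    case 2
    have t: "tsp a b b = a" by simp
    show ?thesis unfolding rk_def 2 t A(1,4) using A(5-7) e by (intro arg_cong[where f=card]) auto
  next
    case 3
    then have t: "tsp a b j = j" by (simp add: tsp_def)
    show ?thesis unfolding rk_def t A(8)[OF 3] ..
  qed
qed

lemma rk_less:
  fixes \<eta> :: "'n::finite => nat"
  assumes "\<eta> b < \<eta> a" shows "rk xs \<eta> a < rk xs \<eta> b"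
proof -
  let ?A = "%j. {i. i ~= j \<and> (if i \<in> aft xs j then \<eta> j < \<eta> i else \<eta> j <= \<eta> i)}"
  have "i \<in> ?A b" if "i \<in> ?A a" for i
  proof -
    have "\<eta> a <= \<eta> i" using that by (auto split: if_splits)
    then show ?thesis using assms by auto
  qed
  moreover have "a \<in> ?A b" "a \<notin> ?A a" using assms by auto
  ultimately have "?A a \<subset> ?A b" by blast
  then show ?thesis unfolding rk_def by (intro psubset_card_mono) auto
qed

text \<open>A larger entry has a smaller rank, so both contributions to the difference have the same
  sign: at least 1 from the entries and at least k from the ranks. The bound makes the constant of
  \<open>jrec_neq\<close> well defined and smaller than 1 in modulus.\<close>

lemma ev_gap:
  fixes \<eta> :: "'n::finite => nat"
  assumes "0 <= k" "\<eta> a ~= \<eta> b"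
  shows "k < \<bar>ev k xs \<eta> b - ev k xs \<eta> a\<bar>"
proof -
  have *: "k < ev k xs \<eta> a - ev k xs \<eta> b" if "\<eta> b < \<eta> a" for a b
  proof -
    have "real (rk xs \<eta> a) + 1 <= real (rk xs \<eta> b)" "real (\<eta> b) + 1 <= real (\<eta> a)"
      using that rk_less[OF that, of xs] by linarith+
    then have "k * (real (rk xs \<eta> a) + 1) <= k * real (rk xs \<eta> b)" using assms(1) mult_left_mono by blast
    then show ?thesis using \<open>real (\<eta> b) + 1 <= real (\<eta> a)\<close> unfolding ev_def by (simp add: algebra_simps)
  qed
  show ?thesis using *[of a b] *[of b a] assms(2) by linarith
qed

text \<open>Knop--Sahi type recursion for the joint eigenfunctions. Instead of acting on the
  coordinates by cyclic shifts and adjacent transpositions, the ordering of the coordinates is changed.\<close>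

inductive jrec :: "real => 'n list => ('n => nat) => (complex^('n::{finite,linorder}) => complex) => bool" for k where
  jrec_one: "cord xs ==> jrec k xs (%_. 0) (%_. 1)"
| jrec_raise: "jrec k (a # xs) \<eta> f ==> jrec k (xs @ [a]) (\<eta>(a := Suc (\<eta> a))) (%x. x $ a * f x)"
| jrec_eq: "jrec k (ys @ a # b # zs) \<eta> f ==> \<eta> a = \<eta> b ==> jrec k (ys @ b # a # zs) \<eta> (%x. f (swapc a b x))"
| jrec_neq: "jrec k (ys @ a # b # zs) \<eta> f ==> \<eta> a ~= \<eta> b ==>
     c = k / (ev k (ys @ a # b # zs) \<eta> b - ev k (ys @ a # b # zs) \<eta> a) ==>
     jrec k (ys @ b # a # zs) \<eta> (%x. f x + of_real c * f (swapc a b x))"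

lemma jrec_cord: "jrec k xs \<eta> f ==> cord xs"
  by (induction rule: jrec.induct) (auto simp: cord_swap, auto simp: cord_def)

lemma mdeg_upd: "mdeg (\<eta>(a := Suc (\<eta> a))) = Suc (mdeg (\<eta>::'n::finite => nat))"
proof -
  have "mdeg (\<eta>(a := Suc (\<eta> a))) = (\<Sum>i\<in>UNIV. \<eta> i + of_bool (i = a))"
    unfolding mdeg_def by (intro sum.cong) auto
  then show ?thesis by (simp add: mdeg_def sum.distrib)
qed

lemma jrec_hom: "jrec k xs \<eta> f ==> hom (mdeg \<eta>) f"
proof (induction rule: jrec.induct)
  case (jrec_one xs)
  then show ?case by (simp add: mdeg_def hom_const)
next
  case (jrec_raise a xs \<eta> f)
  then show ?case unfolding mdeg_upd by (intro hom_coord)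
next
  case (jrec_eq ys a b zs \<eta> f)
  then show ?case by (intro hom_swapc)
next
  case (jrec_neq ys a b zs \<eta> f c)
  then show ?case by (intro hom_add hom_cmult hom_swapc)
qed

definition vcnj :: "complex^('n::finite) => complex^('n::finite)" where
  "vcnj x = (\<chi> i. cnj (x $ i))"

lemma vcnj_swapc: "vcnj (swapc a b x) = swapc a b (vcnj x)"
  by (simp add: vcnj_def vec_eq_iff swapc_nth)

text \<open>All constants of the recursion are real. This is what later turns f (x) f (vcnj x) into
  a squared modulus.\<close>

lemma jrec_real: "jrec k xs \<eta> f ==> f (vcnj x) = cnj (f x)"
proof (induction arbitrary: x rule: jrec.induct)
  case (jrec_raise a xs \<eta> f)
  have "vcnj x $ a = cnj (x $ a)" by (simp add: vcnj_def)
  then show ?case using jrec_raise by simp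
qed (simp_all add: vcnj_swapc[symmetric])

lemma jrec_DD:
  fixes f :: "complex^'n::{finite,linorder} => complex"
  assumes "jrec k xs \<eta> f" "0 <= k"
  shows "DD k xs j f x = of_real (ev k xs \<eta> j) * f x"
  using assms
proof (induction arbitrary: j x rule: jrec.induct)
  case (jrec_one xs)
  obtain ys zs where xs: "xs = ys @ j # zs" using jrec_one by (metis UNIV_I cord_def split_list)
  have d: "j \<notin> set ys" "j \<notin> set zs" "distinct zs" "distinct ys" using jrec_one unfolding xs cord_def by auto
  have a: "aft xs j = set zs" using d by (simp add: xs aft_append)
  have "{i. i ~= j \<and> (if i \<in> set zs then (0::nat) < 0 else (0::nat) <= 0)} = UNIV - insert j (set zs)" by auto
  then have "rk xs (%_. 0) j = CARD('n) - Suc (card (set zs))"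
    unfolding rk_def a using d by (simp only: card_Diff_subset) (simp add: card_Diff_subset)
  moreover have "Suc (card (set zs)) <= CARD('n)"
    using d card_mono[of UNIV "insert j (set zs)"] by simp
  ultimately have "real (rk xs (%_. 0) j) = real CARD('n) - 1 - real (card (set zs))" by simp
  then have "ev k xs (%_. 0) j = k * (1 - real CARD('n)) + k * real (card (set zs))"
    by (simp only: ev_def) (simp add: algebra_simps)
  then show ?case by (simp add: DD_def a)
next
  case (jrec_raise a xs \<eta> f)
  note c = jrec_cord[OF jrec_raise.hyps] and h = jrec_hom[OF jrec_raise.hyps]
  have xs: "distinct xs" "a \<notin> set xs" "set xs = -{a}" using c by (auto simp: cord_def)
  have f1: "aft (xs @ [a]) a = {}" and f2: "j ~= a ==> aft (xs @ [a]) j = insert a (aft xs j)" for j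
    using xs by (auto simp: aft_append)
  have f3: "a \<notin> aft xs j" for j using aft_subset[of xs j] xs by auto
  \<comment> \<open>As last coordinate with the entry increased by 1, a counts against j when \<eta>
    j < \<eta> a + 1, which is the condition \<eta> j \<le> \<eta> a that applied while it was
    first. So no rank changes.\<close>
  have rk: "rk (xs @ [a]) (\<eta>(a := Suc (\<eta> a))) j = rk (a # xs) \<eta> j" for j
  proof (cases "j = a")
    case True
    then show ?thesis unfolding rk_def using f1 xs(3)
      by (intro arg_cong[where f=card]) (auto simp: Suc_le_eq)
  next
    case False
    then show ?thesis unfolding rk_def using f2[OF False] f3[of j]
      by (intro arg_cong[where f=card]) (auto simp: less_Suc_eq_le)
  qed
  have ev: "ev k (xs @ [a]) (\<eta>(a := Suc (\<eta> a))) j = ev k (a # xs) \<eta> j + of_bool (j = a)" for j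
    unfolding ev_def rk by simp
  show ?case
  proof (cases "j = a")
    case True
    have "DD k (xs @ [a]) a (%x. x $ a * f x) x = x $ a * (DD k (a # xs) a f x + f x)"
      by (simp add: DD_def f1 dunkl_coord_mult_hom[OF h]) (simp add: RR_def xs(3) algebra_simps swapc_commute[of a])
    then show ?thesis using True jrec_raise.IH[OF jrec_raise.prems, of a x]
      unfolding ev by (simp add: algebra_simps)
  next
    case False
    have "(\<Sum>i\<in>aft xs j. swapc i j x $ a * f (swapc i j x)) = (\<Sum>i\<in>aft xs j. x $ a * f (swapc i j x))"
      using f3[of j] False by (intro sum.cong refl) (auto simp: swapc_def)
    then have "DD k (xs @ [a]) j (%x. x $ a * f x) x = x $ a * DD k (a # xs) j f x"
      using False f3[of j]
      by (simp add: DD_def f2 dunkl_coord_mult_hom[OF h])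
         (simp add: RR_def swapc_nth sum_distrib_left algebra_simps swapc_commute[of a])
    then show ?thesis using False jrec_raise.IH[OF jrec_raise.prems, of j x]
      unfolding ev by (simp add: algebra_simps)
  qed
next
  case (jrec_eq ys a b zs \<eta> f)
  note c = jrec_cord[OF jrec_eq.hyps(1)] and h = jrec_hom[OF jrec_eq.hyps(1)]
  consider "j = a" | "j = b" | "j ~= a" "j ~= b" by blast
  then show ?case
    by cases (use jrec_eq.IH[OF jrec_eq.prems] jrec_eq.hyps(2) in
      \<open>simp_all add: DD_swap[OF c] DD_swapc[OF c h] ev_def rk_swap_eq[OF c]\<close>)
next
  case (jrec_neq ys a b zs \<eta> f cc)
  let ?xs = "ys @ a # b # zs"
  note c = jrec_cord[OF jrec_neq.hyps(1)] and h = jrec_hom[OF jrec_neq.hyps(1)]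
  note IH = jrec_neq.IH[OF jrec_neq.prems]
  have ne: "ev k ?xs \<eta> b - ev k ?xs \<eta> a ~= 0"
    using ev_gap[OF jrec_neq.prems jrec_neq.hyps(2), of ?xs] jrec_neq.prems by linarith
  then have "cc * (ev k ?xs \<eta> b - ev k ?xs \<eta> a) = k"
    using jrec_neq.hyps(3) by simp
  \<comment> \<open>In the new order the operator of a maps f to ea f - k s f and s f to eb s f,
    where s is the transposition. The recursion constant is chosen so that k = cc (eb - ea), which
    is exactly the condition for f + cc s f to be an eigenfunction.\<close>
  then have cc: "of_real k = of_real cc * (of_real (ev k ?xs \<eta> b) - of_real (ev k ?xs \<eta> a) :: complex)"
    by (metis of_real_diff of_real_mult)
  have lin: "DD k xs j (%x. f x + of_real cc * f (swapc a b x)) x =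
     DD k xs j f x + of_real cc * DD k xs j (%x. f (swapc a b x)) x" for xs j x
    by (simp add: DD_def dunkl_add_hom[OF h hom_cmult[OF hom_swapc[OF h]]] dunkl_cmult_hom[OF hom_swapc[OF h]]
       sum.distrib sum_distrib_left algebra_simps)
  have ev: "ev k (ys @ b # a # zs) \<eta> j = ev k ?xs \<eta> j" for j
    by (simp add: ev_def rk_swap_neq[OF c jrec_neq.hyps(2)])
  consider "j = a" | "j = b" | "j ~= a" "j ~= b" by blast
  then show ?case
  proof cases
    case 1
    then show ?thesis by (simp add: DD_swap[OF c] lin DD_swapc[OF c h] IH ev) (simp add: cc algebra_simps)
  next
    case 2
    then show ?thesis by (simp add: DD_swap[OF c] lin DD_swapc[OF c h] IH ev) (simp add: cc algebra_simps)
  next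
    case 3
    then show ?thesis by (simp add: DD_swap[OF c] lin DD_swapc[OF c h] IH ev algebra_simps)
  qed
qed

text \<open>Each step multiplies the norm by a positive factor: raising by the eigenvalue of T_a
  x_a, a swap of tied neighbours by 1, and the step with a correction term by 1 - cc^2.\<close>

lemma jrec_norm:
  fixes f :: "complex^'n::{finite,linorder} => complex"
  assumes "jrec k xs \<eta> f" "0 <= k"
  shows "\<exists>r>0. fform k (mdeg \<eta>) f f = of_real r"
  using assms
proof (induction rule: jrec.induct)
  case (jrec_one xs)
  then show ?case by (intro exI[of _ 1]) (simp add: mdeg_def)
next
  case (jrec_raise a xs \<eta> f)
  then obtain r where r: "r > 0" "fform k (mdeg \<eta>) f f = of_real r" by blast
  note c = jrec_cord[OF jrec_raise.hyps] and h = jrec_hom[OF jrec_raise.hyps]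
  have xs: "set xs = -{a}" using c by (auto simp: cord_def)
  \<comment> \<open>The eigenvalue of T_a x_a on f; it is at least 1 because ranks do not exceed n -
    1.\<close>
  define e where "e = ev k (a # xs) \<eta> a + 1 + k * (real CARD('n) - 1)"
  have "k * real (rk (a # xs) \<eta> a) <= k * (real CARD('n) - 1)"
    using rk_le[of "a # xs" \<eta> a] jrec_raise.prems zero_less_card_finite[where 'a='n]
    by (intro mult_left_mono) linarith+
  then have e: "e > 0" by (simp add: e_def ev_def)
  have "dT k a (%x. x $ a * f x) = (%x. of_real e * f x)"
  proof
    fix x
    have "dT k a (%x. x $ a * f x) x = DD k (a # xs) a f x + (1 + of_real (k * (real CARD('n) - 1))) * f x"
      by (simp add: DD_def dunkl_coord_mult_hom[OF h]) (simp add: RR_def xs algebra_simps swapc_commute[of a])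
    also have "... = of_real e * f x"
      by (simp add: jrec_DD[OF jrec_raise.hyps jrec_raise.prems] e_def algebra_simps)
    finally show "dT k a (%x. x $ a * f x) x = of_real e * f x" .
  qed
  then have "fform k (Suc (mdeg \<eta>)) (%x. x $ a * f x) (%x. x $ a * f x) = of_real (e * r)"
    using fform_coord_left[OF h hom_coord[OF h], of k a a] fform_cmult_right[OF h, of k f "of_real e"] r by simp
  then show ?case unfolding mdeg_upd using e r by (intro exI[of _ "e * r"]) (simp del: fform.simps)
next
  case (jrec_eq ys a b zs \<eta> f)
  then show ?case using fform_swapc[OF jrec_hom jrec_hom] by fastforce
next
  case (jrec_neq ys a b zs \<eta> f cc)
  then obtain r where r: "r > 0" "fform k (mdeg \<eta>) f f = of_real r" by blast
  let ?xs = "ys @ a # b # zs" and ?m = "mdeg \<eta>" and ?g = "%x. f (swapc a b x)"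
  note c = jrec_cord[OF jrec_neq.hyps(1)] and h = jrec_hom[OF jrec_neq.hyps(1)]
  note D = jrec_DD[OF jrec_neq.hyps(1) jrec_neq.prems]
  have hg: "hom ?m ?g" using h by (rule hom_swapc)
  let ?ea = "ev k ?xs \<eta> a" and ?eb = "ev k ?xs \<eta> b"
  have gap: "k < \<bar>?eb - ?ea\<bar>" using ev_gap[OF jrec_neq.prems jrec_neq.hyps(2)] by blast
  have "\<bar>cc\<bar> = k / \<bar>?eb - ?ea\<bar>" using jrec_neq.hyps(3) jrec_neq.prems by simp
  then have cc: "\<bar>cc\<bar> < 1" using gap jrec_neq.prems by (simp add: divide_less_eq)
  have "?eb - ?ea ~= 0" using gap jrec_neq.prems by auto
  then have cc': "cc * (?eb - ?ea) = k" using jrec_neq.hyps(3) by simp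
  have "\<bar>cc\<bar> * \<bar>cc\<bar> < 1 * 1" using cc by (intro mult_strict_mono) auto
  then have cc2: "cc\<^sup>2 < 1" by (simp add: power2_eq_square abs_mult_self_eq)
  \<comment> \<open>The mixed product of f with its transposed copy is found by letting the
    self-adjoint operator of a act on either side.\<close>
  have "fform k ?m (DD k ?xs a ?g) f = fform k ?m ?g (DD k ?xs a f)"
    by (rule fform_DD[OF hg h])
  moreover have "DD k ?xs a ?g = (%x. of_real ?eb * ?g x + of_real k * f x)"
    by (rule ext) (simp add: DD_swapc[OF c h] D)
  moreover have "DD k ?xs a f = (%x. of_real ?ea * f x)" using D by blast
  ultimately have "of_real ?eb * fform k ?m ?g f + of_real k * of_real r = of_real ?ea * fform k ?m ?g f"
    using h hg r by (simp add: fform_add_left fform_cmult_left fform_cmult_right hom_cmult)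
  then have "of_real (?eb - ?ea) * fform k ?m ?g f = - of_real k * of_real r"
    by (simp add: algebra_simps)
  also have "... = of_real (?eb - ?ea) * (- of_real cc * of_real r)"
    unfolding arg_cong[OF cc', of complex_of_real, symmetric] of_real_mult by (simp only: mult_ac minus_mult_left minus_mult_right)
  finally have gf: "fform k ?m ?g f = - of_real cc * of_real r"
    using gap jrec_neq.prems by (subst (asm) mult_cancel_left) auto
  have "fform k ?m f ?g = - of_real cc * of_real r" using gf fform_sym[OF h hg] by simp
  moreover have "fform k ?m ?g ?g = of_real r" using fform_swapc[OF h h] r by simp
  ultimately have "fform k ?m (%x. f x + of_real cc * ?g x) (%x. f x + of_real cc * ?g x) = of_real ((1 - cc\<^sup>2) * r)"
    using gf r h hg
    by (simp add: fform_add_left fform_add_right fform_cmult_left fform_cmult_right hom_cmult hom_add algebra_simps power2_eq_square)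
  then show ?case using cc2 r by (intro exI[of _ "(1 - cc\<^sup>2) * r"]) simp
qed

lemma jrec_move: "jrec k (ys @ zs @ a # ws) \<eta> f ==> \<exists>f. jrec k (ys @ a # zs @ ws) \<eta> f"
proof (induction zs arbitrary: ws f rule: rev_induct)
  case Nil then show ?case by auto
next
  case (snoc b zs)
  then have j: "jrec k ((ys @ zs) @ b # a # ws) \<eta> f" by simp
  have "\<exists>g. jrec k ((ys @ zs) @ a # b # ws) \<eta> g"
    by (cases "\<eta> b = \<eta> a") (use jrec_eq[OF j] jrec_neq[OF j] in auto)
  then show ?case using snoc.IH[of "b # ws"] by auto
qed

text \<open>Lower a positive entry, put its coordinate first in the order and raise it again; it is
  then last, and swaps of neighbours, which leave the multi-index alone, carry it to its place in
  \<open>xs\<close>.\<close>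

lemma jrec_exists:
  fixes \<eta> :: "'n::{finite,linorder} => nat"
  shows "cord xs ==> \<exists>f. jrec k xs \<eta> f"
proof (induction "mdeg \<eta>" arbitrary: \<eta> xs)
  case 0
  then have "\<eta> = (%_. 0)" by (auto simp: mdeg_def)
  then show ?case using jrec_one 0 by blast
next
  case (Suc m)
  then obtain a where a: "\<eta> a > 0" by (metis Zero_not_Suc mdeg_def neq0_conv sum.neutral)
  define \<eta>' where "\<eta>' = \<eta>(a := \<eta> a - 1)"
  have e: "\<eta> = \<eta>'(a := Suc (\<eta>' a))" using a by (auto simp: \<eta>'_def)
  have m: "m = mdeg \<eta>'" using Suc.hyps(2) e mdeg_upd[of \<eta>' a] by simp
  obtain ys zs where xs: "xs = ys @ a # zs" using Suc.prems by (metis UNIV_I cord_def split_list)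
  have "cord (a # ys @ zs)" using Suc.prems by (auto simp: xs cord_def)
  then obtain f where "jrec k (a # ys @ zs) \<eta>' f" using Suc.hyps(1)[OF m] by blast
  from jrec_raise[OF this] have "jrec k (ys @ zs @ a # []) \<eta> (%x. x $ a * f x)" using e by simp
  then show ?case using jrec_move xs by fastforce
qed

section \<open>Sorting multi-indices\<close>

lemma ipos_less: "ipos (i::'n::{finite,linorder}) < ipos j \<longleftrightarrow> i < j"
proof -
  have *: "ipos i < ipos j" if "i < j" for i j :: 'n
    unfolding ipos_def using that by (intro psubset_card_mono) auto
  show ?thesis using *[of i j] *[of j i] by (cases i j rule: linorder_cases) auto
qed

lemma inj_ipos: "inj (ipos :: 'n::{finite,linorder} => nat)"
  by (rule injI) (metis ipos_less linorder_neq_iff)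

lemma ipos_range: "range (ipos :: 'n::{finite,linorder} => nat) = {..<CARD('n)}"
proof (rule card_subset_eq)
  show "range (ipos :: 'n => nat) \<subseteq> {..<CARD('n)}"
  proof
    fix x assume "x \<in> range (ipos :: 'n => nat)"
    then obtain j :: 'n where x: "x = ipos j" by blast
    have "ipos j < card (UNIV :: 'n set)" unfolding ipos_def by (intro psubset_card_mono) auto
    then show "x \<in> {..<CARD('n)}" by (simp add: x)
  qed
qed (simp_all add: card_image inj_ipos)

definition RS :: "('n::{finite,linorder} => nat) => 'n => 'n set" where
  "RS \<eta> j = {i. \<eta> j < \<eta> i \<or> \<eta> i = \<eta> j \<and> i < j}"

text \<open>The place of a coordinate in the decreasing rearrangement, with ties kept in the
  original order. Its inverse will turn out to be \<open>wperm \<eta>\<close>.\<close>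

definition srt :: "('n::{finite,linorder} => nat) => 'n => 'n" where
  "srt \<eta> j = inv ipos (card (RS \<eta> j))"

lemma ipos_srt: "ipos (srt \<eta> j) = card (RS \<eta> j)"
proof -
  have "card (RS \<eta> j) < card (UNIV :: 'a set)" by (intro psubset_card_mono) (auto simp: RS_def)
  then have "card (RS \<eta> j) \<in> range (ipos :: 'a => nat)" by (simp add: ipos_range)
  then show ?thesis unfolding srt_def by (rule f_inv_into_f)
qed

lemma srt_less: "srt \<eta> i < srt \<eta> j \<longleftrightarrow> i \<in> RS \<eta> j"
proof -
  have *: "srt \<eta> i < srt \<eta> j" if "i \<in> RS \<eta> j" for i j
  proof -
    have "RS \<eta> i \<subset> RS \<eta> j" using that by (auto simp: RS_def)
    then show ?thesis unfolding ipos_less[symmetric] ipos_srt by (intro psubset_card_mono) auto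
  qed
  have "i = j \<or> i \<in> RS \<eta> j \<or> j \<in> RS \<eta> i" by (auto simp: RS_def)
  then show ?thesis using *[of i j] *[of j i] by (auto simp: RS_def)
qed

lemma inj_srt: "inj (srt \<eta>)"
proof (rule injI)
  fix i j assume "srt \<eta> i = srt \<eta> j"
  then have "i \<notin> RS \<eta> j" "j \<notin> RS \<eta> i" using srt_less[of \<eta>] by (metis less_irrefl)+
  then show "i = j" by (auto simp: RS_def)
qed

lemma bij_srt: "bij (srt \<eta>)"
  unfolding bij_def using inj_srt finite_UNIV_inj_surj[OF finite inj_srt] by blast

lemma permutes_UNIV_bij: "w permutes UNIV \<longleftrightarrow> bij w"
  by (metis UNIV_I bij_imp_permutes permutes_bij)

lemma downset_eq:
  fixes A B :: "'n::{finite,linorder} set"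
  assumes "\<And>i j. j \<in> A ==> i <= j ==> i \<in> A" "\<And>i j. j \<in> B ==> i <= j ==> i \<in> B" "card A = card B"
  shows "A = B"
proof -
  have "A \<subseteq> B \<or> B \<subseteq> A" using assms(1,2) by (meson linear subsetI)
  then show ?thesis using assms(3) card_subset_eq[of A B] card_subset_eq[of B A] by auto
qed

text \<open>The sets where a decreasing function is at least t are initial segments, hence
  determined by their sizes, and rearranging does not change these sizes.\<close>

lemma partition_unique:
  fixes \<rho> \<sigma> :: "'n::{finite,linorder} => nat"
  assumes "is_partition \<rho>" "is_partition \<sigma>" "\<rho> = \<sigma> \<circ> g" "bij g"
  shows "\<rho> = \<sigma>"
proof -
  have "{i. t <= \<rho> i} = {i. t <= \<sigma> i}" for t
  proof (rule downset_eq)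
    have "{i. t <= \<sigma> i} = g ` {i. t <= \<rho> i}"
      using assms(3,4) by (auto simp: bij_def image_iff surj_def)
    then show "card {i. t <= \<rho> i} = card {i. t <= \<sigma> i}"
      using assms(4) by (simp add: card_image bij_def inj_on_def)
  qed (use assms(1,2) in \<open>auto simp: is_partition_def intro: order_trans\<close>)
  then have "t <= \<rho> i \<longleftrightarrow> t <= \<sigma> i" for t i by blast
  then show ?thesis by (metis order_antisym order_refl ext)
qed

lemma is_partition_sorted: "is_partition (\<eta> \<circ> inv (srt \<eta>))"
  unfolding is_partition_def
proof safe
  fix i j :: 'a assume "i <= j"
  define a b where "a = inv (srt \<eta>) i" and "b = inv (srt \<eta>) j"
  have "i = srt \<eta> a" "j = srt \<eta> b" using bij_srt[of \<eta>] by (simp_all add: a_def b_def bij_is_surj surj_f_inv_f)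
  then have "a = b \<or> a \<in> RS \<eta> b" using \<open>i <= j\<close> inj_srt[of \<eta>] srt_less[of \<eta> a b] by (auto simp: le_less inj_eq)
  then show "(\<eta> \<circ> inv (srt \<eta>)) j <= (\<eta> \<circ> inv (srt \<eta>)) i" by (auto simp: a_def b_def RS_def)
qed

lemma dec_rearr_unique:
  assumes "is_partition \<rho>" "bij g" "\<rho> = \<eta> \<circ> g"
  shows "dec_rearr \<eta> = \<rho>"
  unfolding dec_rearr_def
proof (rule the_equality)
  show "is_partition \<rho> \<and> (\<exists>w. w permutes UNIV \<and> \<rho> = pact w \<eta>)"
  proof (intro conjI exI)
    show "inv g permutes UNIV" using assms(2) by (simp add: permutes_UNIV_bij bij_imp_bij_inv)
    show "\<rho> = pact (inv g) \<eta>" unfolding pact_def inv_inv_eq[OF assms(2)] by (rule assms(3))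
  qed (rule assms(1))
  fix \<sigma> assume "is_partition \<sigma> \<and> (\<exists>w. w permutes UNIV \<and> \<sigma> = pact w \<eta>)"
  then obtain w where "is_partition \<sigma>" "w permutes UNIV" "\<sigma> = pact w \<eta>" by blast
  then have w: "is_partition \<sigma>" "bij w" "\<sigma> = \<eta> \<circ> inv w"
    unfolding pact_def permutes_UNIV_bij by blast+
  have "\<sigma> = \<rho> \<circ> (inv g \<circ> inv w)" using w(3) assms(2,3)
    by (simp add: fun_eq_iff bij_is_surj surj_f_inv_f)
  moreover have "bij (inv g \<circ> inv w)" by (rule bij_comp) (simp_all add: bij_imp_bij_inv w(2) assms(2))
  ultimately show "\<sigma> = \<rho>" by (rule partition_unique[OF w(1) assms(1)])
qed

lemma dec_rearr_eq: "dec_rearr \<eta> = \<eta> \<circ> inv (srt \<eta>)"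
  by (rule dec_rearr_unique[OF is_partition_sorted bij_imp_bij_inv[OF bij_srt] refl])

lemma dec_rearr_srt: "dec_rearr \<eta> (srt \<eta> j) = \<eta> j"
  by (simp add: dec_rearr_eq inj_srt)

lemma is_partition_dec_rearr: "is_partition (dec_rearr \<eta>)"
  by (simp add: dec_rearr_eq is_partition_sorted)

lemma dec_rearr_comp:
  assumes "bij g" shows "dec_rearr (\<eta> \<circ> g) = dec_rearr \<eta>"
proof (rule dec_rearr_unique[OF is_partition_dec_rearr])
  show "bij (inv g \<circ> inv (srt \<eta>))" using assms by (intro bij_comp bij_imp_bij_inv bij_srt)
  show "dec_rearr \<eta> = \<eta> \<circ> g \<circ> (inv g \<circ> inv (srt \<eta>))"
    using assms by (simp add: dec_rearr_eq fun_eq_iff bij_is_surj surj_f_inv_f)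
qed

lemma dec_rearr_partition: "is_partition \<rho> ==> dec_rearr \<rho> = \<rho>"
  by (rule dec_rearr_unique[of _ id]) auto

lemma sum_comp_bij: "bij g ==> (\<Sum>i\<in>UNIV. f (g i)) = (\<Sum>i\<in>UNIV. f i)"
  by (rule sum.reindex_bij_betw)

lemma mdeg_comp: "bij g ==> mdeg (\<eta> \<circ> g) = mdeg \<eta>"
  unfolding mdeg_def o_def by (rule sum_comp_bij)

lemma mdeg_dec_rearr: "mdeg (dec_rearr \<eta>) = mdeg \<eta>"
  unfolding dec_rearr_eq by (rule mdeg_comp) (intro bij_imp_bij_inv bij_srt)

section \<open>The minimal coset representative and the Bruhat order\<close>

definition invs :: "('n::{finite,linorder} => 'n) => ('n \<times> 'n) set" where
  "invs u = {(p, q). p < q \<and> u q < u p}"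

lemma plen_invs: "plen u = card (invs u)"
  by (simp add: plen_def invs_def)

lemma plen_inv:
  assumes "bij w" shows "plen (inv w) = plen w"
proof -
  have "bij_betw (%(i, j). (w j, w i)) (invs w) (invs (inv w))"
    by (rule bij_betw_byWitness[where f'="%(p, q). (inv w q, inv w p)"])
      (use assms in \<open>auto simp: invs_def bij_is_inj bij_is_surj surj_f_inv_f inv_f_f\<close>)
  then show ?thesis by (simp add: plen_invs bij_betw_same_card)
qed

lemma invs_srt: "invs (srt \<eta>) = {(p, q). p < q \<and> \<eta> p < \<eta> q}"
  by (auto simp: invs_def srt_less RS_def)

text \<open>Any permutation that sorts \<eta> has to invert each pair that stands in the wrong
  order, and \<open>srt \<eta>\<close> inverts no other pair. So \<open>srt \<eta>\<close> is the
  shortest sorting permutation.\<close>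

lemma invs_sorting:
  assumes "is_partition \<rho>" "\<eta> = \<rho> \<circ> u"
  shows "invs (srt \<eta>) \<subseteq> invs u"
  unfolding invs_srt using assms by (auto simp: invs_def is_partition_def) (meson leD not_le)

text \<open>The inversions fix the relative order of all values, and a value of a permutation is
  determined by how many values lie below it.\<close>

lemma invs_inject:
  fixes u v :: "'n::{finite,linorder} => 'n"
  assumes "bij u" "bij v" "invs u = invs v"
  shows "u = v"
proof
  fix p
  have lt: "u q < u p \<longleftrightarrow> v q < v p" for p q
  proof (cases p q rule: linorder_cases)
    case less
    then show ?thesis using assms(3) by (auto simp: invs_def set_eq_iff)
  next
    case greater
    then have "u p < u q \<longleftrightarrow> v p < v q" using assms(3) by (auto simp: invs_def set_eq_iff)
    moreover have "u p ~= u q" "v p ~= v q" using greater assms(1,2) by (auto simp: bij_def inj_eq)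
    ultimately show ?thesis by auto
  qed auto
  have pos: "ipos (w p) = card {q. w q < w p}" if "bij w" for w :: "'n => 'n"
  proof -
    have "{i. i < w p} = w ` {q. w q < w p}" using that by (auto simp: bij_def image_iff surj_def)
    then show ?thesis using that by (simp add: ipos_def card_image bij_def inj_on_def)
  qed
  have "ipos (u p) = ipos (v p)" using pos[OF assms(1)] pos[OF assms(2)] lt by simp
  then show "u p = v p" by (rule injD[OF inj_ipos])
qed

lemma wperm_eq: "wperm \<eta> = inv (srt \<eta>)"
  unfolding wperm_def
proof (rule the_equality)
  have ii: "inv (inv (srt \<eta>)) = srt \<eta>" by (simp add: inv_inv_eq bij_srt)
  have e: "pact (inv (srt \<eta>)) (dec_rearr \<eta>) = \<eta>"
    by (simp add: pact_def ii fun_eq_iff dec_rearr_srt)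
  have min: "plen (inv (srt \<eta>)) <= plen v" "plen v <= plen (inv (srt \<eta>)) ==> v = inv (srt \<eta>)"
    if v: "bij v" "pact v (dec_rearr \<eta>) = \<eta>" for v
  proof -
    have bv: "bij (inv v)" using v by (simp add: bij_imp_bij_inv)
    have s: "invs (srt \<eta>) \<subseteq> invs (inv v)"
      using v by (intro invs_sorting[OF is_partition_dec_rearr[of \<eta>]]) (auto simp: pact_def)
    have p: "plen (inv (srt \<eta>)) = card (invs (srt \<eta>))" "plen v = card (invs (inv v))"
      using plen_inv[OF bij_srt] plen_inv[OF v(1)] by (simp_all add: plen_invs)
    show "plen (inv (srt \<eta>)) <= plen v" unfolding p using s by (intro card_mono) auto
    assume "plen v <= plen (inv (srt \<eta>))"
    then have "invs (srt \<eta>) = invs (inv v)" using s unfolding p by (intro card_seteq) auto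
    then have "srt \<eta> = inv v" using invs_inject bij_srt bv by blast
    then show "v = inv (srt \<eta>)" using v by (simp add: inv_inv_eq)
  qed
  show "inv (srt \<eta>) permutes UNIV \<and> pact (inv (srt \<eta>)) (dec_rearr \<eta>) = \<eta> \<and>
    (\<forall>v. v permutes UNIV \<and> pact v (dec_rearr \<eta>) = \<eta> \<longrightarrow> plen (inv (srt \<eta>)) <= plen v)"
    using e min(1) by (auto simp: permutes_UNIV_bij bij_imp_bij_inv bij_srt)
  show "w = inv (srt \<eta>)" if "w permutes UNIV \<and> pact w (dec_rearr \<eta>) = \<eta> \<and>
    (\<forall>v. v permutes UNIV \<and> pact v (dec_rearr \<eta>) = \<eta> \<longrightarrow> plen w <= plen v)" for w
    using that e min(2)[of w] by (auto simp: permutes_UNIV_bij bij_imp_bij_inv bij_srt)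
qed

lemma plen_transpose_less:
  fixes u :: "'n::{finite,linorder} => 'n"
  assumes "i < j" "u i < u j"
  shows "plen u < plen (u \<circ> tsp i j)"
proof -
  let ?s = "tsp i j"
  \<comment> \<open>An inversion of u is carried along by the transposition unless this would
    reverse the pair; in that case the pair itself is still inverted after the transposition. The
    pair (i, j) is inverted in addition, which makes the inequality strict.\<close>
  define \<phi> where "\<phi> = (%(p, q). if ?s p < ?s q then (?s p, ?s q) else (p, q))"
  have 1: "\<phi> pq \<in> invs (u \<circ> ?s)" if inv: "pq \<in> invs u" for pq
  proof -
    obtain p q where pq: "pq = (p, q)" "p < q" "u q < u p" using inv by (cases pq) (auto simp: invs_def)
    show ?thesis
    proof (cases "?s p < ?s q")
      case True then show ?thesis using pq by (simp add: \<phi>_def invs_def)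
    next
      case False
      then have "p = i \<and> i < q \<and> q < j \<or> q = j \<and> i < p \<and> p < j \<or> p = i \<and> q = j"
        using pq assms(1) by (auto simp: tsp_def split: if_splits)
      then have "u (?s q) < u (?s p)" using pq assms by (auto simp: tsp_def)
      then show ?thesis using pq False by (simp add: \<phi>_def invs_def)
    qed
  qed
  have 2: "inj_on \<phi> (invs u)"
    by (rule inj_onI) (auto simp: \<phi>_def invs_def inj_eq[OF inj_transpose] split: if_splits dest: injD[OF inj_transpose])
  have 3: "(i, j) \<in> invs (u \<circ> ?s)" using assms by (simp add: invs_def)
  have 4: "(i, j) \<notin> \<phi> ` invs u"
  proof
    assume "(i, j) \<in> \<phi> ` invs u"
    then obtain p q where pq: "p < q" "u q < u p" "(i, j) = \<phi> (p, q)" by (auto simp: invs_def)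
    show False
    proof (cases "?s p < ?s q")
      case True
      then have "?s p = i" "?s q = j" using pq by (auto simp: \<phi>_def)
      then have "p = j" "q = i" by (metis transpose_apply_first transpose_apply_second transpose_involutory)+
      then show False using pq assms by auto
    next
      case False
      then show False using pq assms by (auto simp: \<phi>_def)
    qed
  qed
  have "card (invs u) = card (\<phi> ` invs u)" using 2 by (simp add: card_image)
  also have "... < card (invs (u \<circ> ?s))"
    using 1 3 4 by (intro psubset_card_mono) auto
  finally show ?thesis by (simp add: plen_invs)
qed

lemma bij_transpose: "bij (tsp a b)"
  by (metis bij_betw_def inj_transpose surj_transpose)

text \<open>As no entry between the positions i and j equals one of theirs, the swap does not change
  the order inside any group of tied entries, and the stable sorting is merely composed with the
  transposition.\<close>

lemma srt_tight:
  fixes \<eta> :: "'n::{finite,linorder} => nat"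
  assumes "i < j" "\<eta> j < \<eta> i" and tight: "\<And>l. i < l ==> l < j ==> \<eta> l ~= \<eta> i \<and> \<eta> l ~= \<eta> j"
  shows "srt (\<eta> \<circ> tsp i j) = srt \<eta> \<circ> tsp i j"
proof
  fix b
  let ?s = "tsp i j"
  have ord: "a < b \<longleftrightarrow> ?s a < ?s b" if "\<eta> (?s a) = \<eta> (?s b)" for a b
  proof -
    have t: "?s c = (if c = i then j else if c = j then i else c)" for c
      by (simp add: tsp_def)
    show ?thesis using that assms(1,2) tight[of a] tight[of b] unfolding t
      by (auto split: if_splits) (metis linorder_neqE less_trans)+
  qed
  have "RS (\<eta> \<circ> ?s) b = ?s ` RS \<eta> (?s b)"
  proof -
    have "a \<in> RS (\<eta> \<circ> ?s) b \<longleftrightarrow> ?s a \<in> RS \<eta> (?s b)" for a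
      using ord[of a b] by (auto simp: RS_def)
    then have "RS (\<eta> \<circ> ?s) b = ?s -` RS \<eta> (?s b)" by (simp add: vimage_def set_eq_iff)
    also have "... = inv ?s ` RS \<eta> (?s b)" by (rule bij_vimage_eq_inv_image[OF bij_transpose])
    finally show ?thesis by (simp add: inv_unique_comp[of ?s ?s])
  qed
  then have "card (RS (\<eta> \<circ> ?s) b) = card (RS \<eta> (?s b))"
    by (simp add: card_image[OF inj_on_subset[OF inj_transpose subset_UNIV]])
  then show "srt (\<eta> \<circ> ?s) b = (srt \<eta> \<circ> ?s) b" by (simp add: srt_def)
qed

text \<open>Without ties between i and j this is one Bruhat step by \<open>srt_tight\<close>. If
  some l between them has the entry of i or of j, the swap factors into two swaps through l, each
  with fewer tied positions in between.\<close>

lemma bruhat_swap: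
  fixes \<eta> :: "'n::{finite,linorder} => nat"
  shows "i < j ==> \<eta> j < \<eta> i ==> bruhat_less (wperm \<eta>) (wperm (\<eta> \<circ> tsp i j))"
proof (induction "card {l. i < l \<and> l < j \<and> (\<eta> l = \<eta> i \<or> \<eta> l = \<eta> j)}" arbitrary: i j \<eta> rule: less_induct)
  case less
  let ?B = "%i j \<eta>. {l. i < l \<and> l < j \<and> (\<eta> l = \<eta> i \<or> \<eta> l = \<eta> j)}"
  have trans: "bruhat_less u v ==> bruhat_less v w ==> bruhat_less u w" for u v w :: "'n => 'n"
    unfolding bruhat_less_def by (rule tranclp_trans)
  show ?case
  proof (cases "?B i j \<eta> = {}")
    case True
    let ?s = "tsp i j"
    have "srt (\<eta> \<circ> ?s) = srt \<eta> \<circ> ?s" using less.prems True by (intro srt_tight) auto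
    then have w: "wperm (\<eta> \<circ> ?s) = ?s \<circ> wperm \<eta>"
      by (simp add: wperm_eq o_inv_distrib bij_srt bij_transpose inv_unique_comp[of ?s ?s])
    have "srt \<eta> i < srt \<eta> j" using less.prems by (simp add: srt_less RS_def)
    then have "plen (srt \<eta>) < plen (srt \<eta> \<circ> ?s)" using less.prems(1) by (intro plen_transpose_less)
    moreover have "plen (wperm \<eta>) = plen (srt \<eta>)" using plen_inv[OF bij_srt] by (simp add: wperm_eq)
    moreover have "plen (wperm (\<eta> \<circ> ?s)) = plen (srt \<eta> \<circ> ?s)"
      using \<open>srt (\<eta> \<circ> ?s) = _\<close> plen_inv[OF bij_srt, of "\<eta> \<circ> ?s"] by (simp add: wperm_eq)
    ultimately have "plen (wperm \<eta>) < plen (wperm (\<eta> \<circ> ?s))" by simp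
    moreover have "wperm \<eta> permutes UNIV" by (simp add: wperm_eq permutes_UNIV_bij bij_imp_bij_inv bij_srt)
    moreover have "i ~= j" using less.prems(1) by simp
    ultimately show ?thesis unfolding bruhat_less_def
      by (intro tranclp.r_into_trancl conjI exI[of _ i] exI[of _ j]) (simp_all add: w)
  next
    case False
    then obtain l where l: "i < l" "l < j" "\<eta> l = \<eta> i \<or> \<eta> l = \<eta> j" by blast
    have ne: "i ~= l" "l ~= j" "i ~= j" using l by auto
    show ?thesis
    proof (cases "\<eta> l = \<eta> j")
      case True
      define \<eta>1 where "\<eta>1 = \<eta> \<circ> tsp i l"
      have v: "\<eta>1 l = \<eta> i" "\<eta>1 j = \<eta> j" "\<eta>1 i = \<eta> l" "\<And>p. p ~= i ==> p ~= l ==> \<eta>1 p = \<eta> p"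
        using ne by (simp_all add: \<eta>1_def tsp_def)
      have e: "\<eta>1 \<circ> tsp l j = \<eta> \<circ> tsp i j"
        using ne True by (auto simp: fun_eq_iff \<eta>1_def tsp_def)
      have "?B i l \<eta> \<subset> ?B i j \<eta>" using l True by auto
      then have "bruhat_less (wperm \<eta>) (wperm \<eta>1)" unfolding \<eta>1_def
        using l True less.prems by (intro less.hyps psubset_card_mono) auto
      moreover have "?B l j \<eta>1 \<subset> ?B i j \<eta>" using l True v ne less.prems by auto
      then have "bruhat_less (wperm \<eta>1) (wperm (\<eta>1 \<circ> tsp l j))"
        using l True less.prems v by (intro less.hyps psubset_card_mono) auto
      ultimately show ?thesis using trans e by metis
    next
      case False
      with l have lv: "\<eta> l = \<eta> i" by auto
      define \<eta>1 where "\<eta>1 = \<eta> \<circ> tsp l j"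
      have v: "\<eta>1 l = \<eta> j" "\<eta>1 j = \<eta> l" "\<eta>1 i = \<eta> i" "\<And>p. p ~= j ==> p ~= l ==> \<eta>1 p = \<eta> p"
        using ne by (simp_all add: \<eta>1_def tsp_def)
      have e: "\<eta>1 \<circ> tsp i l = \<eta> \<circ> tsp i j"
        using ne lv by (auto simp: fun_eq_iff \<eta>1_def tsp_def)
      have "?B l j \<eta> \<subset> ?B i j \<eta>" using l lv by auto
      then have "bruhat_less (wperm \<eta>) (wperm \<eta>1)" unfolding \<eta>1_def
        using l lv less.prems by (intro less.hyps psubset_card_mono) auto
      moreover have "?B i l \<eta>1 \<subset> ?B i j \<eta>" using l lv v ne less.prems by auto
      then have "bruhat_less (wperm \<eta>1) (wperm (\<eta>1 \<circ> tsp i l))"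
        using l lv less.prems v by (intro less.hyps psubset_card_mono) auto
      ultimately show ?thesis using trans e by metis
    qed
  qed
qed

lemma jprec_swap:
  assumes "i < j" "\<eta> j < \<eta> i"
  shows "jprec (\<eta> \<circ> tsp i j) \<eta>"
  using bruhat_swap[OF assms] by (simp add: jprec_def mdeg_comp dec_rearr_comp bij_transpose)

section \<open>Dominance\<close>

lemma sum_le_initial:
  fixes \<rho> :: "'n::{finite,linorder} => nat"
  assumes "is_partition \<rho>" "card A = card {i. i <= j}"
  shows "(\<Sum>i\<in>A. \<rho> i) <= (\<Sum>i\<in>{i. i <= j}. \<rho> i)"
proof -
  let ?J = "{i. i <= j}"
  have c: "card (A - ?J) = card (?J - A)"
    using assms(2) card_Diff_subset_Int[of A ?J] card_Diff_subset_Int[of ?J A] by (simp add: Int_commute)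
  have le1: "\<rho> i <= \<rho> j" if "\<not> i <= j" for i using assms(1) that by (simp add: is_partition_def)
  have le2: "\<rho> j <= \<rho> i" if "i <= j" for i using assms(1) that by (simp add: is_partition_def)
  have "(\<Sum>i\<in>A - ?J. \<rho> i) <= card (A - ?J) * \<rho> j"
    using sum_bounded_above[of "A - ?J" \<rho> "\<rho> j"] le1 by simp
  also have "... <= (\<Sum>i\<in>?J - A. \<rho> i)"
    unfolding c using sum_bounded_below[of "?J - A" "\<rho> j" \<rho>] le2 by simp
  finally have "(\<Sum>i\<in>A - ?J. \<rho> i) + (\<Sum>i\<in>A \<inter> ?J. \<rho> i) <= (\<Sum>i\<in>?J - A. \<rho> i) + (\<Sum>i\<in>?J \<inter> A. \<rho> i)"
    by (simp add: Int_commute)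
  then show ?thesis
    using sum.Int_Diff[of A \<rho> ?J] sum.Int_Diff[of ?J \<rho> A] by (simp add: add.commute)
qed

text \<open>With \<open>dec_rearr_sum_obtain\<close> this describes a partial sum of the decreasing
  rearrangement as the largest sum over index sets of the given size, a description in which no
  sorting occurs.\<close>

lemma dec_rearr_sum_ge:
  fixes \<eta> :: "'n::{finite,linorder} => nat"
  assumes "card A = card {i. i <= j}"
  shows "(\<Sum>i\<in>A. \<eta> i) <= (\<Sum>i\<in>{i. i <= j}. dec_rearr \<eta> i)"
proof -
  have "(\<Sum>i\<in>A. \<eta> i) = (\<Sum>i\<in>A. dec_rearr \<eta> (srt \<eta> i))" by (simp add: dec_rearr_srt)
  also have "... = (\<Sum>i\<in>srt \<eta> ` A. dec_rearr \<eta> i)"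
    by (subst sum.reindex) (auto intro: inj_on_subset[OF inj_srt])
  also have "... <= (\<Sum>i\<in>{i. i <= j}. dec_rearr \<eta> i)"
    using assms by (intro sum_le_initial is_partition_dec_rearr) (simp add: card_image inj_on_subset[OF inj_srt])
  finally show ?thesis .
qed

lemma dec_rearr_sum_obtain:
  fixes \<eta> :: "'n::{finite,linorder} => nat"
  obtains A where "card A = card {i. i <= j}" "(\<Sum>i\<in>{i. i <= j}. dec_rearr \<eta> i) = (\<Sum>i\<in>A. \<eta> i)"
proof
  let ?A = "inv (srt \<eta>) ` {i. i <= j}"
  have i: "inj (inv (srt \<eta>))" using bij_srt bij_imp_bij_inv bij_is_inj by blast
  show "card ?A = card {i. i <= j}" by (simp add: card_image inj_on_subset[OF i])
  show "(\<Sum>i\<in>{i. i <= j}. dec_rearr \<eta> i) = (\<Sum>i\<in>?A. \<eta> i)"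
    by (subst sum.reindex) (auto intro: inj_on_subset[OF i] simp: dec_rearr_eq)
qed

text \<open>Moving two entries towards each other at constant sum. For each index set A some set of
  the same size has at least the same sum before the move: A itself, or A with j replaced by i. The
  inequality is strict because the sum of squares, which no rearrangement changes,
  decreases.\<close>

lemma dom_less_transfer:
  fixes \<eta> :: "'n::{finite,linorder} => nat"
  assumes ij: "i ~= j" and c: "\<eta> j < c" "c < \<eta> i" and cd: "c + d = \<eta> i + \<eta> j"
  defines "ka \<equiv> \<eta>(i := c, j := d)"
  shows "dom_less (dec_rearr ka) (dec_rearr \<eta>)"
proof -
  have d: "\<eta> j < d" "d < \<eta> i" using c cd by auto
  have k: "ka i = c" "ka j = d" "\<And>l. l ~= i ==> l ~= j ==> ka l = \<eta> l" using ij by (auto simp: ka_def)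
  have split: "sum f UNIV = f i + f j + sum f (UNIV - {i} - {j})" for f :: "'n => nat"
    using ij by (simp add: sum.remove[of UNIV i] sum.remove[of "UNIV - {i}" j])
  have rest: "sum (%l. f (ka l)) (UNIV - {i} - {j}) = sum (%l. f (\<eta> l)) (UNIV - {i} - {j})" for f :: "nat => nat"
    using k(3) by (intro sum.cong) auto
  have m: "mdeg ka = mdeg \<eta>"
    unfolding mdeg_def split[of ka] split[of \<eta>] using rest[of "%x. x"] k cd by simp
  have sq: "c * c + d * d < \<eta> i * \<eta> i + \<eta> j * \<eta> j"
  proof -
    have e: "int d = int (\<eta> i) + int (\<eta> j) - int c" using cd by linarith
    have "0 < (int (\<eta> i) - int c) * (int c - int (\<eta> j))" using c by simp
    then have "int c * int c + int d * int d < int (\<eta> i) * int (\<eta> i) + int (\<eta> j) * int (\<eta> j)"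
      unfolding e by (simp add: algebra_simps)
    then show ?thesis by (metis of_nat_add of_nat_less_iff of_nat_mult)
  qed
  have ss: "(\<Sum>l\<in>UNIV. ka l * ka l) < (\<Sum>l\<in>UNIV. \<eta> l * \<eta> l)"
    unfolding split[of "%l. ka l * ka l"] split[of "%l. \<eta> l * \<eta> l"] rest[of "%x. x * x"]
    using sq k by simp
  have sd: "(\<Sum>l\<in>UNIV. dec_rearr \<eta> l * dec_rearr \<eta> l) = (\<Sum>l\<in>UNIV. \<eta> l * \<eta> l)" for \<eta> :: "'n => nat"
    unfolding dec_rearr_eq o_def
    using sum_comp_bij[OF bij_imp_bij_inv[OF bij_srt], of "%l. \<eta> l * \<eta> l" \<eta>] .
  have ne: "dec_rearr ka ~= dec_rearr \<eta>" using ss sd[of ka] sd[of \<eta>] by auto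
  have "(\<Sum>l\<in>{l. l <= p}. dec_rearr ka l) <= (\<Sum>l\<in>{l. l <= p}. dec_rearr \<eta> l)" for p
  proof -
    obtain A where A: "card A = card {l. l <= p}" "(\<Sum>l\<in>{l. l <= p}. dec_rearr ka l) = sum ka A"
      by (rule dec_rearr_sum_obtain)
    have "\<exists>B. card B = card A \<and> sum ka A <= sum \<eta> B"
    proof -
      consider "i \<in> A" "j \<in> A" | "i \<in> A" "j \<notin> A" | "i \<notin> A" "j \<in> A" | "i \<notin> A" "j \<notin> A" by blast
      then show ?thesis
      proof cases
        case 1
        have "sum f A = f i + f j + sum f (A - {i} - {j})" for f :: "'n => nat"
          using 1 ij by (simp add: sum.remove[of A i] sum.remove[of "A - {i}" j])
        moreover have "sum ka (A - {i} - {j}) = sum \<eta> (A - {i} - {j})" using k(3) by (intro sum.cong) auto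
        ultimately have "sum ka A = sum \<eta> A" using k cd by simp
        then show ?thesis by auto
      next
        case 2
        have "sum ka A <= sum \<eta> A" using 2 k c by (intro sum_mono) (metis less_imp_le order_refl)
        then show ?thesis by auto
      next
        case 3
        let ?B = "insert i (A - {j})"
        have "card A = Suc (card (A - {j}))" using 3 by (intro card.remove) auto
        then have "card ?B = card A" using 3 by simp
        moreover have "sum ka A = d + sum \<eta> (A - {j})"
        proof -
          have "sum ka A = ka j + sum ka (A - {j})" using 3 by (intro sum.remove) auto
          moreover have "sum ka (A - {j}) = sum \<eta> (A - {j})" using 3 k(3) by (intro sum.cong) (auto, metis)
          ultimately show ?thesis using k by simp
        qed
        then have "sum ka A <= sum \<eta> ?B" using 3 d by simp
        ultimately show ?thesis by blast
      next
        case 4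
        then have "sum ka A = sum \<eta> A" using k(3) by (intro sum.cong) (auto, metis)
        then show ?thesis by auto
      qed
    qed
    then obtain B where "card B = card A" "sum ka A <= sum \<eta> B" by blast
    then show ?thesis using A dec_rearr_sum_ge[of B p \<eta>] by simp
  qed
  then show ?thesis using ne m by (simp add: dom_less_def mdeg_dec_rearr)
qed

lemma dom_less_trans:
  fixes \<rho> \<sigma> \<tau> :: "'n::{finite,linorder} => nat"
  assumes "dom_less \<rho> \<sigma>" "dom_less \<sigma> \<tau>"
  shows "dom_less \<rho> \<tau>"
proof -
  have inj: "\<rho> = \<sigma>" if "\<And>j. (\<Sum>i\<in>{i. i <= j}. \<rho> i) = (\<Sum>i\<in>{i. i <= j}. \<sigma> i)"
  proof
    fix j :: 'n
    show "\<rho> j = \<sigma> j"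
    proof (induction j rule: measure_induct_rule[of ipos])
      case (less j)
      have "(\<Sum>i\<in>{i. i <= j}. f i) = f j + (\<Sum>i\<in>{i. i < j}. f i)" for f :: "'n => nat"
      proof -
        have "{i. i <= j} = insert j {i. i < j}" by auto
        then show ?thesis by simp
      qed
      moreover have "(\<Sum>i\<in>{i. i < j}. \<rho> i) = (\<Sum>i\<in>{i. i < j}. \<sigma> i)"
        using less by (intro sum.cong) (auto simp: ipos_less)
      ultimately show ?case using that[of j] by simp
    qed
  qed
  have "\<rho> ~= \<tau>"
  proof
    assume "\<rho> = \<tau>"
    then have "\<rho> = \<sigma>" using assms by (intro inj order_antisym) (auto simp: dom_less_def)
    then show False using assms by (simp add: dom_less_def)
  qed
  then show ?thesis using assms unfolding dom_less_def by (auto intro: order_trans)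
qed

lemma bruhat_less_plen: "bruhat_less u v ==> plen u < plen v"
  unfolding bruhat_less_def by (induction rule: tranclp_induct) auto

lemma jprec_irrefl: "\<not> jprec \<eta> \<eta>"
  using bruhat_less_plen[of "wperm \<eta>" "wperm \<eta>"] by (auto simp: jprec_def dom_less_def)

lemma jprec_trans: "jprec ka \<eta> ==> jprec \<eta> \<theta> ==> jprec ka \<theta>"
  unfolding jprec_def bruhat_less_def by (auto intro: dom_less_trans elim: tranclp_trans)

lemma finite_mdeg: "finite {ka. mdeg (ka :: 'n::finite => nat) = m}"
proof (rule finite_subset)
  have "ka i <= mdeg ka" for ka :: "'n => nat" and i unfolding mdeg_def by (rule member_le_sum) auto
  then show "{ka. mdeg (ka :: 'n => nat) = m} \<subseteq> (\<Pi>\<^sub>E i\<in>UNIV. {..m})" by (auto simp: PiE_def)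
qed (auto intro: finite_PiE)

lemma finite_jprec: "finite (jlow \<eta>)"
  by (rule finite_subset[OF _ finite_mdeg[of "mdeg \<eta>"]]) (auto simp: jprec_def)

section \<open>Spectral data\<close>

definition slist :: "'n::{finite,linorder} list" where
  "slist = sorted_list_of_set UNIV"

lemma aft_sorted: "sorted xs ==> distinct xs ==> j \<in> set xs ==> aft xs (j::'n::linorder) = {i \<in> set xs. j < i}"
  by (induction xs) (auto simp: less_le)

lemma aft_slist: "aft slist j = {i. j < i}"
  by (subst aft_sorted) (auto simp: slist_def)

lemma cord_slist: "cord slist"
  by (auto simp: cord_def slist_def)

lemma DD_slist: "DD k slist j f x = cher_op k j f x"
  by (simp add: DD_def cher_op_def aft_slist)

lemma rk_slist: "rk slist \<eta> j = ipos (srt \<eta> j)"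
proof -
  have "i ~= j \<and> (if i \<in> aft slist j then \<eta> j < \<eta> i else \<eta> j <= \<eta> i) \<longleftrightarrow> i \<in> RS \<eta> j" for i
    by (cases i j rule: linorder_cases) (auto simp: aft_slist RS_def)
  then show ?thesis by (simp add: rk_def ipos_srt)
qed

lemma ev_slist: "ev k slist \<eta> j = etabar k \<eta> j"
proof -
  have "RS \<eta> j = {i. i < j \<and> \<eta> j <= \<eta> i} \<union> {i. j < i \<and> \<eta> j < \<eta> i}"
  proof (rule set_eqI)
    fix i show "i \<in> RS \<eta> j \<longleftrightarrow> i \<in> {i. i < j \<and> \<eta> j <= \<eta> i} \<union> {i. j < i \<and> \<eta> j < \<eta> i}"
      by (cases i j rule: linorder_cases) (auto simp: RS_def)
  qed
  then have "card (RS \<eta> j) = card {i. i < j \<and> \<eta> j <= \<eta> i} + card {i. j < i \<and> \<eta> j < \<eta> i}"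
    using card_Un_disjoint[of "{i. i < j \<and> \<eta> j <= \<eta> i}" "{i. j < i \<and> \<eta> j < \<eta> i}"] by fastforce
  then show ?thesis by (simp add: ev_def rk_slist ipos_srt etabar_def algebra_simps)
qed

text \<open>For k > 0 the eigenvalues are ordered strictly like the coordinates under stable
  sorting. They therefore determine \<open>srt \<eta>\<close>, hence all ranks, hence the entries.
  For k = 0 they are the entries.\<close>

lemma etabar_inject:
  fixes \<eta> ka :: "'n::{finite,linorder} => nat"
  assumes k: "0 <= k" and e: "\<And>j. etabar k \<eta> j = etabar k ka j"
  shows "\<eta> = ka"
proof (cases "k = 0")
  case True
  then show ?thesis using e by (auto simp: etabar_def)
next
  case False
  with k have kp: "k > 0" by simp
  have eb: "etabar k \<eta> j = real (\<eta> j) - k * real (ipos (srt \<eta> j))" for \<eta> :: "'n => nat" and j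
    using ev_slist[of k \<eta> j] by (simp add: ev_def rk_slist)
  have lt: "etabar k \<eta> j < etabar k \<eta> i" if "i \<in> RS \<eta> j" for i j and \<eta> :: "'n => nat"
  proof -
    have "ipos (srt \<eta> i) < ipos (srt \<eta> j)" using that by (simp add: ipos_less srt_less)
    then have "k * real (ipos (srt \<eta> i)) < k * real (ipos (srt \<eta> j))" using kp by simp
    moreover have "\<eta> j <= \<eta> i" using that by (auto simp: RS_def)
    ultimately show ?thesis unfolding eb by linarith
  qed
  have "i \<in> RS \<eta> j \<longleftrightarrow> etabar k \<eta> j < etabar k \<eta> i" for i j and \<eta> :: "'n => nat"
  proof -
    have "i = j \<or> i \<in> RS \<eta> j \<or> j \<in> RS \<eta> i" by (auto simp: RS_def)
    then show ?thesis using lt[of i \<eta> j] lt[of j \<eta> i] by (auto simp: RS_def)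
  qed
  then have "RS \<eta> j = RS ka j" for j using e by auto
  then have "srt \<eta> = srt ka" by (simp add: srt_def fun_eq_iff)
  then have "real (\<eta> j) = real (ka j)" for j using e[of j] unfolding eb by simp
  then show ?thesis by auto
qed

section \<open>Monomial expansions\<close>

lemma monom_split: "mon ka x = x $ i ^ ka i * (\<Prod>j\<in>-{i}. x $ j ^ ka j)"
  unfolding monom_def by (subst prod.remove[of UNIV i]) (auto simp: Compl_eq_Diff_UNIV)

lemma monom_upd: "mon (ka(a := Suc (ka a))) x = x $ a * mon ka x"
proof -
  have "(\<Prod>j\<in>-{a}. x $ j ^ (ka(a := Suc (ka a))) j) = (\<Prod>j\<in>-{a}. x $ j ^ ka j)"
    by (intro prod.cong) auto
  then show ?thesis unfolding monom_split[of _ x a] by simp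
qed

lemma monom_zero: "mon (%_. 0) x = 1"
  by (simp add: monom_def)

lemma mdeg_Suc_obtain:
  fixes ka :: "'n::finite => nat"
  assumes "mdeg ka = Suc m"
  obtains a ka' where "ka = ka'(a := Suc (ka' a))" "mdeg ka' = m"
proof -
  obtain a where a: "ka a > 0" using assms by (metis Zero_not_Suc mdeg_def neq0_conv sum.neutral)
  define ka' where "ka' = ka(a := ka a - 1)"
  have e: "ka = ka'(a := Suc (ka' a))" using a by (auto simp: ka'_def)
  then have "mdeg ka' = m" using arg_cong[OF e, of mdeg] assms mdeg_upd[of ka' a] by simp
  then show ?thesis using that[OF e] by blast
qed

lemma hom_monom: "hom (mdeg ka) (mon ka)"
proof (induction "mdeg ka" arbitrary: ka)
  case 0
  then have "ka = (%_. 0)" by (auto simp: mdeg_def)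
  then have "mon ka = (%x. 1)" by (auto simp: monom_zero)
  then show ?case using 0 hom_const[of 1] by simp
next
  case (Suc m)
  obtain a ka' where k: "ka = ka'(a := Suc (ka' a))" "mdeg ka' = m"
    using Suc.hyps(2)[symmetric] by (rule mdeg_Suc_obtain)
  have "mon ka = (%x. x $ a * mon ka' x)" unfolding k(1) by (rule ext) (rule monom_upd)
  then show ?case using Suc.hyps(1)[of ka'] k(2) Suc.hyps(2) hom_coord by metis
qed

lemma sum_mdeg_Suc:
  fixes g :: "('n::finite => nat) => complex"
  shows "(\<Sum>ka\<in>{ka. mdeg ka = Suc m}. if 0 < ka i then g ka else 0) = (\<Sum>ka\<in>mi m. g (ka(i := Suc (ka i))))"
proof -
  have "(\<Sum>ka\<in>{ka. mdeg ka = Suc m}. if 0 < ka i then g ka else 0) = (\<Sum>ka\<in>{ka\<in>{ka. mdeg ka = Suc m}. 0 < ka i}. g ka)"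
    by (rule sum.inter_filter[symmetric, OF finite_mdeg])
  also have "... = (\<Sum>ka\<in>mi m. g (ka(i := Suc (ka i))))"
  proof (rule sum.reindex_bij_witness[where i="%ka. ka(i := Suc (ka i))" and j="%ka. ka(i := ka i - 1)"])
    fix ka :: "'n => nat" assume k: "ka \<in> {ka \<in> {ka. mdeg ka = Suc m}. 0 < ka i}"
    then show e: "(ka(i := ka i - 1))(i := Suc ((ka(i := ka i - 1)) i)) = ka" by auto
    then show "ka(i := ka i - 1) \<in> mi m" using mdeg_upd[of "ka(i := ka i - 1)" i] k by simp
    show "g ((ka(i := ka i - 1))(i := Suc ((ka(i := ka i - 1)) i))) = g ka" by (simp only: e)
  next
    fix ka :: "'n => nat" assume k: "ka \<in> mi m"
    then have "mdeg (ka(i := Suc (ka i))) = Suc m" by (simp only: mdeg_upd) simp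
    then show "ka(i := Suc (ka i)) \<in> {ka \<in> {ka. mdeg ka = Suc m}. 0 < ka i}" by simp
  qed auto
  finally show ?thesis .
qed

lemma hom_monom_sum:
  "hom m f ==> \<exists>a. f = (%x. \<Sum>ka\<in>mi m. a ka * mon ka x)"
proof (induction rule: hom.induct)
  case (hom_const c)
  have "{ka. mdeg (ka :: 'a => nat) = 0} = {%_. 0}" by (auto simp: mdeg_def fun_eq_iff)
  then show ?case by (intro exI[of _ "%_. c"]) (simp add: monom_zero)
next
  case (hom_coord m f i)
  then obtain a where a: "f = (%x. \<Sum>ka\<in>mi m. a ka * mon ka x)" by blast
  define b where "b = (%ka. if 0 < ka i then a (ka(i := ka i - 1)) else 0)"
  have "(\<Sum>ka\<in>{ka. mdeg ka = Suc m}. b ka * mon ka x) = x $ i * f x" for x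
  proof -
    have "(\<Sum>ka\<in>{ka. mdeg ka = Suc m}. b ka * mon ka x) =
      (\<Sum>ka\<in>{ka. mdeg ka = Suc m}. if 0 < ka i then a (ka(i := ka i - 1)) * mon ka x else 0)"
      by (intro sum.cong) (auto simp: b_def)
    also have "... = (\<Sum>ka\<in>mi m. a ka * mon (ka(i := Suc (ka i))) x)"
      by (subst sum_mdeg_Suc) simp
    also have "... = x $ i * f x" unfolding monom_upd a by (simp add: sum_distrib_left mult_ac)
    finally show ?thesis .
  qed
  then show ?case by (intro exI[of _ b]) auto
next
  case (hom_add m f g)
  then obtain a b where "f = (%x. \<Sum>ka\<in>mi m. a ka * mon ka x)"
     "g = (%x. \<Sum>ka\<in>mi m. b ka * mon ka x)" by blast
  then show ?case by (intro exI[of _ "%ka. a ka + b ka"]) (simp add: sum.distrib distrib_right)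
qed

lemma dderiv_monom:
  "dderiv (mon ka) (axis i 1) x = of_nat (ka i) * mon (ka(i := ka i - 1)) x"
proof -
  let ?R = "\<Prod>j\<in>-{i}. x $ j ^ ka j"
  have 1: "mon ka (x + t *s axis i 1) = (x $ i + t) ^ ka i * ?R" for t
  proof -
    have "(\<Prod>j\<in>-{i}. (x + t *s axis i 1) $ j ^ ka j) = ?R"
      by (intro prod.cong) (auto simp: axis_def)
    then show ?thesis unfolding monom_split[of ka _ i] by (simp add: axis_def)
  qed
  have 2: "mon (ka(i := ka i - 1)) x = x $ i ^ (ka i - 1) * ?R"
  proof -
    have "(\<Prod>j\<in>-{i}. x $ j ^ (ka(i := ka i - 1)) j) = ?R" by (intro prod.cong) auto
    then show ?thesis unfolding monom_split[of _ x i] by simp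
  qed
  have "((%t. (x $ i + t) ^ ka i * ?R) has_field_derivative of_nat (ka i) * (x $ i ^ (ka i - 1) * ?R)) (at 0)"
    by (auto intro!: derivative_eq_intros)
  then show ?thesis unfolding dderiv_def 1 2 by (rule DERIV_imp_deriv)
qed

lemma dT_0: "dT 0 i f x = dderiv f (axis i 1) x"
  by (simp add: dunkl_op_def)

text \<open>Differentiation in a coordinate that occurs in the monomial multiplies its coefficient
  by a positive integer and lowers the degree.\<close>

lemma monom_indep:
  fixes a :: "('n::{finite,linorder} => nat) => complex"
  shows "(\<And>x. (\<Sum>ka\<in>mi m. a ka * mon ka x) = 0) ==> mdeg ka = m ==> a ka = 0"
proof (induction m arbitrary: a ka)
  case 0
  have "{ka. mdeg (ka :: 'n => nat) = 0} = {%_. 0}" by (auto simp: mdeg_def fun_eq_iff)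
  moreover have "ka = (%_. 0)" using 0(2) by (auto simp: mdeg_def)
  ultimately show ?case using 0(1)[of 0] by (simp add: monom_zero)
next
  case (Suc m)
  obtain i ka' where k: "ka = ka'(i := Suc (ka' i))" "mdeg ka' = m" using Suc.prems(2) by (rule mdeg_Suc_obtain)
  let ?f = "%x. \<Sum>ka\<in>{ka. mdeg ka = Suc m}. a ka * mon ka x"
  have hm: "hom (Suc m) (mon ka)" if "mdeg ka = Suc m" for ka :: "'n => nat"
    using that hom_monom[of ka] by simp
  have "(\<Sum>ka\<in>mi m. (a (ka(i := Suc (ka i))) * of_nat (Suc (ka i))) * mon ka x) = 0" for x
  proof -
    have "?f = (%x. 0)" using Suc.prems(1) by blast
    then have "0 = dT 0 i ?f x" by simp
    also have "... = (\<Sum>ka\<in>{ka. mdeg ka = Suc m}. a ka * dT 0 i (mon ka) x)"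
      by (subst dunkl_sum_hom[where m="Suc m"])
        (auto simp: finite_mdeg hm hom_cmult intro!: sum.cong dunkl_cmult hom_cdiff[OF hom_monom])
    also have "... = (\<Sum>ka\<in>{ka. mdeg ka = Suc m}. if 0 < ka i then a ka * of_nat (ka i) * mon (ka(i := ka i - 1)) x else 0)"
      unfolding dT_0 dderiv_monom by (intro sum.cong) auto
    finally show ?thesis unfolding sum_mdeg_Suc by (simp add: mult_ac)
  qed
  then have "a (ka'(i := Suc (ka' i))) * of_nat (Suc (ka' i)) = 0"
    by (rule Suc.IH[OF _ k(2)])
  then show ?case unfolding k(1) by (metis mult_eq_0_iff of_nat_neq_0)
qed

section \<open>Triangularity of the Cherednik operators\<close>

definition low :: "('n::{finite,linorder} => nat) => (complex^('n::{finite,linorder}) => complex) => bool" where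
  "low \<eta> f \<longleftrightarrow> (\<exists>c. f = (%x. \<Sum>ka\<in>(jlow \<eta>). c ka * mon ka x))"

lemma low_add: "low \<eta> f ==> low \<eta> g ==> low \<eta> (%x. f x + g x)"
  unfolding low_def
proof safe
  fix c d
  show "\<exists>e. (%x. (\<Sum>ka\<in>(jlow \<eta>). c ka * mon ka x) + (\<Sum>ka\<in>(jlow \<eta>). d ka * mon ka x)) =
    (%x. \<Sum>ka\<in>(jlow \<eta>). e ka * mon ka x)"
    by (intro exI[of _ "%ka. c ka + d ka"]) (simp add: sum.distrib distrib_right)
qed

lemma low_cmult: "low \<eta> f ==> low \<eta> (%x. c * f x)"
  unfolding low_def
proof safe
  fix d
  show "\<exists>e. (%x. c * (\<Sum>ka\<in>(jlow \<eta>). d ka * mon ka x)) =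
    (%x. \<Sum>ka\<in>(jlow \<eta>). e ka * mon ka x)"
    by (intro exI[of _ "%ka. c * d ka"]) (simp add: sum_distrib_left mult_ac)
qed

lemma low_zero: "low \<eta> (%x. 0)"
  unfolding low_def by (intro exI[of _ "%_. 0"]) simp

lemma low_sum: "finite A ==> (\<And>a. a \<in> A ==> low \<eta> (f a)) ==> low \<eta> (%x. \<Sum>a\<in>A. f a x)"
  by (induction A rule: finite_induct) (auto intro: low_zero low_add)

lemma low_monom:
  assumes "jprec ka \<eta>" shows "low \<eta> (mon ka)"
proof -
  have "(\<Sum>\<theta>\<in>(jlow \<eta>). of_bool (\<theta> = ka) * mon \<theta> x) = mon ka x" for x
  proof -
    have "(\<Sum>\<theta>\<in>(jlow \<eta>). of_bool (\<theta> = ka) * mon \<theta> x) = (\<Sum>\<theta>\<in>(jlow \<eta>). if \<theta> = ka then mon \<theta> x else 0)"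
      by (intro sum.cong) auto
    then show ?thesis using assms by (simp add: finite_jprec)
  qed
  then show ?thesis unfolding low_def by (intro exI[of _ "%\<theta>. of_bool (\<theta> = ka)"]) simp
qed

lemma monom_swapc: "mon \<eta> (swapc i j x) = mon (\<eta> \<circ> tsp i j) x"
  unfolding monom_def swapc_nth
  by (rule prod.reindex_bij_witness[of _ "tsp i j" "tsp i j"]) auto

lemma monom_split2:
  assumes "i ~= j"
  shows "mon (\<eta>(j := c, i := d)) x = x $ j ^ c * x $ i ^ d * (\<Prod>l\<in>-{i, j}. x $ l ^ \<eta> l)"
proof -
  have "mon (\<eta>(j := c, i := d)) x = x $ i ^ d * (\<Prod>l\<in>-{i}. x $ l ^ (\<eta>(j := c, i := d)) l)"
    unfolding monom_split[of _ x i] by simp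
  also have "(\<Prod>l\<in>-{i}. x $ l ^ (\<eta>(j := c, i := d)) l) = x $ j ^ c * (\<Prod>l\<in>-{i}-{j}. x $ l ^ (\<eta>(j := c, i := d)) l)"
    using assms by (subst prod.remove[of _ j]) auto
  also have "(\<Prod>l\<in>-{i}-{j}. x $ l ^ (\<eta>(j := c, i := d)) l) = (\<Prod>l\<in>-{i, j}. x $ l ^ \<eta> l)"
    by (intro prod.cong) auto
  finally show ?thesis by (simp only: mult_ac)
qed

text \<open>A geometric sum. With the factor x_j its exponents run through all multi-indices
  strictly between \<eta> and its transposed copy, and through \<eta> itself, which is the last
  summand; the transposed copy is not reached.\<close>

lemma divdiff_monom:
  assumes ij: "i ~= j" and lt: "\<eta> i < \<eta> j"
  shows "x $ j * divdiff (mon \<eta>) j i x =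
    (\<Sum>l<\<eta> j - \<eta> i. mon (\<eta>(j := \<eta> i + l + 1, i := \<eta> j - 1 - l)) x)"
proof -
  let ?a = "\<eta> j" and ?b = "\<eta> i" and ?R = "\<Prod>l\<in>-{i, j}. x $ l ^ \<eta> l"
  have m: "mon \<eta> x = x $ j ^ ?a * x $ i ^ ?b * ?R" using monom_split2[OF ij, of \<eta> ?a ?b x] by simp
  have rhs: "(\<Sum>l<?a - ?b. mon (\<eta>(j := ?b + l + 1, i := ?a - 1 - l)) x) =
     x $ j * (x $ j * x $ i) ^ ?b * ?R * (\<Sum>l<?a - ?b. x $ i ^ (?a - ?b - Suc l) * x $ j ^ l)"
    unfolding sum_distrib_left monom_split2[OF ij]
  proof (intro sum.cong refl)
    fix l assume "l \<in> {..<?a - ?b}"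
    then have "?a - 1 - l = ?b + (?a - ?b - Suc l)" by simp
    then have "x $ i ^ (?a - 1 - l) = x $ i ^ ?b * x $ i ^ (?a - ?b - Suc l)" by (simp only: power_add)
    then show "x $ j ^ (?b + l + 1) * x $ i ^ (?a - 1 - l) * ?R =
       x $ j * (x $ j * x $ i) ^ ?b * ?R * (x $ i ^ (?a - ?b - Suc l) * x $ j ^ l)"
      by (simp add: power_add power_mult_distrib)
  qed
  show ?thesis
  proof (cases "x $ j = x $ i")
    case True
    have e: "x $ p * dderiv (mon \<eta>) (axis p 1) x = of_nat (\<eta> p) * mon \<eta> x" for p
    proof (cases "\<eta> p")
      case 0 then show ?thesis by (simp add: dderiv_monom)
    next
      case (Suc q)
      then have "\<eta> = (\<eta>(p := \<eta> p - 1))(p := Suc ((\<eta>(p := \<eta> p - 1)) p))" by auto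
      then have "mon \<eta> x = x $ p * mon (\<eta>(p := \<eta> p - 1)) x" using monom_upd by metis
      then show ?thesis by (simp add: dderiv_monom mult_ac)
    qed
    have "x $ j * divdiff (mon \<eta>) j i x = x $ j * dderiv (mon \<eta>) (axis j 1) x - x $ i * dderiv (mon \<eta>) (axis i 1) x"
      using True by (simp add: divdiff_def dderiv_linear(2)[OF hom_cdiff[OF hom_monom]] right_diff_distrib)
    also have "... = (of_nat ?a - of_nat ?b) * mon \<eta> x" by (simp add: e left_diff_distrib)
    also have "... = of_nat (?a - ?b) * (x $ j ^ (?a + ?b) * ?R)"
      using lt True by (simp add: m power_add of_nat_diff)
    also have "... = (\<Sum>l<?a - ?b. mon (\<eta>(j := ?b + l + 1, i := ?a - 1 - l)) x)"
    proof -
      have "mon (\<eta>(j := ?b + l + 1, i := ?a - 1 - l)) x = x $ j ^ (?a + ?b) * ?R" if "l < ?a - ?b" for l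
      proof -
        have "?a + ?b = (?b + l + 1) + (?a - 1 - l)" using that by simp
        then have "x $ j ^ (?a + ?b) = x $ j ^ (?b + l + 1) * x $ j ^ (?a - 1 - l)" by (simp only: power_add)
        then show ?thesis unfolding monom_split2[OF ij] using True by simp
      qed
      then show ?thesis by simp
    qed
    finally show ?thesis .
  next
    case False
    then have ne: "x $ j - x $ i ~= 0" by simp
    have "mon \<eta> (swapc j i x) = x $ j ^ ?b * x $ i ^ ?a * ?R"
    proof -
      have "\<eta> \<circ> tsp j i = \<eta>(j := ?b, i := ?a)"
        by (auto simp: fun_eq_iff tsp_def)
      then show ?thesis unfolding monom_swapc using monom_split2[OF ij, of \<eta> ?b ?a x] by simp
    qed
    moreover have "x $ j ^ ?a = x $ j ^ ?b * x $ j ^ (?a - ?b)" "x $ i ^ ?a = x $ i ^ ?b * x $ i ^ (?a - ?b)"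
      using lt by (simp_all flip: power_add)
    ultimately have "mon \<eta> x - mon \<eta> (swapc j i x) =
        (x $ j * x $ i) ^ ?b * ?R * (x $ j ^ (?a - ?b) - x $ i ^ (?a - ?b))"
      by (simp add: m power_mult_distrib algebra_simps)
    also have "... = (x $ j - x $ i) * ((x $ j * x $ i) ^ ?b * ?R * (\<Sum>l<?a - ?b. x $ i ^ (?a - ?b - Suc l) * x $ j ^ l))"
      by (simp add: power_diff_sumr2)
    finally show ?thesis unfolding rhs using False ne by (simp add: divdiff_def mult_ac)
  qed
qed

text \<open>All summands but the last arise by a transfer between two entries, hence are strictly
  dominated. Since dominance looks only at decreasing rearrangements, they are also lower than every
  rearrangement \<theta> of \<eta>.\<close>

lemma divdiff_monom_low_gt:
  assumes "i ~= j" "\<eta> i < \<eta> j" and \<theta>: "dec_rearr \<theta> = dec_rearr \<eta>" "mdeg \<theta> = mdeg \<eta>"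
  shows "\<exists>g. low \<theta> g \<and> (\<forall>x. x $ j * divdiff (mon \<eta>) j i x = mon \<eta> x + g x)"
proof -
  let ?M = "%l. \<eta>(j := \<eta> i + l + 1, i := \<eta> j - 1 - l)"
  obtain n where n: "\<eta> j - \<eta> i = Suc n" using assms(2) by (metis Suc_diff_Suc)
  have "?M n = \<eta>" using n assms(1) by (auto simp: fun_eq_iff)
  then have 1: "x $ j * divdiff (mon \<eta>) j i x = mon \<eta> x + (\<Sum>l<n. mon (?M l) x)" for x
    unfolding divdiff_monom[of i j \<eta>, OF assms(1,2)] n by simp
  have "jprec (?M l) \<theta>" if "l < n" for l
  proof -
    have "dom_less (dec_rearr (?M l)) (dec_rearr \<eta>)"
      using assms(1) n that by (intro dom_less_transfer) auto
    then show ?thesis using \<theta> by (auto simp: jprec_def dom_less_def mdeg_dec_rearr)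
  qed
  then have "low \<theta> (%x. \<Sum>l<n. mon (?M l) x)" by (intro low_sum low_monom) auto
  with 1 show ?thesis by blast
qed

lemma divdiff_swap_neg:
  assumes "cdiff f x" shows "divdiff (%x. f (swapc j i x)) j i x = - divdiff f j i x"
proof (cases "x $ j = x $ i")
  case True
  then show ?thesis using divdiff_antisym[OF assms, of i j] by (simp add: divdiff_swapc swapc_eq_self)
next
  case False
  then show ?thesis by (simp add: divdiff_def divide_simps)
qed

lemma divdiff_monom_low:
  assumes ij: "i ~= j"
  shows "\<exists>g. low \<eta> g \<and> (\<forall>x. x $ j * divdiff (mon \<eta>) j i x =
    (if \<eta> i < \<eta> j then mon \<eta> x else if \<eta> j < \<eta> i then - mon (\<eta> \<circ> tsp j i) x else 0) + g x)"
proof (cases "\<eta> i" "\<eta> j" rule: linorder_cases)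
  case less
  then show ?thesis using divdiff_monom_low_gt[OF ij less refl refl] by simp
next
  case equal
  have "mon \<eta> (swapc j i x) = mon \<eta> x" for x
    unfolding monom_swapc by (rule arg_cong[where f="%\<eta>. mon \<eta> x"]) (auto simp: fun_eq_iff tsp_def equal)
  then have s: "(%x. mon \<eta> (swapc j i x)) = mon \<eta>" by blast
  have "divdiff (mon \<eta>) j i x = 0" for x
    using divdiff_swap_neg[OF hom_cdiff[OF hom_monom], of \<eta> j i x] unfolding s by simp
  then show ?thesis using equal low_zero by (intro exI[of _ "%x. 0"]) auto
next
  case greater
  let ?\<eta> = "\<eta> \<circ> tsp j i"
  have "?\<eta> i < ?\<eta> j" using greater by simp
  then obtain g where g: "low \<eta> g" "\<And>x. x $ j * divdiff (mon ?\<eta>) j i x = mon ?\<eta> x + g x"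
    using divdiff_monom_low_gt[OF ij, of ?\<eta> \<eta>] by (auto simp: dec_rearr_comp bij_transpose mdeg_comp)
  have "(%x. mon ?\<eta> (swapc j i x)) = mon \<eta>"
    unfolding monom_swapc by (simp add: o_assoc[symmetric])
  then have "divdiff (mon \<eta>) j i x = - divdiff (mon ?\<eta>) j i x" for x
    using divdiff_swap_neg[OF hom_cdiff[OF hom_monom], of ?\<eta> j i x] by simp
  then have "x $ j * divdiff (mon \<eta>) j i x = - mon ?\<eta> x + (- 1) * g x" for x
    using g(2)[of x] by simp
  then show ?thesis using greater low_cmult[OF g(1), of "-1"] by (intro exI[of _ "%x. (-1) * g x"]) simp
qed

lemma cher_monom:
  fixes \<eta> :: "'n::{finite,linorder} => nat"
  shows "\<exists>g. low \<eta> g \<and> (\<forall>x. cher_op k j (mon \<eta>) x = of_real (etabar k \<eta> j) * mon \<eta> x + g x)"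
proof -
  \<comment> \<open>P a holds when the pair (j, a) contributes the monomial itself: through the
    divided difference if \<eta> a < \<eta> j, through the transposition in a tie with j < a. Among
    the coordinates other than j the complement is \<open>RS \<eta> j\<close>; together with the
    constant k (1 - n) this yields - k times the rank.\<close>
  define P where "P a \<longleftrightarrow> \<eta> a < \<eta> j \<or> \<eta> a = \<eta> j \<and> j < a" for a
  have "\<exists>g. low \<eta> g \<and> (\<forall>x. x $ j * divdiff (mon \<eta>) j a x + of_bool (j < a) * mon \<eta> (swapc a j x)
       = of_bool (P a) * mon \<eta> x + g x)" if a: "a ~= j" for a
  proof -
    obtain g where g: "low \<eta> g" "\<And>x. x $ j * divdiff (mon \<eta>) j a x =
      (if \<eta> a < \<eta> j then mon \<eta> x else if \<eta> j < \<eta> a then - mon (\<eta> \<circ> tsp j a) x else 0) + g x"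
      using divdiff_monom_low[OF a, of \<eta>] by blast
    let ?s = "\<eta> \<circ> tsp j a"
    have ms: "mon \<eta> (swapc a j x) = mon ?s x" for x
      unfolding swapc_commute[of a j] by (rule monom_swapc)
    \<comment> \<open>In the third case the transposed monomials cancel. In the first and the fourth
      one of them remains, and there the larger entry has moved to the right, which makes it lower
      by \<open>jprec_swap\<close>.\<close>
    consider "j < a" "\<eta> a < \<eta> j" | "\<not> j < a" "\<eta> a < \<eta> j" | "j < a" "\<eta> j < \<eta> a" | "a < j" "\<eta> j < \<eta> a" | "\<eta> a = \<eta> j"
      using a by (metis linorder_neqE)
    then show ?thesis
    proof cases
      case 1
      then have "low \<eta> (mon ?s)" by (intro low_monom jprec_swap) auto
      then show ?thesis using 1 g low_add[OF g(1)] by (intro exI[of _ "%x. g x + mon ?s x"]) (auto simp: P_def ms)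
    next
      case 2
      then show ?thesis using g by (intro exI[of _ g]) (auto simp: P_def)
    next
      case 3
      then show ?thesis using g by (intro exI[of _ g]) (auto simp: P_def ms)
    next
      case 4
      have "?s = \<eta> \<circ> tsp a j" by (simp add: transpose_commute)
      then have "low \<eta> (mon ?s)" using 4 by (intro low_monom) (simp add: jprec_swap)
      then show ?thesis using 4 g low_add[OF g(1) low_cmult[of \<eta> "mon ?s" "-1"]]
        by (intro exI[of _ "%x. g x + (-1) * mon ?s x"]) (auto simp: P_def)
    next
      case 5
      then have "?s = \<eta>" by (auto simp: fun_eq_iff tsp_def)
      then show ?thesis using 5 g by (intro exI[of _ g]) (auto simp: P_def ms)
    qed
  qed
  then obtain G where G: "\<And>a. a ~= j ==> low \<eta> (G a)"
    "\<And>a x. a ~= j ==> x $ j * divdiff (mon \<eta>) j a x + of_bool (j < a) * mon \<eta> (swapc a j x)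
       = of_bool (P a) * mon \<eta> x + G a x" by metis
  let ?g = "%x. of_real k * (\<Sum>a\<in>-{j}. G a x)"
  have lg: "low \<eta> ?g" using G(1) by (intro low_cmult low_sum) auto
  have "card {a. P a} + card (RS \<eta> j) = CARD('n) - 1"
  proof -
    have "{a. P a} \<union> RS \<eta> j = UNIV - {j}" "{a. P a} \<inter> RS \<eta> j = {}"
      by (auto simp: P_def RS_def)
    then show ?thesis using card_Un_disjoint[of "{a. P a}" "RS \<eta> j"] by simp
  qed
  then have "card {a. P a} + card (RS \<eta> j) + 1 = CARD('n)" using zero_less_card_finite[where 'a='n] by linarith
  then have card: "real (card {a. P a}) = real CARD('n) - 1 - real (card (RS \<eta> j))" by linarith
  have "cher_op k j (mon \<eta>) x = of_real (etabar k \<eta> j) * mon \<eta> x + ?g x" for x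
  proof -
    have e: "x $ j * dderiv (mon \<eta>) (axis j 1) x = of_nat (\<eta> j) * mon \<eta> x"
    proof (cases "\<eta> j")
      case 0 then show ?thesis by (simp add: dderiv_monom)
    next
      case (Suc q)
      then have "\<eta> = (\<eta>(j := \<eta> j - 1))(j := Suc ((\<eta>(j := \<eta> j - 1)) j))" by auto
      then have "mon \<eta> x = x $ j * mon (\<eta>(j := \<eta> j - 1)) x" using monom_upd by metis
      then show ?thesis by (simp add: dderiv_monom mult_ac)
    qed
    have sw: "(\<Sum>i\<in>{i. j < i}. mon \<eta> (swapc i j x)) = (\<Sum>a\<in>-{j}. of_bool (j < a) * mon \<eta> (swapc a j x))"
      by (rule sum.mono_neutral_cong_left) auto
    have bP: "(\<Sum>a\<in>-{j}. of_bool (P a) * mon \<eta> x) = of_nat (card {a. P a}) * mon \<eta> x"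
    proof -
      have "(\<Sum>a\<in>-{j}. of_bool (P a) * mon \<eta> x) = (\<Sum>a\<in>{a. P a}. mon \<eta> x)"
        by (rule sum.mono_neutral_cong_right) (auto simp: P_def)
      then show ?thesis by simp
    qed
    have "(\<Sum>a\<in>-{j}. x $ j * divdiff (mon \<eta>) j a x + of_bool (j < a) * mon \<eta> (swapc a j x))
      = (\<Sum>a\<in>-{j}. of_bool (P a) * mon \<eta> x + G a x)"
      using G(2) by (intro sum.cong) auto
    then have s: "x $ j * (\<Sum>a\<in>-{j}. divdiff (mon \<eta>) j a x) + (\<Sum>i\<in>{i. j < i}. mon \<eta> (swapc i j x))
       = of_nat (card {a. P a}) * mon \<eta> x + (\<Sum>a\<in>-{j}. G a x)"
      unfolding sum.distrib sw bP sum_distrib_left .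
    have "cher_op k j (mon \<eta>) x = x $ j * dderiv (mon \<eta>) (axis j 1) x + of_real (k * (1 - real CARD('n))) * mon \<eta> x
       + of_real k * (x $ j * (\<Sum>a\<in>-{j}. divdiff (mon \<eta>) j a x) + (\<Sum>i\<in>{i. j < i}. mon \<eta> (swapc i j x)))"
      unfolding cher_op_def dunkl_axis[OF hom_cdiff[OF hom_monom]] by (simp add: algebra_simps)
    also have "... = of_real (real (\<eta> j) + k * (1 - real CARD('n)) + k * real (card {a. P a})) * mon \<eta> x + ?g x"
      unfolding s e by (simp add: algebra_simps)
    also have "real (\<eta> j) + k * (1 - real CARD('n)) + k * real (card {a. P a}) = etabar k \<eta> j"
      unfolding card ev_slist[symmetric] ev_def rk_slist ipos_srt by (simp add: algebra_simps)
    finally show ?thesis .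
  qed
  then show ?thesis using lg by blast
qed

section \<open>Nonsymmetric Jack polynomials\<close>

lemma cher_sum:
  assumes "finite A" "\<And>a. a \<in> A ==> hom m (g a)"
  shows "cher_op k j (%x. \<Sum>a\<in>A. c a * g a x) x = (\<Sum>a\<in>A. c a * cher_op k j (g a) x)"
proof -
  have "dT k j (%x. \<Sum>a\<in>A. c a * g a x) x = (\<Sum>a\<in>A. c a * dT k j (g a) x)"
    using assms by (subst dunkl_sum_hom[where m=m]) (auto simp: hom_cmult intro!: sum.cong dunkl_cmult hom_cdiff)
  moreover have "(\<Sum>i\<in>{i. j < i}. \<Sum>a\<in>A. c a * g a (swapc i j x)) = (\<Sum>a\<in>A. c a * (\<Sum>i\<in>{i. j < i}. g a (swapc i j x)))"
    by (subst sum.swap) (simp add: sum_distrib_left)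
  ultimately show ?thesis
    unfolding cher_op_def by (simp add: sum_distrib_left sum.distrib distrib_left mult_ac)
qed

lemma finite_above_maximal:
  fixes S :: "('n::{finite,linorder} => nat) set"
  assumes "finite S" "ka \<in> S"
  obtains ka0 where "ka0 \<in> S" "ka = ka0 \<or> jprec ka ka0" "\<And>\<theta>. \<theta> \<in> S ==> \<not> jprec ka0 \<theta>"
proof -
  let ?P = "%ka0. ka0 \<in> S \<and> (ka = ka0 \<or> jprec ka ka0)"
  let ?f = "%ka. card {\<theta> \<in> S. jprec ka \<theta>}"
  have "?P ka" using assms(2) by simp
  then obtain ka0 where k0: "?P ka0" "\<And>\<theta>. ?P \<theta> ==> ?f ka0 <= ?f \<theta>"
    using ex_has_least_nat[of ?P ka ?f] by blast
  have "\<not> jprec ka0 \<theta>" if "\<theta> \<in> S" for \<theta>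
  proof
    assume p: "jprec ka0 \<theta>"
    have "?P \<theta>" using k0(1) p that jprec_trans by blast
    moreover have "{\<theta>' \<in> S. jprec \<theta> \<theta>'} \<subset> {\<theta>' \<in> S. jprec ka0 \<theta>'}"
      using p that jprec_trans jprec_irrefl by blast
    then have "?f \<theta> < ?f ka0" using assms(1) by (intro psubset_card_mono) auto
    ultimately show False using k0(2)[of \<theta>] by simp
  qed
  then show ?thesis using that k0(1) by blast
qed

text \<open>Take a maximal exponent of the support above \<open>ka\<close>. By triangularity no
  other monomial of the support contributes to it, so comparing its coefficient gives it the
  spectrum of \<eta>, and \<open>etabar_inject\<close> identifies it with \<eta>.\<close>

lemma cher_eig_support:
  fixes a :: "('n::{finite,linorder} => nat) => complex"
  assumes k: "0 <= k" and f: "f = (%x. \<Sum>ka\<in>mi m. a ka * mon ka x)"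
    and eig: "\<And>j x. cher_op k j f x = of_real (etabar k \<eta> j) * f x"
    and ka: "mdeg ka = m" "a ka ~= 0"
  shows "a \<eta> ~= 0" "mdeg \<eta> = m" "ka = \<eta> \<or> jprec ka \<eta>"
proof -
  let ?D = "{ka :: 'n => nat. mdeg ka = m}"
  have fin: "finite ?D" by (rule finite_mdeg)
  let ?S = "{ka\<in>?D. a ka ~= 0}"
  obtain ka0 where k0: "ka0 \<in> ?S" "ka = ka0 \<or> jprec ka ka0" "\<And>\<theta>. \<theta> \<in> ?S ==> \<not> jprec ka0 \<theta>"
    using finite_above_maximal[of ?S ka] fin ka by auto
  have "etabar k ka0 j = etabar k \<eta> j" for j
  proof -
    have "\<exists>c. \<forall>x. cher_op k j (mon ka) x = of_real (etabar k ka j) * mon ka x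
        + (\<Sum>\<theta>\<in>{\<theta>. jprec \<theta> ka}. c \<theta> * mon \<theta> x)" for ka :: "'n => nat"
      using cher_monom[of ka k j] unfolding low_def by blast
    then obtain c where c: "\<And>ka x. cher_op k j (mon ka) x = of_real (etabar k ka j) * mon ka x
        + (\<Sum>\<theta>\<in>{\<theta>. jprec \<theta> ka}. c ka \<theta> * mon \<theta> x)" by metis
    define b where "b \<theta> = of_real (etabar k \<theta> j) * a \<theta> + (\<Sum>ka\<in>?D. if jprec \<theta> ka then a ka * c ka \<theta> else 0) - of_real (etabar k \<eta> j) * a \<theta>" for \<theta>
    have "(\<Sum>\<theta>\<in>?D. b \<theta> * mon \<theta> x) = 0" for x
    proof -
      have "cher_op k j f x = (\<Sum>ka\<in>?D. a ka * cher_op k j (mon ka) x)"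
        unfolding f by (rule cher_sum[where m=m]) (use fin hom_monom in auto)
      also have "... = (\<Sum>ka\<in>?D. of_real (etabar k ka j) * a ka * mon ka x)
          + (\<Sum>ka\<in>?D. \<Sum>\<theta>\<in>{\<theta>. jprec \<theta> ka}. a ka * c ka \<theta> * mon \<theta> x)"
        by (simp add: c sum.distrib distrib_left sum_distrib_left mult_ac)
      also have "(\<Sum>ka\<in>?D. \<Sum>\<theta>\<in>{\<theta>. jprec \<theta> ka}. a ka * c ka \<theta> * mon \<theta> x)
         = (\<Sum>ka\<in>?D. \<Sum>\<theta>\<in>?D. (if jprec \<theta> ka then a ka * c ka \<theta> else 0) * mon \<theta> x)"
        by (intro sum.cong refl sum.mono_neutral_cong_left fin) (auto simp: jprec_def)
      also have "... = (\<Sum>\<theta>\<in>?D. (\<Sum>ka\<in>?D. if jprec \<theta> ka then a ka * c ka \<theta> else 0) * mon \<theta> x)"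
        by (subst sum.swap) (simp add: sum_distrib_right)
      finally have "cher_op k j f x - of_real (etabar k \<eta> j) * f x = (\<Sum>\<theta>\<in>?D. b \<theta> * mon \<theta> x)"
        unfolding b_def f by (simp add: left_diff_distrib distrib_right sum.distrib sum_subtractf sum_distrib_left mult.assoc)
      then show ?thesis using eig by simp
    qed
    then have "b ka0 = 0" using k0(1) by (intro monom_indep[where m=m and a=b]) auto
    moreover have "(\<Sum>ka\<in>?D. if jprec ka0 ka then a ka * c ka ka0 else 0) = 0"
      using k0(3) by (intro sum.neutral) auto
    ultimately have "of_real (etabar k ka0 j) * a ka0 = of_real (etabar k \<eta> j) * a ka0" by (simp add: b_def)
    then show ?thesis using k0(1) by simp
  qed
  then have "ka0 = \<eta>" using etabar_inject[OF k] by blast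
  then show "a \<eta> ~= 0" "mdeg \<eta> = m" "ka = \<eta> \<or> jprec ka \<eta>" using k0 by auto
qed

text \<open>Some solution of the recursion for the standard order, without any normalisation: the
  kernels built from it contain only quotients of a product of two values by the norm, and these do
  not depend on the scale.\<close>

definition jf :: "real => ('n::{finite,linorder} => nat) => complex^('n::{finite,linorder}) => complex" where
  "jf k \<eta> = (SOME f. jrec k slist \<eta> f)"

definition jn :: "real => ('n::{finite,linorder} => nat) => real" where
  "jn k \<eta> = Re (fform k (mdeg \<eta>) (jf k \<eta>) (jf k \<eta>))"

lemma jf_jrec: "jrec k slist \<eta> (jf k \<eta>)"
  unfolding jf_def using jrec_exists[OF cord_slist] by (rule someI_ex)

lemma jf_hom: "hom (mdeg \<eta>) (jf k \<eta>)"
  using jrec_hom[OF jf_jrec] .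

lemma jf_cher: "0 <= k ==> cher_op k j (jf k \<eta>) x = of_real (etabar k \<eta> j) * jf k \<eta> x"
  using jrec_DD[OF jf_jrec, of k j \<eta> x] by (simp add: DD_slist ev_slist)

lemma jf_norm:
  assumes "0 <= k"
  shows "fform k (mdeg \<eta>) (jf k \<eta>) (jf k \<eta>) = of_real (jn k \<eta>)" "jn k \<eta> > 0"
  using jrec_norm[OF jf_jrec assms, of \<eta>] by (auto simp: jn_def)

lemma jf_vcnj: "jf k \<eta> (vcnj x) = cnj (jf k \<eta> x)"
  using jrec_real[OF jf_jrec] .

lemma jf_orth:
  assumes k: "0 <= k" and "\<eta> ~= ka" "mdeg \<eta> = m" "mdeg ka = m"
  shows "fform k m (jf k \<eta>) (jf k ka) = 0"
proof -
  obtain j where j: "etabar k \<eta> j ~= etabar k ka j" using etabar_inject[OF k] assms(2) by blast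
  have h: "hom m (jf k \<eta>)" "hom m (jf k ka)" using jf_hom[of \<eta> k] jf_hom[of ka k] assms by simp_all
  have D: "DD k slist j (jf k \<eta>) = (%x. of_real (etabar k \<eta> j) * jf k \<eta> x)" for \<eta>
    by (rule ext) (simp add: DD_slist jf_cher k)
  have "of_real (etabar k \<eta> j) * fform k m (jf k \<eta>) (jf k ka) = of_real (etabar k ka j) * fform k m (jf k \<eta>) (jf k ka)"
    using fform_DD[OF h, of k slist j] unfolding D by (simp add: fform_cmult_left fform_cmult_right h)
  then show ?thesis using j by simp
qed

lemma jf_leading:
  assumes k: "0 <= k"
  obtains a c where "a ~= 0" "\<And>x. jf k \<eta> x = a * (mon \<eta> x + (\<Sum>ka\<in>(jlow \<eta>). c ka * mon ka x))"
proof -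
  let ?D = "{ka. mdeg ka = mdeg \<eta>}"
  obtain a where a: "jf k \<eta> = (%x. \<Sum>ka\<in>?D. a ka * mon ka x)"
    using hom_monom_sum[OF jf_hom] by blast
  note S = cher_eig_support[OF k a, of \<eta>, OF jf_cher[OF k]]
  have "\<exists>ka. mdeg ka = mdeg \<eta> \<and> a ka ~= 0"
  proof (rule ccontr)
    assume "\<not> ?thesis"
    then have "jf k \<eta> = (%x. 0)" unfolding a by (intro ext sum.neutral) auto
    then show False using jf_norm[OF k, of \<eta>] by (simp add: fform_zero_left)
  qed
  then have a0: "a \<eta> ~= 0" using S by blast
  have "jf k \<eta> x = a \<eta> * (mon \<eta> x + (\<Sum>ka\<in>(jlow \<eta>). a ka / a \<eta> * mon ka x))" for x
  proof -
    have "jf k \<eta> x = a \<eta> * mon \<eta> x + (\<Sum>ka\<in>?D - {\<eta>}. a ka * mon ka x)"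
      unfolding a by (rule sum.remove) (auto simp: finite_mdeg)
    also have "(\<Sum>ka\<in>?D - {\<eta>}. a ka * mon ka x) = (\<Sum>ka\<in>(jlow \<eta>). a ka * mon ka x)"
    proof (rule sum.mono_neutral_right)
      show "(jlow \<eta>) \<subseteq> ?D - {\<eta>}" using jprec_irrefl[of \<eta>] by (auto simp: jprec_def)
      show "\<forall>ka\<in>?D - {\<eta>} - (jlow \<eta>). a ka * mon ka x = 0" using S(3) by fastforce
    qed (simp add: finite_mdeg)
    also have "... = a \<eta> * (\<Sum>ka\<in>(jlow \<eta>). a ka / a \<eta> * mon ka x)"
      using a0 by (simp add: sum_distrib_left)
    finally show ?thesis by (simp add: distrib_left)
  qed
  then show ?thesis by (rule that[of "a \<eta>" "%ka. a ka / a \<eta>", OF a0])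
qed

text \<open>Division by the leading coefficient gives existence. The difference of two candidates is
  an eigenfunction with the same eigenvalues in which \<eta> itself does not occur, and by
  \<open>cher_eig_support\<close> such a function has empty support.\<close>

lemma jackE_jf:
  assumes k: "0 <= k"
  obtains a where "a ~= 0" "\<And>x. jackE k \<eta> x = jf k \<eta> x / a"
proof -
  obtain a c where a: "a ~= 0" and c: "\<And>x. jf k \<eta> x = a * (mon \<eta> x + (\<Sum>ka\<in>(jlow \<eta>). c ka * mon ka x))"
    using jf_leading[OF k] by blast
  let ?f = "%x. 1 / a * jf k \<eta> x"
  let ?P = "%f. (\<exists>c. f = (%x. mon \<eta> x + (\<Sum>ka\<in>(jlow \<eta>). c ka * mon ka x)))
        \<and> (\<forall>j x. cher_op k j f x = of_real (etabar k \<eta> j) * f x)"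
  have "cher_op k j ?f x = of_real (etabar k \<eta> j) * ?f x" for j x
  proof -
    have "cher_op k j (%x. \<Sum>b\<in>{()}. 1 / a * jf k \<eta> x) x = (\<Sum>b\<in>{()}. 1 / a * cher_op k j (jf k \<eta>) x)"
      by (rule cher_sum) (use jf_hom in auto)
    then show ?thesis by (simp add: jf_cher[OF k])
  qed
  then have P: "?P ?f" using c a by auto
  have uniq: "f = g" if P: "?P f" "?P g" for f g
  proof -
    obtain c d where f: "f = (%x. mon \<eta> x + (\<Sum>ka\<in>(jlow \<eta>). c ka * mon ka x))"
      and g: "g = (%x. mon \<eta> x + (\<Sum>ka\<in>(jlow \<eta>). d ka * mon ka x))" using P by blast
    define b where "b ka = (if jprec ka \<eta> then c ka - d ka else 0)" for ka
    have fg: "(%x. f x - g x) = (%x. \<Sum>ka\<in>{ka. mdeg ka = mdeg \<eta>}. b ka * mon ka x)"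
    proof
      fix x
      have "f x - g x = (\<Sum>ka\<in>(jlow \<eta>). (c ka - d ka) * mon ka x)"
        by (simp add: f g sum_subtractf left_diff_distrib)
      also have "... = (\<Sum>ka\<in>{ka. mdeg ka = mdeg \<eta>}. b ka * mon ka x)"
        by (rule sum.mono_neutral_cong_left) (auto simp: finite_mdeg b_def jprec_def)
      finally show "f x - g x = (\<Sum>ka\<in>{ka. mdeg ka = mdeg \<eta>}. b ka * mon ka x)" .
    qed
    have lh: "hom (mdeg \<eta>) (%x. mon \<eta> x + (\<Sum>ka\<in>(jlow \<eta>). c ka * mon ka x))" for c
    proof (intro hom_add hom_sum finite_jprec hom_cmult)
      show "hom (mdeg \<eta>) (mon \<eta>)" by (rule hom_monom)
      show "hom (mdeg \<eta>) (mon ka)" if "ka \<in> (jlow \<eta>)" for ka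
        using that hom_monom[of ka] by (simp add: jprec_def)
    qed
    have "cher_op k j (%x. f x - g x) x = of_real (etabar k \<eta> j) * (f x - g x)" for j x
    proof -
      \<comment> \<open>The difference f - g is written as a sum over a two-element index set so
        that \<open>cher_sum\<close> applies.\<close>
      have "cher_op k j (%x. \<Sum>b\<in>{True, False}. (if b then 1 else -1) * (if b then f x else g x)) x =
         (\<Sum>b\<in>{True, False}. (if b then 1 else -1) * cher_op k j (%x. if b then f x else g x) x)"
      proof (rule cher_sum[where m="mdeg \<eta>"])
        show "hom (mdeg \<eta>) (%x. if b then f x else g x)" for b using lh f g by (cases b) simp_all
      qed simp
      then show ?thesis using P by (simp add: right_diff_distrib)
    qed
    note S = cher_eig_support(1)[OF k fg, of \<eta>, OF this]
    have "b ka = 0" if "mdeg ka = mdeg \<eta>" for ka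
    proof (rule ccontr)
      assume "b ka ~= 0"
      with that have "b \<eta> ~= 0" using S by blast
      then show False by (simp add: b_def jprec_irrefl)
    qed
    then have "f x - g x = 0" for x using fun_cong[OF fg, of x] by simp
    then show ?thesis by (intro ext) simp
  qed
  have "jackE k \<eta> = ?f" unfolding jackE_def
  proof (rule the_equality)
    show "f = ?f" if "?P f" for f by (rule uniq[OF that P])
  qed (rule P)
  then show ?thesis using a that[of a] by simp
qed

text \<open>A triangular system is inverted: each monomial is a multiple of its \<open>jf\<close>
  minus lower monomials, by induction on the number of multi-indices below.\<close>

lemma hom_jf_span:
  fixes f :: "complex^'n::{finite,linorder} => complex"
  assumes k: "0 <= k" and f: "hom m f"
  shows "\<exists>b. f = (%x. \<Sum>\<eta>\<in>mi m. b \<eta> * jf k \<eta> x)"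
proof -
  let ?D = "{\<eta> :: 'n => nat. mdeg \<eta> = m}"
  define sp where "sp f \<longleftrightarrow> (\<exists>b. f = (%x. \<Sum>\<eta>\<in>?D. b \<eta> * jf k \<eta> x))" for f
  have add: "sp (%x. f x + g x)" if fg: "sp f" "sp g" for f g
  proof -
    obtain b c where "f = (%x. \<Sum>\<eta>\<in>?D. b \<eta> * jf k \<eta> x)" "g = (%x. \<Sum>\<eta>\<in>?D. c \<eta> * jf k \<eta> x)"
      using fg unfolding sp_def by blast
    then show ?thesis unfolding sp_def by (intro exI[of _ "%\<eta>. b \<eta> + c \<eta>"]) (simp add: sum.distrib distrib_right)
  qed
  have cm: "sp (%x. d * f x)" if f: "sp f" for f d
  proof -
    obtain b where "f = (%x. \<Sum>\<eta>\<in>?D. b \<eta> * jf k \<eta> x)" using f unfolding sp_def by blast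
    then show ?thesis unfolding sp_def by (intro exI[of _ "%\<eta>. d * b \<eta>"]) (simp add: sum_distrib_left mult_ac)
  qed
  have z: "sp (%x. 0)" unfolding sp_def by (intro exI[of _ "%_. 0"]) simp
  have su: "sp (%x. \<Sum>a\<in>A. f a x)" if "finite A" "\<And>a. a \<in> A ==> sp (f a)" for A :: "('n => nat) set" and f
    using that by (induction A rule: finite_induct) (auto intro: z add)
  have sj: "sp (jf k \<eta>)" if "mdeg \<eta> = m" for \<eta>
  proof -
    have "jf k \<eta> x = (\<Sum>\<theta>\<in>?D. of_bool (\<theta> = \<eta>) * jf k \<theta> x)" for x
    proof -
      have "(\<Sum>\<theta>\<in>?D. of_bool (\<theta> = \<eta>) * jf k \<theta> x) = (\<Sum>\<theta>\<in>?D. if \<theta> = \<eta> then jf k \<theta> x else 0)" by (intro sum.cong) auto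
      then show ?thesis using that by (simp add: finite_mdeg)
    qed
    then show ?thesis unfolding sp_def by (intro exI[of _ "%\<theta>. of_bool (\<theta> = \<eta>)"]) auto
  qed
  have sm: "sp (mon \<eta>)" if "mdeg \<eta> = m" for \<eta> :: "'n => nat"
    using that
  proof (induction "card (jlow \<eta>)" arbitrary: \<eta> rule: less_induct)
    case less
    obtain a c where a: "a ~= 0" and c: "\<And>x. jf k \<eta> x = a * (mon \<eta> x + (\<Sum>ka\<in>(jlow \<eta>). c ka * mon ka x))"
      using jf_leading[OF k] by blast
    have "mon \<eta> = (%x. 1 / a * jf k \<eta> x + (-1) * (\<Sum>ka\<in>(jlow \<eta>). c ka * mon ka x))"
      using a by (auto simp: c)
    moreover have "sp (%x. \<Sum>ka\<in>(jlow \<eta>). c ka * mon ka x)"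
    proof (intro su finite_jprec cm)
      fix ka assume "ka \<in> (jlow \<eta>)"
      then have p: "jprec ka \<eta>" by simp
      have "{\<theta>. jprec \<theta> ka} \<subset> {\<theta>. jprec \<theta> \<eta>}" using p jprec_trans jprec_irrefl by blast
      then show "sp (mon ka)"
        using p less.prems by (intro less.hyps psubset_card_mono finite_jprec) (auto simp: jprec_def)
    qed
    ultimately show ?case using add[OF cm[OF sj[OF less.prems], of "1 / a"] cm[of _ "-1"]] by simp
  qed
  obtain a where "f = (%x. \<Sum>ka\<in>?D. a ka * mon ka x)" using hom_monom_sum[OF f] by blast
  moreover have "sp (%x. \<Sum>ka\<in>?D. a ka * mon ka x)" by (intro su finite_mdeg cm sm) simp
  ultimately show ?thesis unfolding sp_def by blast
qed

lemma fform_jf_coeff: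
  fixes b :: "('n::{finite,linorder} => nat) => complex"
  assumes k: "0 <= k" and ka: "mdeg ka = m"
  shows "fform k m (%x. \<Sum>\<eta>\<in>mi m. b \<eta> * jf k \<eta> x) (jf k ka) = b ka * of_real (jn k ka)"
proof -
  have "fform k m (%x. \<Sum>\<eta>\<in>mi m. b \<eta> * jf k \<eta> x) (jf k ka) = (\<Sum>\<eta>\<in>mi m. fform k m (%x. b \<eta> * jf k \<eta> x) (jf k ka))"
    by (rule fform_sum_left) (auto simp: finite_mdeg intro!: hom_cmult, use jf_hom in blast)
  also have "... = (\<Sum>\<eta>\<in>mi m. if \<eta> = ka then b ka * of_real (jn k ka) else 0)"
  proof (intro sum.cong refl)
    fix \<eta> :: "'n => nat" assume e: "\<eta> \<in> mi m"
    have "hom m (jf k \<eta>)" using e jf_hom by blast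
    then have "fform k m (%x. b \<eta> * jf k \<eta> x) (jf k ka) = b \<eta> * fform k m (jf k \<eta>) (jf k ka)" by (rule fform_cmult_left)
    then show "fform k m (%x. b \<eta> * jf k \<eta> x) (jf k ka) = (if \<eta> = ka then b ka * of_real (jn k ka) else 0)"
      using jf_orth[OF k, of \<eta> ka m] jf_norm(1)[OF k, of ka] e ka by auto
  qed
  finally show ?thesis using ka by (simp add: finite_mdeg)
qed

lemma fform_nondeg:
  fixes g :: "complex^'n::{finite,linorder} => complex"
  assumes k: "0 <= k" and g: "hom m g" and z: "\<And>q. hom m q ==> fform k m g q = 0"
  shows "g x = 0"
proof -
  obtain b where b: "g = (%x. \<Sum>\<eta>\<in>mi m. b \<eta> * jf k \<eta> x)" using hom_jf_span[OF k g] by blast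
  have "b \<eta> = 0" if "mdeg \<eta> = m" for \<eta>
    using fform_jf_coeff[OF k that, of b] z[of "jf k \<eta>"] jf_hom[of \<eta> k] jf_norm(2)[OF k, of \<eta>] that b by auto
  then show ?thesis by (simp add: b)
qed

lemma jf_indep:
  fixes b :: "('n::{finite,linorder} => nat) => complex"
  assumes k: "0 <= k" and "\<And>x. (\<Sum>\<eta>\<in>mi m. b \<eta> * jf k \<eta> x) = 0" "mdeg ka = m"
  shows "b ka = 0"
  using fform_jf_coeff[OF k assms(3), of b] jf_norm(2)[OF k, of ka] by (simp add: assms(2) fform_zero_left)

section \<open>The homogeneous components of the Dunkl kernel\<close>

text \<open>The reproducing kernel of the Fischer form in degree m, as \<open>Kd_reproducing\<close>
  shows.\<close>

definition Kd :: "real => nat => complex^('n::{finite,linorder}) => complex^('n::{finite,linorder}) => complex" where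
  "Kd k m z w = (\<Sum>\<eta>\<in>mi m. jf k \<eta> z * jf k \<eta> w / of_real (jn k \<eta>))"

lemma Kd_sym: "Kd k m z w = Kd k m w z"
  by (simp add: Kd_def mult.commute)

lemma Kd_hom: "hom m (Kd k m z)"
proof -
  have "Kd k m z = (%w. \<Sum>\<eta>\<in>mi m. (jf k \<eta> z / of_real (jn k \<eta>)) * jf k \<eta> w)"
    by (rule ext) (simp add: Kd_def)
  moreover have "hom m ..." by (intro hom_sum hom_cmult finite_mdeg) (use jf_hom in blast)
  ultimately show ?thesis by simp
qed

lemma Kd_reproducing:
  assumes k: "0 <= k" and p: "hom m p"
  shows "fform k m (Kd k m z) p = p z"
proof -
  obtain b where b: "p = (%x. \<Sum>\<eta>\<in>mi m. b \<eta> * jf k \<eta> x)" using hom_jf_span[OF k p] by blast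
  have hj: "hom m (jf k \<eta>)" if "mdeg \<eta> = m" for \<eta> using jf_hom that by blast
  have K: "Kd k m z = (%w. \<Sum>\<eta>\<in>mi m. (jf k \<eta> z / of_real (jn k \<eta>)) * jf k \<eta> w)"
    by (rule ext) (simp add: Kd_def)
  have "fform k m (Kd k m z) p = (\<Sum>\<eta>\<in>mi m. b \<eta> * fform k m (Kd k m z) (jf k \<eta>))"
    unfolding b by (subst fform_sum_right) (auto simp: finite_mdeg fform_cmult_right hj hom_cmult intro!: sum.cong)
  also have "... = (\<Sum>\<eta>\<in>mi m. b \<eta> * jf k \<eta> z)"
  proof (intro sum.cong refl)
    fix \<eta> :: "'a => nat" assume e: "\<eta> \<in> mi m"
    have "fform k m (Kd k m z) (jf k \<eta>) = jf k \<eta> z / of_real (jn k \<eta>) * of_real (jn k \<eta>)"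
      unfolding K by (rule fform_jf_coeff[OF k]) (use e in simp)
    also have "... = jf k \<eta> z" using jf_norm(2)[OF k, of \<eta>] by simp
    finally show "b \<eta> * fform k m (Kd k m z) (jf k \<eta>) = b \<eta> * jf k \<eta> z" by simp
  qed
  finally show ?thesis by (simp add: b)
qed

text \<open>The Dunkl operator is adjoint to multiplication by \<open>bil x \<xi>\<close>, and
  pairing with the kernel evaluates at z. Hence both sides have the same pairing with every q, and
  the form is nondegenerate.\<close>

lemma Kd_dunkl:
  assumes k: "0 <= k"
  shows "dunkl_op k \<xi> (Kd k (Suc m) z) w = bil z \<xi> * Kd k m z w"
proof -
  let ?g = "%w. dunkl_op k \<xi> (Kd k (Suc m) z) w - bil z \<xi> * Kd k m z w"
  have hT: "hom m (dunkl_op k \<xi> (Kd k (Suc m) z))" by (intro hom_dunkl Kd_hom)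
  have hK: "hom m (%w. bil z \<xi> * Kd k m z w)" by (intro hom_cmult Kd_hom)
  have hg: "hom m ?g" using hom_diff[OF hT hK] .
  have "fform k m ?g q = 0" if q: "hom m q" for q
  proof -
    have "?g = (%w. dunkl_op k \<xi> (Kd k (Suc m) z) w + (- bil z \<xi>) * Kd k m z w)" by auto
    then have A: "fform k m ?g q = fform k m (dunkl_op k \<xi> (Kd k (Suc m) z)) q - bil z \<xi> * q z"
      using fform_add_left[OF hT hom_cmult[OF Kd_hom[of m k z], of "- bil z \<xi>"], of k q]
        fform_cmult_left[OF Kd_hom[of m k z], of k "- bil z \<xi>" q] Kd_reproducing[OF k q, of z]
      by simp
    have B: "dunkl_op k \<xi> (Kd k (Suc m) z) = (%w. \<Sum>j\<in>UNIV. \<xi> $ j * dT k j (Kd k (Suc m) z) w)"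
      using dunkl_op_linear hom_cdiff[OF Kd_hom] by blast
    have "fform k m (dunkl_op k \<xi> (Kd k (Suc m) z)) q = (\<Sum>j\<in>UNIV. \<xi> $ j * fform k m (dT k j (Kd k (Suc m) z)) q)"
      unfolding B by (subst fform_sum_left) (auto intro!: hom_cmult hom_dT Kd_hom sum.cong fform_cmult_left)
    also have "... = (\<Sum>j\<in>UNIV. \<xi> $ j * (z $ j * q z))"
    proof (intro sum.cong refl)
      fix j
      have "fform k m (dT k j (Kd k (Suc m) z)) q = fform k (Suc m) (Kd k (Suc m) z) (%x. x $ j * q x)"
        by (rule fform_coord_right[symmetric, OF Kd_hom q])
      also have "... = z $ j * q z" by (rule Kd_reproducing[OF k hom_coord[OF q]])
      finally show "\<xi> $ j * fform k m (dT k j (Kd k (Suc m) z)) q = \<xi> $ j * (z $ j * q z)" by simp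
    qed
    also have "... = bil z \<xi> * q z" by (simp add: bil_def sum_distrib_left sum_distrib_right mult_ac)
    finally show ?thesis unfolding A by simp
  qed
  from fform_nondeg[OF k hg this, of w] show ?thesis by simp
qed

lemma Kd_0:
  assumes k: "0 <= k" shows "Kd k 0 z w = 1"
proof -
  obtain c where c: "Kd k 0 z = (%x. c)" using hom_0D[OF Kd_hom] by blast
  have "fform k 0 (Kd k 0 z) (%x. 1) = 1" by (rule Kd_reproducing[OF k hom_const])
  then show ?thesis by (simp add: c)
qed

lemma dunkl_unique_hom:
  assumes k: "0 <= k" and f: "hom (Suc m) f" and T: "\<And>i x. dT k i f x = 0"
  shows "f x = 0"
proof (rule fform_nondeg[OF k f])
  fix q :: "(complex, 'a) vec => complex"
  assume "hom (Suc m) q"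
  then show "fform k (Suc m) f q = 0"
  proof (induction "Suc m" q rule: hom.induct)
    case (hom_coord q i)
    then have "fform k (Suc m) f (%x. x $ i * q x) = fform k m (dT k i f) q" using f by (intro fform_coord_right) auto
    moreover have "dT k i f = (%x. 0)" using T by blast
    ultimately show ?case using hom_coord by (simp add: fform_zero_left del: fform.simps)
  next
    case (hom_add q q')
    then show ?case by (simp add: fform_add_right del: fform.simps)
  qed
qed

text \<open>A power of the coordinate sum is symmetric, so its divided differences vanish and each
  T_i acts as the ordinary derivative. Both sides then satisfy the same recursion, and
  \<open>dunkl_unique_hom\<close> applies to the difference.\<close>

lemma Kd_ones:
  assumes k: "0 <= k"
  shows "Kd k m ones w = (\<Sum>i\<in>UNIV. w $ i) ^ m / fact m"
proof (induction m arbitrary: w)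
  case 0 then show ?case by (simp add: Kd_0[OF k])
next
  case (Suc m)
  let ?s = "%w :: (complex, 'a) vec. \<Sum>i\<in>UNIV. w $ i"
  have hs: "hom m (%w. ?s w ^ m)" for m
  proof (induction m)
    case 0 then show ?case using hom_const[of 1] by simp
  next
    case (Suc m)
    have "(%w. ?s w ^ Suc m) = (%w. \<Sum>i\<in>UNIV. w $ i * ?s w ^ m)" by (simp add: sum_distrib_right)
    then show ?case using Suc by (auto intro!: hom_sum hom_coord)
  qed
  have sym: "?s (swapc i j w) = ?s w" for i j w
  proof -
    have "?s (swapc i j w) = bil (swapc i j w) ones" "?s w = bil w (swapc i j ones)"
      by (auto simp: bil_def ones_def swapc_nth)
    then show ?thesis by (simp add: bil_swapc)
  qed
  have dd: "dderiv (%w. ?s w ^ Suc m) \<xi> w = of_nat (Suc m) * ?s \<xi> * ?s w ^ m" for \<xi> w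
  proof -
    have "((%t. ?s (w + t *s \<xi>) ^ Suc m) has_field_derivative of_nat (Suc m) * ?s \<xi> * ?s w ^ m) (at 0)"
    proof -
      have "((%t. ?s (w + t *s \<xi>)) has_field_derivative ?s \<xi>) (at 0)"
        by (auto intro!: derivative_eq_intros simp: sum.distrib simp flip: sum_distrib_left)
      from DERIV_power_Suc[OF this, of m] show ?thesis by (simp add: mult_ac)
    qed
    then show ?thesis unfolding dderiv_def by (rule DERIV_imp_deriv)
  qed
  have T: "dT k i (%w. ?s w ^ Suc m) w = of_nat (Suc m) * ?s w ^ m" for i w
  proof -
    have s1: "?s (axis i 1) = 1" for i :: 'a by (simp add: axis_component)
    have "divdiff (%w. ?s w ^ Suc m) i j w = 0" for i j
      unfolding divdiff_def dd sym by (simp add: sum_subtractf axis_component)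
    then show ?thesis by (subst dunkl_axis[OF hom_cdiff[OF hs]]) (simp add: dd s1 del: power_Suc)
  qed
  define g where "g w = Kd k (Suc m) ones w - 1 / fact (Suc m) * ?s w ^ Suc m" for w
  have h2: "hom (Suc m) (%w. 1 / fact (Suc m) * ?s w ^ Suc m)" by (intro hom_cmult hs)
  have "hom (Suc m) g" unfolding g_def[abs_def] by (intro hom_diff Kd_hom h2)
  moreover have "dT k i g w = 0" for i w
  proof -
    have "dT k i g w = bil ones (axis i 1) * Kd k m ones w - 1 / fact (Suc m) * dT k i (%w. ?s w ^ Suc m) w"
      unfolding g_def[abs_def]
      by (simp only: dunkl_diff_hom[OF Kd_hom h2] dunkl_cmult_hom[OF hs] Kd_dunkl[OF k])
    also have "... = 0"
    proof -
      have "1 / fact (Suc m) * (of_nat (Suc m) * X) = X / fact m" for X :: complex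
        by (simp del: of_nat_Suc)
      then show ?thesis unfolding T Suc by (simp add: ones_def)
    qed
    finally show ?thesis .
  qed
  ultimately have "g w = 0" by (rule dunkl_unique_hom[OF k])
  then show ?case by (simp add: g_def)
qed

text \<open>By \<open>Kd_ones\<close> the power of the coordinate sum is m! times the kernel at
  \<open>ones\<close>, which is already an expansion in the \<open>jf\<close>; comparing
  coefficients in this basis determines \<open>jack_c\<close>.\<close>

lemma jackL_eq:
  fixes \<eta> :: "'n::{finite,linorder} => nat"
  assumes k: "0 <= k"
  shows "jackL k \<eta> z = fact (mdeg \<eta>) * jf k \<eta> ones * jf k \<eta> z / of_real (jn k \<eta>)"
proof -
  have "\<exists>a. a ~= 0 \<and> (\<forall>x. jackE k \<eta> x = jf k \<eta> x / a)" for \<eta> :: "'n => nat"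
    by (rule jackE_jf[OF k, of \<eta>]) auto
  then obtain a where a: "\<And>\<eta> :: 'n => nat. a \<eta> ~= 0" "\<And>(\<eta> :: 'n => nat) x. jackE k \<eta> x = jf k \<eta> x / a \<eta>" by metis
  define c where "c \<eta> = fact (mdeg \<eta>) * jf k \<eta> ones * a \<eta> / of_real (jn k \<eta>)" for \<eta> :: "'n => nat"
  have ex: "(\<Sum>i\<in>UNIV. z $ i) ^ m = (\<Sum>\<eta>\<in>mi m. c \<eta> * jackE k \<eta> z)" for m and z :: "(complex, 'n) vec"
  proof -
    have "(\<Sum>\<eta>\<in>mi m. c \<eta> * jackE k \<eta> z) = (\<Sum>\<eta>\<in>mi m. fact m * (jf k \<eta> ones * jf k \<eta> z / of_real (jn k \<eta>)))"
      by (intro sum.cong refl) (auto simp: c_def a)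
    also have "... = fact m * Kd k m ones z" by (simp add: Kd_def sum_distrib_left)
    finally show ?thesis by (simp add: Kd_ones[OF k])
  qed
  have "jack_c k = c" unfolding jack_c_def
  proof (rule the_equality)
    fix d :: "('n => nat) => complex"
    assume d: "\<forall>m z. (\<Sum>i\<in>UNIV. z $ i) ^ m = (\<Sum>\<eta>\<in>mi m. d \<eta> * jackE k \<eta> z)"
    show "d = c"
    proof
      fix ka :: "'n => nat"
      have "(\<Sum>\<eta>\<in>{\<eta>. mdeg \<eta> = mdeg ka}. ((d \<eta> - c \<eta>) / a \<eta>) * jf k \<eta> z) = 0" for z
      proof -
        have "(\<Sum>\<eta>\<in>{\<eta>. mdeg \<eta> = mdeg ka}. ((d \<eta> - c \<eta>) / a \<eta>) * jf k \<eta> z) =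
          (\<Sum>\<eta>\<in>{\<eta>. mdeg \<eta> = mdeg ka}. d \<eta> * jackE k \<eta> z) - (\<Sum>\<eta>\<in>{\<eta>. mdeg \<eta> = mdeg ka}. c \<eta> * jackE k \<eta> z)"
          unfolding sum_subtractf[symmetric] by (intro sum.cong refl) (simp add: a(2) left_diff_distrib diff_divide_distrib)
        then show ?thesis using d ex by simp
      qed
      then have "(d ka - c ka) / a ka = 0" by (rule jf_indep[OF k]) simp
      then show "d ka = c ka" using a(1)[of ka] by simp
    qed
  qed (use ex in blast)
  then show ?thesis using a(1)[of \<eta>] by (simp add: jackL_def c_def a(2))
qed

section \<open>The Dunkl kernel\<close>

text \<open>In the radial direction the factors x_i - x_j cancel the denominators. The estimates for
  the kernel rest on this.\<close>

lemma dunkl_radial: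
  "dunkl_op k x f x = dderiv f x x + of_real k * (\<Sum>i\<in>UNIV. \<Sum>j\<in>{j. i < j}. f x - f (swapc i j x))"
proof -
  have "(x $ i - x $ j) * divdiff f i j x = f x - f (swapc i j x)" for i j
    by (simp add: divdiff_def swapc_eq_self)
  then show ?thesis by (simp add: dunkl_op_def)
qed

lemma dderiv_hom: "hom m f ==> dderiv f x x = of_nat m * f x"
proof (induction rule: hom.induct)
  case (hom_coord m f i)
  then show ?case by (simp add: dderiv_mult hom_cdiff algebra_simps)
next
  case (hom_add m f g)
  then show ?case by (simp add: dderiv_add hom_cdiff algebra_simps)
qed simp

lemma Kd_euler:
  assumes k: "0 <= k"
  shows "of_nat (Suc m) * Kd k (Suc m) z w + of_real k * (\<Sum>i\<in>UNIV. \<Sum>j\<in>{j. i < j}. Kd k (Suc m) z w - Kd k (Suc m) z (swapc i j w))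
     = bil z w * Kd k m z w"
  using Kd_dunkl[OF k, of w m z w] unfolding dunkl_radial dderiv_hom[OF Kd_hom] .

text \<open>Euler's relation is evaluated where the modulus is maximal on \<Omega>. The values at
  reflected points are at most this maximum, so the terms with k cancel and a bound free of k
  remains.\<close>

lemma Kd_bound_orbit:
  fixes \<Omega> :: "(complex^'n::{finite,linorder}) set"
  assumes k: "0 <= k" and fin: "finite \<Omega>" and cl: "\<And>v i j. v \<in> \<Omega> ==> swapc i j v \<in> \<Omega>"
    and C: "\<And>v. v \<in> \<Omega> ==> norm (bil z v) <= C"
  shows "v \<in> \<Omega> ==> norm (Kd k m z v) <= C ^ m / fact m"
proof (induction m arbitrary: v)
  case 0 then show ?case by (simp add: Kd_0[OF k])
next
  case (Suc m)
  let ?K = "%v. norm (Kd k (Suc m) z v)"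
  define M where "M = Max (?K ` \<Omega>)"
  have "?K ` \<Omega> ~= {}" "finite (?K ` \<Omega>)" using Suc.prems fin by auto
  then obtain v0 where v0: "v0 \<in> \<Omega>" "?K v0 = M" using Max_in[of "?K ` \<Omega>"] unfolding M_def by (metis (no_types, lifting) imageE)
  have le: "?K v <= M" if "v \<in> \<Omega>" for v using that fin by (simp add: M_def)
  define N where "N = (\<Sum>i\<in>(UNIV::'n set). \<Sum>j\<in>{j. i < j}. (1::real))"
  have N: "(\<Sum>i\<in>(UNIV::'n set). \<Sum>j\<in>{j. i < j}. c) = N * c" for c :: real
    by (simp add: N_def sum_distrib_right)
  have NC: "(\<Sum>i\<in>(UNIV::'n set). \<Sum>j\<in>{j. i < j}. c) = of_real N * c" for c :: complex
    by (simp add: N_def sum_distrib_right)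
  have C0: "0 <= C" using C[OF v0(1)] norm_ge_zero order_trans by blast
  have "(of_nat (Suc m) + of_real (k * N)) * Kd k (Suc m) z v0 =
      bil z v0 * Kd k m z v0 + of_real k * (\<Sum>i\<in>UNIV. \<Sum>j\<in>{j. i < j}. Kd k (Suc m) z (swapc i j v0))"
    using Kd_euler[OF k, of m z v0] by (simp only: sum_subtractf NC) (simp add: algebra_simps)
  then have "norm ((of_nat (Suc m) + of_real (k * N)) * Kd k (Suc m) z v0)
      <= norm (bil z v0 * Kd k m z v0) + norm (of_real k * (\<Sum>i\<in>UNIV. \<Sum>j\<in>{j. i < j}. Kd k (Suc m) z (swapc i j v0)))"
    by (simp only: norm_triangle_ineq)
  also have "norm (bil z v0 * Kd k m z v0) <= C * (C ^ m / fact m)"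
    unfolding norm_mult by (intro mult_mono C Suc.IH v0 C0) auto
  also have "norm (of_real k * (\<Sum>i\<in>UNIV. \<Sum>j\<in>{j. i < j}. Kd k (Suc m) z (swapc i j v0))) <= k * (N * M)"
  proof -
    have "norm (\<Sum>i\<in>UNIV. \<Sum>j\<in>{j. i < j}. Kd k (Suc m) z (swapc i j v0)) <= (\<Sum>i\<in>(UNIV::'n set). \<Sum>j\<in>{j. i < j}. M)"
      by (intro sum_norm_le sum_mono order_trans[OF sum_norm_le sum_mono[OF order_refl]] le cl v0)
    then show ?thesis unfolding N norm_mult using k by (simp add: mult_left_mono)
  qed
  finally have "norm ((of_nat (Suc m) + of_real (k * N)) * Kd k (Suc m) z v0) <= C * (C ^ m / fact m) + k * (N * M)" by simp
  moreover have "norm (of_nat (Suc m) + of_real (k * N) :: complex) = real (Suc m) + k * N"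
  proof -
    have "(of_nat (Suc m) + of_real (k * N) :: complex) = of_real (real (Suc m) + k * N)" by simp
    moreover have "0 <= N" unfolding N_def by (intro sum_nonneg) auto
    ultimately show ?thesis using k by (simp only: norm_of_real) simp
  qed
  ultimately have "(real (Suc m) + k * N) * M <= C * (C ^ m / fact m) + k * (N * M)"
    unfolding norm_mult v0(2) by simp
  then have "real (Suc m) * M <= C ^ Suc m / fact m" by (simp add: algebra_simps)
  then have "M <= C ^ Suc m / fact m / real (Suc m)" by (simp only: pos_le_divide_eq of_nat_0_less_iff zero_less_Suc mult.commute)
  also have "... = C ^ Suc m / fact (Suc m)" by simp
  finally show ?case using le[OF Suc.prems] by linarith
qed

section \<open>Orbits under permutations of the coordinates\<close>

definition orb :: "complex^('n::finite) => (complex^('n::finite)) set" where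
  "orb w = (%\<pi>. \<chi> i. w $ \<pi> i) ` {\<pi>. \<pi> permutes UNIV}"

lemma orb_self: "w \<in> orb w"
  unfolding orb_def by (rule image_eqI[of _ _ id]) (auto simp: permutes_id)

lemma finite_orb: "finite (orb w)"
  unfolding orb_def by (intro finite_imageI finite_permutations) simp

lemma card_orb: "card (orb (w :: complex^'n::finite)) <= fact CARD('n)"
  unfolding orb_def using card_image_le[of "{\<pi>. \<pi> permutes (UNIV::'n set)}"]
  by (metis card_permutations finite finite_permutations)

lemma orb_swapc: "v \<in> orb w ==> swapc i j v \<in> orb w"
  unfolding orb_def
proof (elim imageE, clarify)
  fix \<pi> :: "'a => 'a" assume "\<pi> permutes UNIV"
  then have "\<pi> \<circ> tsp i j permutes UNIV"
    by (intro permutes_compose permutes_swap_id) auto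
  then show "swapc i j (\<chi> i. w $ \<pi> i) \<in> (%\<pi>. \<chi> i. w $ \<pi> i) ` {\<pi>. \<pi> permutes UNIV}"
    by (intro image_eqI[of _ _ "\<pi> \<circ> tsp i j"]) (auto simp: vec_eq_iff swapc_nth)
qed

lemma norm_orb: "v \<in> orb w ==> norm v = norm w"
proof -
  assume "v \<in> orb w"
  then obtain \<pi> where p: "\<pi> permutes UNIV" "v = (\<chi> i. w $ \<pi> i)" by (auto simp: orb_def)
  have "(\<Sum>i\<in>UNIV. (norm (w $ \<pi> i))\<^sup>2) = (\<Sum>i\<in>UNIV. (norm (w $ i))\<^sup>2)"
    using p(1) by (intro sum.reindex_bij_betw[where g="%i. (norm (w $ i))\<^sup>2"]) (simp add: permutes_bij)
  then show ?thesis by (simp add: p(2) norm_vec_def L2_set_def)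
qed

lemma norm_bil_le: "norm (bil z w) <= norm z * norm w"
proof -
  have "norm (bil z w) <= (\<Sum>i\<in>UNIV. norm (z $ i) * norm (w $ i))"
    unfolding bil_def by (intro order_trans[OF norm_sum]) (simp add: norm_mult)
  also have "... <= norm z * norm w"
    unfolding norm_vec_def using L2_set_mult_ineq[of "%i. norm (z $ i)" "%i. norm (w $ i)" UNIV] by simp
  finally show ?thesis .
qed

lemma Kd_bound:
  assumes k: "0 <= k" shows "norm (Kd k m z w) <= (norm z * norm w) ^ m / fact m"
proof (rule Kd_bound_orbit[OF k finite_orb[of w] _ _ orb_self])
  show "norm (bil z v) <= norm z * norm w" if "v \<in> orb w" for v
    using norm_bil_le[of z v] norm_orb[OF that] by simp
qed (rule orb_swapc)

section \<open>The sum of the homogeneous components and its holomorphy\<close>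

definition dk :: "real => complex^('n::{finite,linorder}) => complex^('n::{finite,linorder}) => complex" where
  "dk k z w = (\<Sum>m. Kd k m z w)"

lemma summable_Kd_norm: "0 <= k ==> summable (%m. norm (Kd k m z w))"
proof (rule summable_comparison_test[OF _ summable_exp])
  assume "0 <= k"
  then show "\<exists>N. \<forall>n\<ge>N. norm (norm (Kd k n z w)) <= inverse (fact n) * (norm z * norm w) ^ n"
    using Kd_bound[of k _ z w] by (auto simp: field_simps)
qed

lemma Kd_sums: "0 <= k ==> (%m. Kd k m z w) sums dk k z w"
  unfolding dk_def by (rule summable_sums[OF summable_norm_cancel[OF summable_Kd_norm]])

lemma has_field_derivative_line_at:
  assumes "(f has_derivative bil d) (at (x + s *s \<xi>))"
  shows "((%t. f (x + t *s \<xi>)) has_field_derivative bil d \<xi>) (at s)"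
proof -
  have "((%t. f ((x + s *s \<xi>) + t *s \<xi>)) has_field_derivative bil d \<xi>) (at 0)"
    using assms by (rule has_field_derivative_line)
  moreover have "(x + s *s \<xi>) + t *s \<xi> = x + (t + s) *s \<xi>" for t by (simp add: vec_eq_iff algebra_simps)
  ultimately have "((%t. f (x + (t + s) *s \<xi>)) has_field_derivative bil d \<xi>) (at 0)" by simp
  then show ?thesis using DERIV_shift[of "%t. f (x + t *s \<xi>)" "bil d \<xi>" 0 s] by simp
qed

lemma norm_axis_complex: "norm (axis i (t::complex)) = norm t"
proof -
  have "(\<Sum>j\<in>UNIV. (norm (axis i t $ j))\<^sup>2) = (\<Sum>j\<in>UNIV. if j = i then (norm t)\<^sup>2 else 0)"
    by (intro sum.cong) (auto simp: axis_def)
  then show ?thesis by (simp add: norm_vec_def L2_set_def)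
qed

text \<open>Cauchy's inequality on the unit circle of the complex line through x in direction
  \<xi>.\<close>

lemma dderiv_bound:
  assumes f: "\<And>y. cdiff f y" and B: "\<And>t. norm t = 1 ==> norm (f (x + t *s \<xi>)) <= B"
  shows "norm (dderiv f \<xi> x) <= B"
proof -
  have d: "((%t. f (x + t *s \<xi>)) field_differentiable (at s))" for s
    using f[of "x + s *s \<xi>"] has_field_derivative_line_at unfolding cdiff_def field_differentiable_def by blast
  then have h: "(%t. f (x + t *s \<xi>)) holomorphic_on A" for A
    by (simp add: holomorphic_on_def field_differentiable_at_within)
  have "norm ((deriv ^^ 1) (%t. f (x + t *s \<xi>)) 0) <= fact 1 * B / 1 ^ 1"
    by (rule Cauchy_inequality[OF h holomorphic_on_imp_continuous_on[OF h]]) (use B in auto)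
  then show ?thesis by (simp add: dderiv_def)
qed

lemma has_derivative_partials:
  assumes "((%p. F (fst p) (snd p)) has_derivative (%h. bil d (fst h) + bil e (snd h))) (at (z, w))"
  shows "((%z. F z w) has_derivative bil d) (at z)" "(F z has_derivative bil e) (at w)"
proof -
  have "((%z. (z, w)) has_derivative (%h. (h, 0))) (at z)" by (auto intro!: derivative_eq_intros)
  from has_derivative_compose[OF this, of "%p. F (fst p) (snd p)" "%h. bil d (fst h) + bil e (snd h)"] assms
  show "((%z. F z w) has_derivative bil d) (at z)" by simp
  have "((%w. (z, w)) has_derivative (%h. (0, h))) (at w)" by (auto intro!: derivative_eq_intros)
  from has_derivative_compose[OF this, of "%p. F (fst p) (snd p)" "%h. bil d (fst h) + bil e (snd h)"] assms
  show "(F z has_derivative bil e) (at w)" by simp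
qed

lemma Kd_has_derivative:
  fixes p :: "(complex^'n::{finite,linorder}) \<times> (complex^'n::{finite,linorder})"
  shows "\<exists>d e. ((%p. Kd k m (fst p) (snd p)) has_derivative (%h. bil d (fst h) + bil e (snd h))) (at p)"
proof -
  have "\<exists>d. (jf k \<eta> has_derivative bil d) (at x)" for \<eta> and x :: "(complex,'n) vec"
    using hom_cdiff[OF jf_hom] unfolding cdiff_def by blast
  then obtain D where D: "\<And>\<eta> x. (jf k \<eta> has_derivative bil (D \<eta> x)) (at (x :: (complex,'n) vec))" by metis
  have 1: "((%p. jf k \<eta> (fst p)) has_derivative (%h. bil (D \<eta> (fst p)) (fst h))) (at p)" for \<eta>
    by (rule has_derivative_compose[OF bounded_linear.has_derivative[OF bounded_linear_fst has_derivative_ident] D])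
  have 2: "((%p. jf k \<eta> (snd p)) has_derivative (%h. bil (D \<eta> (snd p)) (snd h))) (at p)" for \<eta>
    by (rule has_derivative_compose[OF bounded_linear.has_derivative[OF bounded_linear_snd has_derivative_ident] D])
  define d where "d = (\<Sum>\<eta>\<in>mi m. (jf k \<eta> (snd p) / of_real (jn k \<eta>)) *s D \<eta> (fst p))"
  define e where "e = (\<Sum>\<eta>\<in>mi m. (jf k \<eta> (fst p) / of_real (jn k \<eta>)) *s D \<eta> (snd p))"
  have bs: "bil (\<Sum>a\<in>A. f a) h = (\<Sum>a\<in>A. bil (f a) h)" if "finite A" for A :: "('n => nat) set" and f and h :: "(complex,'n) vec"
    using that by (induction A rule: finite_induct) simp_all
  have "((%p. Kd k m (fst p) (snd p)) has_derivative (%h. \<Sum>\<eta>\<in>mi m.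
     (jf k \<eta> (fst p) * bil (D \<eta> (snd p)) (snd h) + bil (D \<eta> (fst p)) (fst h) * jf k \<eta> (snd p)) / of_real (jn k \<eta>))) (at p)"
    unfolding Kd_def divide_inverse by (intro has_derivative_sum has_derivative_mult_left has_derivative_mult 1 2)
  moreover have "(%h. \<Sum>\<eta>\<in>mi m. (jf k \<eta> (fst p) * bil (D \<eta> (snd p)) (snd h) + bil (D \<eta> (fst p)) (fst h) * jf k \<eta> (snd p)) / of_real (jn k \<eta>))
     = (%h. bil d (fst h) + bil e (snd h))"
    by (rule ext) (simp add: d_def e_def bs[OF finite_mdeg] sum.distrib[symmetric] add_divide_distrib mult_ac add.commute)
  ultimately show ?thesis by auto
qed

text \<open>Termwise differentiation on a ball around p. Cauchy estimates for the partial
  derivatives of the summands make their series converge uniformly. Joint differentiability serves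
  \<open>holo2\<close>, the termwise formula in the second argument serves
  \<open>dk_dunkl\<close>.\<close>

lemma dk_series_derivative:
  fixes p :: "(complex^'n::{finite,linorder}) \<times> (complex^'n::{finite,linorder})"
  assumes k: "0 <= k"
  shows "\<exists>d e. ((%p. dk k (fst p) (snd p)) has_derivative (%h. bil d (fst h) + bil e (snd h))) (at p)
    \<and> (\<forall>\<xi>. (%m. dderiv (Kd k m (fst p)) \<xi> (snd p)) sums bil e \<xi>)"
proof -
  let ?P = "%m (p :: (complex,'n) vec \<times> (complex,'n) vec) de.
     ((%p. Kd k m (fst p) (snd p)) has_derivative (%h. bil (fst de) (fst h) + bil (snd de) (snd h))) (at p)"
  define D where "D m p = fst (SOME de. ?P m p de)" for m p
  define E where "E m p = snd (SOME de. ?P m p de)" for m p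
  have DE: "((%p. Kd k m (fst p) (snd p)) has_derivative (%h. bil (D m p) (fst h) + bil (E m p) (snd h))) (at p)" for m p
  proof -
    obtain d e where "((%p. Kd k m (fst p) (snd p)) has_derivative (%h. bil d (fst h) + bil e (snd h))) (at p)"
      using Kd_has_derivative by blast
    then have "?P m p (d, e)" by simp
    then show ?thesis unfolding D_def E_def by (rule someI)
  qed
  have d1: "((%z. Kd k m z (snd p)) has_derivative bil (D m p)) (at (fst p))" for m p
    by (rule has_derivative_partials(1)[of "Kd k m" _ "E m p"]) (use DE[of m p] in simp)
  have d2: "(Kd k m (fst p) has_derivative bil (E m p)) (at (snd p))" for m p
    by (rule has_derivative_partials(2)[of "Kd k m" "D m p"]) (use DE[of m p] in simp)
  \<comment> \<open>One unit for the ball S around p, one for the circles of the Cauchy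
    estimates.\<close>
  define R where "R = norm p + 2"
  have R0: "0 <= R" by (simp add: R_def add_nonneg_nonneg)
  let ?B = "%m. (R * R) ^ m / fact m"
  define S where "S = ball p 1"
  have nS: "norm (fst q) <= R - 1" "norm (snd q) <= R - 1" if "q \<in> S" for q
  proof -
    have "norm q <= norm p + dist p q" using norm_triangle_sub[of q p] by (simp add: dist_norm norm_minus_commute)
    then have "norm q <= R - 1" using that by (simp add: S_def R_def)
    then show "norm (fst q) <= R - 1" "norm (snd q) <= R - 1"
      using norm_fst_le[of "fst q" "snd q"] norm_snd_le[of "snd q" "fst q"] by auto
  qed
  have na: "norm (x + t *s axis i 1) <= R" if "norm x <= R - 1" "norm t = 1" for x :: "(complex,'n) vec" and t i
  proof -
    have "t *s axis i 1 = (axis i t :: (complex,'n) vec)" by (simp add: vec_eq_iff axis_def)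
    then have "norm (t *s (axis i 1 :: (complex,'n) vec)) = 1" using that by (simp add: norm_axis_complex)
    then show ?thesis using norm_triangle_ineq[of x "t *s axis i 1"] that by simp
  qed
  have bD: "norm (D m q $ i) <= ?B m" if "q \<in> S" for m q i
  proof -
    have "norm (dderiv (%z. Kd k m z (snd q)) (axis i 1) (fst q)) <= ?B m"
    proof (rule dderiv_bound)
      show "cdiff (%z. Kd k m z (snd q)) y" for y using d1[of m "(y, snd q)"] by (auto simp: cdiff_def)
      fix t :: complex assume t: "norm t = 1"
      have "norm (fst q + t *s axis i 1) * norm (snd q) <= R * R"
        using na[OF nS(1)[OF that] t, of i] nS(2)[OF that] R0 by (intro mult_mono) auto
      then show "norm (Kd k m (fst q + t *s axis i 1) (snd q)) <= ?B m"
        using Kd_bound[OF k, of m "fst q + t *s axis i 1" "snd q"] by (meson divide_right_mono fact_ge_zero mult_nonneg_nonneg norm_ge_zero order_trans power_mono)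
    qed
    then show ?thesis using dderiv_eq[OF d1[of m q], of "axis i 1"] by simp
  qed
  have bE: "norm (E m q $ i) <= ?B m" if "q \<in> S" for m q i
  proof -
    have "norm (dderiv (Kd k m (fst q)) (axis i 1) (snd q)) <= ?B m"
    proof (rule dderiv_bound)
      show "cdiff (Kd k m (fst q)) y" for y using d2[of m "(fst q, y)"] by (auto simp: cdiff_def)
      fix t :: complex assume t: "norm t = 1"
      have "norm (fst q) * norm (snd q + t *s axis i 1) <= R * R"
        using na[OF nS(2)[OF that] t, of i] nS(1)[OF that] R0 by (intro mult_mono) auto
      then show "norm (Kd k m (fst q) (snd q + t *s axis i 1)) <= ?B m"
        using Kd_bound[OF k, of m "fst q" "snd q + t *s axis i 1"] by (meson divide_right_mono fact_ge_zero mult_nonneg_nonneg norm_ge_zero order_trans power_mono)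
    qed
    then show ?thesis using dderiv_eq[OF d2[of m q], of "axis i 1"] by simp
  qed
  have sB: "summable ?B" using summable_exp[of "R * R"] by (simp add: divide_inverse mult.commute)
  have sD: "summable (%m. D m q $ i)" and sE: "summable (%m. E m q $ i)" if "q \<in> S" for q i
    using bD[OF that] bE[OF that] by (auto intro!: summable_comparison_test[OF _ sB])
  define D' where "D' q = (\<chi> i. \<Sum>m. D m q $ i)" for q
  define E' where "E' q = (\<chi> i. \<Sum>m. E m q $ i)" for q
  have tail: "norm ((\<Sum>m<n. f m) - suminf f) <= suminf (%m. ?B (m + n))"
    if "\<And>m. norm (f m) <= ?B m" for f :: "nat => complex" and n
  proof -
    have sf: "summable f" using that by (auto intro!: summable_comparison_test[OF _ sB])
    have "suminf f - (\<Sum>m<n. f m) = suminf (%m. f (m + n))" using suminf_minus_initial_segment[OF sf, of n] by simp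
    moreover have "norm (suminf (%m. f (m + n))) <= suminf (%m. ?B (m + n))"
      by (rule norm_suminf_le) (use that summable_ignore_initial_segment[OF sB] in auto)
    ultimately show ?thesis by (simp add: norm_minus_commute)
  qed
  have "\<exists>g. \<forall>x\<in>S. (%m. Kd k m (fst x) (snd x)) sums g x \<and> (g has_derivative (%h. bil (D' x) (fst h) + bil (E' x) (snd h))) (at x within S)"
  proof (rule has_derivative_series[where f'="%m q h. bil (D m q) (fst h) + bil (E m q) (snd h)"])
    show "convex S" by (simp add: S_def)
    show "((%x. Kd k m (fst x) (snd x)) has_derivative (%h. bil (D m x) (fst h) + bil (E m x) (snd h))) (at x within S)" for m x
      using DE has_derivative_at_withinI by blast
    show "p \<in> S" by (simp add: S_def)
    show "(%m. Kd k m (fst p) (snd p)) sums dk k (fst p) (snd p)" by (rule Kd_sums[OF k])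
    fix ee :: real assume ee: "ee > 0"
    define N where "N = 2 * real CARD('n)"
    have N: "N > 0" by (simp add: N_def)
    have "(%n. suminf (%m. ?B (m + n))) \<longlonglongrightarrow> 0"
      using suminf_exist_split2[OF sB] by simp
    then have "eventually (%n. suminf (%m. ?B (m + n)) < ee / N) sequentially"
      using ee N by (intro order_tendstoD) auto
    then show "\<forall>\<^sub>F n in sequentially. \<forall>x\<in>S. \<forall>h. norm ((\<Sum>i<n. bil (D i x) (fst h) + bil (E i x) (snd h)) - (bil (D' x) (fst h) + bil (E' x) (snd h))) <= ee * norm h"
    proof (eventually_elim, intro ballI allI)
      fix n q and h :: "(complex,'n) vec \<times> (complex,'n) vec"
      assume n: "suminf (%m. ?B (m + n)) < ee / N" and q: "q \<in> S"
      let ?t = "suminf (%m. ?B (m + n))"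
      have bs: "norm ((\<Sum>i<n. bil (F i) h) - bil (\<chi> i. \<Sum>m. F m $ i) h) <= real CARD('n) * (?t * norm h)"
        if F: "\<And>m i. norm (F m $ i) <= ?B m" for F :: "nat => (complex,'n) vec" and h :: "(complex,'n) vec"
      proof -
        have "(\<Sum>i<n. bil (F i) h) - bil (\<chi> i. \<Sum>m. F m $ i) h = (\<Sum>i\<in>UNIV. ((\<Sum>m<n. F m $ i) - (\<Sum>m. F m $ i)) * h $ i)"
          unfolding bil_def by (subst sum.swap) (simp add: left_diff_distrib sum_subtractf sum_distrib_right)
        also have "norm ... <= (\<Sum>i\<in>(UNIV::'n set). ?t * norm h)"
        proof (intro sum_norm_le)
          fix i
          show "norm (((\<Sum>m<n. F m $ i) - (\<Sum>m. F m $ i)) * h $ i) <= ?t * norm h"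
            unfolding norm_mult using tail[of "%m. F m $ i" n] F Finite_Cartesian_Product.norm_nth_le[of h i]
            by (intro mult_mono) (auto intro: order_trans[OF norm_ge_zero])
        qed
        finally show ?thesis by simp
      qed
      have "norm ((\<Sum>i<n. bil (D i q) (fst h) + bil (E i q) (snd h)) - (bil (D' q) (fst h) + bil (E' q) (snd h)))
        = norm (((\<Sum>i<n. bil (D i q) (fst h)) - bil (D' q) (fst h)) + ((\<Sum>i<n. bil (E i q) (snd h)) - bil (E' q) (snd h)))"
        by (simp add: sum.distrib algebra_simps)
      also have "... <= real CARD('n) * (?t * norm (fst h)) + real CARD('n) * (?t * norm (snd h))"
        unfolding D'_def E'_def by (intro order_trans[OF norm_triangle_ineq] add_mono bs bD bE q)
      also have "... <= real CARD('n) * (?t * norm h) + real CARD('n) * (?t * norm h)"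
      proof -
        have "0 <= ?t" using summable_ignore_initial_segment[OF sB] by (intro suminf_nonneg) (auto simp: R0)
        then show ?thesis using norm_fst_le[of "fst h" "snd h"] norm_snd_le[of "snd h" "fst h"]
          by (intro add_mono mult_left_mono) auto
      qed
      also have "... = (?t * N) * norm h" by (simp add: N_def)
      also have "... <= ee * norm h"
      proof (rule mult_right_mono)
        show "?t * N <= ee" using n N by (metis less_imp_le pos_less_divide_eq)
      qed simp
      finally show "norm ((\<Sum>i<n. bil (D i q) (fst h) + bil (E i q) (snd h)) - (bil (D' q) (fst h) + bil (E' q) (snd h))) <= ee * norm h" .
    qed
  qed
  then obtain g where g: "\<And>x. x \<in> S ==> (%m. Kd k m (fst x) (snd x)) sums g x"
    "\<And>x. x \<in> S ==> (g has_derivative (%h. bil (D' x) (fst h) + bil (E' x) (snd h))) (at x within S)" by blast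
  have pS: "p \<in> S" "open S" by (auto simp: S_def)
  have "(g has_derivative (%h. bil (D' p) (fst h) + bil (E' p) (snd h))) (at p)"
    using g(2)[OF pS(1)] unfolding at_within_open[OF pS] .
  then have "((%p. dk k (fst p) (snd p)) has_derivative (%h. bil (D' p) (fst h) + bil (E' p) (snd h))) (at p)"
    by (rule has_derivative_transform_within_open[OF _ pS(2,1)]) (use g(1) Kd_sums[OF k] sums_unique2 in blast)
  moreover have "(%m. dderiv (Kd k m (fst p)) \<xi> (snd p)) sums bil (E' p) \<xi>" for \<xi>
  proof -
    have "(%m. \<Sum>i\<in>UNIV. E m p $ i * \<xi> $ i) sums (\<Sum>i\<in>UNIV. E' p $ i * \<xi> $ i)"
      using sE[OF pS(1)] by (intro sums_sum sums_mult2) (auto simp: E'_def summable_sums)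
    then show ?thesis unfolding dderiv_eq[OF d2] bil_def .
  qed
  ultimately show ?thesis by blast
qed

lemma holo2_dk: "0 <= k ==> holo2 (dk k)"
  unfolding holo2_def using dk_series_derivative by blast

lemma holo2_cdiff:
  assumes "holo2 F" shows "cdiff (F z) w"
proof -
  obtain d e where de: "((%p. F (fst p) (snd p)) has_derivative (%h. bil d (fst h) + bil e (snd h))) (at (z, w))"
    using assms unfolding holo2_def by blast
  then show ?thesis using has_derivative_partials(2) unfolding cdiff_def by blast
qed

lemma dk_dunkl:
  assumes k: "0 <= k" shows "dunkl_op k \<xi> (dk k z) w = bil z \<xi> * dk k z w"
proof -
  have dd: "(%m. dderiv (Kd k m z) \<zeta> w) sums dderiv (dk k z) \<zeta> w" for \<zeta>
  proof -
    obtain d e where de: "((%p. dk k (fst p) (snd p)) has_derivative (%h. bil d (fst h) + bil e (snd h))) (at (z, w))"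
      "\<And>\<zeta>. (%m. dderiv (Kd k m z) \<zeta> w) sums bil e \<zeta>" using dk_series_derivative[OF k, of "(z, w)"] by auto
    show ?thesis unfolding dderiv_eq[OF has_derivative_partials(2)[OF de(1)]] by (rule de(2))
  qed
  have dv: "(%m. divdiff (Kd k m z) i j w) sums divdiff (dk k z) i j w" for i j
    unfolding divdiff_def using dd by (auto intro!: sums_divide sums_diff Kd_sums k)
  have "(%m. dunkl_op k \<xi> (Kd k m z) w) sums dunkl_op k \<xi> (dk k z) w"
    unfolding dunkl_op_def by (intro sums_add dd sums_mult sums_sum dv)
  moreover have "dunkl_op k \<xi> (Kd k 0 z) w = 0" by (simp add: dunkl_hom_0[OF Kd_hom])
  ultimately have "(%m. dunkl_op k \<xi> (Kd k (Suc m) z) w) sums dunkl_op k \<xi> (dk k z) w"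
    using sums_Suc_iff[of "%m. dunkl_op k \<xi> (Kd k m z) w"] by simp
  moreover have "(%m. dunkl_op k \<xi> (Kd k (Suc m) z) w) sums (bil z \<xi> * dk k z w)"
    unfolding Kd_dunkl[OF k] by (intro sums_mult Kd_sums k)
  ultimately show ?thesis by (rule sums_unique2)
qed

lemma hom_at_0: "hom m f ==> m > 0 ==> f 0 = 0"
  by (induction rule: hom.induct) auto

lemma dk_0: "0 <= k ==> dk k z 0 = 1"
proof -
  assume k: "0 <= k"
  have "(%m. Kd k m z 0) = (%m. if m = 0 then 1 else 0)"
    by (intro ext) (simp add: hom_at_0[OF Kd_hom] Kd_0[OF k])
  then show ?thesis using Kd_sums[OF k, of z 0] sums_single[of 0 "%_. 1::complex"] sums_unique2 by (metis (no_types, lifting))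
qed

section \<open>Uniqueness and growth of the Dunkl kernel\<close>

text \<open>Along a ray the radial Dunkl equation becomes a linear system for the values on the orbit;
  its reflection part is dissipative for the sum of squares.\<close>

lemma dunkl_growth:
  fixes f :: "complex^'n::{finite,linorder} => complex"
  assumes k: "0 <= k" and cd: "\<And>x. cdiff f x"
    and eq: "\<And>x. dunkl_op k x f x = bil l x * f x"
    and c: "\<And>v. v \<in> orb z ==> Re (bil l v) <= c"
  shows "(norm (f z))\<^sup>2 <= fact CARD('n) * (norm (f 0))\<^sup>2 * exp (2 * c)"
proof -
  define \<phi> where "\<phi> v t = f (of_real t *s v)" for v and t :: real
  define \<phi>' where "\<phi>' v t = dderiv f v (of_real t *s v)" for v and t :: real
  have d\<phi>: "(\<phi> v has_vector_derivative \<phi>' v t) (at t)" for v t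
  proof -
    obtain d where d: "(f has_derivative bil d) (at (of_real t *s v))" "\<phi>' v t = bil d v"
      using cd[of "of_real t *s v"] unfolding \<phi>'_def by (rule cdiff_dderiv) auto
    have "((%s. f (0 + s *s v)) has_field_derivative bil d v) (at (of_real t))"
      by (rule has_field_derivative_line_at) (use d in simp)
    then have "((%s. f (0 + of_real s *s v)) has_vector_derivative bil d v) (at t)"
      by (rule has_vector_derivative_real_field)
    then show ?thesis unfolding \<phi>_def[abs_def] d(2) by simp
  qed
  define S where "S t = (\<Sum>v\<in>orb z. \<phi> v t \<bullet> \<phi> v t)" for t
  define S' where "S' t = (\<Sum>v\<in>orb z. 2 * (\<phi> v t \<bullet> \<phi>' v t))" for t
  have dS: "(S has_real_derivative S' t) (at t)" for t
    unfolding S_def[abs_def] S'_def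
  proof (intro DERIV_sum)
    fix v
    have "(\<phi> v has_derivative (%h. h *\<^sub>R \<phi>' v t)) (at t)" using d\<phi> unfolding has_vector_derivative_def .
    from has_derivative_inner[OF this this]
    show "((%t. \<phi> v t \<bullet> \<phi> v t) has_real_derivative 2 * (\<phi> v t \<bullet> \<phi>' v t)) (at t)"
      unfolding has_field_derivative_def by (rule has_derivative_eq_rhs) (auto simp: inner_commute algebra_simps)
  qed
  \<comment> \<open>Only for t > 0, because the radial equation is divided by t; at t = 0 the
    monotonicity argument below uses continuity alone.\<close>
  have le: "S' t <= 2 * c * S t" if t: "0 < t" for t
  proof -
    have p': "\<phi>' v t = bil l v * \<phi> v t - of_real (k / t) * (\<Sum>i\<in>UNIV. \<Sum>j\<in>{j. i < j}. \<phi> v t - \<phi> (swapc i j v) t)" for v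
    proof -
      have "dderiv f (of_real t *s v) (of_real t *s v) = of_real t * \<phi>' v t"
        using cd[of "of_real t *s v"] unfolding \<phi>'_def by (rule cdiff_dderiv) simp
      then have "of_real t * \<phi>' v t + of_real k * (\<Sum>i\<in>UNIV. \<Sum>j\<in>{j. i < j}. \<phi> v t - \<phi> (swapc i j v) t) = of_real t * (bil l v * \<phi> v t)"
        using eq[of "of_real t *s v"] unfolding dunkl_radial \<phi>_def by (simp add: mult.assoc)
      then have "of_real t * \<phi>' v t = of_real t * (bil l v * \<phi> v t - of_real (k / t) * (\<Sum>i\<in>UNIV. \<Sum>j\<in>{j. i < j}. \<phi> v t - \<phi> (swapc i j v) t))"
        using t by (simp add: algebra_simps)
      then show ?thesis using t by simp
    qed
    have in1: "a \<bullet> (b * a) = Re b * (a \<bullet> a)" for a b :: complex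
      by (simp add: inner_complex_def algebra_simps)
    have in2: "a \<bullet> (of_real r * b) = r * (a \<bullet> b)" for a b :: complex and r
      by (simp add: inner_complex_def algebra_simps)
    have "S' t = (\<Sum>v\<in>orb z. 2 * (Re (bil l v) * (\<phi> v t \<bullet> \<phi> v t)))
        - 2 * (k / t) * (\<Sum>i\<in>UNIV. \<Sum>j\<in>{j. i < j}. \<Sum>v\<in>orb z. \<phi> v t \<bullet> (\<phi> v t - \<phi> (swapc i j v) t))"
    proof -
      have "(\<Sum>v\<in>orb z. \<Sum>i\<in>UNIV. \<Sum>j\<in>{j. i < j}. \<phi> v t \<bullet> (\<phi> v t - \<phi> (swapc i j v) t))
        = (\<Sum>i\<in>UNIV. \<Sum>v\<in>orb z. \<Sum>j\<in>{j. i < j}. \<phi> v t \<bullet> (\<phi> v t - \<phi> (swapc i j v) t))"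
        by (rule sum.swap)
      also have "... = (\<Sum>i\<in>UNIV. \<Sum>j\<in>{j. i < j}. \<Sum>v\<in>orb z. \<phi> v t \<bullet> (\<phi> v t - \<phi> (swapc i j v) t))"
        by (rule sum.cong[OF refl], rule sum.swap)
      finally have sw: "(\<Sum>v\<in>orb z. \<Sum>i\<in>UNIV. \<Sum>j\<in>{j. i < j}. \<phi> v t \<bullet> (\<phi> v t - \<phi> (swapc i j v) t))
        = (\<Sum>i\<in>UNIV. \<Sum>j\<in>{j. i < j}. \<Sum>v\<in>orb z. \<phi> v t \<bullet> (\<phi> v t - \<phi> (swapc i j v) t))" .
      have "S' t = (\<Sum>v\<in>orb z. 2 * (Re (bil l v) * (\<phi> v t \<bullet> \<phi> v t))
         - 2 * (k / t) * (\<Sum>i\<in>UNIV. \<Sum>j\<in>{j. i < j}. \<phi> v t \<bullet> (\<phi> v t - \<phi> (swapc i j v) t)))"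
        unfolding S'_def p' inner_diff_right[of _ "_ * _"] in1 in2 inner_sum_right
        by (intro sum.cong refl) (simp add: algebra_simps)
      then show ?thesis unfolding sum_subtractf sum_distrib_left[symmetric] sw .
    qed
    also have "... <= (\<Sum>v\<in>orb z. 2 * (c * (\<phi> v t \<bullet> \<phi> v t))) - 0"
    proof (intro diff_mono sum_mono mult_left_mono mult_right_mono c)
      \<comment> \<open>Transpositions permute the orbit, so this sum is half the sum of the squared
        differences of the values at v and at its image.\<close>
      have "0 <= (\<Sum>v\<in>orb z. \<phi> v t \<bullet> (\<phi> v t - \<phi> (swapc i j v) t))" for i j
      proof -
        let ?a = "%v. \<phi> v t" and ?s = "swapc i j"
        have r: "(\<Sum>v\<in>orb z. ?a (?s v) \<bullet> ?a (?s v)) = (\<Sum>v\<in>orb z. ?a v \<bullet> ?a v)"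
          by (rule sum.reindex_bij_witness[of _ ?s ?s]) (simp_all add: orb_swapc)
        have "(\<Sum>v\<in>orb z. (?a v - ?a (?s v)) \<bullet> (?a v - ?a (?s v))) =
          (\<Sum>v\<in>orb z. ?a v \<bullet> ?a v) + (\<Sum>v\<in>orb z. ?a (?s v) \<bullet> ?a (?s v)) - 2 * (\<Sum>v\<in>orb z. ?a v \<bullet> ?a (?s v))"
          by (simp add: inner_diff_left inner_diff_right sum_subtractf sum.distrib sum_distrib_left inner_commute algebra_simps)
        also have "... = 2 * (\<Sum>v\<in>orb z. ?a v \<bullet> (?a v - ?a (?s v)))"
          unfolding r by (simp add: inner_diff_right sum_subtractf)
        finally show ?thesis using sum_nonneg[of "orb z" "%v. (?a v - ?a (?s v)) \<bullet> (?a v - ?a (?s v))"] by simp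
      qed
      then have "0 <= (\<Sum>i\<in>UNIV. \<Sum>j\<in>{j. i < j}. \<Sum>v\<in>orb z. \<phi> v t \<bullet> (\<phi> v t - \<phi> (swapc i j v) t))"
        by (rule sum_nonneg[OF sum_nonneg])
      then show "0 <= 2 * (k / t) * (\<Sum>i\<in>UNIV. \<Sum>j\<in>{j. i < j}. \<Sum>v\<in>orb z. \<phi> v t \<bullet> (\<phi> v t - \<phi> (swapc i j v) t))"
        using k t by (intro mult_nonneg_nonneg) auto
    qed auto
    also have "... = 2 * c * S t" by (simp add: S_def sum_distrib_left mult_ac)
    finally show ?thesis .
  qed
  define h where "h t = S t * exp (- 2 * c * t)" for t
  have dh: "(h has_real_derivative (S' t - 2 * c * S t) * exp (- 2 * c * t)) (at t)" for t
    unfolding h_def[abs_def] by (auto intro!: derivative_eq_intros dS simp: algebra_simps)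
  have "h 1 <= h 0"
  proof (rule DERIV_nonpos_imp_decreasing_open[of "0::real" 1])
    show "\<exists>y. (h has_real_derivative y) (at t) \<and> y <= 0" if "0 < t" "t < 1" for t
      using dh[of t] le[OF that(1)] by (intro exI conjI) (auto simp: mult_nonpos_nonneg)
    show "continuous_on {0..1} h" by (rule DERIV_continuous_on[OF has_field_derivative_at_within[OF dh]])
  qed simp
  then have "S 1 <= S 0 * exp (2 * c)" by (simp add: h_def exp_minus field_simps)
  also have "S 0 = real (card (orb z)) * (norm (f 0))\<^sup>2"
    by (simp add: S_def \<phi>_def power2_norm_eq_inner)
  finally have "S 1 <= real (card (orb z)) * (norm (f 0))\<^sup>2 * exp (2 * c)" .
  also have "... <= fact CARD('n) * (norm (f 0))\<^sup>2 * exp (2 * c)"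
    using card_orb[of z] by (intro mult_right_mono) (auto, metis of_nat_fact of_nat_le_iff)
  also have "(norm (f z))\<^sup>2 <= S 1"
    unfolding S_def \<phi>_def using member_le_sum[of z "orb z" "%v. f v \<bullet> f v"] orb_self[of z] finite_orb[of z]
    by (simp add: power2_norm_eq_inner)
  finally show ?thesis by simp
qed

text \<open>The growth estimate for the difference has the value at 0 as a factor, and there the
  difference vanishes. Only the radial equation enters.\<close>

lemma dunkl_unique:
  fixes f g :: "complex^'n::{finite,linorder} => complex"
  assumes k: "0 <= k" and cd: "\<And>x. cdiff f x" "\<And>x. cdiff g x"
    and eq: "\<And>x. dunkl_op k x f x = bil l x * f x" "\<And>x. dunkl_op k x g x = bil l x * g x"
    and 0: "f 0 = g 0"
  shows "f = g"
proof
  fix z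
  define h where "h x = f x + (-1) * g x" for x
  have ch: "cdiff h x" for x unfolding h_def[abs_def] by (intro cdiff_add cdiff_mult cdiff_const cd)
  have "dunkl_op k x h x = bil l x * h x" for x
  proof -
    have "dunkl_op k x h x = dunkl_op k x f x + (-1) * dunkl_op k x g x"
      unfolding h_def[abs_def]
      by (simp only: dunkl_add[OF cd(1) cdiff_mult[OF cdiff_const cd(2)]] dunkl_cmult[OF cd(2)])
    then show ?thesis by (simp add: eq h_def algebra_simps)
  qed
  from dunkl_growth[OF k ch this, of z "Max ((%v. Re (bil l v)) ` orb z)"]
  have "(norm (h z))\<^sup>2 <= 0" using 0 by (simp add: finite_orb h_def)
  then show "f z = g z" by (simp add: h_def)
qed

lemma dunkl_kernel_eq:
  assumes k: "0 <= k"
  shows "dunkl_kernel k = (dk k :: complex^'n::{finite,linorder} => _)"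
  unfolding dunkl_kernel_def
proof (rule the_equality)
  show "holo2 (dk k :: complex^'n::{finite,linorder} => _) \<and> (\<forall>lam \<xi> z. dunkl_op k \<xi> (dk k lam) z = bil lam \<xi> * dk k lam (z :: (complex,'n) vec)) \<and> (\<forall>lam. dk k lam (0 :: (complex,'n) vec) = 1)"
    using holo2_dk[OF k] dk_dunkl[OF k] dk_0[OF k] by blast
  fix F :: "(complex,'n) vec => (complex,'n) vec => complex"
  assume F: "holo2 F \<and> (\<forall>lam \<xi> z. dunkl_op k \<xi> (F lam) z = bil lam \<xi> * F lam z) \<and> (\<forall>lam. F lam 0 = 1)"
  show "F = dk k"
  proof
    fix l
    show "F l = dk k l"
      by (rule dunkl_unique[OF k, of _ _ l]) (use F holo2_cdiff holo2_dk[OF k] dk_dunkl[OF k] dk_0[OF k] in auto)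
  qed
qed

lemma dk_sym: "dk k z w = dk k w z"
  by (simp add: dk_def Kd_sym[of k _ z w])

lemma dk_cdiff: "0 <= k ==> cdiff (dk k z) w"
  by (rule holo2_cdiff[OF holo2_dk])

lemma hom_scale: "hom m f ==> f (c *s x) = c ^ m * f x"
  by (induction rule: hom.induct) (auto simp: algebra_simps)

lemma dk_scale: "dk k (c *s z) w = dk k z (c *s w)"
proof -
  have "Kd k m (c *s z) w = Kd k m z (c *s w)" for m
    using hom_scale[OF Kd_hom[of m k w], of c z] hom_scale[OF Kd_hom[of m k z], of c w] by (simp add: Kd_sym[of k m w])
  then show ?thesis by (simp add: dk_def)
qed

lemma dk_minus: "dk k (- z) w = dk k (- w) z"
proof -
  have e: "- x = (-1) *s x" for x :: "complex^'n::finite" by (simp add: vec_eq_iff)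
  show ?thesis unfolding e[of z] e[of w] by (subst dk_scale) (rule dk_sym)
qed

lemma dk_swapc:
  assumes k: "0 <= k" shows "dk k (swapc a b z) (swapc a b w) = dk k z w"
proof -
  have "Kd k m (swapc a b z) (swapc a b w) = Kd k m z w" for m
  proof -
    let ?g = "%w. Kd k m (swapc a b z) (swapc a b w)"
    have h: "hom m ?g" by (intro hom_swapc Kd_hom)
    have "fform k m (%w. ?g w - Kd k m z w) q = 0" if q: "hom m q" for q
    proof -
      have "fform k m (%w. ?g w - Kd k m z w) q = fform k m ?g q - fform k m (Kd k m z) q"
        using fform_add_left[OF h hom_cmult[OF Kd_hom[of m k z], of "-1"], of k q] fform_cmult_left[OF Kd_hom[of m k z], of k "-1" q]
        by simp
      also have "fform k m ?g q = q z"
        unfolding fform_swapc_left[OF Kd_hom q] by (subst Kd_reproducing[OF k hom_swapc[OF q]]) simp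
      finally show ?thesis by (simp add: Kd_reproducing[OF k q])
    qed
    from fform_nondeg[OF k hom_diff[OF h Kd_hom[of m k z]] this, of w] show ?thesis by simp
  qed
  then show ?thesis by (simp add: dk_def)
qed

lemma dk_ones: "0 <= k ==> dk k ones w = exp (\<Sum>i\<in>UNIV. w $ i)"
proof -
  assume k: "0 <= k"
  have "(%m. Kd k m ones w) sums exp (\<Sum>i\<in>UNIV. w $ i)"
    unfolding Kd_ones[OF k] using exp_converges[of "\<Sum>i\<in>UNIV. w $ i"] by (simp add: scaleR_conv_of_real divide_inverse mult.commute)
  then show ?thesis using Kd_sums[OF k] sums_unique2 by blast
qed

text \<open>\<open>dunkl_growth\<close> asks for a bound of the exponent on the whole orbit of x.
  For nonnegative coordinates - a times their sum is one, and the sum is the same at all orbit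
  points. The constant is the root of the bound n! for the size of the orbit.\<close>

lemma dk_decay:
  fixes x :: "real^'n::{finite,linorder}" and z :: "complex^'n::{finite,linorder}"
  assumes k: "0 <= k" and a: "\<And>i. a <= Re (z $ i)" and x: "\<And>i. 0 <= x $ i"
  shows "norm (dk k (- z) (cvec x)) <= sqrt (fact CARD('n)) * exp (- a * (\<Sum>i\<in>UNIV. x $ i))"
proof -
  let ?c = "- a * (\<Sum>i\<in>UNIV. x $ i)"
  have "(norm (dk k (- z) (cvec x)))\<^sup>2 <= fact CARD('n) * (norm (dk k (- z) 0))\<^sup>2 * exp (2 * ?c)"
  proof (rule dunkl_growth[OF k dk_cdiff[OF k] dk_dunkl[OF k]])
    fix v assume "v \<in> orb (cvec x)"
    then obtain \<pi> where p: "\<pi> permutes UNIV" "v = (\<chi> i. cvec x $ \<pi> i)" by (auto simp: orb_def)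
    have "(\<Sum>i\<in>UNIV. x $ i) = (\<Sum>i\<in>UNIV. x $ \<pi> i)" using p(1)
      by (intro sum.reindex_bij_betw[where g="%i. x $ i", symmetric]) (simp add: permutes_bij)
    moreover have "a * (\<Sum>i\<in>UNIV. x $ \<pi> i) <= (\<Sum>i\<in>UNIV. Re (z $ i) * x $ \<pi> i)"
      unfolding sum_distrib_left by (intro sum_mono mult_right_mono a x)
    moreover have "Re (bil (- z) v) = - (\<Sum>i\<in>UNIV. Re (z $ i) * x $ \<pi> i)"
      by (simp add: bil_def p(2) cvec_def sum_negf)
    ultimately show "Re (bil (- z) v) <= ?c" by simp
  qed
  also have "... = (sqrt (fact CARD('n)) * exp ?c)\<^sup>2"
    unfolding exp_double[of ?c] power_mult_distrib by (simp add: dk_0[OF k])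
  finally show ?thesis by (rule power2_le_imp_le) simp
qed

section \<open>Integration against the Selberg weight\<close>

text \<open>Integration takes place over functions on a finite index set and not over vectors: a
  single variable can be split off by Fubini's theorem, and the evaluation of the Selberg integral
  can run by induction on the index set. The passage to \<open>lborel\<close> on vectors comes at
  the end.\<close>

abbreviation LM :: "'i set => ('i => real) measure" where
  "LM K \<equiv> PiM K (%_. lborel)"

lemma product_sigma_finite_lborel: "product_sigma_finite (%_::'i. lborel :: real measure)"
  by (simp add: product_sigma_finite_def sigma_finite_lborel)

lemma measurable_LM_coord: "l \<in> J ==> (%x. x l) \<in> borel_measurable (LM J)"
  using measurable_component_singleton[of l J "%_. lborel"] by simp

lemma distr_LM_swap:
  assumes K: "finite K" and ij: "i \<in> K" "j \<in> K"
  defines "\<tau> \<equiv> tsp i j"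
  shows "distr (LM K) (LM K) (%x. \<lambda>l\<in>K. x (\<tau> l)) = LM K"
proof -
  interpret product_sigma_finite "%_::'a. lborel :: real measure" by (rule product_sigma_finite_lborel)
  have tK: "\<tau> l \<in> K \<longleftrightarrow> l \<in> K" for l using ij by (auto simp: \<tau>_def tsp_def)
  have tt: "\<tau> (\<tau> l) = l" for l by (simp add: \<tau>_def)
  have m: "(%x. \<lambda>l\<in>K. x (\<tau> l)) \<in> measurable (LM K) (LM K)"
    by (intro measurable_restrict measurable_component_singleton) (simp add: tK)
  show ?thesis
  proof (rule PiM_eqI[OF K])
    fix A :: "'a => real set" assume A: "\<And>l. l \<in> K ==> A l \<in> sets lborel"
    have PA: "Pi\<^sub>E K A \<in> sets (LM K)" using K A by (intro sets_PiM_I_finite) auto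
    have "(%x. \<lambda>l\<in>K. x (\<tau> l)) -` Pi\<^sub>E K A \<inter> space (LM K) = Pi\<^sub>E K (%l. A (\<tau> l))"
      using tK tt by (auto simp: space_PiM PiE_iff) metis+
    then have "emeasure (distr (LM K) (LM K) (%x. \<lambda>l\<in>K. x (\<tau> l))) (Pi\<^sub>E K A) = emeasure (LM K) (Pi\<^sub>E K (%l. A (\<tau> l)))"
      by (simp add: emeasure_distr[OF m PA])
    also have "... = (\<Prod>l\<in>K. emeasure lborel (A (\<tau> l)))"
      using K A tK by (intro emeasure_PiM) auto
    also have "... = (\<Prod>l\<in>K. emeasure lborel (A l))"
      by (rule prod.reindex_bij_witness[of _ \<tau> \<tau>]) (auto simp: tK tt)
    finally show "emeasure (distr (LM K) (LM K) (%x. \<lambda>l\<in>K. x (\<tau> l))) (Pi\<^sub>E K A) = (\<Prod>l\<in>K. emeasure lborel (A l))" .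
  qed simp
qed

lemma integral_LM_swap:
  fixes f :: "('i => real) => 'b::{banach,second_countable_topology}"
  assumes K: "finite K" and ij: "i \<in> K" "j \<in> K" and f: "f \<in> borel_measurable (LM K)"
  shows "(\<integral>x. f (x \<circ> tsp i j) \<partial>LM K) = integral\<^sup>L (LM K) f"
proof -
  let ?\<tau> = "tsp i j"
  have tK: "?\<tau> l \<in> K \<longleftrightarrow> l \<in> K" for l using ij by (auto simp: tsp_def)
  have m: "(%x. \<lambda>l\<in>K. x (?\<tau> l)) \<in> measurable (LM K) (LM K)"
    by (intro measurable_restrict measurable_component_singleton) (simp add: tK)
  have "integral\<^sup>L (LM K) f = integral\<^sup>L (distr (LM K) (LM K) (%x. \<lambda>l\<in>K. x (?\<tau> l))) f"
    by (simp only: distr_LM_swap[OF K ij])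
  also have "... = (\<integral>x. f (\<lambda>l\<in>K. x (?\<tau> l)) \<partial>LM K)" by (rule integral_distr[OF m f])
  also have "... = (\<integral>x. f (x \<circ> ?\<tau>) \<partial>LM K)"
  proof (rule Bochner_Integration.integral_cong[OF refl])
    fix x assume "x \<in> space (LM K)"
    then have "(\<lambda>l\<in>K. x (?\<tau> l)) = x \<circ> ?\<tau>"
      using tK by (auto simp: space_PiM PiE_iff extensional_def fun_eq_iff restrict_def)
    then show "f (\<lambda>l\<in>K. x (?\<tau> l)) = f (x \<circ> ?\<tau>)" by simp
  qed
  finally show ?thesis ..
qed

section \<open>The weight on a finite index set\<close>

lemma rpow0_nonneg [simp]: "0 <= rpow0 t a"
  by (simp add: rpow0_def)

lemma rpow0_pos: "0 < t ==> rpow0 t a = t powr a"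
  by (simp add: rpow0_def)

lemma rpow0_zero: "0 < a ==> rpow0 0 a = 0"
  by (simp add: rpow0_def)

lemma rpow0_double: "0 <= t ==> rpow0 t k * rpow0 t k = rpow0 t (2 * k)"
  by (simp add: rpow0_def powr_add[symmetric])

lemma rpow0_le: "0 <= t ==> t <= q ==> 1 <= q ==> 0 <= a ==> rpow0 t a <= q powr a"
  by (auto simp: rpow0_def powr_mono2 ge_one_powr_ge_zero)

lemma continuous_rpow0: "0 <= a ==> continuous_on {0..} (%t. rpow0 t a)"
proof (cases "a = 0")
  case True
  have "continuous_on {0..} (%t. rpow0 t a) = continuous_on {0..} (%_::real. 1::real)"
    by (rule continuous_on_cong) (use True in \<open>auto simp: rpow0_def\<close>)
  then show ?thesis by simp
next
  case False
  assume "0 <= a"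
  with False have a: "0 < a" by simp
  have e: "(%t. rpow0 t a) = (%t. t powr a)" using False by (simp add: rpow0_def fun_eq_iff)
  show ?thesis unfolding e by (rule continuous_on_powr') (use a in auto)
qed

lemma borel_measurable_rpow0 [measurable]: "(%t. rpow0 t a) \<in> borel_measurable borel"
  unfolding rpow0_def by measurable

text \<open>Each unordered pair occurs twice with exponent k, which amounts to exponent 2 k. Written
  in this way the weight is visibly symmetric and uses no order on the index set.\<close>

definition vd :: "real => 'i set => ('i => real) => real" where
  "vd k K x = (\<Prod>p\<in>K. \<Prod>q\<in>K - {p}. rpow0 \<bar>x p - x q\<bar> k)"

lemma vd_nonneg [simp]: "0 <= vd k K x"
  unfolding vd_def by (intro prod_nonneg) simp

lemma vd_insert:
  assumes "finite I" "i \<notin> I"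
  shows "vd k (insert i I) x = vd k I x * (\<Prod>j\<in>I. rpow0 \<bar>x i - x j\<bar> (2 * k))"
proof -
  have "(\<Prod>q\<in>insert i I - {p}. rpow0 \<bar>x p - x q\<bar> k) = rpow0 \<bar>x i - x p\<bar> k * (\<Prod>q\<in>I - {p}. rpow0 \<bar>x p - x q\<bar> k)" if "p \<in> I" for p
  proof -
    have "insert i I - {p} = insert i (I - {p})" using that assms by auto
    then show ?thesis using assms by (simp add: abs_minus_commute)
  qed
  then have "(\<Prod>p\<in>I. \<Prod>q\<in>insert i I - {p}. rpow0 \<bar>x p - x q\<bar> k) = (\<Prod>p\<in>I. rpow0 \<bar>x i - x p\<bar> k) * vd k I x"
    unfolding vd_def prod.distrib[symmetric] by (intro prod.cong) auto
  moreover have "insert i I - {i} = I" using assms by auto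
  ultimately have "vd k (insert i I) x = vd k I x * ((\<Prod>j\<in>I. rpow0 \<bar>x i - x j\<bar> k) * (\<Prod>j\<in>I. rpow0 \<bar>x i - x j\<bar> k))"
    using assms unfolding vd_def[of k "insert i I"] by simp
  then show ?thesis by (simp add: prod.distrib[symmetric] rpow0_double)
qed

lemma vd_cong: "(\<And>l. l \<in> K ==> x l = y l) ==> vd k K x = vd k K y"
  unfolding vd_def by (intro prod.cong) auto

lemma vd_swap:
  assumes "i \<in> K" "j \<in> K" shows "vd k K (x \<circ> tsp i j) = vd k K x"
proof -
  let ?\<tau> = "tsp i j"
  have tK: "?\<tau> l \<in> K \<longleftrightarrow> l \<in> K" for l using assms by (auto simp: tsp_def)
  have "(\<Prod>q\<in>K - {p}. rpow0 \<bar>x (?\<tau> p) - x (?\<tau> q)\<bar> k) = (\<Prod>q\<in>K - {?\<tau> p}. rpow0 \<bar>x (?\<tau> p) - x q\<bar> k)" for p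
    by (rule prod.reindex_bij_witness[of _ ?\<tau> ?\<tau>]) (auto simp: tK transpose_eq_iff)
  then have "vd k K (x \<circ> ?\<tau>) = (\<Prod>p\<in>K. \<Prod>q\<in>K - {?\<tau> p}. rpow0 \<bar>x (?\<tau> p) - x q\<bar> k)" by (simp add: vd_def)
  also have "... = vd k K x" unfolding vd_def
    by (rule prod.reindex_bij_witness[of _ ?\<tau> ?\<tau>]) (auto simp: tK)
  finally show ?thesis .
qed

lemma vd_eq_0:
  assumes "finite K" "i \<in> K" "j \<in> K" "i ~= j" "x i = x j" "0 < k"
  shows "vd k K x = 0"
  unfolding vd_def using assms
  by (intro prod_zero bexI[of _ i] bexI[of _ j]) (auto simp: rpow0_zero)

lemma borel_measurable_vd: "finite K ==> K \<subseteq> J ==> vd k K \<in> borel_measurable (LM J)"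
  unfolding vd_def
  by (intro borel_measurable_prod measurable_compose[OF _ borel_measurable_rpow0] borel_measurable_abs borel_measurable_diff
    measurable_LM_coord) auto

subsection \<open>Bounds\<close>

text \<open>One majorant, at least 1, for all coordinates and all differences of coordinates, with
  powers that factor over the coordinates.\<close>

definition QQ :: "'i set => ('i => real) => real" where
  "QQ K x = (\<Prod>l\<in>K. 1 + \<bar>x l\<bar>)"

lemma QQ_ge1: "1 <= QQ K x"
  unfolding QQ_def by (rule prod_ge_1) simp

lemma QQ_ge_diff:
  assumes "finite K" "p \<in> K" "q \<in> K" "p ~= q"
  shows "\<bar>x p - x q\<bar> <= QQ K x"
proof -
  have "QQ K x = (1 + \<bar>x p\<bar>) * ((1 + \<bar>x q\<bar>) * (\<Prod>l\<in>K - {p} - {q}. 1 + \<bar>x l\<bar>))"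
    unfolding QQ_def using assms by (subst prod.remove[of _ p], simp, simp, subst prod.remove[of _ q]) auto
  moreover have "1 * (1 + \<bar>x q\<bar>) <= (\<Prod>l\<in>K - {p} - {q}. 1 + \<bar>x l\<bar>) * (1 + \<bar>x q\<bar>)"
    by (intro mult_right_mono prod_ge_1) auto
  ultimately have "(1 + \<bar>x p\<bar>) * (1 + \<bar>x q\<bar>) <= QQ K x"
    using mult_left_mono[of "1 + \<bar>x q\<bar>" "(1 + \<bar>x q\<bar>) * (\<Prod>l\<in>K - {p} - {q}. 1 + \<bar>x l\<bar>)" "1 + \<bar>x p\<bar>"] by (simp add: mult_ac)
  moreover have "\<bar>x p - x q\<bar> <= (1 + \<bar>x p\<bar>) * (1 + \<bar>x q\<bar>)"
  proof -
    have "\<bar>x p - x q\<bar> <= 1 + \<bar>x p\<bar> + \<bar>x q\<bar> + \<bar>x p\<bar> * \<bar>x q\<bar>"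
      using abs_triangle_ineq4[of "x p" "x q"] mult_nonneg_nonneg[of "\<bar>x p\<bar>" "\<bar>x q\<bar>"] by linarith
    then show ?thesis by (simp add: algebra_simps)
  qed
  ultimately show ?thesis by linarith
qed

lemma QQ_mono: "finite K ==> I \<subseteq> K ==> QQ I x <= QQ K x"
  unfolding QQ_def by (rule prod_mono2) auto

lemma prod_le_powr_card:
  fixes f :: "'a => real"
  assumes "finite A" "\<And>a. a \<in> A ==> 0 <= f a \<and> f a <= q powr c" "0 < q"
  shows "(\<Prod>a\<in>A. f a) <= q powr (c * real (card A))"
proof -
  have "(\<Prod>a\<in>A. f a) <= (\<Prod>a\<in>A. q powr c)" using assms(2) by (intro prod_mono) auto
  also have "... = q powr (c * real (card A))" using assms(3)
    by (simp add: powr_powr[symmetric] powr_realpow)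
  finally show ?thesis .
qed

lemma vd_le:
  assumes "0 <= k" "finite K" "K \<subseteq> J" "finite J"
  shows "vd k K x <= QQ J x powr (k * real (card K) * real (card K))"
  unfolding vd_def
proof (rule prod_le_powr_card)
  fix p assume p: "p \<in> K"
  have q0: "0 < QQ J x" using QQ_ge1[of J x] by linarith
  have "(\<Prod>q\<in>K - {p}. rpow0 \<bar>x p - x q\<bar> k) <= QQ J x powr (k * real (card (K - {p})))"
    using assms p q0 QQ_ge1 by (intro prod_le_powr_card conjI rpow0_le) (auto intro!: QQ_ge_diff[OF assms(4)])
  also have "... <= QQ J x powr (k * real (card K))"
    using assms QQ_ge1 by (intro powr_mono mult_left_mono) (auto simp: card_mono)
  finally show "0 <= (\<Prod>q\<in>K - {p}. rpow0 \<bar>x p - x q\<bar> k) \<and> (\<Prod>q\<in>K - {p}. rpow0 \<bar>x p - x q\<bar> k) <= QQ J x powr (k * real (card K))"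
    by (simp add: prod_nonneg)
qed (use assms QQ_ge1[of J x] in auto)

text \<open>The part of |t|^(2 k - 1) near 0. For k > 0 it is integrable.\<close>

definition psi :: "real => real => real" where
  "psi k t = indicator {-1<..<1} t * \<bar>t\<bar> powr (2 * k - 1)"

lemma borel_measurable_psi [measurable]: "psi k \<in> borel_measurable borel"
  unfolding psi_def[abs_def] by measurable

lemma psi_nonneg [simp]: "0 <= psi k t"
  by (simp add: psi_def)

text \<open>The weight contains |x_i - x_j|^(2 k), so the quotient is no worse than
  \<open>psi\<close> when the two coordinates are closer than 1, and is bounded by the weight itself
  when they are not.\<close>

lemma vd_singular_le:
  assumes k: "0 < k" and I: "finite I" "i \<notin> I" "j \<in> I"
  shows "vd k (insert i I) x / \<bar>x i - x j\<bar> <=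
    QQ (insert i I) x powr (k * real (card I) * real (card I) + 2 * k * real (card I) + 2 * k) * (1 + psi k (x i - x j))"
proof -
  let ?Q = "QQ (insert i I) x" and ?d = "\<bar>x i - x j\<bar>"
  have ij: "i ~= j" using I by auto
  have q: "1 <= ?Q" by (rule QQ_ge1)
  have a: "vd k I x <= ?Q powr (k * real (card I) * real (card I))" using k I by (intro vd_le) auto
  have b: "(\<Prod>l\<in>I - {j}. rpow0 \<bar>x i - x l\<bar> (2 * k)) <= ?Q powr (2 * k * real (card I))"
  proof -
    have "(\<Prod>l\<in>I - {j}. rpow0 \<bar>x i - x l\<bar> (2 * k)) <= ?Q powr (2 * k * real (card (I - {j})))"
      using k I q QQ_ge_diff[of "insert i I" i _ x] by (intro prod_le_powr_card conjI rpow0_le) auto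
    also have "... <= ?Q powr (2 * k * real (card I))"
      using k I q by (intro powr_mono mult_left_mono) (auto simp: card_mono)
    finally show ?thesis .
  qed
  have c: "rpow0 ?d (2 * k) / ?d <= ?Q powr (2 * k) * (1 + psi k (x i - x j))"
  proof -
    have q1: "1 <= ?Q powr (2 * k)" using q k by (intro ge_one_powr_ge_zero) auto
    consider "?d = 0" | "0 < ?d" "?d < 1" | "1 <= ?d" by fastforce
    then show ?thesis
    proof cases
      case 1 then show ?thesis by simp
    next
      case 2
      then have "rpow0 ?d (2 * k) / ?d = psi k (x i - x j)"
        by (simp add: rpow0_pos psi_def powr_diff abs_less_iff)
      also have "... <= 1 * (1 + psi k (x i - x j))" by simp
      also have "... <= ?Q powr (2 * k) * (1 + psi k (x i - x j))" using q1 by (intro mult_right_mono) auto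
      finally show ?thesis .
    next
      case 3
      have "rpow0 ?d (2 * k) / ?d <= rpow0 ?d (2 * k)" using 3 frac_le[of "rpow0 ?d (2 * k)" "rpow0 ?d (2 * k)" 1 ?d] by simp
      also have "... <= ?Q powr (2 * k)" using k q QQ_ge_diff[of "insert i I" i j x] I ij by (intro rpow0_le) auto
      also have "... <= ?Q powr (2 * k) * (1 + psi k (x i - x j))" by (simp add: mult_le_cancel_left1)
      finally show ?thesis .
    qed
  qed
  have "vd k (insert i I) x / ?d = (vd k I x * (\<Prod>l\<in>I - {j}. rpow0 \<bar>x i - x l\<bar> (2 * k))) * (rpow0 ?d (2 * k) / ?d)"
    unfolding vd_insert[OF I(1,2)] using I by (simp add: prod.remove[of I j])
  also have "... <= (?Q powr (k * real (card I) * real (card I)) * ?Q powr (2 * k * real (card I))) * (?Q powr (2 * k) * (1 + psi k (x i - x j)))"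
    by (intro mult_mono a b c) (auto intro!: prod_nonneg mult_nonneg_nonneg)
  also have "... = ?Q powr (k * real (card I) * real (card I) + 2 * k * real (card I) + 2 * k) * (1 + psi k (x i - x j))"
    using q by (simp add: powr_add)
  finally show ?thesis .
qed

text \<open>The Gamma integrand with shape b and rate c. Products of these functions are the
  integrable majorants used throughout.\<close>

definition gam :: "real => real => real => real" where
  "gam b c t = indicator {0<..} t * (t powr (b - 1) * exp (- c * t))"

lemma borel_measurable_gam [measurable]: "gam b c \<in> borel_measurable borel"
  unfolding gam_def[abs_def] by measurable

lemma gam_nonneg [simp]: "0 <= gam b c t"
  by (simp add: gam_def)

lemma integrable_gam:
  assumes "0 < b" "0 < c" shows "integrable lborel (gam b c)"
proof -
  have "(%t. complex_of_real t powr (of_real b - 1) / of_real (exp (c * t))) absolutely_integrable_on {0<..}"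
    by (rule absolutely_integrable_Gamma_integral) (use assms in auto)
  then have "(%t. norm (complex_of_real t powr (of_real b - 1) / of_real (exp (c * t)))) absolutely_integrable_on {0<..}"
    by (rule absolutely_integrable_norm[unfolded o_def])
  moreover have "set_integrable lebesgue {0<..} (%t. norm (complex_of_real t powr (of_real b - 1) / of_real (exp (c * t))))
      = set_integrable lebesgue {0<..} (%t. t powr (b - 1) * exp (- c * t))"
    by (rule set_integrable_cong) (auto simp: norm_divide norm_powr_real_powr exp_minus divide_inverse norm_mult norm_inverse)
  ultimately have "(%t. t powr (b - 1) * exp (- c * t)) absolutely_integrable_on {0<..}" by simp
  then have "integrable lebesgue (%t. indicator {0<..} t *\<^sub>R (t powr (b - 1) * exp (- c * t)))"
    by (simp add: set_integrable_def)
  then have "integrable lebesgue (gam b c)" by (simp add: gam_def[abs_def])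
  then show ?thesis using integrable_completion[of "gam b c" lborel] borel_measurable_gam[of b c] by simp
qed

lemma powr_le_exp:
  fixes M d :: real
  assumes "0 <= M" "0 < d"
  obtains C where "0 < C" "\<And>t. 0 <= t ==> (1 + t) powr M <= C * exp (d * t)"
proof -
  \<comment> \<open>The denominator M + 1 gives e M \<le> d and stays positive for M = 0.\<close>
  define e where "e = d / (M + 1)"
  have e: "0 < e" "e * M <= d" using assms by (auto simp: e_def field_simps)
  define C where "C = max 1 (1 / e) powr M"
  have "(1 + t) powr M <= C * exp (d * t)" if t: "0 <= t" for t
  proof -
    have m1: "1 <= max 1 (1 / e)" "1 <= max 1 (1 / e) * e" using e by (auto simp: max_def field_simps)
    have "1 + t <= max 1 (1 / e) + max 1 (1 / e) * e * t" using m1 t by (intro add_mono) (auto simp: mult_le_cancel_right1)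
    also have "... = max 1 (1 / e) * (1 + e * t)" by (simp add: algebra_simps)
    also have "... <= max 1 (1 / e) * exp (e * t)" using m1 by (intro mult_left_mono exp_ge_add_one_self) auto
    finally have "(1 + t) powr M <= (max 1 (1 / e) * exp (e * t)) powr M" using t assms by (intro powr_mono2) auto
    also have "... = C * exp (e * M * t)" using m1 by (simp add: C_def powr_mult exp_powr_real mult_ac)
    also have "... <= C * exp (d * t)" using e t by (intro mult_left_mono) (auto simp: C_def mult_right_mono)
    finally show ?thesis .
  qed
  moreover have "0 < C" by (simp add: C_def)
  ultimately show ?thesis using that by blast
qed

definition pos :: "'i set => ('i => real) => bool" where
  "pos K x \<longleftrightarrow> (\<forall>l\<in>K. 0 < x l)"

lemma QQ_powr_le:
  assumes K: "finite K" and Mc: "0 <= M" "0 < c"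
  obtains C where "0 < C" "\<And>x. pos K x ==> QQ K x powr M <= C * (\<Prod>l\<in>K. exp (c * x l))"
proof -
  obtain C where C: "0 < C" "\<And>t. 0 <= t ==> (1 + t) powr M <= C * exp (c * t)" using powr_le_exp[OF Mc] by blast
  have "QQ K x powr M <= C ^ card K * (\<Prod>l\<in>K. exp (c * x l))" if p: "pos K x" for x
  proof -
    have "QQ K x powr M = (\<Prod>l\<in>K. (1 + \<bar>x l\<bar>) powr M)" unfolding QQ_def by (rule prod_powr_distrib)
    also have "... <= (\<Prod>l\<in>K. C * exp (c * x l))" using p C(2) by (intro prod_mono) (auto simp: pos_def less_imp_le)
    finally show ?thesis by (simp add: prod.distrib)
  qed
  then show ?thesis using that[of "C ^ card K"] C(1) by simp
qed

lemma measurable_pos: "finite K ==> Measurable.pred (LM K) (pos K)"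
proof -
  assume K: "finite K"
  have "(%x. 0 < x l) \<in> measurable (LM K) (count_space UNIV)" if "l \<in> K" for l
    using measurable_LM_coord[OF that] by measurable
  then show ?thesis unfolding pos_def[abs_def] using K by (intro pred_intros_finite(3)) auto
qed

text \<open>Half of the exponential rate absorbs the polynomial growth of the weight; the other half
  is left for integrability.\<close>

lemma integrable_vd:
  fixes F :: "('i => real) => 'b::{banach,second_countable_topology}"
  assumes k: "0 <= k" and K: "finite K" and F: "F \<in> borel_measurable (LM K)"
    and bc: "0 < b" "0 < c"
    and B: "\<And>x. x \<in> space (LM K) ==> pos K x ==> norm (F x) <= C * (\<Prod>l\<in>K. gam b c (x l))"
  shows "integrable (LM K) (%x. (of_bool (pos K x) * vd k K x) *\<^sub>R F x)"
proof -
  interpret product_sigma_finite "%_::'i. lborel :: real measure" by (rule product_sigma_finite_lborel)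
  obtain C' where C': "0 < C'" "\<And>x. pos K x ==> QQ K x powr (k * real (card K) * real (card K)) <= C' * (\<Prod>l\<in>K. exp (c / 2 * x l))"
    using QQ_powr_le[OF K, of "k * real (card K) * real (card K)" "c / 2"] k bc by auto
  have "integrable (LM K) (%x. (C' * \<bar>C\<bar>) * (\<Prod>l\<in>K. gam b (c / 2) (x l)))"
    using bc by (intro integrable_mult_right product_integrable_prod K integrable_gam) auto
  then show ?thesis
  proof (rule Bochner_Integration.integrable_bound)
    show "(%x. (of_bool (pos K x) * vd k K x) *\<^sub>R F x) \<in> borel_measurable (LM K)"
    proof -
      have [measurable]: "vd k K \<in> borel_measurable (LM K)" "Measurable.pred (LM K) (pos K)"
        by (rule borel_measurable_vd[OF K subset_refl], rule measurable_pos[OF K])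
      show ?thesis using F by measurable
    qed
    show "AE x in LM K. norm ((of_bool (pos K x) * vd k K x) *\<^sub>R F x) <= norm ((C' * \<bar>C\<bar>) * (\<Prod>l\<in>K. gam b (c / 2) (x l)))"
    proof (rule AE_I2)
      fix x assume x: "x \<in> space (LM K)"
      show "norm ((of_bool (pos K x) * vd k K x) *\<^sub>R F x) <= norm ((C' * \<bar>C\<bar>) * (\<Prod>l\<in>K. gam b (c / 2) (x l)))"
      proof (cases "pos K x")
        case True
        have "norm ((of_bool (pos K x) * vd k K x) *\<^sub>R F x) = vd k K x * norm (F x)" using True by simp
        also have "... <= (C' * (\<Prod>l\<in>K. exp (c / 2 * x l))) * (\<bar>C\<bar> * (\<Prod>l\<in>K. gam b c (x l)))"
        proof (intro mult_mono)
          show "vd k K x <= C' * (\<Prod>l\<in>K. exp (c / 2 * x l))"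
            using vd_le[OF k K subset_refl K, of x] C'(2)[OF True] by linarith
          show "norm (F x) <= \<bar>C\<bar> * (\<Prod>l\<in>K. gam b c (x l))"
            using B[OF x True] by (rule order_trans) (intro mult_right_mono, auto intro!: prod_nonneg)
        qed (use C' in \<open>auto intro!: mult_nonneg_nonneg prod_nonneg\<close>)
        also have "... = (C' * \<bar>C\<bar>) * (\<Prod>l\<in>K. exp (c / 2 * x l) * gam b c (x l))" by (simp add: prod.distrib)
        also have "(\<Prod>l\<in>K. exp (c / 2 * x l) * gam b c (x l)) = (\<Prod>l\<in>K. gam b (c / 2) (x l))"
          by (intro prod.cong refl) (simp add: gam_def exp_add[symmetric] mult.left_commute)
        finally show ?thesis using C' by (auto simp: abs_mult abs_prod)
      qed (use C' in \<open>auto simp: abs_mult\<close>)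
    qed
  qed
qed

lemma nn_integral_psi_const: "(\<integral>\<^sup>+t. ennreal (psi k (t - y)) \<partial>lborel) = (\<integral>\<^sup>+t. ennreal (psi k t) \<partial>lborel)"
proof -
  have "(\<integral>\<^sup>+t. ennreal (psi k t) \<partial>lborel) = ennreal \<bar>1\<bar> * (\<integral>\<^sup>+t. ennreal (psi k (- y + 1 * t)) \<partial>lborel)"
    by (rule nn_integral_real_affine[OF measurable_compose[OF borel_measurable_psi measurable_ennreal]]) simp
  moreover have "- y + 1 * t = t - y" for t by simp
  ultimately show ?thesis by (simp only: abs_one ennreal_1 mult_1_left)
qed

lemma nn_integral_psi:
  assumes "0 < k" shows "(\<integral>\<^sup>+t. ennreal (psi k (t - y)) \<partial>lborel) < \<infinity>"
proof -
  have e: "psi k t <= exp 1 * (gam (2 * k) 1 t + gam (2 * k) 1 (- t)) " if "t ~= 0" for t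
  proof (cases "\<bar>t\<bar> < 1")
    case True
    have "exp (- 1) <= exp (- \<bar>t\<bar>)" using True by simp
    then have "1 <= exp 1 * exp (- \<bar>t\<bar>)" by (simp add: exp_minus field_simps)
    then have "\<bar>t\<bar> powr (2 * k - 1) * 1 <= \<bar>t\<bar> powr (2 * k - 1) * (exp 1 * exp (- \<bar>t\<bar>))" by (intro mult_left_mono) auto
    then show ?thesis using True that by (cases "t < 0") (auto simp: psi_def gam_def mult_ac)
  next
    case False
    then have "psi k t = 0" by (auto simp: psi_def indicator_def abs_less_iff)
    then show ?thesis by simp
  qed
  have i: "integrable lborel (gam (2 * k) 1)" by (rule integrable_gam) (use assms in auto)
  have "integrable lborel (%t. gam (2 * k) 1 (- t))"
    using lborel_integrable_real_affine[OF i, of "-1" 0] by simp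
  with i have i2: "integrable lborel (%t. exp 1 * (gam (2 * k) 1 t + gam (2 * k) 1 (- t)))" by simp
  have "(\<integral>\<^sup>+t. ennreal (psi k (t - y)) \<partial>lborel) = (\<integral>\<^sup>+t. ennreal (psi k t) \<partial>lborel)"
    by (rule nn_integral_psi_const)
  also have "... <= (\<integral>\<^sup>+t. ennreal (exp 1 * (gam (2 * k) 1 t + gam (2 * k) 1 (- t))) \<partial>lborel)"
  proof (rule nn_integral_mono_AE)
    have "AE t in lborel. t ~= (0::real)" by (rule AE_lborel_singleton)
    then show "AE t in lborel. ennreal (psi k t) <= ennreal (exp 1 * (gam (2 * k) 1 t + gam (2 * k) 1 (- t)))"
      by eventually_elim (intro ennreal_leI e)
  qed
  also have "... < \<infinity>" 
  proof -
    have "0 <= exp 1 * (gam (2 * k) 1 t + gam (2 * k) 1 (- t))" for t by (intro mult_nonneg_nonneg add_nonneg_nonneg) auto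
    then show ?thesis using i2 unfolding integrable_iff_bounded real_norm_def by (simp only: abs_of_nonneg)
  qed
  finally show ?thesis .
qed

text \<open>The singular term is integrated in x_i first, where by translation invariance the result
  does not depend on x_j. The bound on F carries no power of x_i, so that the singularity at x_i =
  x_j does not meet another one at x_i = 0.\<close>

lemma integrable_vd_singular:
  fixes F :: "('i => real) => 'b::{banach,second_countable_topology}"
  assumes k: "0 < k" and I: "finite I" "i \<notin> I" "j \<in> I"
    and F: "F \<in> borel_measurable (LM (insert i I))"
    and bc: "0 < b" "0 < c"
    and B: "\<And>x. x \<in> space (LM (insert i I)) ==> pos (insert i I) x ==>
       norm (F x) <= C * (exp (- c * x i) * (\<Prod>l\<in>I. gam b c (x l)))"
  shows "integrable (LM (insert i I)) (%x. (of_bool (pos (insert i I) x) * (vd k (insert i I) x / (x i - x j))) *\<^sub>R F x)"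
proof -
  interpret product_sigma_finite "%_::'i. lborel :: real measure" by (rule product_sigma_finite_lborel)
  let ?K = "insert i I"
  have ij: "i ~= j" using I by auto
  define M where "M = k * real (card I) * real (card I) + 2 * k * real (card I) + 2 * k"
  have M: "0 <= M" using k by (simp add: M_def)
  have fK: "finite ?K" using I by simp
  obtain C' where C': "0 < C'" "\<And>x. pos ?K x ==> QQ ?K x powr M <= C' * (\<Prod>l\<in>?K. exp (c / 2 * x l))"
    using QQ_powr_le[OF fK M, of "c / 2"] bc by auto
  let ?g = "%x. \<Prod>l\<in>I. gam b (c / 2) (x l)"
  have i1: "integrable (LM ?K) (%x. gam 1 (c / 2) (x i) * ?g x)"
  proof -
    have "integrable (LM ?K) (%x. \<Prod>l\<in>?K. (if l = i then gam 1 (c / 2) else gam b (c / 2)) (x l))"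
      using bc by (intro product_integrable_prod fK) (auto intro!: integrable_gam)
    moreover have "(\<Prod>l\<in>?K. (if l = i then gam 1 (c / 2) else gam b (c / 2)) (x l)) = gam 1 (c / 2) (x i) * ?g x" for x
      using I by (auto intro!: prod.cong arg_cong2[where f="(*)"])
    ultimately show ?thesis by simp
  qed
  have i2: "integrable (LM ?K) (%x. psi k (x i - x j) * ?g x)"
    unfolding integrable_iff_bounded
  proof
    show m: "(%x. psi k (x i - x j) * ?g x) \<in> borel_measurable (LM ?K)"
      using I by (intro borel_measurable_times borel_measurable_prod measurable_compose[OF _ borel_measurable_psi]
        measurable_compose[OF _ borel_measurable_gam] borel_measurable_diff measurable_LM_coord) auto
    have mm: "(%x. ennreal (norm (psi k (x i - x j) * ?g x))) \<in> borel_measurable (LM ?K)" using m by measurable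
    have "(\<integral>\<^sup>+x. ennreal (norm (psi k (x i - x j) * ?g x)) \<partial>LM ?K)
       = (\<integral>\<^sup>+x. (\<integral>\<^sup>+t. ennreal (norm (psi k ((x(i := t)) i - (x(i := t)) j) * ?g (x(i := t)))) \<partial>lborel) \<partial>LM I)"
      by (rule product_nn_integral_insert[OF I(1,2) mm])
    also have "... = (\<integral>\<^sup>+x. ennreal (?g x) * (\<integral>\<^sup>+t. ennreal (psi k t) \<partial>lborel) \<partial>LM I)"
    proof (rule nn_integral_cong)
      fix x
      have "?g (x(i := t)) = ?g x" for t using I by (intro prod.cong) auto
      then have "(\<integral>\<^sup>+t. ennreal (norm (psi k ((x(i := t)) i - (x(i := t)) j) * ?g (x(i := t)))) \<partial>lborel)
        = (\<integral>\<^sup>+t. ennreal (?g x) * ennreal (psi k (t - x j)) \<partial>lborel)"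
        using ij by (intro nn_integral_cong) (simp add: abs_mult prod_nonneg ennreal_mult' mult.commute)
      also have "... = ennreal (?g x) * (\<integral>\<^sup>+t. ennreal (psi k (t - x j)) \<partial>lborel)" 
        by (rule nn_integral_cmult) (intro measurable_compose[OF _ measurable_ennreal] measurable_compose[OF _ borel_measurable_psi], simp)
      finally show "(\<integral>\<^sup>+t. ennreal (norm (psi k ((x(i := t)) i - (x(i := t)) j) * ?g (x(i := t)))) \<partial>lborel)
        = ennreal (?g x) * (\<integral>\<^sup>+t. ennreal (psi k t) \<partial>lborel)" by (simp only: nn_integral_psi_const)
    qed
    also have "... = (\<integral>\<^sup>+x. ennreal (?g x) \<partial>LM I) * (\<integral>\<^sup>+t. ennreal (psi k t) \<partial>lborel)"
      using I by (intro nn_integral_multc) measurable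
    also have "... < \<infinity>"
    proof -
      have "integrable (LM I) ?g" using bc by (intro product_integrable_prod I integrable_gam) auto
      then have "(\<integral>\<^sup>+x. ennreal (?g x) \<partial>LM I) < \<infinity>" unfolding integrable_iff_bounded by (simp add: prod_nonneg)
      then show ?thesis using nn_integral_psi[OF k, of 0] by (simp add: ennreal_mult_less_top)
    qed
    finally show "(\<integral>\<^sup>+x. ennreal (norm (psi k (x i - x j) * ?g x)) \<partial>LM ?K) < \<infinity>" .
  qed
  have "integrable (LM ?K) (%x. (C' * \<bar>C\<bar>) * (gam 1 (c / 2) (x i) * ?g x + psi k (x i - x j) * ?g x))"
    by (intro integrable_mult_right Bochner_Integration.integrable_add i1 i2)
  then show ?thesis
  proof (rule Bochner_Integration.integrable_bound)
    show "(%x. (of_bool (pos ?K x) * (vd k ?K x / (x i - x j))) *\<^sub>R F x) \<in> borel_measurable (LM ?K)"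
    proof -
      have [measurable]: "vd k ?K \<in> borel_measurable (LM ?K)" "Measurable.pred (LM ?K) (pos ?K)"
        "(%x. x i) \<in> borel_measurable (LM ?K)" "(%x. x j) \<in> borel_measurable (LM ?K)"
        by (rule borel_measurable_vd[OF fK subset_refl], rule measurable_pos[OF fK]) (use I in \<open>auto intro!: measurable_LM_coord\<close>)
      show ?thesis using F by measurable
    qed
    show "AE x in LM ?K. norm ((of_bool (pos ?K x) * (vd k ?K x / (x i - x j))) *\<^sub>R F x) <= norm ((C' * \<bar>C\<bar>) * (gam 1 (c / 2) (x i) * ?g x + psi k (x i - x j) * ?g x))"
    proof (rule AE_I2)
      fix x assume x: "x \<in> space (LM ?K)"
      have g0: "0 <= ?g x" by (intro prod_nonneg) simp
      show "norm ((of_bool (pos ?K x) * (vd k ?K x / (x i - x j))) *\<^sub>R F x) <= norm ((C' * \<bar>C\<bar>) * (gam 1 (c / 2) (x i) * ?g x + psi k (x i - x j) * ?g x))"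
      proof (cases "pos ?K x")
        case True
        let ?p = "1 + psi k (x i - x j)"
        have "norm ((of_bool (pos ?K x) * (vd k ?K x / (x i - x j))) *\<^sub>R F x) = vd k ?K x / \<bar>x i - x j\<bar> * norm (F x)" using True by simp
        also have "... <= (C' * (\<Prod>l\<in>?K. exp (c / 2 * x l)) * ?p) * (\<bar>C\<bar> * (exp (- c * x i) * (\<Prod>l\<in>I. gam b c (x l))))"
        proof (intro mult_mono)
          show "vd k ?K x / \<bar>x i - x j\<bar> <= C' * (\<Prod>l\<in>?K. exp (c / 2 * x l)) * ?p"
            using vd_singular_le[OF k I, of x] mult_right_mono[OF C'(2)[OF True], of ?p] unfolding M_def[symmetric] by (simp add: add_nonneg_nonneg)
          show "norm (F x) <= \<bar>C\<bar> * (exp (- c * x i) * (\<Prod>l\<in>I. gam b c (x l)))"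
            using B[OF x True] by (rule order_trans) (intro mult_right_mono, auto intro!: prod_nonneg mult_nonneg_nonneg)
        qed (use C' in \<open>auto intro!: mult_nonneg_nonneg prod_nonneg add_nonneg_nonneg\<close>)
        also have "... = (C' * \<bar>C\<bar>) * (exp (- (c / 2) * x i) * (\<Prod>l\<in>I. exp (c / 2 * x l) * gam b c (x l)) * ?p)"
        proof -
          have "exp (c / 2 * x i) * exp (- c * x i) = exp (- (c / 2) * x i)" unfolding exp_add[symmetric] by simp
          then have "(\<Prod>l\<in>?K. exp (c / 2 * x l)) * exp (- c * x i) = exp (- (c / 2) * x i) * (\<Prod>l\<in>I. exp (c / 2 * x l))"
            using I by (simp add: mult_ac)
          then show ?thesis by (simp add: prod.distrib mult_ac)
        qed
        also have "(\<Prod>l\<in>I. exp (c / 2 * x l) * gam b c (x l)) = ?g x"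
          by (intro prod.cong refl) (simp add: gam_def exp_add[symmetric] mult.left_commute)
        also have "exp (- (c / 2) * x i) * ?g x * ?p <= gam 1 (c / 2) (x i) * ?g x + psi k (x i - x j) * ?g x"
        proof -
          have xi: "0 < x i" using True by (simp add: pos_def)
          have "exp (- (c / 2) * x i) = gam 1 (c / 2) (x i)" using xi by (simp add: gam_def)
          moreover have "exp (- (c / 2) * x i) * psi k (x i - x j) <= 1 * psi k (x i - x j)"
            using xi bc by (intro mult_right_mono) auto
          then have "exp (- (c / 2) * x i) * psi k (x i - x j) * ?g x <= psi k (x i - x j) * ?g x"
            using mult_right_mono g0 by fastforce
          ultimately show ?thesis by (simp add: algebra_simps)
        qed
        finally show ?thesis using C' g0 by (simp add: abs_mult mult_left_mono abs_of_nonneg add_nonneg_nonneg)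
      qed (use C' in \<open>auto simp: abs_mult\<close>)
    qed
  qed
qed

section \<open>Integration by parts\<close>

text \<open>The fundamental theorem on [0, b] with finitely many exceptional points, followed by b
  \<rightarrow> \<infinity>. The exceptional points will be the places where t meets another
  coordinate.\<close>

lemma integral_halfline_deriv:
  fixes u u' :: "real => 'b::euclidean_space"
  assumes S: "finite S" and cont: "continuous_on {0..} u"
    and der: "\<And>t. 0 < t ==> t \<notin> S ==> (u has_vector_derivative u' t) (at t)"
    and lim: "(u \<longlongrightarrow> 0) at_top" and int: "integrable lborel (%t. indicator {0<..} t *\<^sub>R u' t)"
  shows "(\<integral>t. indicator {0<..} t *\<^sub>R u' t \<partial>lborel) = - u 0"
proof -
  define v where "v t = indicator {0<..} t *\<^sub>R u' t" for t
  have iv: "integrable lborel v" using int by (simp add: v_def[abs_def])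
  have si: "set_integrable lborel A v" if "A \<in> sets borel" for A
    unfolding set_integrable_def using that iv by (intro integrable_mult_indicator) auto
  have 1: "set_lebesgue_integral lborel {0..b} v = u b - u 0" if "0 <= b" for b
  proof -
    have "(v has_integral (u b - u 0)) {0..b}"
    proof (rule fundamental_theorem_of_calculus_interior_strong[OF S that])
      show "(u has_vector_derivative v t) (at t)" if "t \<in> {0<..<b} - S" for t
        using der[of t] that by (simp add: v_def)
      show "continuous_on {0..b} u" by (rule continuous_on_subset[OF cont]) auto
    qed
    moreover have "set_lebesgue_integral lborel {0..b} v = integral {0..b} v"
      by (rule set_borel_integral_eq_integral) (rule si, simp)
    ultimately show ?thesis by (simp add: integral_unique)
  qed
  have "((%b. set_lebesgue_integral lborel {0..b} v) \<longlongrightarrow> set_lebesgue_integral lborel {0..} v) at_top"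
    by (rule tendsto_set_lebesgue_integral_at_top) (auto intro: si)
  moreover have "((%b. set_lebesgue_integral lborel {0..b} v) \<longlongrightarrow> 0 - u 0) at_top"
  proof (rule Lim_transform_eventually)
    show "((%b. u b - u 0) \<longlongrightarrow> 0 - u 0) at_top" by (intro tendsto_diff lim tendsto_const)
    show "\<forall>\<^sub>F b in at_top. u b - u 0 = set_lebesgue_integral lborel {0..b} v"
      using eventually_ge_at_top[of 0] by eventually_elim (simp add: 1)
  qed
  ultimately have "set_lebesgue_integral lborel {0..} v = - u 0"
    using tendsto_unique trivial_limit_at_top_linorder by fastforce
  moreover have "set_lebesgue_integral lborel {0..} v = integral\<^sup>L lborel v"
    unfolding set_lebesgue_integral_def by (intro Bochner_Integration.integral_cong refl) (auto simp: v_def indicator_def)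
  ultimately show ?thesis by (simp add: v_def[abs_def])
qed

lemma rpow0_abs_deriv:
  assumes "t ~= y"
  shows "((%t. rpow0 \<bar>t - y\<bar> a) has_real_derivative a / (t - y) * rpow0 \<bar>t - y\<bar> a) (at t)"
proof (cases "y < t")
  case True
  have "((%t. (t - y) powr a) has_real_derivative a / (t - y) * rpow0 \<bar>t - y\<bar> a) (at t)"
    using True by (auto intro!: derivative_eq_intros simp: rpow0_pos powr_diff)
  then show ?thesis
    by (rule has_field_derivative_transform_within_open[of _ _ _ "{y<..}"]) (use True in \<open>auto simp: rpow0_pos\<close>)
next
  case False
  with assms have ty: "t < y" by simp
  have "((%t. (y - t) powr a) has_real_derivative a / (t - y) * rpow0 \<bar>t - y\<bar> a) (at t)"
    using ty by (auto intro!: derivative_eq_intros simp: rpow0_pos powr_diff field_simps)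
  then show ?thesis
    by (rule has_field_derivative_transform_within_open[of _ _ _ "{..<y}"]) (use ty in \<open>auto simp: rpow0_pos abs_if\<close>)
qed

lemma prod_rpow0_deriv:
  assumes "finite J" "t \<notin> x ` J"
  shows "((%t. \<Prod>j\<in>J. rpow0 \<bar>t - x j\<bar> a) has_real_derivative (\<Sum>j\<in>J. a / (t - x j)) * (\<Prod>j\<in>J. rpow0 \<bar>t - x j\<bar> a)) (at t)"
  using assms
proof (induction J rule: finite_induct)
  case (insert i J)
  have "t ~= x i" using insert.prems by auto
  have "((%t. rpow0 \<bar>t - x i\<bar> a * (\<Prod>j\<in>J. rpow0 \<bar>t - x j\<bar> a)) has_real_derivative
     (a / (t - x i) * rpow0 \<bar>t - x i\<bar> a) * (\<Prod>j\<in>J. rpow0 \<bar>t - x j\<bar> a)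
      + ((\<Sum>j\<in>J. a / (t - x j)) * (\<Prod>j\<in>J. rpow0 \<bar>t - x j\<bar> a)) * rpow0 \<bar>t - x i\<bar> a) (at t)"
    by (rule DERIV_mult[OF rpow0_abs_deriv[OF \<open>t ~= x i\<close>] insert.IH]) (use insert.prems in auto)
  then show ?case using insert.hyps by (simp add: algebra_simps)
qed simp

lemma continuous_prod_rpow0:
  assumes "0 <= a" shows "continuous_on A (%t. \<Prod>j\<in>J. rpow0 \<bar>t - x j\<bar> a)"
  by (intro continuous_on_prod continuous_on_compose2[OF continuous_rpow0[OF assms]] continuous_intros) auto

lemma AE_integrable_fun_upd:
  fixes f :: "('i => real) => 'b::{banach,second_countable_topology}"
  assumes I: "finite I" "i \<notin> I" and f: "integrable (LM (insert i I)) f"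
  shows "AE x in LM I. integrable lborel (%t. f (x(i := t)))"
    "(%x. \<integral>t. f (x(i := t)) \<partial>lborel) \<in> borel_measurable (LM I)"
proof -
  interpret product_sigma_finite "%_::'i. lborel :: real measure" by (rule product_sigma_finite_lborel)
  have fm: "f \<in> borel_measurable (LM (insert i I))" using f by auto
  have pm: "(%(x, t). x(i := t)) \<in> measurable (LM I \<Otimes>\<^sub>M lborel) (LM (insert i I))" by (rule measurable_add_dim)
  have m2: "(%(x, t). f (x(i := t))) \<in> borel_measurable (LM I \<Otimes>\<^sub>M lborel)"
    using measurable_compose[OF pm fm] by (simp add: case_prod_unfold)
  show "(%x. \<integral>t. f (x(i := t)) \<partial>lborel) \<in> borel_measurable (LM I)"
    using lborel.borel_measurable_lebesgue_integral[of "%x t. f (x(i := t))"] m2 by simp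
  have nm: "(%x. \<integral>\<^sup>+t. ennreal (norm (f (x(i := t)))) \<partial>lborel) \<in> borel_measurable (LM I)"
    using lborel.borel_measurable_nn_integral[of "%x t. ennreal (norm (f (x(i := t))))" "LM I"] m2
    by (simp add: case_prod_unfold)
  have "(\<integral>\<^sup>+x. (\<integral>\<^sup>+t. ennreal (norm (f (x(i := t)))) \<partial>lborel) \<partial>LM I) = (\<integral>\<^sup>+x. ennreal (norm (f x)) \<partial>LM (insert i I))"
    by (rule product_nn_integral_insert[symmetric, OF I]) (use fm in measurable)
  also have "... < \<infinity>" using f unfolding integrable_iff_bounded by simp
  finally have "AE x in LM I. (\<integral>\<^sup>+t. ennreal (norm (f (x(i := t)))) \<partial>lborel) ~= \<infinity>"
    by (intro nn_integral_PInf_AE nm) auto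
  with AE_space show "AE x in LM I. integrable lborel (%t. f (x(i := t)))"
  proof eventually_elim
    case (elim x)
    have "(%t. x(i := t)) \<in> measurable lborel (LM (insert i I))"
      using measurable_compose[OF measurable_Pair1' pm, of x] elim(1) by simp
    then have "(%t. f (x(i := t))) \<in> borel_measurable lborel" by (rule measurable_compose[OF _ fm])
    then show ?case using elim(2) unfolding integrable_iff_bounded by (simp add: less_top)
  qed
qed

text \<open>The sum of the 2 k / (x_i - x_j) is the logarithmic derivative in x_i of the weight.
  Only the boundary term at x_i = 0 survives, since B decays exponentially while the weight grows
  polynomially.\<close>

lemma ibp_vd:
  fixes B B' :: "('i => real) => 'b::euclidean_space"
  assumes k: "0 <= k" and I: "finite I" "i \<notin> I"
    and der: "\<And>x t. x \<in> space (LM I) ==> pos I x ==> 0 < t ==> ((%t. B (x(i := t))) has_vector_derivative B' (x(i := t))) (at t)"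
    and cont: "\<And>x. x \<in> space (LM I) ==> pos I x ==> continuous_on {0..} (%t. B (x(i := t)))"
    and dec: "\<And>x. x \<in> space (LM I) ==> pos I x ==> \<exists>C c. 0 < c \<and> (\<forall>t\<ge>0. norm (B (x(i := t))) <= C * exp (- c * t))"
    and bm: "(%x. (of_bool (pos I x) * vd k (insert i I) (x(i := 0))) *\<^sub>R B (x(i := 0))) \<in> borel_measurable (LM I)"
    and int: "integrable (LM (insert i I)) (%x. (of_bool (pos (insert i I) x) * vd k (insert i I) x) *\<^sub>R (B' x + (\<Sum>j\<in>I. 2 * k / (x i - x j)) *\<^sub>R B x))"
  shows "(\<integral>x. (of_bool (pos (insert i I) x) * vd k (insert i I) x) *\<^sub>R (B' x + (\<Sum>j\<in>I. 2 * k / (x i - x j)) *\<^sub>R B x) \<partial>LM (insert i I))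
    = - (\<integral>x. (of_bool (pos I x) * vd k (insert i I) (x(i := 0))) *\<^sub>R B (x(i := 0)) \<partial>LM I)"
proof -
  interpret product_sigma_finite "%_::'i. lborel :: real measure" by (rule product_sigma_finite_lborel)
  let ?K = "insert i I"
  define H where "H x = (of_bool (pos ?K x) * vd k ?K x) *\<^sub>R (B' x + (\<Sum>j\<in>I. 2 * k / (x i - x j)) *\<^sub>R B x)" for x
  have iH: "integrable (LM ?K) H" using int by (simp add: H_def[abs_def])
  have vK: "vd k ?K (x(i := t)) = vd k I x * (\<Prod>j\<in>I. rpow0 \<bar>t - x j\<bar> (2 * k))" for x t
  proof -
    have "vd k I (x(i := t)) = vd k I x" using I by (intro vd_cong) auto
    moreover have "(\<Prod>j\<in>I. rpow0 \<bar>(x(i := t)) i - (x(i := t)) j\<bar> (2 * k)) = (\<Prod>j\<in>I. rpow0 \<bar>t - x j\<bar> (2 * k))"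
      using I by (intro prod.cong) auto
    ultimately show ?thesis unfolding vd_insert[OF I] by simp
  qed
  have pK: "pos ?K (x(i := t)) \<longleftrightarrow> 0 < t \<and> pos I x" for x t using I by (auto simp: pos_def)
  have inner: "(\<integral>t. H (x(i := t)) \<partial>lborel) = - ((of_bool (pos I x) * vd k ?K (x(i := 0))) *\<^sub>R B (x(i := 0)))"
    if x: "x \<in> space (LM I)" and ix: "integrable lborel (%t. H (x(i := t)))" for x
  \<comment> \<open>Where the weight of the remaining variables vanishes, both sides are 0.
    Elsewhere that weight is a nonzero constant in t and can be divided out, which gives the
    integrability of the derivative.\<close>
  proof (cases "pos I x \<and> vd k I x ~= 0")
    case False
    then have "H (x(i := t)) = 0" for t by (auto simp: H_def pK vK)
    then show ?thesis using False by (auto simp: vK)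
  next
    case True
    define V where "V t = (\<Prod>j\<in>I. rpow0 \<bar>t - x j\<bar> (2 * k))" for t
    define u where "u t = V t *\<^sub>R B (x(i := t))" for t
    define u' where "u' t = V t *\<^sub>R B' (x(i := t)) + ((\<Sum>j\<in>I. 2 * k / (t - x j)) * V t) *\<^sub>R B (x(i := t))" for t
    have Hu: "H (x(i := t)) = vd k I x *\<^sub>R (indicator {0<..} t *\<^sub>R u' t)" for t
    proof -
      have "(\<Sum>j\<in>I. 2 * k / ((x(i := t)) i - (x(i := t)) j)) = (\<Sum>j\<in>I. 2 * k / (t - x j))"
        using I by (intro sum.cong) auto
      then show ?thesis using True unfolding H_def pK vK V_def[symmetric] u'_def
        by (simp add: scaleR_add_right indicator_def mult_ac)
    qed
    have "(\<integral>t. indicator {0<..} t *\<^sub>R u' t \<partial>lborel) = - u 0"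
    proof (rule integral_halfline_deriv[of "x ` I"])
      show "finite (x ` I)" using I by simp
      show "continuous_on {0..} u" unfolding u_def[abs_def] V_def
        by (intro continuous_on_scaleR continuous_prod_rpow0 cont x) (use k True in auto)
      show "(u has_vector_derivative u' t) (at t)" if "0 < t" "t \<notin> x ` I" for t
      proof -
        have "(V has_real_derivative (\<Sum>j\<in>I. 2 * k / (t - x j)) * V t) (at t)"
          unfolding V_def[abs_def] by (rule prod_rpow0_deriv[OF I(1) that(2)])
        from has_vector_derivative_scaleR[OF this der[OF x _ that(1)]] True
        show ?thesis by (simp add: u_def[abs_def] u'_def)
      qed
      show "(u \<longlongrightarrow> 0) at_top"
      proof -
        obtain C c where Cc: "0 < c" "\<And>t. 0 <= t ==> norm (B (x(i := t))) <= C * exp (- c * t)" using dec[OF x] True by blast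
        define M where "M = 2 * k * real (card I)"
        have M: "0 <= M" using k by (simp add: M_def)
        obtain D where D: "0 < D" "\<And>t. 0 <= t ==> (1 + t) powr M <= D * exp (c / 2 * t)"
          using powr_le_exp[OF M, of "c / 2"] Cc(1) by auto
        have Vle: "V t <= QQ I x powr M * (1 + t) powr M" if t: "0 <= t" for t
        proof -
          have "V t <= QQ ?K (x(i := t)) powr (2 * k * real (card I))" unfolding V_def
          proof (rule prod_le_powr_card[OF I(1)])
            fix j assume j: "j \<in> I"
            then have "\<bar>(x(i := t)) i - (x(i := t)) j\<bar> <= QQ ?K (x(i := t))" using I by (intro QQ_ge_diff) auto
            then have "\<bar>t - x j\<bar> <= QQ ?K (x(i := t))" using I j by (auto split: if_splits)
            then show "0 <= rpow0 \<bar>t - x j\<bar> (2 * k) \<and> rpow0 \<bar>t - x j\<bar> (2 * k) <= QQ ?K (x(i := t)) powr (2 * k)"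
              using k QQ_ge1 by (auto intro!: rpow0_le)
          qed (use QQ_ge1[of ?K "x(i := t)"] in linarith)
          also have "QQ ?K (x(i := t)) = (1 + t) * QQ I x"
          proof -
            have "(\<Prod>l\<in>I. 1 + \<bar>(x(i := t)) l\<bar>) = QQ I x" unfolding QQ_def using I by (intro prod.cong) auto
            then show ?thesis unfolding QQ_def[of ?K] using I t by simp
          qed
          finally show ?thesis using QQ_ge1[of I x] t by (simp add: powr_mult M_def mult.commute)
        qed
        have "norm (u t) <= (QQ I x powr M * D * \<bar>C\<bar>) * exp (- (c / 2) * t)" if t: "0 <= t" for t
        proof -
          have V0: "0 <= V t" unfolding V_def by (intro prod_nonneg) simp
          have "norm (u t) = V t * norm (B (x(i := t)))" by (simp add: u_def V0)
          also have "... <= (QQ I x powr M * (D * exp (c / 2 * t))) * (\<bar>C\<bar> * exp (- c * t))"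
          proof (intro mult_mono)
            have "QQ I x powr M * (1 + t) powr M <= QQ I x powr M * (D * exp (c / 2 * t))" using D(2)[OF t] by (intro mult_left_mono) auto
            then show "V t <= QQ I x powr M * (D * exp (c / 2 * t))" using Vle[OF t] by linarith
            show "norm (B (x(i := t))) <= \<bar>C\<bar> * exp (- c * t)" using Cc(2)[OF t] by (rule order_trans) simp
          qed (use D in auto)
          also have "... = (QQ I x powr M * D * \<bar>C\<bar>) * exp (- (c / 2) * t)"
          proof -
            have "exp (c / 2 * t) * exp (- c * t) = exp (- (c / 2) * t)" unfolding exp_add[symmetric] by simp
            then show ?thesis by (simp add: mult_ac)
          qed
          finally show ?thesis .
        qed
        then have ev: "\<forall>\<^sub>F t in at_top. norm (u t) <= (QQ I x powr M * D * \<bar>C\<bar>) * exp (- (c / 2) * t)"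
          by (rule eventually_mono[OF eventually_ge_at_top[of 0]])
        have "((%t. (QQ I x powr M * D * \<bar>C\<bar>) * exp (- (c / 2) * t)) \<longlongrightarrow> (QQ I x powr M * D * \<bar>C\<bar>) * 0) at_top"
        proof (intro tendsto_mult tendsto_const)
          have "filterlim (%t. - (c / 2) * t) at_bot at_top"
            using Cc(1) by (intro filterlim_tendsto_neg_mult_at_bot[OF tendsto_const _ filterlim_ident]) auto
          then show "((%t. exp (- (c / 2) * t)) \<longlongrightarrow> 0) at_top" by (rule filterlim_compose[OF exp_at_bot])
        qed
        then show ?thesis using Lim_null_comparison[OF ev] by simp
      qed
      show "integrable lborel (%t. indicator {0<..} t *\<^sub>R u' t)"
      proof -
        have "integrable lborel (%t. (1 / vd k I x) *\<^sub>R H (x(i := t)))" using ix by simp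
        then show ?thesis unfolding Hu using True by simp
      qed
    qed
    then have "(\<integral>t. vd k I x *\<^sub>R (indicator {0<..} t *\<^sub>R u' t) \<partial>lborel) = vd k I x *\<^sub>R (- u 0)"
      by (simp only: integral_scaleR_right)
    then show ?thesis unfolding Hu using True by (simp only: vK u_def V_def) simp
  qed
  have "integral\<^sup>L (LM ?K) H = (\<integral>x. (\<integral>t. H (x(i := t)) \<partial>lborel) \<partial>LM I)"
    by (rule product_integral_insert[OF I iH])
  also have "... = (\<integral>x. - ((of_bool (pos I x) * vd k ?K (x(i := 0))) *\<^sub>R B (x(i := 0))) \<partial>LM I)"
  proof (rule integral_cong_AE)
    show "(%x. \<integral>t. H (x(i := t)) \<partial>lborel) \<in> borel_measurable (LM I)" by (rule AE_integrable_fun_upd(2)[OF I iH])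
    show "(%x. - ((of_bool (pos I x) * vd k ?K (x(i := 0))) *\<^sub>R B (x(i := 0)))) \<in> borel_measurable (LM I)"
      using bm by (rule borel_measurable_uminus)
    show "AE x in LM I. (\<integral>t. H (x(i := t)) \<partial>lborel) = - ((of_bool (pos I x) * vd k ?K (x(i := 0))) *\<^sub>R B (x(i := 0)))"
      using AE_space AE_integrable_fun_upd(1)[OF I iH] by eventually_elim (rule inner)
  qed
  finally show ?thesis by (simp add: H_def[abs_def])
qed

section \<open>The Selberg--Laguerre integral for real parameters\<close>

definition SW :: "real => real => 'i set => ('i => real) => real" where
  "SW a k K x = of_bool (pos K x) * vd k K x * (\<Prod>l\<in>K. x l powr (a - 1) * exp (- x l))"

definition mom :: "real => 'i set => real => 'i set => real" where
  "mom k K a U = (\<integral>x. (\<Prod>l\<in>U. x l) * SW a k K x \<partial>LM K)"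

abbreviation SR :: "real => 'i set => real => real" where
  "SR k K a \<equiv> mom k K a {}"

lemma measurable_prod_powr: "finite K ==> (%x. \<Prod>l\<in>K. x l powr (a - 1) * exp (- x l)) \<in> borel_measurable (LM K)"
  by (intro borel_measurable_prod borel_measurable_times powr_real_measurable measurable_const measurable_compose[OF _ borel_measurable_exp]
     borel_measurable_uminus measurable_LM_coord) auto

lemma measurable_prod_coord: "finite K ==> U \<subseteq> K ==> (%x. \<Prod>l\<in>U. x l) \<in> borel_measurable (LM K)"
  by (intro borel_measurable_prod measurable_LM_coord) auto

lemma prod_coord_le_QQ:
  assumes "finite K" "U \<subseteq> K" "pos K x"
  shows "(\<Prod>l\<in>U. x l) <= QQ K x" "0 <= (\<Prod>l\<in>U. x l)"
proof -
  have "(\<Prod>l\<in>U. x l) <= QQ U x" unfolding QQ_def using assms by (intro prod_mono) (auto simp: pos_def intro: less_imp_le)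
  also have "... <= QQ K x" using assms by (intro QQ_mono)
  finally show "(\<Prod>l\<in>U. x l) <= QQ K x" .
  show "0 <= (\<Prod>l\<in>U. x l)" using assms by (intro prod_nonneg) (auto simp: pos_def intro: less_imp_le)
qed

lemma prod_gam: "pos K x ==> (\<Prod>l\<in>K. x l powr (a - 1) * exp (- x l)) = (\<Prod>l\<in>K. gam a 1 (x l))"
  by (intro prod.cong) (auto simp: gam_def pos_def)

lemma gam_exp: "exp (c / 2 * t) * gam b c t = gam b (c / 2) t"
  by (simp add: gam_def exp_add[symmetric] mult.left_commute)

lemma integrable_mom:
  assumes k: "0 <= k" and K: "finite K" "U \<subseteq> K" and a: "0 < a"
  shows "integrable (LM K) (%x. (\<Prod>l\<in>U. x l) * SW a k K x)"
proof -
  let ?F = "%x. (\<Prod>l\<in>U. x l) * (\<Prod>l\<in>K. x l powr (a - 1) * exp (- x l))"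
  obtain C where C: "0 < C" "\<And>x. pos K x ==> QQ K x powr 1 <= C * (\<Prod>l\<in>K. exp (1 / 2 * x l))"
    using QQ_powr_le[OF K(1), of 1 "1/2"] by auto
  have "integrable (LM K) (%x. (of_bool (pos K x) * vd k K x) *\<^sub>R ?F x)"
  proof (rule integrable_vd[OF k K(1), of _ a "1/2" C])
    show "?F \<in> borel_measurable (LM K)" using K by (intro borel_measurable_times measurable_prod_coord measurable_prod_powr)
    fix x assume p: "pos K x"
    have "norm (?F x) = (\<Prod>l\<in>U. x l) * (\<Prod>l\<in>K. gam a 1 (x l))"
      unfolding prod_gam[OF p] using prod_coord_le_QQ[OF K p] by (simp add: abs_mult prod_nonneg)
    also have "... <= (C * (\<Prod>l\<in>K. exp (1 / 2 * x l))) * (\<Prod>l\<in>K. gam a 1 (x l))"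
      using C(2)[OF p] prod_coord_le_QQ[OF K p] QQ_ge1[of K x] by (intro mult_right_mono) (auto intro!: prod_nonneg)
    also have "... = C * (\<Prod>l\<in>K. gam a (1 / 2) (x l))"
      unfolding gam_exp[of 1, symmetric] by (simp add: prod.distrib)
    finally show "norm (?F x) <= C * (\<Prod>l\<in>K. gam a (1 / 2) (x l))" .
  qed (use a in auto)
  then show ?thesis by (rule Bochner_Integration.integrable_cong[THEN iffD1, OF refl, rotated]) (simp add: SW_def)
qed

text \<open>The condition on i guarantees a nonnegative power of x_i in the integrand: either the
  extra factor x_i raises the exponent a - 1 to a, or the exponent is 0.\<close>

lemma integrable_mom_singular:
  assumes k: "0 < k" and I: "finite I" "i \<notin> I" "j \<in> I" and U: "U \<subseteq> insert i I"
    and a: "0 < a" and ia: "i \<in> U \<or> a = 1"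
  shows "integrable (LM (insert i I)) (%x. (\<Prod>l\<in>U. x l) * SW a k (insert i I) x / (x i - x j))"
proof -
  let ?K = "insert i I"
  let ?F = "%x. (\<Prod>l\<in>U. x l) * (\<Prod>l\<in>?K. x l powr (a - 1) * exp (- x l))"
  have fK: "finite ?K" using I by simp
  obtain C where C: "0 < C" "\<And>x. pos ?K x ==> QQ ?K x powr (1 + a) <= C * (\<Prod>l\<in>?K. exp (1 / 2 * x l))"
    using QQ_powr_le[OF fK, of "1 + a" "1/2"] a by auto
  have "integrable (LM ?K) (%x. (of_bool (pos ?K x) * (vd k ?K x / (x i - x j))) *\<^sub>R ?F x)"
  proof (rule integrable_vd_singular[OF k I, of _ a "1/2" C])
    show "?F \<in> borel_measurable (LM ?K)" using fK U by (intro borel_measurable_times measurable_prod_coord measurable_prod_powr)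
    fix x assume p: "pos ?K x"
    have xi: "0 < x i" using p by (simp add: pos_def)
    have pI: "pos I x" using p by (simp add: pos_def)
    let ?g = "\<Prod>l\<in>I. gam a 1 (x l)"
    have Q1: "1 <= QQ ?K x" by (rule QQ_ge1)
    have le: "(\<Prod>l\<in>U. x l) * x i powr (a - 1) <= QQ ?K x powr (1 + a)"
    proof (cases "i \<in> U")
      case True
      have fU: "finite U" using U fK finite_subset by blast
      have "(\<Prod>l\<in>U. x l) = x i * (\<Prod>l\<in>U - {i}. x l)" using True fU by (intro prod.remove) auto
      then have "(\<Prod>l\<in>U. x l) * x i powr (a - 1) = (\<Prod>l\<in>U - {i}. x l) * x i powr a"
        using xi by (simp add: powr_diff)
      also have "... <= QQ ?K x * QQ ?K x powr a"
      proof (intro mult_mono)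
        show "(\<Prod>l\<in>U - {i}. x l) <= QQ ?K x" using U by (intro prod_coord_le_QQ(1) fK p) auto
        have "x i <= QQ ?K x" using prod_coord_le_QQ(1)[OF fK _ p, of "{i}"] by simp
        then show "x i powr a <= QQ ?K x powr a" using xi a by (intro powr_mono2) auto
      qed (use Q1 in auto)
      also have "... = QQ ?K x powr (1 + a)" using Q1 by (simp add: powr_add)
      finally show ?thesis .
    next
      case False
      with ia have "a = 1" by simp
      then have "(\<Prod>l\<in>U. x l) * x i powr (a - 1) = (\<Prod>l\<in>U. x l)" using xi by simp
      also have "... <= QQ ?K x powr 1" using prod_coord_le_QQ(1)[OF fK U p] Q1 by simp
      also have "... <= QQ ?K x powr (1 + a)" using Q1 a by (intro powr_mono) auto
      finally show ?thesis .
    qed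
    have "norm (?F x) = ((\<Prod>l\<in>U. x l) * x i powr (a - 1)) * (exp (- x i) * ?g)"
      using I prod_coord_le_QQ(2)[OF fK U p] prod_gam[OF pI, of a] by (simp add: abs_mult prod_nonneg mult_ac)
    also have "... <= (C * (\<Prod>l\<in>?K. exp (1 / 2 * x l))) * (exp (- x i) * ?g)"
      using le C(2)[OF p] by (intro mult_right_mono) (auto intro!: mult_nonneg_nonneg prod_nonneg)
    also have "... = C * ((exp (1 / 2 * x i) * exp (- x i)) * ((\<Prod>l\<in>I. exp (1 / 2 * x l)) * ?g))"
      using I by (simp add: mult_ac)
    also have "exp (1 / 2 * x i) * exp (- x i) = exp (- (1 / 2) * x i)" unfolding exp_add[symmetric] by simp
    also have "(\<Prod>l\<in>I. exp (1 / 2 * x l)) * ?g = (\<Prod>l\<in>I. gam a (1 / 2) (x l))"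
      unfolding gam_exp[of 1, symmetric] by (simp add: prod.distrib)
    finally show "norm (?F x) <= C * (exp (- (1 / 2) * x i) * (\<Prod>l\<in>I. gam a (1 / 2) (x l)))" .
  qed (use a in auto)
  then show ?thesis by (rule Bochner_Integration.integrable_cong[THEN iffD1, OF refl, rotated]) (simp add: SW_def)
qed

lemma SW_swap:
  assumes "i \<in> K" "j \<in> K" shows "SW a k K (x \<circ> tsp i j) = SW a k K x"
proof -
  let ?\<tau> = "tsp i j"
  have tK: "?\<tau> l \<in> K \<longleftrightarrow> l \<in> K" for l using assms by (auto simp: tsp_def)
  have "(\<Prod>l\<in>K. x (?\<tau> l) powr (a - 1) * exp (- x (?\<tau> l))) = (\<Prod>l\<in>K. x l powr (a - 1) * exp (- x l))"
    by (rule prod.reindex_bij_witness[of _ ?\<tau> ?\<tau>]) (auto simp: tK)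
  moreover have "pos K (x \<circ> ?\<tau>) = pos K x"
  proof -
    have "(\<forall>l\<in>K. 0 < x (?\<tau> l)) \<longleftrightarrow> (\<forall>l\<in>K. 0 < x l)" using tK by (metis transpose_involutory)
    then show ?thesis by (simp add: pos_def)
  qed
  ultimately show ?thesis unfolding SW_def vd_swap[OF assms] by simp
qed

lemma mom_antisym:
  assumes k: "0 < k" and I: "finite I" "i \<notin> I" "j \<in> I" and U: "U \<subseteq> insert i I" and a: "0 < a" "i \<in> U \<or> a = 1"
    and sym: "i \<in> U \<longleftrightarrow> j \<in> U"
  shows "(\<integral>x. (\<Prod>l\<in>U. x l) * SW a k (insert i I) x / (x i - x j) \<partial>LM (insert i I)) = 0"
proof -
  let ?K = "insert i I" and ?\<tau> = "tsp i j"
  let ?f = "%x. (\<Prod>l\<in>U. x l) * SW a k ?K x / (x i - x j)"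
  have tU: "?\<tau> l \<in> U \<longleftrightarrow> l \<in> U" for l using sym by (auto simp: tsp_def)
  have "(\<Prod>l\<in>U. x (?\<tau> l)) = (\<Prod>l\<in>U. x l)" for x :: "'a => real"
    by (rule prod.reindex_bij_witness[of _ ?\<tau> ?\<tau>]) (auto simp: tU)
  moreover have "SW a k ?K (x \<circ> ?\<tau>) = SW a k ?K x" for x using I by (intro SW_swap) auto
  ultimately have f: "?f (x \<circ> ?\<tau>) = - ?f x" for x
    by (simp add: minus_divide_right)
  have "integrable (LM ?K) ?f" by (rule integrable_mom_singular[OF k I U a])
  then have "(\<integral>x. ?f (x \<circ> ?\<tau>) \<partial>LM ?K) = integral\<^sup>L (LM ?K) ?f" using I by (intro integral_LM_swap) auto
  then show ?thesis unfolding f by simp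
qed

text \<open>Symmetrising in i and j uses x_i / (x_i - x_j) + x_j / (x_j - x_i) = 1. On the diagonal,
  where this fails, the weight vanishes because k > 0.\<close>

lemma mom_half:
  assumes k: "0 < k" and I: "finite I" "i \<notin> I" "j \<in> I" and U: "U \<subseteq> insert i I" and a: "0 < a" "i \<in> U"
    and j: "j \<notin> U"
  shows "(\<integral>x. (\<Prod>l\<in>U. x l) * SW a k (insert i I) x / (x i - x j) \<partial>LM (insert i I)) = mom k (insert i I) a (U - {i}) / 2"
proof -
  let ?K = "insert i I" and ?\<tau> = "tsp i j"
  let ?f = "%x. (\<Prod>l\<in>U. x l) * SW a k ?K x / (x i - x j)"
  have fU: "finite U" using U I finite_subset by blast
  have ij: "i ~= j" using I by auto
  have f1: "(\<Prod>l\<in>U. x l) = x i * (\<Prod>l\<in>U - {i}. x l)" for x :: "'a => real" using a fU by (intro prod.remove) auto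
  have f2: "(\<Prod>l\<in>U - {i}. x (?\<tau> l)) = (\<Prod>l\<in>U - {i}. x l)" for x :: "'a => real"
    using j by (intro prod.cong) (auto simp: tsp_def)
  have sw: "SW a k ?K (x \<circ> ?\<tau>) = SW a k ?K x" for x using I by (intro SW_swap) auto
  have s: "?f x + ?f (x \<circ> ?\<tau>) = (\<Prod>l\<in>U - {i}. x l) * SW a k ?K x" for x
  proof (cases "x i = x j")
    case True
    then have "SW a k ?K x = 0" using vd_eq_0[of ?K i j x k] I k ij by (auto simp: SW_def)
    then show ?thesis by (simp add: sw)
  next
    case False
    then have d: "x j - x i ~= 0" "x i - x j ~= 0" by auto
    have A: "?f (x \<circ> ?\<tau>) = x j * (\<Prod>l\<in>U - {i}. x l) * SW a k ?K x / (x j - x i)"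
      unfolding f1[of "x \<circ> ?\<tau>"] sw using f2[of x] by simp
    have A': "?f x = x i * (\<Prod>l\<in>U - {i}. x l) * SW a k ?K x / (x i - x j)" unfolding f1[of x] ..
    have "x i * M / (x i - x j) + x j * M / (x j - x i) = M" for M
      using d by (simp add: divide_simps) (simp add: algebra_simps)
    from this[of "(\<Prod>l\<in>U - {i}. x l) * SW a k ?K x"] show ?thesis unfolding A A' by (simp only: mult.assoc)
  qed
  have i: "integrable (LM ?K) ?f" by (rule integrable_mom_singular[OF k I U a(1)]) (use a in auto)
  then have e: "(\<integral>x. ?f (x \<circ> ?\<tau>) \<partial>LM ?K) = integral\<^sup>L (LM ?K) ?f" using I by (intro integral_LM_swap) auto
  have "integrable (LM ?K) (%x. (\<Prod>l\<in>U - {i}. x l) * SW a k ?K x)" using k I U a by (intro integrable_mom) auto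
  then have i2: "integrable (LM ?K) (%x. (\<Prod>l\<in>U - {i}. x l) * SW a k ?K x - ?f x)" using i by (rule Bochner_Integration.integrable_diff)
  have "(%x. ?f (x \<circ> ?\<tau>)) = (%x. (\<Prod>l\<in>U - {i}. x l) * SW a k ?K x - ?f x)" using s by (auto simp: algebra_simps)
  with i2 have i3: "integrable (LM ?K) (%x. ?f (x \<circ> ?\<tau>))" by simp
  have "mom k ?K a (U - {i}) = integral\<^sup>L (LM ?K) ?f + (\<integral>x. ?f (x \<circ> ?\<tau>) \<partial>LM ?K)"
    unfolding mom_def s[symmetric] by (rule Bochner_Integration.integral_add[OF i i3])
  then show ?thesis using e by simp
qed

text \<open>Integration by parts in x_i of the integrand with exponent a in place of a - 1. The
  boundary term vanishes; the ordinary derivative gives a times the smaller moment minus the full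
  one; the singular term for j is 0 by antisymmetry if j lies in U, and otherwise 2 k times half the
  smaller moment.\<close>

lemma aomoto:
  assumes k: "0 <= k" and K: "finite K" "U \<subseteq> K" and i: "i \<in> U" and a: "0 < a"
  shows "mom k K a U = (a + k * real (card K - card U)) * mom k K a (U - {i})"
proof -
  define I where "I = K - {i}"
  have I: "finite I" "i \<notin> I" and KI: "K = insert i I" using K i by (auto simp: I_def)
  define R where "R x = (\<Prod>l\<in>U - {i}. x l) * (\<Prod>l\<in>I. x l powr (a - 1) * exp (- x l))" for x :: "'a => real"
  define B where "B x = (x i powr a * exp (- x i)) * R x" for x
  define B' where "B' x = ((a * x i powr (a - 1) - x i powr a) * exp (- x i)) * R x" for x
  have R: "R (x(i := t)) = R x" for x t unfolding R_def using I by (intro arg_cong2[where f="(*)"] prod.cong) auto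
  have fU: "finite U" using K finite_subset by blast
  have mU: "(\<Prod>l\<in>U. x l) = x i * (\<Prod>l\<in>U - {i}. x l)" for x :: "'a => real" using i fU by (intro prod.remove) auto
  let ?m = "%U x. (\<Prod>l\<in>U. x l) * SW a k K x"
  let ?H = "%x. (of_bool (pos K x) * vd k K x) *\<^sub>R (B' x + (\<Sum>j\<in>I. 2 * k / (x i - x j)) *\<^sub>R B x)"
  have H: "?H x = a * ?m (U - {i}) x - ?m U x + (\<Sum>j\<in>I. 2 * k * (?m U x / (x i - x j)))" for x
  proof (cases "pos K x")
    case True
    then have xi: "0 < x i" using i K by (auto simp: pos_def)
    have B1: "B x = (\<Prod>l\<in>U. x l) * (\<Prod>l\<in>K. x l powr (a - 1) * exp (- x l))"
      unfolding B_def R_def mU KI using I xi by (simp add: powr_diff mult_ac)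
    have B2: "B' x = a * ((\<Prod>l\<in>U - {i}. x l) * (\<Prod>l\<in>K. x l powr (a - 1) * exp (- x l))) - B x"
      unfolding B'_def B_def R_def KI using I by (simp add: algebra_simps)
    show ?thesis unfolding B2 B1 SW_def using True
      by (simp add: algebra_simps sum_distrib_left sum_distrib_right)
  qed (simp add: SW_def)
  have im: "integrable (LM K) (?m V)" if "V \<subseteq> K" for V using integrable_mom[OF k K(1) that a] .
  have isg: "integrable (LM K) (%x. 2 * k * (?m U x / (x i - x j)))" if "j \<in> I" for j
  proof (cases "k = 0")
    case False
    with k have kp: "0 < k" by simp
    show ?thesis using integrable_mom_singular[OF kp I that _ a, of U] K i unfolding KI by (intro integrable_mult_right) auto
  qed simp
  have intH: "integrable (LM K) ?H" unfolding H
    by (rule Bochner_Integration.integrable_add[OF Bochner_Integration.integrable_diff[OF integrable_mult_right[OF im] im]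
       Bochner_Integration.integrable_sum[OF isg]]) (use K in auto)
  have "integral\<^sup>L (LM K) ?H = - (\<integral>x. (of_bool (pos I x) * vd k K (x(i := 0))) *\<^sub>R B (x(i := 0)) \<partial>LM I)"
    unfolding KI
  proof (rule ibp_vd[OF k I])
    fix x and t :: real assume x: "x \<in> space (LM I)" "pos I x"
    show "continuous_on {0..} (%t. B (x(i := t)))" unfolding B_def R fun_upd_same
      using a by (intro continuous_intros continuous_on_powr') auto
    obtain C where C: "0 < C" "\<And>t. 0 <= t ==> (1 + t) powr a <= C * exp (1 / 2 * t)"
      using powr_le_exp[of a "1/2"] a by auto
    have "norm (B (x(i := t))) <= (C * \<bar>R x\<bar>) * exp (- (1/2) * t)" if t: "0 <= t" for t
    proof -
      have "t powr a <= C * exp (1 / 2 * t)" using C(2)[OF t] powr_mono2[of a t "1 + t"] a t by simp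
      then have "(t powr a * exp (- t)) * \<bar>R x\<bar> <= (C * exp (1 / 2 * t) * exp (- t)) * \<bar>R x\<bar>" by (intro mult_right_mono) auto
      also have "... = (C * \<bar>R x\<bar>) * (exp (1 / 2 * t) * exp (- t))" by (simp add: mult_ac)
      also have "exp (1 / 2 * t) * exp (- t) = exp (- (1/2) * t)" unfolding exp_add[symmetric] by simp
      finally show ?thesis unfolding B_def R by (simp add: abs_mult)
    qed
    then show "\<exists>C c. 0 < c \<and> (\<forall>t\<ge>0. norm (B (x(i := t))) <= C * exp (- c * t))"
      by (intro exI[of _ "C * \<bar>R x\<bar>"] exI[of _ "1/2"]) auto
    assume t: "0 < t"
    show "((%t. B (x(i := t))) has_vector_derivative B' (x(i := t))) (at t)"
      unfolding B_def B'_def R fun_upd_same has_real_derivative_iff_has_vector_derivative[symmetric]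
      using t by (auto intro!: derivative_eq_intros simp: powr_diff algebra_simps)
  next
    show "(%x. (of_bool (pos I x) * vd k (insert i I) (x(i := 0))) *\<^sub>R B (x(i := 0))) \<in> borel_measurable (LM I)"
      using a by (simp add: B_def)
  qed (use intH KI in simp)
  also have "... = 0" using a by (simp add: B_def)
  finally have "0 = integral\<^sup>L (LM K) (%x. a * ?m (U - {i}) x - ?m U x + (\<Sum>j\<in>I. 2 * k * (?m U x / (x i - x j))))"
    unfolding H by simp
  also have "... = a * mom k K a (U - {i}) - mom k K a U + (\<Sum>j\<in>I. \<integral>x. 2 * k * (?m U x / (x i - x j)) \<partial>LM K)"
  proof -
    have i1: "integrable (LM K) (%x. a * ?m (U - {i}) x)" by (rule integrable_mult_right[OF im]) (use K in auto)
    have i2: "integrable (LM K) (?m U)" by (rule im[OF K(2)])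
    have i3: "integrable (LM K) (%x. \<Sum>j\<in>I. 2 * k * (?m U x / (x i - x j)))"
      by (rule Bochner_Integration.integrable_sum[OF isg])
    have s3: "(\<integral>x. (\<Sum>j\<in>I. 2 * k * (?m U x / (x i - x j))) \<partial>LM K) = (\<Sum>j\<in>I. \<integral>x. 2 * k * (?m U x / (x i - x j)) \<partial>LM K)"
      by (rule Bochner_Integration.integral_sum) (rule isg)
    show ?thesis unfolding mom_def Bochner_Integration.integral_add[OF Bochner_Integration.integrable_diff[OF i1 i2] i3]
        Bochner_Integration.integral_diff[OF i1 i2] s3 by simp
  qed
  also have "(\<Sum>j\<in>I. \<integral>x. 2 * k * (?m U x / (x i - x j)) \<partial>LM K) = (\<Sum>j\<in>I. if j \<in> U then 0 else k * mom k K a (U - {i}))"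
  proof (intro sum.cong refl)
    fix j assume j: "j \<in> I"
    show "(\<integral>x. 2 * k * (?m U x / (x i - x j)) \<partial>LM K) = (if j \<in> U then 0 else k * mom k K a (U - {i}))"
    proof (cases "k = 0")
      case False
      with k have kp: "0 < k" by simp
      have "(\<integral>x. ?m U x / (x i - x j) \<partial>LM K) = (if j \<in> U then 0 else mom k K a (U - {i}) / 2)"
        using mom_antisym[OF kp I j, of U a] mom_half[OF kp I j, of U a] K i a unfolding KI by auto
      then show ?thesis by (simp only: integral_mult_right_zero) simp
    qed simp
  qed
  also have "... = real (card (K - U)) * (k * mom k K a (U - {i}))"
  proof -
    have "(\<Sum>j\<in>I. if j \<in> U then 0 else k * mom k K a (U - {i})) = (\<Sum>j\<in>K - U. k * mom k K a (U - {i}))"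
      by (rule sum.mono_neutral_cong_right) (use I i in \<open>auto simp: KI\<close>)
    then show ?thesis by simp
  qed
  also have "card (K - U) = card K - card U" using K fU by (intro card_Diff_subset)
  finally show ?thesis by (simp add: algebra_simps)
qed

lemma mom_full:
  assumes k: "0 <= k" and K: "finite K" "U \<subseteq> K" and a: "0 < a"
  shows "mom k K a U = (\<Prod>r<card U. a + k * real (card K - Suc r)) * SR k K a"
proof -
  have "finite U" using K finite_subset by blast
  then show ?thesis using K(2)
  proof (induction U rule: finite_induct)
    case (insert i U)
    have "mom k K a (insert i U) = (a + k * real (card K - card (insert i U))) * mom k K a (insert i U - {i})"
      by (rule aomoto[OF k K(1) insert.prems _ a]) simp
    then show ?case using insert by simp
  qed simp
qed

lemma SR_shift:
  assumes k: "0 <= k" and K: "finite K" and a: "0 < a"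
  shows "SR k K (a + 1) = (\<Prod>j<card K. a + k * real j) * SR k K a"
proof -
  have "SR k K (a + 1) = mom k K a K"
    unfolding mom_def
  proof (rule Bochner_Integration.integral_cong[OF refl])
    fix x
    show "(\<Prod>l\<in>{}. x l) * SW (a + 1) k K x = (\<Prod>l\<in>K. x l) * SW a k K x"
    proof (cases "pos K x")
      case True
      have "(\<Prod>l\<in>K. x l powr (a + 1 - 1) * exp (- x l)) = (\<Prod>l\<in>K. x l * (x l powr (a - 1) * exp (- x l)))"
        using True by (intro prod.cong) (auto simp: pos_def powr_diff)
      then show ?thesis by (simp add: SW_def prod.distrib)
    qed (simp add: SW_def)
  qed
  also have "... = (\<Prod>r<card K. a + k * real (card K - Suc r)) * SR k K a" by (rule mom_full[OF k K subset_refl a])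
  also have "(\<Prod>r<card K. a + k * real (card K - Suc r)) = (\<Prod>j<card K. a + k * real j)"
    by (rule prod.nat_diff_reindex)
  finally show ?thesis .
qed

text \<open>For a = 1 the integrand has no power of x_i and the boundary term at x_i = 0 remains.
  There the weight becomes that of the other variables times the x_j^(2 k), which shifts their
  exponent from 1 to 2 k + 1. The singular terms vanish by antisymmetry.\<close>

lemma SR_one_step:
  assumes k: "0 <= k" and I: "finite I" "i \<notin> I"
  shows "SR k (insert i I) 1 = SR k I (2 * k + 1)"
proof -
  let ?K = "insert i I"
  define B where "B x = (\<Prod>l\<in>?K. exp (- x l))" for x :: "'a => real"
  define R where "R x = (\<Prod>l\<in>I. exp (- x l))" for x :: "'a => real"
  have BR: "B x = exp (- x i) * R x" for x using I by (simp add: B_def R_def)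
  have R: "R (x(i := t)) = R x" for x t unfolding R_def using I by (intro prod.cong) auto
  let ?S = "SW 1 k ?K"
  let ?H = "%x. (of_bool (pos ?K x) * vd k ?K x) *\<^sub>R (- B x + (\<Sum>j\<in>I. 2 * k / (x i - x j)) *\<^sub>R B x)"
  have S: "of_bool (pos ?K x) * vd k ?K x * B x = ?S x" for x
  proof (cases "pos ?K x")
    case True
    have "(\<Prod>l\<in>?K. x l powr (1 - 1) * exp (- x l)) = B x" unfolding B_def using True by (intro prod.cong) (auto simp: pos_def)
    then show ?thesis by (simp only: SW_def)
  qed (simp add: SW_def)
  have H: "?H x = - ?S x + (\<Sum>j\<in>I. 2 * k * (?S x / (x i - x j)))" for x
    unfolding S[symmetric] by (simp add: algebra_simps sum_distrib_left sum_distrib_right)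
  have im: "integrable (LM ?K) ?S" using integrable_mom[OF k, of ?K "{}" 1] I by simp
  have isg: "integrable (LM ?K) (%x. 2 * k * (?S x / (x i - x j)))" if "j \<in> I" for j
  proof (cases "k = 0")
    case False
    with k have kp: "0 < k" by simp
    show ?thesis using integrable_mom_singular[OF kp I that, of "{}" 1] by (intro integrable_mult_right) auto
  qed simp
  have intH: "integrable (LM ?K) ?H" unfolding H
    by (rule Bochner_Integration.integrable_add[OF Bochner_Integration.integrable_minus[OF im] Bochner_Integration.integrable_sum[OF isg]])
  let ?b = "%x. (of_bool (pos I x) * vd k ?K (x(i := 0))) *\<^sub>R B (x(i := 0))"
  have b: "?b x = SW (2 * k + 1) k I x" for x
  proof (cases "pos I x")
    case True
    have "vd k I (x(i := 0)) = vd k I x" using I by (intro vd_cong) auto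
    moreover have "(\<Prod>j\<in>I. rpow0 \<bar>(x(i := 0)) i - (x(i := 0)) j\<bar> (2 * k)) = (\<Prod>j\<in>I. x j powr (2 * k))"
      using I True by (intro prod.cong refl) (auto simp: pos_def rpow0_pos)
    ultimately have "vd k ?K (x(i := 0)) = vd k I x * (\<Prod>j\<in>I. x j powr (2 * k))" unfolding vd_insert[OF I] by simp
    moreover have "B (x(i := 0)) = R x" unfolding BR R by simp
    ultimately show ?thesis using True by (simp add: SW_def R_def prod.distrib)
  qed (simp add: SW_def)
  have bi: "integrable (LM I) (SW (2 * k + 1) k I)" using integrable_mom[OF k I(1), of "{}" "2 * k + 1"] k by simp
  have "integral\<^sup>L (LM ?K) ?H = - integral\<^sup>L (LM I) ?b"
  proof (rule ibp_vd[OF k I])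
    fix x and t :: real assume x: "x \<in> space (LM I)" "pos I x"
    show "continuous_on {0..} (%t. B (x(i := t)))" unfolding BR R fun_upd_same by (intro continuous_intros)
    show "\<exists>C c. 0 < c \<and> (\<forall>t\<ge>0. norm (B (x(i := t))) <= C * exp (- c * t))"
      by (intro exI[of _ "\<bar>R x\<bar>"] exI[of _ "1::real"]) (auto simp: BR R abs_mult)
    assume "0 < t"
    show "((%t. B (x(i := t))) has_vector_derivative - B (x(i := t))) (at t)"
      unfolding BR R fun_upd_same has_real_derivative_iff_has_vector_derivative[symmetric]
      by (auto intro!: derivative_eq_intros)
  next
    show "?b \<in> borel_measurable (LM I)" unfolding b using bi by auto
  qed (rule intH)
  then have "integral\<^sup>L (LM ?K) (%x. - ?S x + (\<Sum>j\<in>I. 2 * k * (?S x / (x i - x j)))) = - SR k I (2 * k + 1)"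
    unfolding H b by (simp add: mom_def)
  moreover have "integral\<^sup>L (LM ?K) (%x. - ?S x + (\<Sum>j\<in>I. 2 * k * (?S x / (x i - x j)))) =
     - SR k ?K 1 + (\<Sum>j\<in>I. \<integral>x. 2 * k * (?S x / (x i - x j)) \<partial>LM ?K)"
  proof -
    have i1: "integrable (LM ?K) (%x. - ?S x)" using im by simp
    have i3: "integrable (LM ?K) (%x. \<Sum>j\<in>I. 2 * k * (?S x / (x i - x j)))"
      by (rule Bochner_Integration.integrable_sum[OF isg])
    have s3: "(\<integral>x. (\<Sum>j\<in>I. 2 * k * (?S x / (x i - x j))) \<partial>LM ?K) = (\<Sum>j\<in>I. \<integral>x. 2 * k * (?S x / (x i - x j)) \<partial>LM ?K)"
      by (rule Bochner_Integration.integral_sum) (rule isg)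
    show ?thesis unfolding Bochner_Integration.integral_add[OF i1 i3] s3 by (simp add: mom_def)
  qed
  moreover have "(\<integral>x. 2 * k * (?S x / (x i - x j)) \<partial>LM ?K) = 0" if "j \<in> I" for j
  proof (cases "k = 0")
    case False
    with k have kp: "0 < k" by simp
    have "(\<integral>x. ?S x / (x i - x j) \<partial>LM ?K) = 0" using mom_antisym[OF kp I that, of "{}" 1] I that by auto
    then show ?thesis by (simp only: integral_mult_right_zero mult_zero_right)
  qed simp
  ultimately show ?thesis by simp
qed

section \<open>Evaluation of the Selberg--Laguerre integral\<close>

lemma SW_nonneg: "0 <= SW a k K x"
  unfolding SW_def by (intro mult_nonneg_nonneg prod_nonneg) auto

lemma SR_nonneg: "0 <= SR k K a"
  unfolding mom_def by (intro Bochner_Integration.integral_nonneg) (simp add: SW_nonneg)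

lemma SR_empty: "SR k {} a = 1"
proof -
  have "SW a k {} x = 1" for x by (simp add: SW_def pos_def vd_def)
  then show ?thesis by (simp add: mom_def PiM_empty lebesgue_integral_count_space_finite)
qed

lemma SR_zero_iff:
  assumes k: "0 <= k" and K: "finite K" and a: "0 < a" "0 < b" and z: "SR k K a = 0"
  shows "SR k K b = 0"
proof -
  have i: "integrable (LM K) (SW c k K)" if "0 < c" for c using integrable_mom[OF k K, of "{}" c] that by simp
  have e: "SW a k K x = 0 \<longleftrightarrow> SW b k K x = 0" for x
  proof (cases "pos K x")
    case True
    then have "0 < (\<Prod>l\<in>K. x l powr (c - 1) * exp (- x l))" for c by (intro prod_pos) (auto simp: pos_def)
    then have "(\<Prod>l\<in>K. x l powr (c - 1) * exp (- x l)) ~= 0" for c by (metis less_irrefl)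
    then show ?thesis unfolding SW_def by (simp only: mult_eq_0_iff)
  qed (simp add: SW_def)
  have "AE x in LM K. SW a k K x = 0"
    using z integral_nonneg_eq_0_iff_AE[OF i[OF a(1)]] by (simp add: mom_def SW_nonneg)
  then show ?thesis
    using integral_nonneg_eq_0_iff_AE[OF i[OF a(2)]] by (simp add: mom_def SW_nonneg e)
qed

text \<open>At a = 1 the integral equals one with fewer variables. Positivity then passes to all a,
  since the integrands for different exponents have the same zeros.\<close>

lemma SR_pos:
  assumes k: "0 <= k" shows "finite K ==> 0 < a ==> 0 < SR k K a"
proof (induction K arbitrary: a rule: finite_induct)
  case empty then show ?case by (simp add: SR_empty)
next
  case (insert i I)
  have "SR k (insert i I) 1 > 0"
    unfolding SR_one_step[OF k insert.hyps] using k by (intro insert.IH) auto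
  then have "SR k (insert i I) a ~= 0" using SR_zero_iff[OF k, of "insert i I" a 1] insert by auto
  then show ?case using SR_nonneg[of k "insert i I" a] by linarith
qed

text \<open>Hoelder's inequality, proved by integrating Young's inequality after both integrands
  have been normalised to integral 1; D undoes the normalisation.\<close>

lemma SR_log_convex:
  assumes k: "0 <= k" and K: "finite K"
  shows "convex_on {0<..} (%a. ln (SR k K a))"
  unfolding convex_on_def
proof (intro conjI ballI allI impI)
  fix a b u v :: real
  assume ab: "a \<in> {0<..}" "b \<in> {0<..}" and uv: "0 <= u" "0 <= v" "u + v = 1"
  define c where "c = u * a + v * b"
  have c: "0 < c"
  proof -
    show ?thesis using ab uv by (cases "u = 0") (auto simp: c_def intro!: add_pos_nonneg)
  qed
  define Sa Sb where "Sa = SR k K a" and "Sb = SR k K b"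
  have S: "0 < Sa" "0 < Sb" "0 < SR k K c" unfolding Sa_def Sb_def using SR_pos[OF k K] ab c by auto
  have i: "integrable (LM K) (SW c k K)" if "0 < c" for c using integrable_mom[OF k K, of "{}" c] that by simp
  define D where "D = Sa powr u * Sb powr v"
  have D: "0 < D" using S by (simp add: D_def)
  have le: "SW c k K x <= D * (u * (SW a k K x / Sa) + v * (SW b k K x / Sb))" for x
  proof (cases "pos K x")
    case True
    define P where "P = (\<Prod>l\<in>K. x l)"
    define R where "R = of_bool (pos K x) * vd k K x * (\<Prod>l\<in>K. exp (- x l) / x l)"
    have P: "0 < P" unfolding P_def using True by (intro prod_pos) (auto simp: pos_def)
    have R: "0 <= R" unfolding R_def using True by (intro mult_nonneg_nonneg prod_nonneg) (auto simp: pos_def intro: less_imp_le)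
    have W: "SW e k K x = P powr e * R" for e
    proof -
      have "(\<Prod>l\<in>K. x l powr (e - 1) * exp (- x l)) = (\<Prod>l\<in>K. x l powr e * (exp (- x l) / x l))"
        using True by (intro prod.cong) (auto simp: pos_def powr_diff)
      also have "... = P powr e * (\<Prod>l\<in>K. exp (- x l) / x l)" unfolding P_def prod.distrib by (simp add: prod_powr_distrib)
      finally show ?thesis unfolding SW_def R_def by simp
    qed
    have "(P powr a / Sa) powr u * (P powr b / Sb) powr v <= u * (P powr a / Sa) + v * (P powr b / Sb)"
      using uv P S by (intro Youngs_inequality_0) auto
    moreover have "(P powr a / Sa) powr u * (P powr b / Sb) powr v = P powr c / D"
      using P S by (simp add: powr_divide powr_powr c_def D_def powr_add mult.commute)
    ultimately have "P powr c <= D * (u * (P powr a / Sa) + v * (P powr b / Sb))"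
      using D by (simp add: divide_le_eq mult.commute)
    then have "P powr c * R <= D * (u * (P powr a / Sa) + v * (P powr b / Sb)) * R" using R by (rule mult_right_mono)
    then show ?thesis unfolding W by (simp add: algebra_simps)
  qed (simp add: SW_def)
  have "SR k K c = integral\<^sup>L (LM K) (SW c k K)" by (simp add: mom_def)
  also have "... <= (\<integral>x. D * (u * (SW a k K x / Sa) + v * (SW b k K x / Sb)) \<partial>LM K)"
    using i ab c le by (intro integral_mono integrable_mult_right Bochner_Integration.integrable_add integrable_divide) auto
  also have "... = D * (u * (Sa / Sa) + v * (Sb / Sb))"
  proof -
    have "integrable (LM K) (%x. u * (SW a k K x / Sa))" "integrable (LM K) (%x. v * (SW b k K x / Sb))"
      using i ab by (auto intro!: integrable_mult_right integrable_divide)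
    moreover have "integral\<^sup>L (LM K) (SW a k K) = Sa" "integral\<^sup>L (LM K) (SW b k K) = Sb" by (simp_all add: mom_def Sa_def Sb_def)
    ultimately show ?thesis by (simp add: Bochner_Integration.integral_add)
  qed
  also have "... = D" using S uv by simp
  finally have "ln (SR k K c) <= ln D" using S D by simp
  also have "ln D = u * ln Sa + v * ln Sb" unfolding D_def using S by (simp add: ln_mult ln_powr)
  finally show "ln (SR k K (u *\<^sub>R a + v *\<^sub>R b)) <= u * ln (SR k K a) + v * ln (SR k K b)"
    by (simp add: c_def Sa_def Sb_def)
qed simp

text \<open>The argument of the Bohr-Mollerup theorem: the difference is 1-periodic, and far out
  convexity encloses the growth of F and of G over a step shorter than 1 between the same multiples
  of neighbouring increments.\<close>

lemma convex_same_increments: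
  fixes F G r :: "real => real"
  assumes F: "convex_on {0<..} F" and G: "convex_on {0<..} G"
    and rF: "\<And>x. 0 < x ==> F (x + 1) = F x + r x" and rG: "\<And>x. 0 < x ==> G (x + 1) = G x + r x"
    and lim: "(%N. r (real N + 2) - r (real N + 1)) \<longlonglongrightarrow> 0" and x: "0 < x"
  shows "F x - G x = F 1 - G 1"
proof -
  have up: "F (y + t) - F y <= t * r y" if "convex_on {0<..} F" "\<And>x. 0 < x ==> F (x + 1) = F x + r x" "0 < y" "0 <= t" "t <= 1" for F :: "real => real" and y t
  proof -
    have "F ((1 - t) *\<^sub>R y + t *\<^sub>R (y + 1)) <= (1 - t) * F y + t * F (y + 1)"
      using that by (intro convex_onD[OF that(1)]) auto
    then show ?thesis using that(2)[OF that(3)] by (simp add: algebra_simps)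
  qed
  have lo: "t * r y <= F (y + 1 + t) - F (y + 1)" if "convex_on {0<..} F" "\<And>x. 0 < x ==> F (x + 1) = F x + r x" "0 < y" "0 <= t" "t <= 1" for F :: "real => real" and y t
  proof -
    define s where "s = 1 / (1 + t)"
    have s: "0 <= s" "s <= 1" and st: "(1 + t) * s = 1" using that by (auto simp: s_def)
    have "F ((1 - s) *\<^sub>R y + s *\<^sub>R (y + 1 + t)) <= (1 - s) * F y + s * F (y + 1 + t)"
      using that s by (intro convex_onD[OF that(1)]) auto
    moreover have "(1 - s) *\<^sub>R y + s *\<^sub>R (y + 1 + t) = y + 1"
      using st by (simp add: algebra_simps)
    ultimately have "F (y + 1) <= (1 - s) * F y + s * F (y + 1 + t)" by simp
    then have "(1 + t) * F (y + 1) <= (1 + t) * ((1 - s) * F y + s * F (y + 1 + t))" using that by (intro mult_left_mono) auto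
    also have "... = (1 + t - (1 + t) * s) * F y + ((1 + t) * s) * F (y + 1 + t)" by (simp add: algebra_simps)
    also have "... = t * F y + F (y + 1 + t)" unfolding st by simp
    finally show ?thesis using that(2)[OF that(3)] by (simp add: algebra_simps)
  qed
  define Hd where "Hd y = F y - G y" for y
  have per: "Hd (y + real N) = Hd y" if "0 < y" for y N
  proof (induction N)
    case (Suc N)
    have "Hd (y + real N + 1) = Hd (y + real N)" using rF[of "y + real N"] rG[of "y + real N"] that by (simp add: Hd_def)
    then show ?case using Suc by (simp add: add_ac)
  qed simp
  have unit: "Hd y = Hd 1" if y: "0 < y" "y <= 1" for y
  proof -
    \<comment> \<open>By \<open>up\<close> and \<open>lo\<close>, both F (N + 2 + y) - F (N + 2) and
      the same difference of G lie between y r (N + 1) and y r (N + 2).\<close>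
    have b: "\<bar>Hd y - Hd 1\<bar> <= y * (r (real N + 2) - r (real N + 1))" for N
    proof -
      have e: "Hd (y + real (N + 2)) = Hd y" "Hd (1 + real (N + 1)) = Hd 1"
        by (rule per[OF y(1)], rule per) simp
      have n: "y + real (N + 2) = (real N + 1) + 1 + y" "1 + real (N + 1) = (real N + 1) + 1" by auto
      have n2: "real N + 1 + 1 = real N + 2" by simp
      note u = up[of _ "real N + 2" y, folded n2] and l = lo[of _ "real N + 1" y]
      show ?thesis using u[OF F rF] u[OF G rG] l[OF F rF] l[OF G rG] y e unfolding n Hd_def
        by (simp add: algebra_simps abs_le_iff)
    qed
    have "(%N. y * (r (real N + 2) - r (real N + 1))) \<longlonglongrightarrow> y * 0" by (intro tendsto_mult tendsto_const lim)
    then have "\<bar>Hd y - Hd 1\<bar> <= y * 0" by (rule Lim_bounded2[OF _ ]) (use b in auto)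
    then show ?thesis by simp
  qed
  \<comment> \<open>The integer with N < x \<le> N + 1, so that periodicity reduces x to the
    interval (0, 1].\<close>
  define N where "N = nat (\<lceil>x\<rceil> - 1)"
  have N: "0 < x - real N" "x - real N <= 1" using x unfolding N_def by (auto simp: ceiling_less_iff less_ceiling_iff) linarith+
  have "Hd x = Hd (x - real N)" using per[OF N(1), of N] by simp
  then show ?thesis using unit[OF N] by (simp add: Hd_def)
qed

lemma SR_eval_gamma:
  assumes k: "0 <= k" and K: "finite K" and a: "0 < a"
  shows "SR k K a = SR k K 1 * (\<Prod>j<card K. Gamma (a + k * real j) / Gamma (1 + k * real j))"
proof -
  let ?n = "card K"
  define G where "G a = (\<Sum>j<?n. ln (Gamma (a + k * real j)))" for a
  define r where "r a = (\<Sum>j<?n. ln (a + k * real j))" for a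
  have cG: "convex_on {0<..} G"
  proof -
    have cj: "convex_on {0<..} (%a. ln (Gamma (a + k * real j)))" for j unfolding convex_on_def
    proof (intro conjI ballI allI impI)
      fix x y u v :: real assume xy: "x \<in> {0<..}" "y \<in> {0<..}" and uv: "0 <= u" "0 <= v" "u + v = 1"
      have "(ln \<circ> Gamma) (u *\<^sub>R (x + k * real j) + v *\<^sub>R (y + k * real j)) <= u * (ln \<circ> Gamma) (x + k * real j) + v * (ln \<circ> Gamma) (y + k * real j)"
        using log_convex_Gamma_real xy uv k unfolding convex_on_def by (auto simp: add_pos_nonneg)
      moreover have "u *\<^sub>R (x + k * real j) + v *\<^sub>R (y + k * real j) = u *\<^sub>R x + v *\<^sub>R y + k * real j"
      proof -
        have "u * (k * real j) + v * (k * real j) = k * real j" using uv(3) by (metis distrib_right mult_1)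
        then show ?thesis by (simp add: algebra_simps)
      qed
      ultimately show "ln (Gamma (u *\<^sub>R x + v *\<^sub>R y + k * real j)) <= u * ln (Gamma (x + k * real j)) + v * ln (Gamma (y + k * real j))" by simp
    qed simp
    have "convex_on {0<..} (%a. \<Sum>j<n. ln (Gamma (a + k * real j)))" for n
    proof (induction n)
      case 0 then show ?case by (simp add: convex_on_def)
    next
      case (Suc n) then show ?case using convex_on_add[OF Suc cj[of n]] by simp
    qed
    then show ?thesis unfolding G_def[abs_def] .
  qed
  have p: "0 < x + k * real j" if "0 < x" for x j using that k by (simp add: add_pos_nonneg)
  have "ln (SR k K a) - G a = ln (SR k K 1) - G 1"
  proof (rule convex_same_increments[OF SR_log_convex[OF k K] cG _ _ _ a])
    fix x :: real assume x: "0 < x"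
    have P: "0 < (\<Prod>j<?n. x + k * real j)" using p[OF x] by (intro prod_pos) auto
    show "ln (SR k K (x + 1)) = ln (SR k K x) + r x"
    proof -
      have "ln (\<Prod>j<?n. x + k * real j) = r x" unfolding r_def using p[OF x] by (intro ln_prod) (auto simp: less_imp_neq[symmetric])
      then show ?thesis unfolding SR_shift[OF k K x] using SR_pos[OF k K x] P by (simp add: ln_mult_pos)
    qed
    show "G (x + 1) = G x + r x" unfolding G_def r_def sum.distrib[symmetric]
    proof (intro sum.cong refl)
      fix j
      have "Gamma (x + k * real j + 1) = (x + k * real j) * Gamma (x + k * real j)"
        using p[OF x, of j] by (intro Gamma_plus1) (auto elim!: nonpos_Ints_cases')
      then show "ln (Gamma (x + 1 + k * real j)) = ln (Gamma (x + k * real j)) + ln (x + k * real j)"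
        using p[OF x, of j] Gamma_real_pos[OF p[OF x, of j]] by (simp add: ln_mult_pos add_ac)
    qed
  next
    have "(%N. ln (real N + 2 + c) - ln (real N + 1 + c)) \<longlonglongrightarrow> 0" if c: "0 <= c" for c
    proof -
      have "(%N. ln (1 + 1 / (real N + 1 + c))) \<longlonglongrightarrow> ln (1 + 0)"
      proof (intro tendsto_ln tendsto_add tendsto_const)
        have "filterlim (%N. real N + (1 + c)) at_top sequentially"
          using filterlim_tendsto_add_at_top[OF tendsto_const[of "1 + c"] filterlim_real_sequentially] by (simp add: add.commute)
        then have "filterlim (%N. real N + 1 + c) at_top sequentially" by (simp add: add.assoc)
        then show "(%N. 1 / (real N + 1 + c)) \<longlonglongrightarrow> 0"
          using tendsto_divide_0[OF tendsto_const filterlim_at_top_imp_at_infinity] by blast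
      qed simp
      moreover have "ln (1 + 1 / (real N + 1 + c)) = ln (real N + 2 + c) - ln (real N + 1 + c)" for N
      proof -
        have "1 + 1 / (real N + 1 + c) = (real N + 2 + c) / (real N + 1 + c)" using c by (simp add: field_simps)
        then show ?thesis using c by (simp add: ln_div)
      qed
      ultimately show ?thesis by simp
    qed
    then have "(%N. \<Sum>j<?n. ln (real N + 2 + k * real j) - ln (real N + 1 + k * real j)) \<longlonglongrightarrow> (\<Sum>j<?n. 0)"
      using k by (intro tendsto_sum) auto
    then show "(%N. r (real N + 2) - r (real N + 1)) \<longlonglongrightarrow> 0" by (simp add: r_def sum_subtractf)
  qed
  then have "exp (ln (SR k K a)) = exp (ln (SR k K 1) + (G a - G 1))" by simp
  then have "SR k K a = SR k K 1 * exp (G a - G 1)" using SR_pos[OF k K] a by (simp add: exp_add)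
  also have "exp (G a - G 1) = (\<Prod>j<?n. Gamma (a + k * real j) / Gamma (1 + k * real j))"
  proof -
    have "exp (ln (Gamma (x + k * real j))) = Gamma (x + k * real j)" if "0 < x" for x j
      using Gamma_real_pos[OF p[OF that, of j]] by simp
    then show ?thesis using a by (simp add: G_def sum_subtractf[symmetric] exp_sum exp_diff)
  qed
  finally show ?thesis .
qed

text \<open>Induction on the number of variables: \<open>SR_eval_gamma\<close> reduces the exponent
  a to 1, and \<open>SR_one_step\<close> reduces the exponent 1 to 2 k + 1 with one variable less.
  The Gamma factors that arise telescope.\<close>

theorem selberg_laguerre_real:
  assumes k: "0 <= k" shows "finite K ==> 0 < a ==>
    SR k K a = (\<Prod>j<card K. Gamma (a + k * real j)) * (\<Prod>j<card K. Gamma (1 + k * real (Suc j)) / Gamma (1 + k))"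
proof (induction K arbitrary: a rule: finite_induct)
  case empty then show ?case by (simp add: SR_empty)
next
  case (insert i I)
  let ?n = "card I"
  define g where "g j = Gamma (1 + k * real j)" for j
  have g: "0 < g j" for j unfolding g_def using k by (intro Gamma_real_pos) (simp add: add_pos_nonneg)
  have gs: "(\<Prod>j<Suc ?n. g j) = (\<Prod>j<?n. g (Suc j))" unfolding prod.lessThan_Suc_shift by (simp add: g_def)
  have gs2: "(\<Prod>j<Suc ?n. g (Suc j) / g 1) = (\<Prod>j<?n. g (Suc (Suc j)) / g 1)" unfolding prod.lessThan_Suc_shift using g[of 1] by simp
  have one: "SR k (insert i I) 1 = (\<Prod>j<?n. g (Suc (Suc j))) * (\<Prod>j<?n. g (Suc j) / g 1)"
    unfolding SR_one_step[OF k insert.hyps(1,2)]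
    using insert.IH[of "2 * k + 1"] k by (simp add: g_def algebra_simps)
  have "SR k (insert i I) a = SR k (insert i I) 1 * (\<Prod>j<Suc ?n. Gamma (a + k * real j) / g j)"
    using SR_eval_gamma[OF k, of "insert i I" a] insert by (simp add: g_def)
  also have "... = (\<Prod>j<Suc ?n. Gamma (a + k * real j)) * ((\<Prod>j<?n. g (Suc (Suc j))) * (\<Prod>j<?n. g (Suc j) / g 1) / (\<Prod>j<Suc ?n. g j))"
    unfolding one prod_dividef by simp
  also have "(\<Prod>j<?n. g (Suc (Suc j))) * (\<Prod>j<?n. g (Suc j) / g 1) / (\<Prod>j<Suc ?n. g j) = (\<Prod>j<Suc ?n. g (Suc j) / g 1)"
  proof -
    have "(\<Prod>j<?n. g (Suc j)) ~= 0" using g by (metis less_irrefl prod_pos)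
    then show ?thesis unfolding gs gs2 by (simp add: prod_dividef)
  qed
  finally show ?case using insert by (simp add: g_def)
qed

section \<open>Complex exponents\<close>

text \<open>A majorant of the function itself suffices: Cauchy's inequality bounds the derivative,
  and with it the difference quotients, by a multiple of the same majorant, and dominated
  convergence along sequences applies.\<close>

lemma deriv_under_integral:
  fixes f :: "complex => 'a => complex"
  assumes r: "0 < r" and hol: "\<And>x. x \<in> space M ==> (%z. f z x) holomorphic_on ball z0 r"
    and m: "\<And>z. z \<in> ball z0 r ==> f z \<in> borel_measurable M"
    and g: "integrable M g" and b: "\<And>x z. x \<in> space M ==> z \<in> ball z0 r ==> norm (f z x) <= g x"
  shows "((%z. \<integral>x. f z x \<partial>M) has_field_derivative (\<integral>x. deriv (%z. f z x) z0 \<partial>M)) (at z0)"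
    "integrable M (%x. deriv (%z. f z x) z0)"
proof -
  have if': "integrable M (f z)" if "z \<in> ball z0 r" for z
    by (rule Bochner_Integration.integrable_bound[OF g m[OF that]]) (auto intro!: AE_I2 order_trans[OF b[OF _ that]])
  have db: "norm (deriv (%z. f z x) w) <= 4 / r * g x" if x: "x \<in> space M" and w: "w \<in> ball z0 (r / 2)" for x w
  proof -
    \<comment> \<open>For w in the ball of half the radius, discs of radius r / 4 remain inside the
      region of holomorphy; hence the factor 4 / r.\<close>
    have "cball w (r / 4) \<subseteq> ball z0 r"
    proof
      fix v assume "v \<in> cball w (r / 4)"
      then show "v \<in> ball z0 r" using w r dist_triangle[of z0 v w] by auto
    qed
    then have h: "(%z. f z x) holomorphic_on cball w (r / 4)" and s: "\<And>v. norm (w - v) = r / 4 ==> v \<in> ball z0 r"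
      using holomorphic_on_subset[OF hol[OF x]] by (auto simp: dist_norm)
    have "norm ((deriv ^^ 1) (%z. f z x) w) <= fact 1 * g x / (r / 4) ^ 1"
      using r h s b[OF x] by (intro Cauchy_inequality holomorphic_on_imp_continuous_on holomorphic_on_subset[OF h]) auto
    then show ?thesis by (simp add: mult.commute)
  qed
  have qb: "norm ((f w x - f z0 x) / (w - z0)) <= 4 / r * g x" if x: "x \<in> space M" and w: "w \<in> ball z0 (r / 2)" for x w
  proof -
    have "norm (f w x - f z0 x) <= 4 / r * g x * norm (w - z0)"
    proof (rule field_differentiable_bound[of "ball z0 (r / 2)" "%z. f z x" "deriv (%z. f z x)"])
      show "((%z. f z x) has_field_derivative deriv (%z. f z x) v) (at v within ball z0 (r / 2))" if "v \<in> ball z0 (r / 2)" for v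
        using holomorphic_derivI[OF hol[OF x], of v "ball z0 (r/2)"] that r by auto
    qed (use r w db[OF x] in auto)
    then show ?thesis using b[OF x, of z0] r order_trans[OF norm_ge_zero b[OF x, of z0]] by (cases "w = z0") (auto simp: norm_divide divide_le_eq)
  qed
  have lim: "(%n. (f (X n) x - f z0 x) / (X n - z0)) \<longlonglongrightarrow> deriv (%z. f z x) z0"
    if x: "x \<in> space M" and X: "\<And>n. X n ~= z0" "X \<longlonglongrightarrow> z0" for x X
  proof -
    have "((%z. f z x) has_field_derivative deriv (%z. f z x) z0) (at z0)"
      using holomorphic_derivI[OF hol[OF x], of z0] r by auto
    then have "((%w. (f w x - f z0 x) / (w - z0)) \<longlongrightarrow> deriv (%z. f z x) z0) (at z0)" by (simp add: has_field_derivative_iff)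
    then show ?thesis unfolding tendsto_at_iff_sequentially comp_def using X by auto
  qed
  have main: "integrable M (%x. deriv (%z. f z x) z0) \<and> (%n. \<integral>x. (f (X n) x - f z0 x) / (X n - z0) \<partial>M) \<longlonglongrightarrow> (\<integral>x. deriv (%z. f z x) z0 \<partial>M)"
    if X: "\<And>n. X n ~= z0" "X \<longlonglongrightarrow> z0" "\<And>n. X n \<in> ball z0 (r / 2)" for X
  proof -
    have Xm: "f (X n) \<in> borel_measurable M" for n using X(3)[of n] r by (intro m) auto
    have qm: "(%x. (f (X n) x - f z0 x) / (X n - z0)) \<in> borel_measurable M" for n
      using Xm[of n] m[of z0] r by simp
    have dm: "(%x. deriv (%z. f z x) z0) \<in> borel_measurable M"
      by (rule borel_measurable_LIMSEQ_metric[OF qm lim[OF _ X(1,2)]])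
    have gi: "integrable M (%x. 4 / r * g x)" using g by (rule integrable_mult_right)
    have ael: "AE x in M. (%n. (f (X n) x - f z0 x) / (X n - z0)) \<longlonglongrightarrow> deriv (%z. f z x) z0" using lim[OF _ X(1,2)] by (intro AE_I2) auto
    have aeb: "AE x in M. norm ((f (X n) x - f z0 x) / (X n - z0)) <= 4 / r * g x" for n using qb[OF _ X(3)] by (intro AE_I2) auto
    show ?thesis
      using integrable_dominated_convergence[OF dm qm gi ael aeb] integral_dominated_convergence[OF dm qm gi ael aeb] by auto
  qed
  have X0: "(%n. z0 + of_real (r / 4 / real (Suc n))) \<longlonglongrightarrow> z0"
  proof -
    have "(%n. r / 4 / real (Suc n)) \<longlonglongrightarrow> 0" by (rule LIMSEQ_Suc[OF lim_const_over_n])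
    then have "(%n. z0 + of_real (r / 4 / real (Suc n))) \<longlonglongrightarrow> z0 + of_real 0" by (intro tendsto_add tendsto_const tendsto_of_real)
    then show ?thesis by simp
  qed
  have "norm (of_real (r / 4 / real (Suc n)) :: complex) < r / 2" for n
  proof -
    have "r / 4 / real (Suc n) <= r / 4 / 1" using r by (intro divide_left_mono) auto
    moreover have "0 <= r / 4 / real (Suc n)" using r by simp
    ultimately show ?thesis unfolding norm_of_real using r by linarith
  qed
  then show "integrable M (%x. deriv (%z. f z x) z0)"
    using main[OF _ X0] r by (auto simp: dist_norm simp del: of_nat_Suc)
  show "((%z. \<integral>x. f z x \<partial>M) has_field_derivative (\<integral>x. deriv (%z. f z x) z0 \<partial>M)) (at z0)"
    unfolding has_field_derivative_iff tendsto_at_iff_sequentially comp_def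
  proof (intro allI impI)
    fix X assume X: "\<forall>n. X n \<in> UNIV - {z0}" "X \<longlonglongrightarrow> z0"
    have "eventually (%n. X n \<in> ball z0 (r / 2)) sequentially" using X(2) r by (intro topological_tendstoD) auto
    then obtain N where N: "\<And>n. N <= n ==> X n \<in> ball z0 (r / 2)" by (auto simp: eventually_sequentially)
    let ?Y = "%n. X (n + N)"
    have Y: "\<And>n. ?Y n \<in> ball z0 (r / 2)" by (rule N) simp
    have "(\<integral>x. (f (?Y n) x - f z0 x) / (?Y n - z0) \<partial>M) = ((\<integral>x. f (?Y n) x \<partial>M) - (\<integral>x. f z0 x \<partial>M)) / (?Y n - z0)" for n
    proof -
      have "integrable M (f (?Y n))" "integrable M (f z0)" using Y[of n] r by (auto intro!: if')
      then show ?thesis by simp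
    qed
    moreover have "(%n. \<integral>x. (f (?Y n) x - f z0 x) / (?Y n - z0) \<partial>M) \<longlonglongrightarrow> (\<integral>x. deriv (%z. f z x) z0 \<partial>M)"
      using main[of ?Y] X Y LIMSEQ_ignore_initial_segment[OF X(2), of N] by auto
    ultimately have "(%n. ((\<integral>x. f (?Y n) x \<partial>M) - (\<integral>x. f z0 x \<partial>M)) / (?Y n - z0)) \<longlonglongrightarrow> (\<integral>x. deriv (%z. f z x) z0 \<partial>M)" by (simp only:)
    then show "(%n. ((\<integral>x. f (X n) x \<partial>M) - (\<integral>x. f z0 x \<partial>M)) / (X n - z0)) \<longlonglongrightarrow> (\<integral>x. deriv (%z. f z x) z0 \<partial>M)"
      by (rule LIMSEQ_offset)
  qed
qed

text \<open>A power of the product of coordinates with complex exponent, through the real logarithm: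
  entire in s, and equal to \<open>Delta_pow\<close> on the positive orthant, to which
  \<open>pos\<close> restricts the integrals.\<close>

definition dpw :: "'i set => complex => ('i => real) => complex" where
  "dpw K s x = exp (s * of_real (\<Sum>l\<in>K. ln (x l)))"

lemma norm_dpw: "finite K ==> pos K x ==> norm (dpw K s x) = (\<Prod>l\<in>K. x l powr Re s)"
proof -
  assume K: "finite K" "pos K x"
  have "norm (dpw K s x) = exp (\<Sum>l\<in>K. Re s * ln (x l))" by (simp add: dpw_def sum_distrib_left)
  also have "... = (\<Prod>l\<in>K. exp (Re s * ln (x l)))" using K by (simp add: exp_sum)
  also have "... = (\<Prod>l\<in>K. x l powr Re s)" using K(2) by (intro prod.cong) (auto simp: powr_def pos_def)
  finally show ?thesis .
qed

lemma measurable_dpw: "finite K ==> dpw K s \<in> borel_measurable (LM K)"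
  unfolding dpw_def
  by (intro measurable_compose[OF _ borel_measurable_exp] borel_measurable_times borel_measurable_const
     measurable_compose[OF _ borel_measurable_of_real] borel_measurable_sum borel_measurable_ln measurable_LM_coord) auto

lemma powr_sub_le_gam:
  assumes b: "0 < b" and c: "0 < c"
  obtains C where "0 < C" "\<And>t a. 0 < t ==> b <= a ==> a <= 3 * b ==> t powr (a - 1) * exp (- c * t) <= C * gam b (c / 2) t"
proof -
  obtain C where C: "0 < C" "\<And>t. 0 <= t ==> (1 + t) powr (2 * b) <= C * exp (c / 2 * t)"
    using powr_le_exp[of "2 * b" "c / 2"] b c by auto
  have "t powr (a - 1) * exp (- c * t) <= C * gam b (c / 2) t" if t: "0 < t" and a: "b <= a" "a <= 3 * b" for t a
  proof -
    have "t powr (a - 1) = t powr (b - 1) * t powr (a - b)" using t by (simp add: powr_add[symmetric])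
    also have "t powr (a - b) <= (1 + t) powr (a - b)" using t a by (intro powr_mono2) auto
    also have "... <= (1 + t) powr (2 * b)" using t a by (intro powr_mono) auto
    also have "... <= C * exp (c / 2 * t)" using C(2) t by simp
    finally have "t powr (a - 1) <= t powr (b - 1) * (C * exp (c / 2 * t))" by (simp add: mult_left_mono)
    then have "t powr (a - 1) * exp (- c * t) <= t powr (b - 1) * (C * exp (c / 2 * t)) * exp (- c * t)" by (intro mult_right_mono) auto
    also have "... = C * (t powr (b - 1) * exp (c / 2 * t + - c * t))" by (simp only: exp_add mult_ac)
    also have "c / 2 * t + - c * t = - (c / 2) * t" by (simp add: field_simps)
    finally show ?thesis unfolding gam_def using t by simp
  qed
  then show ?thesis using C(1) that by blast
qed

definition CS :: "real => 'i set => complex => complex" where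
  "CS k K a = (\<integral>x. (of_bool (pos K x) * vd k K x) *\<^sub>R (dpw K (a - 1) x * of_real (exp (- (\<Sum>l\<in>K. x l)))) \<partial>LM K)"

lemma CS_of_real:
  assumes "finite K" shows "CS k K (of_real a) = of_real (SR k K a)"
proof -
  have "(of_bool (pos K x) * vd k K x) *\<^sub>R (dpw K (of_real a - 1) x * of_real (exp (- (\<Sum>l\<in>K. x l)))) = complex_of_real (SW a k K x)" for x
  proof (cases "pos K x")
    case True
    have "(\<Prod>l\<in>K. x l powr (a - 1) * exp (- x l)) = exp ((a - 1) * (\<Sum>l\<in>K. ln (x l))) * exp (- (\<Sum>l\<in>K. x l))"
    proof -
      have "(\<Prod>l\<in>K. x l powr (a - 1) * exp (- x l)) = (\<Prod>l\<in>K. exp ((a - 1) * ln (x l) + - x l))"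
        using True by (intro prod.cong refl) (simp only: exp_add, auto simp: powr_def pos_def)
      also have "... = exp (\<Sum>l\<in>K. (a - 1) * ln (x l) + - x l)" using assms by (simp add: exp_sum)
      also have "(\<Sum>l\<in>K. (a - 1) * ln (x l) + - x l) = (a - 1) * (\<Sum>l\<in>K. ln (x l)) + - (\<Sum>l\<in>K. x l)"
        by (simp only: sum.distrib sum_negf sum_distrib_left)
      finally show ?thesis by (simp only: exp_add)
    qed
    moreover have "dpw K (of_real a - 1) x = of_real (exp ((a - 1) * (\<Sum>l\<in>K. ln (x l))))"
      unfolding exp_of_real[symmetric] by (simp add: dpw_def)
    ultimately show ?thesis unfolding SW_def by (simp add: scaleR_conv_of_real del: of_real_prod)
  qed (simp add: SW_def)
  then show ?thesis unfolding CS_def mom_def by simp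
qed

lemma CS_holomorphic:
  assumes k: "0 <= k" and K: "finite K"
  shows "CS k K holomorphic_on {a. 0 < Re a}"
proof -
  have "\<exists>D. (CS k K has_field_derivative D) (at a)" if a: "0 < Re a" for a
  proof -
    \<comment> \<open>In the ball of radius b around a the real parts lie between b and 3 b, the
      range covered uniformly by \<open>powr_sub_le_gam\<close>.\<close>
    define b where "b = Re a / 2"
    have b: "0 < b" using a by (simp add: b_def)
    obtain C where C: "0 < C" "\<And>t a. 0 < t ==> b <= a ==> a <= 3 * b ==> t powr (a - 1) * exp (- 1 * t) <= C * gam b (1 / 2) t"
      using powr_sub_le_gam[OF b, of 1] by auto
    let ?G = "%x. C ^ card K * (\<Prod>l\<in>K. gam b (1 / 2) (x l))"
    have gm: "?G \<in> borel_measurable (LM K)"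
      by (intro borel_measurable_times borel_measurable_const borel_measurable_prod measurable_compose[OF _ borel_measurable_gam] measurable_LM_coord)
    have gi: "integrable (LM K) (%x. (of_bool (pos K x) * vd k K x) *\<^sub>R ?G x)"
    proof (rule integrable_vd[OF k K gm b, of "1/2" "C ^ card K"])
      fix x show "norm (?G x) <= C ^ card K * (\<Prod>l\<in>K. gam b (1 / 2) (x l))"
        using C(1) by (simp add: abs_mult abs_of_nonneg prod_nonneg)
    qed simp
    have "((%a. \<integral>x. (of_bool (pos K x) * vd k K x) *\<^sub>R (dpw K (a - 1) x * of_real (exp (- (\<Sum>l\<in>K. x l)))) \<partial>LM K) has_field_derivative
      (\<integral>x. deriv (%a. (of_bool (pos K x) * vd k K x) *\<^sub>R (dpw K (a - 1) x * of_real (exp (- (\<Sum>l\<in>K. x l))))) a \<partial>LM K)) (at a)"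
    proof (rule deriv_under_integral(1)[OF b _ _ gi])
      fix x show "(%a. (of_bool (pos K x) * vd k K x) *\<^sub>R (dpw K (a - 1) x * of_real (exp (- (\<Sum>l\<in>K. x l))))) holomorphic_on ball a b"
        unfolding dpw_def scaleR_conv_of_real by (intro holomorphic_intros)
    next
      fix w assume "w \<in> ball a b"
      then have "\<bar>Re (a - w)\<bar> < b" using abs_Re_le_cmod[of "a - w"] by (simp add: dist_norm)
      then have w: "b <= Re w" "Re w <= 3 * b" unfolding b_def minus_complex.sel abs_less_iff by auto
      have pm: "(%x. of_bool (pos K x) :: real) \<in> borel_measurable (LM K)" using measurable_pos[OF K] by measurable
      show "(%x. (of_bool (pos K x) * vd k K x) *\<^sub>R (dpw K (w - 1) x * of_real (exp (- (\<Sum>l\<in>K. x l))))) \<in> borel_measurable (LM K)"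
        by (intro borel_measurable_scaleR borel_measurable_times pm borel_measurable_vd[OF K] measurable_dpw[OF K] measurable_compose[OF _ borel_measurable_of_real]
          measurable_compose[OF _ borel_measurable_exp] borel_measurable_uminus borel_measurable_sum measurable_LM_coord) auto
      fix x
      show "norm ((of_bool (pos K x) * vd k K x) *\<^sub>R (dpw K (w - 1) x * of_real (exp (- (\<Sum>l\<in>K. x l))))) <= (of_bool (pos K x) * vd k K x) *\<^sub>R ?G x"
      proof (cases "pos K x")
        case True
        have "norm (dpw K (w - 1) x * of_real (exp (- (\<Sum>l\<in>K. x l)))) = (\<Prod>l\<in>K. x l powr (Re w - 1) * exp (- 1 * x l))"
          using True K by (simp add: norm_mult norm_dpw prod.distrib exp_sum[symmetric] sum_negf del: of_real_exp)
        also have "... <= (\<Prod>l\<in>K. C * gam b (1 / 2) (x l))"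
          using True w by (intro prod_mono conjI C(2)) (auto simp: pos_def)
        also have "... = ?G x" by (simp add: prod.distrib)
        finally show ?thesis unfolding norm_scaleR using True by (simp add: mult_left_mono)
      qed simp
    qed
    then show ?thesis unfolding CS_def[abs_def] by blast
  qed
  then show ?thesis by (auto simp: holomorphic_on_def field_differentiable_def intro: has_field_derivative_at_within)
qed

text \<open>Both sides are holomorphic for Re a > 0 and agree for positive real a, so the identity
  theorem applies.\<close>

theorem selberg_laguerre:
  assumes k: "0 <= k" and K: "finite K" and a: "0 < Re a"
  shows "CS k K a = (\<Prod>j<card K. Gamma (a + of_real (k * real j))) * (\<Prod>j<card K. Gamma (of_real (1 + k * real (Suc j))) / Gamma (of_real (1 + k)))"
proof -
  let ?R = "%a::complex. (\<Prod>j<card K. Gamma (a + of_real (k * real j))) * (\<Prod>j<card K. Gamma (of_real (1 + k * real (Suc j))) / Gamma (of_real (1 + k)))"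
  have "CS k K a - ?R a = 0"
  proof (rule analytic_continuation[of "%a. CS k K a - ?R a" "{a. 0 < Re a}" "of_real ` {0<..}" 1])
    have "(%a. Gamma (a + of_real (k * real j))) holomorphic_on {a. 0 < Re a}" for j
    proof -
      have "0 < Re (a + of_real (k * real j))" if "0 < Re a" for a using that k by (simp add: add_pos_nonneg)
      then have "a + of_real (k * real j) \<notin> \<int>\<^sub>\<le>\<^sub>0" if "0 < Re a" for a
        using that by (metis nonpos_Ints_nonpos nonpos_Reals_def complex_nonpos_Reals_iff nonpos_Ints_subset_nonpos_Reals not_less subsetD)
      then show ?thesis by (intro holomorphic_on_compose_gen[OF _ holomorphic_Gamma[of "- \<int>\<^sub>\<le>\<^sub>0"], unfolded o_def]) (auto intro!: holomorphic_intros)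
    qed
    then show "(%a. CS k K a - ?R a) holomorphic_on {a. 0 < Re a}"
      by (intro holomorphic_on_diff holomorphic_on_mult holomorphic_on_prod holomorphic_on_const CS_holomorphic[OF k K])
    show "(1::complex) islimpt of_real ` {0<..}" unfolding islimpt_approachable
    proof (intro allI impI)
      fix e :: real assume e: "0 < e"
      have m: "complex_of_real (1 + e / 2) \<in> of_real ` {0<..}" using e by (intro imageI) simp
      have "complex_of_real (1 + e / 2) ~= 1 \<and> dist (complex_of_real (1 + e / 2)) 1 < e"
        using e by (simp add: dist_norm norm_divide)
      then show "\<exists>x'\<in>of_real ` {0<..}. x' ~= (1::complex) \<and> dist x' 1 < e"
        using m by blast
    qed
    show "connected {a. 0 < Re a}" by (intro convex_connected convex_halfspace_Re_gt)
    show "open {a. 0 < Re a}" by (rule open_halfspace_Re_gt)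
    fix z :: complex assume "z \<in> of_real ` {0<..}"
    then obtain t where t: "0 < t" "z = of_real t" by auto
    have "complex_of_real (Gamma (t + k * real j)) = Gamma (z + of_real (k * real j))" for j unfolding t(2) of_real_add[symmetric] Gamma_complex_of_real ..
    moreover have "complex_of_real (Gamma (1 + k * real (Suc j)) / Gamma (1 + k)) = Gamma (of_real (1 + k * real (Suc j))) / Gamma (of_real (1 + k))" for j
      unfolding Gamma_complex_of_real by simp
    ultimately show "CS k K z - ?R z = 0" unfolding t(2) CS_of_real[OF K] selberg_laguerre_real[OF k K t(1)] of_real_mult of_real_prod by simp
  qed (use a in auto)
  then show ?thesis by simp
qed

section \<open>The Laplace transform of homogeneous polynomials\<close>

definition V :: "('n::finite => real) => complex^('n::finite)" where
  "V x = (\<chi> l. of_real (x l))"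

lemma V_nth [simp]: "V x $ l = of_real (x l)"
  by (simp add: V_def)

lemma V_cvec: "V x = cvec (\<chi> l. x l)"
  by (simp add: V_def cvec_def)

lemma V_swap: "V (x \<circ> tsp a b) = swapc a b (V x)"
  by (simp add: vec_eq_iff swapc_nth)

lemma measurable_V: "V \<in> borel_measurable (LM UNIV)"
proof (rule iffD2[OF borel_measurable_euclidean_space], rule ballI)
  fix u :: "complex^'n" assume "u \<in> Basis"
  then obtain i v where "u = axis i v" by (auto simp: Basis_vec_def)
  moreover have "(%x. complex_of_real (x i) \<bullet> v) \<in> borel_measurable (LM UNIV)"
    by (intro borel_measurable_inner borel_measurable_const measurable_compose[OF _ borel_measurable_of_real] measurable_LM_coord) simp
  ultimately show "(%x. V x \<bullet> u) \<in> borel_measurable (LM UNIV)" by (simp add: inner_axis)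
qed

lemma cdiff_measurable: "(\<And>x. cdiff f x) ==> f \<in> borel_measurable borel"
  by (intro borel_measurable_continuous_onI continuous_at_imp_continuous_on ballI cdiff_isCont) auto

lemma measurable_hom_V: "hom m q ==> (%x. q (V x)) \<in> borel_measurable (LM UNIV)"
  by (rule measurable_compose[OF measurable_V cdiff_measurable]) (rule hom_cdiff)

lemma measurable_dk_V:
  assumes "0 <= k" shows "(%x. dk k (- V x) z) \<in> borel_measurable (LM UNIV)"
proof -
  have "(%x. dk k (- z) (V x)) \<in> borel_measurable (LM UNIV)"
    by (rule measurable_compose[OF measurable_V cdiff_measurable]) (rule dk_cdiff[OF assms])
  then show ?thesis using dk_minus[of k z] by simp
qed

lemma hom_bound: "hom m q ==> \<exists>C\<ge>0. \<forall>x. norm (q x) <= C * norm x ^ m"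
proof (induction rule: hom.induct)
  case (hom_const c) then show ?case by (intro exI[of _ "norm c"]) auto
next
  case (hom_coord m f i)
  then obtain C where C: "0 <= C" "\<And>x. norm (f x) <= C * norm x ^ m" by blast
  have "norm (x $ i * f x) <= C * norm x ^ Suc m" for x
  proof -
    have "norm (x $ i * f x) <= norm x * (C * norm x ^ m)" unfolding norm_mult
      by (intro mult_mono C(2) Finite_Cartesian_Product.norm_nth_le) auto
    then show ?thesis by (simp add: mult_ac)
  qed
  then show ?case using C(1) by blast
next
  case (hom_add m f g)
  then obtain C D where C: "0 <= C" "\<And>x. norm (f x) <= C * norm x ^ m" and D: "0 <= D" "\<And>x. norm (g x) <= D * norm x ^ m" by blast
  have "norm (f x + g x) <= (C + D) * norm x ^ m" for x
    using norm_triangle_ineq[of "f x" "g x"] C(2)[of x] D(2)[of x] by (simp add: algebra_simps)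
  then show ?case using C(1) D(1) by (intro exI[of _ "C + D"]) auto
qed

lemma norm_V_le_sum: "pos UNIV x ==> norm (V x :: complex^'n::finite) <= (\<Sum>l\<in>UNIV. x l)"
proof -
  assume "pos UNIV x"
  then have "\<bar>x l\<bar> = x l" for l by (simp add: pos_def less_imp_le)
  then show ?thesis unfolding norm_vec_def using L2_set_le_sum_abs[of "%i. norm (V x $ i)" "UNIV :: 'n set"] by simp
qed

lemma norm_V_le: "norm (V x :: complex^'n::finite) <= real CARD('n) * QQ UNIV x"
proof -
  have "\<bar>x l\<bar> <= QQ UNIV x" for l
    using QQ_mono[of UNIV "{l}" x] by (simp add: QQ_def)
  then have "(\<Sum>l\<in>UNIV. \<bar>x l\<bar>) <= real CARD('n) * QQ UNIV x" by (intro sum_bounded_above) auto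
  moreover have "norm (V x) <= (\<Sum>l\<in>UNIV. \<bar>x l\<bar>)" unfolding norm_vec_def
    using L2_set_le_sum_abs[of "%i. norm (V x $ i)" "UNIV :: 'n set"] by simp
  ultimately show ?thesis by linarith
qed

abbreviation (input) HR :: "complex^('n::finite) => bool" where
  "HR z \<equiv> \<forall>i. 0 < Re (z $ i)"

lemma HR_lower:
  fixes z :: "complex^'n::finite"
  assumes "HR z" obtains c where "0 < c" "\<And>i. c <= Re (z $ i)"
proof -
  let ?c = "Min (range (%i. Re (z $ i)))"
  have "?c \<in> range (%i. Re (z $ i))" by (intro Min_in) auto
  then have "0 < ?c" using assms by auto
  moreover have "?c <= Re (z $ i)" for i by (intro Min_le) auto
  ultimately show ?thesis using that by blast
qed

lemma HR_nz: "HR z ==> z $ i ~= 0"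
  by (metis less_irrefl zero_complex.simps(1))

lemma HR_swapc: "HR z ==> HR (swapc a b z)"
  by (simp add: swapc_nth)

lemma dk_V_decay:
  fixes x :: "'n::{finite,linorder} => real" and z :: "complex^'n::{finite,linorder}"
  assumes k: "0 <= k" and c: "\<And>i. c <= Re (z $ i)" and x: "\<And>l. 0 <= x l"
  shows "norm (dk k (- V x) z) <= sqrt (fact CARD('n)) * exp (- c * (\<Sum>l\<in>UNIV. x l))"
  using dk_decay[OF k c, of "\<chi> l. x l"] x by (simp add: V_cvec dk_minus[of k _ z])

text \<open>The minus sign is attached to x, so that z is the plain second argument of the kernel,
  on which the Dunkl operators act; \<open>dk_minus\<close> restores the form used in the integral
  of the theorem.\<close>

definition lapi :: "real => complex => (complex^('n::{finite,linorder}) => complex) => complex^('n::{finite,linorder}) => ('n => real) => complex" where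
  "lapi k a q z x = dk k (- V x) z * (q (V x) * dpw UNIV (a - 1) x)"

abbreviation wv :: "real => ('n::finite => real) => real" where
  "wv k x \<equiv> of_bool (pos UNIV x) * vd k UNIV x"

text \<open>The parameter a is the one of the Selberg integral, so the coordinates carry the power a
  - 1. In the theorem it is \<mu>' minus k (n - 1).\<close>

definition lap :: "real => complex => (complex^('n::{finite,linorder}) => complex) => complex^('n::{finite,linorder}) => complex" where
  "lap k a q z = (\<integral>x. wv k x *\<^sub>R lapi k a q z x \<partial>LM UNIV)"

lemma lapi_bound:
  fixes q :: "complex^'n::{finite,linorder} => complex"
  assumes k: "0 <= k" and q: "hom m q" and c: "0 < c"
  obtains C where "0 <= C" "\<And>(z::(complex,'n) vec) x. (\<And>i. c <= Re (z $ i)) ==> pos UNIV x ==>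
    norm (lapi k a q z x) <= C * (\<Prod>l\<in>UNIV. gam (Re a) (c / 2) (x l))"
proof -
  obtain C where C: "0 <= C" "\<And>x. norm (q x) <= C * norm x ^ m" using hom_bound[OF q] by blast
  obtain D where D: "0 < D" "\<And>x::'n => real. pos UNIV x ==> QQ UNIV x powr (real m) <= D * (\<Prod>l\<in>UNIV. exp (c / 2 * x l))"
    using QQ_powr_le[of "UNIV :: 'n set" "real m" "c / 2"] c by auto
  define E where "E = sqrt (fact CARD('n)) * (C * real CARD('n) ^ m * D)"
  have "norm (lapi k a q z x) <= E * (\<Prod>l\<in>UNIV. gam (Re a) (c / 2) (x l))"
    if z: "\<And>i. c <= Re (z $ i)" and x: "pos UNIV x" for z :: "(complex,'n) vec" and x
  proof -
    have q1: "0 < QQ UNIV x" using QQ_ge1[of UNIV x] by linarith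
    have 1: "norm (dk k (- V x) z) <= sqrt (fact CARD('n)) * (\<Prod>l\<in>UNIV. exp (- c * x l))"
      using dk_V_decay[OF k z, of x] x by (simp add: pos_def less_imp_le exp_sum[symmetric] sum_distrib_left sum_negf)
    have "norm (q (V x)) <= C * (real CARD('n) * QQ UNIV x) ^ m"
      by (rule order_trans[OF C(2)]) (intro mult_left_mono power_mono norm_V_le C(1) norm_ge_zero)
    also have "... = C * real CARD('n) ^ m * QQ UNIV x powr (real m)" using q1 by (simp add: power_mult_distrib powr_realpow)
    also have "... <= C * real CARD('n) ^ m * (D * (\<Prod>l\<in>UNIV. exp (c / 2 * x l)))" using C(1) D(2)[OF x] by (intro mult_left_mono) auto
    finally have 2: "norm (q (V x)) <= C * real CARD('n) ^ m * (D * (\<Prod>l\<in>UNIV. exp (c / 2 * x l)))" .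
    have 3: "norm (dpw UNIV (a - 1) x) = (\<Prod>l\<in>UNIV. x l powr (Re a - 1))" using norm_dpw[OF _ x] by simp
    have "norm (lapi k a q z x) <= (sqrt (fact CARD('n)) * (\<Prod>l\<in>UNIV. exp (- c * x l))) *
       ((C * real CARD('n) ^ m * (D * (\<Prod>l\<in>UNIV. exp (c / 2 * x l)))) * (\<Prod>l\<in>UNIV. x l powr (Re a - 1)))"
      unfolding lapi_def norm_mult 3 by (intro mult_mono 1 2 order_refl mult_nonneg_nonneg prod_nonneg) (use C D in auto)
    also have "... = E * ((\<Prod>l\<in>UNIV. exp (- c * x l)) * (\<Prod>l\<in>UNIV. exp (c / 2 * x l)) * (\<Prod>l\<in>UNIV. x l powr (Re a - 1)))"
      unfolding E_def by (simp only: mult_ac)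
    also have "(\<Prod>l\<in>UNIV. exp (- c * x l)) * (\<Prod>l\<in>UNIV. exp (c / 2 * x l)) * (\<Prod>l\<in>UNIV. x l powr (Re a - 1)) = (\<Prod>l\<in>UNIV. gam (Re a) (c / 2) (x l))"
      unfolding prod.distrib[symmetric]
    proof (intro prod.cong refl)
      fix l
      have "exp (- c * x l) * exp (c / 2 * x l) = exp (- (c / 2) * x l)" unfolding exp_add[symmetric] by (simp add: field_simps)
      then show "exp (- c * x l) * exp (c / 2 * x l) * x l powr (Re a - 1) = gam (Re a) (c / 2) (x l)"
        using x by (simp add: gam_def pos_def)
    qed
    finally show ?thesis .
  qed
  moreover have "0 <= E" unfolding E_def using C D by simp
  ultimately show ?thesis using that by blast
qed

lemma measurable_lapi: "0 <= k ==> hom m q ==> lapi k a q z \<in> borel_measurable (LM UNIV)"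
  unfolding lapi_def[abs_def] by (intro borel_measurable_times measurable_dk_V measurable_hom_V measurable_dpw) auto

lemma measurable_wv: "(%x. wv k x) \<in> borel_measurable (LM (UNIV :: 'n::finite set))"
proof -
  have "(%x. of_bool (pos UNIV x) :: real) \<in> borel_measurable (LM (UNIV :: 'n set))" using measurable_pos[of "UNIV :: 'n set"] by measurable
  then show ?thesis by (intro borel_measurable_times borel_measurable_vd) auto
qed

lemma integrable_gam_UNIV:
  assumes "0 <= k" "0 < b" "0 < c"
  shows "integrable (LM (UNIV :: 'n::finite set)) (%x. wv k x *\<^sub>R (C * (\<Prod>l\<in>UNIV. gam b c (x l))))"
proof (rule integrable_vd[OF assms(1) _ _ assms(2,3), of _ _ "\<bar>C\<bar>"])
  show "(%x. C * (\<Prod>l\<in>UNIV. gam b c (x l))) \<in> borel_measurable (LM (UNIV :: 'n set))"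
    by (intro borel_measurable_times borel_measurable_const borel_measurable_prod measurable_compose[OF _ borel_measurable_gam] measurable_LM_coord) auto
  fix x show "norm (C * (\<Prod>l\<in>UNIV. gam b c (x l))) <= \<bar>C\<bar> * (\<Prod>l\<in>(UNIV :: 'n set). gam b c (x l))"
    by (simp add: abs_mult abs_of_nonneg prod_nonneg)
qed simp

lemma integrable_lapi:
  fixes q :: "complex^'n::{finite,linorder} => complex" and z :: "complex^'n::{finite,linorder}"
  assumes k: "0 <= k" and q: "hom m q" and a: "0 < Re a" and z: "HR z"
  shows "integrable (LM UNIV) (%x. wv k x *\<^sub>R lapi k a q z x)"
proof -
  obtain c where c: "0 < c" "\<And>i. c <= Re (z $ i)" using HR_lower[OF z] by blast
  obtain C where C: "0 <= C" "\<And>(z::(complex,'n) vec) x. (\<And>i. c <= Re (z $ i)) ==> pos UNIV x ==> norm (lapi k a q z x) <= C * (\<Prod>l\<in>UNIV. gam (Re a) (c / 2) (x l))"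
    using lapi_bound[OF k q c(1), of a] by blast
  show ?thesis by (rule integrable_vd[where b = "Re a" and c = "c / 2" and C = C, OF k _ measurable_lapi[OF k q]]) (use a c C in auto)
qed

section \<open>Dunkl operators under the integral sign\<close>

lemma lap_line:
  fixes q :: "complex^'n::{finite,linorder} => complex" and z \<xi> :: "complex^'n::{finite,linorder}"
  assumes k: "0 <= k" and q: "hom m q" and a: "0 < Re a" and z: "HR z"
  defines "d \<equiv> %x. wv k x *\<^sub>R (dderiv (dk k (- V x)) \<xi> z * (q (V x) * dpw UNIV (a - 1) x))"
  shows "((%t. lap k a q (z + t *s \<xi>)) has_field_derivative (\<integral>x. d x \<partial>LM UNIV)) (at 0)" "integrable (LM UNIV) d"
proof -
  obtain c where c: "0 < c" "\<And>i. c <= Re (z $ i)" using HR_lower[OF z] by blast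
  obtain C where C: "0 <= C" "\<And>(z::(complex,'n) vec) x. (\<And>i. c / 2 <= Re (z $ i)) ==> pos UNIV x ==> norm (lapi k a q z x) <= C * (\<Prod>l\<in>UNIV. gam (Re a) (c / 2 / 2) (x l))"
    using lapi_bound[OF k q, of "c / 2" a] c by auto
  \<comment> \<open>Small enough that on the disc of radius r the real parts along the line stay
    above c / 2, so that one majorant serves the whole disc.\<close>
  define r where "r = c / (2 * (1 + norm \<xi>))"
  have "0 < 1 + norm \<xi>" by (simp add: add_pos_nonneg)
  then have r: "0 < r" "r * norm \<xi> <= c / 2" using c(1) by (auto simp: r_def field_simps)
  have zt: "c / 2 <= Re ((z + t *s \<xi>) $ i)" if "t \<in> ball 0 r" for t i
  proof -
    have "norm ((t *s \<xi>) $ i) <= r * norm \<xi>" unfolding vector_smult_component norm_mult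
      using that r by (intro mult_mono Finite_Cartesian_Product.norm_nth_le) auto
    then have "norm ((t *s \<xi>) $ i) <= c / 2" using r by linarith
    then have "- (c / 2) <= Re ((t *s \<xi>) $ i)" using abs_Re_le_cmod[of "(t *s \<xi>) $ i"] by linarith
    then show ?thesis using c(2)[of i] by simp
  qed
  let ?f = "%t x. wv k x *\<^sub>R lapi k a q (z + t *s \<xi>) x"
  have line: "((%t. dk k (- V x) (z + t *s \<xi>)) has_field_derivative dderiv (dk k (- V x)) \<xi> (z + s *s \<xi>)) (at s)" for s and x :: "'n => real"
  proof -
    obtain e where "(dk k (- V x) has_derivative bil e) (at (z + s *s \<xi>))" "\<And>\<zeta>. dderiv (dk k (- V x)) \<zeta> (z + s *s \<xi>) = bil e \<zeta>"
      using cdiff_dderiv[OF dk_cdiff[OF k, of "- V x" "z + s *s \<xi>"]] by blast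
    then show ?thesis using has_field_derivative_line_at by metis
  qed
  have fd: "((%t. ?f t x) has_field_derivative wv k x *\<^sub>R (dderiv (dk k (- V x)) \<xi> (z + s *s \<xi>) * (q (V x) * dpw UNIV (a - 1) x))) (at s)" for s x
    unfolding lapi_def scaleR_conv_of_real by (intro DERIV_cmult DERIV_cmult_right line)
  have dd: "deriv (%t. ?f t x) 0 = d x" for x unfolding d_def using DERIV_imp_deriv[OF fd[where s = 0]] by simp
  have gi: "integrable (LM UNIV) (%x::'n => real. wv k x *\<^sub>R (C * (\<Prod>l\<in>UNIV. gam (Re a) (c / 2 / 2) (x l))))"
    by (rule integrable_gam_UNIV[OF k a]) (use c in auto)
  have hol: "(%t. ?f t x) holomorphic_on ball 0 r" for x
    unfolding holomorphic_on_def field_differentiable_def using has_field_derivative_at_within[OF fd] by blast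
  have m: "?f t \<in> borel_measurable (LM UNIV)" for t by (intro borel_measurable_scaleR measurable_wv measurable_lapi[OF k q])
  have b: "norm (?f t x) <= wv k x *\<^sub>R (C * (\<Prod>l\<in>UNIV. gam (Re a) (c / 2 / 2) (x l)))" if "t \<in> ball 0 r" for t x
    using C(2)[OF zt[OF that], of x] unfolding norm_scaleR by (cases "pos UNIV x") (auto intro!: mult_left_mono)
  note R = deriv_under_integral[OF r(1) hol m gi b, unfolded dd]
  show "((%t. lap k a q (z + t *s \<xi>)) has_field_derivative (\<integral>x. d x \<partial>LM UNIV)) (at 0)" unfolding lap_def using R(1) by simp
  show "integrable (LM UNIV) d" using R(2) by (simp add: eta_contract_eq)
qed

lemma lap_dderiv:
  fixes q :: "complex^'n::{finite,linorder} => complex"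
  assumes "0 <= k" "hom m q" "0 < Re a" "HR z"
  shows "dderiv (lap k a q) \<xi> z = (\<integral>x. wv k x *\<^sub>R (dderiv (dk k (- V x)) \<xi> z * (q (V x) * dpw UNIV (a - 1) x)) \<partial>LM UNIV)"
  unfolding dderiv_def[of "lap k a q"] by (rule DERIV_imp_deriv[OF lap_line(1)[OF assms]])

lemma lap_divdiff:
  fixes q :: "complex^'n::{finite,linorder} => complex" and z :: "complex^'n::{finite,linorder}" and i j :: 'n
  assumes k: "0 <= k" and q: "hom m q" and a: "0 < Re a" and z: "HR z"
  defines "d \<equiv> %x. wv k x *\<^sub>R (divdiff (dk k (- V x)) i j z * (q (V x) * dpw UNIV (a - 1) x))"
  shows "divdiff (lap k a q) i j z = (\<integral>x. d x \<partial>LM UNIV) \<and> integrable (LM UNIV) d"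
proof (cases "z $ i = z $ j")
  case True
  then have "d = (%x. wv k x *\<^sub>R (dderiv (dk k (- V x)) (axis i 1 - axis j 1) z * (q (V x) * dpw UNIV (a - 1) x)))"
    by (simp add: d_def divdiff_def)
  then show ?thesis using lap_dderiv[OF assms(1-4), of "axis i 1 - axis j 1"] lap_line(2)[OF assms(1-4), of "axis i 1 - axis j 1"] True
    by (simp add: divdiff_def)
next
  case False
  let ?h = "%z x. wv k x *\<^sub>R lapi k a q z x"
  have d: "d = (%x. (?h z x - ?h (swapc i j z) x) / (z $ i - z $ j))"
    using False by (auto simp: d_def divdiff_def lapi_def fun_eq_iff scaleR_conv_of_real field_simps)
  have i: "integrable (LM UNIV) (?h z)" "integrable (LM UNIV) (?h (swapc i j z))"
    by (rule integrable_lapi[OF k q a z], rule integrable_lapi[OF k q a HR_swapc[OF z]])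
  have di: "integrable (LM UNIV) (%x. ?h z x - ?h (swapc i j z) x)" by (rule Bochner_Integration.integrable_diff[OF i])
  have "(\<integral>x. d x \<partial>LM UNIV) = (\<integral>x. ?h z x - ?h (swapc i j z) x \<partial>LM UNIV) / (z $ i - z $ j)" unfolding d by (rule integral_divide_zero)
  also have "(\<integral>x. ?h z x - ?h (swapc i j z) x \<partial>LM UNIV) = lap k a q z - lap k a q (swapc i j z)"
    unfolding lap_def by (rule Bochner_Integration.integral_diff[OF i])
  finally show ?thesis using False integrable_divide[OF di] unfolding d divdiff_def by simp
qed

text \<open>All parts of the operator pass under the integral onto the kernel, which is an
  eigenfunction in z with eigenvalue - \<open>bil x \<xi>\<close>.\<close>

lemma lap_dunkl:
  fixes q :: "complex^'n::{finite,linorder} => complex" and z :: "complex^'n::{finite,linorder}"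
  assumes k: "0 <= k" and q: "hom m q" and a: "0 < Re a" and z: "HR z"
  shows "dunkl_op k \<xi> (lap k a q) z = - lap k a (%x. bil x \<xi> * q x) z"
proof -
  let ?c = "%x. q (V x) * dpw UNIV (a - 1) x"
  let ?d = "%x. wv k x *\<^sub>R (dderiv (dk k (- V x)) \<xi> z * ?c x)"
  let ?e = "%i j x. wv k x *\<^sub>R (divdiff (dk k (- V x)) i j z * ?c x)"
  note D = lap_dderiv[OF k q a z, of \<xi>] and E = lap_divdiff[OF k q a z]
  have id: "integrable (LM UNIV) ?d" by (rule lap_line(2)[OF k q a z])
  have ie: "integrable (LM UNIV) (%x. (\<xi>$i - \<xi>$j) * ?e i j x)" for i j by (rule integrable_mult_right) (use E in blast)
  have is1: "integrable (LM UNIV) (%x. \<Sum>j\<in>{j. i < j}. (\<xi>$i - \<xi>$j) * ?e i j x)" for i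
    by (rule Bochner_Integration.integrable_sum) (rule ie)
  have is2: "integrable (LM UNIV) (%x. \<Sum>i\<in>UNIV. \<Sum>j\<in>{j. i < j}. (\<xi>$i - \<xi>$j) * ?e i j x)"
    by (rule Bochner_Integration.integrable_sum) (rule is1)
  have s2: "(\<integral>x. (\<Sum>i\<in>UNIV. \<Sum>j\<in>{j. i < j}. (\<xi>$i - \<xi>$j) * ?e i j x) \<partial>LM UNIV) = (\<Sum>i\<in>UNIV. \<Sum>j\<in>{j. i < j}. (\<xi>$i - \<xi>$j) * divdiff (lap k a q) i j z)"
  proof -
    have "(\<integral>x. (\<Sum>i\<in>UNIV. \<Sum>j\<in>{j. i < j}. (\<xi>$i - \<xi>$j) * ?e i j x) \<partial>LM UNIV) = (\<Sum>i\<in>UNIV. \<integral>x. (\<Sum>j\<in>{j. i < j}. (\<xi>$i - \<xi>$j) * ?e i j x) \<partial>LM UNIV)"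
      by (rule Bochner_Integration.integral_sum) (rule is1)
    also have "... = (\<Sum>i\<in>UNIV. \<Sum>j\<in>{j. i < j}. \<integral>x. (\<xi>$i - \<xi>$j) * ?e i j x \<partial>LM UNIV)"
      by (intro sum.cong refl Bochner_Integration.integral_sum) (rule ie)
    also have "... = (\<Sum>i\<in>UNIV. \<Sum>j\<in>{j. i < j}. (\<xi>$i - \<xi>$j) * divdiff (lap k a q) i j z)"
      using E by (intro sum.cong refl) (simp only: integral_mult_right_zero)
    finally show ?thesis .
  qed
  have p: "wv k x *\<^sub>R (- (bil (V x) \<xi>) * dk k (- V x) z * ?c x) = ?d x + of_real k * (\<Sum>i\<in>UNIV. \<Sum>j\<in>{j. i < j}. (\<xi>$i - \<xi>$j) * ?e i j x)" for x
  proof -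
    have "- (bil (V x) \<xi>) * dk k (- V x) z = dunkl_op k \<xi> (dk k (- V x)) z" using dk_dunkl[OF k, of \<xi> "- V x" z] by simp
    then show ?thesis unfolding dunkl_op_def scaleR_conv_of_real by (simp add: algebra_simps sum_distrib_left sum_distrib_right)
  qed
  have "- lap k a (%x. bil x \<xi> * q x) z = (\<integral>x. wv k x *\<^sub>R (- (bil (V x) \<xi>) * dk k (- V x) z * ?c x) \<partial>LM UNIV)"
    unfolding lap_def lapi_def integral_minus[symmetric] by (intro Bochner_Integration.integral_cong refl) (simp add: mult_ac)
  also have "... = (\<integral>x. ?d x \<partial>LM UNIV) + of_real k * (\<integral>x. (\<Sum>i\<in>UNIV. \<Sum>j\<in>{j. i < j}. (\<xi>$i - \<xi>$j) * ?e i j x) \<partial>LM UNIV)"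
    unfolding p Bochner_Integration.integral_add[OF id integrable_mult_right[OF is2]] integral_mult_right_zero ..
  also have "... = dunkl_op k \<xi> (lap k a q) z" unfolding s2 dunkl_op_def D ..
  finally show ?thesis by simp
qed

lemma dpw_swap: "dpw UNIV s (x \<circ> tsp i j) = dpw UNIV s (x :: 'n::finite => real)"
proof -
  have "(\<Sum>l\<in>UNIV. ln (x (tsp i j l))) = (\<Sum>l\<in>UNIV. ln (x l))"
    by (rule sum.reindex_bij_witness[of _ "tsp i j" "tsp i j"]) auto
  then show ?thesis by (simp add: dpw_def)
qed

lemma pos_swap: "pos UNIV (x \<circ> tsp i j) = pos UNIV x"
proof -
  have "(\<forall>l. 0 < x (tsp i j l)) \<longleftrightarrow> (\<forall>l. 0 < x l)" by (metis Transposition.transpose_involutory)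
  then show ?thesis by (simp add: pos_def)
qed

lemma lap_swapc:
  fixes q :: "complex^'n::{finite,linorder} => complex"
  assumes k: "0 <= k" and q: "hom m q"
  shows "lap k a q (swapc i j z) = lap k a (%x. q (swapc i j x)) z"
proof -
  let ?\<tau> = "tsp i j"
  let ?f = "%x. wv k x *\<^sub>R lapi k a q (swapc i j z) x"
  have "wv k (x \<circ> ?\<tau>) *\<^sub>R lapi k a q (swapc i j z) (x \<circ> ?\<tau>) = wv k x *\<^sub>R lapi k a (%x. q (swapc i j x)) z x" for x
  proof -
    have "dk k (- swapc i j (V x)) (swapc i j z) = dk k (- V x) z" using dk_swapc[OF k, of i j "- V x" z] by simp
    then show ?thesis unfolding lapi_def V_swap pos_swap dpw_swap by (simp add: vd_swap)
  qed
  moreover have "?f \<in> borel_measurable (LM UNIV)" by (intro borel_measurable_scaleR measurable_wv measurable_lapi[OF k q])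
  ultimately show ?thesis unfolding lap_def using integral_LM_swap[of "UNIV :: 'n set" i j ?f] by simp
qed

lemma lap_add:
  assumes "0 <= k" "hom m p" "hom m q" "0 < Re a" "HR z"
  shows "lap k a (%x. p x + c * q x) z = lap k a p z + c * lap k a q z"
proof -
  note i = integrable_lapi[OF assms(1,2,4,5)] integrable_lapi[OF assms(1,3,4,5)]
  have "wv k x *\<^sub>R lapi k a (%x. p x + c * q x) z x = wv k x *\<^sub>R lapi k a p z x + c * (wv k x *\<^sub>R lapi k a q z x)" for x
    by (simp add: lapi_def scaleR_conv_of_real algebra_simps)
  then show ?thesis unfolding lap_def using Bochner_Integration.integral_add[OF i(1) integrable_mult_right[OF i(2), of c]] by (simp only: integral_mult_right_zero)
qed

subsection \<open>The transform of the constant polynomial\<close>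

text \<open>The power with exponent a, written as t times the power with exponent a - 1. The factor
  t gives the value 0 at the origin whatever \<open>ln 0\<close> is, and Re a > 0 makes this the
  limit.\<close>

lemma continuous_pow_zero:
  assumes a: "0 < Re a"
  defines "h \<equiv> %t::real. of_real t * exp ((a - 1) * of_real (ln t))"
  shows "continuous_on {0..} h" "\<And>t. 0 <= t ==> norm (h t) = t powr Re a"
proof -
  show n: "norm (h t) = t powr Re a" if "0 <= t" for t
  proof (cases "t = 0")
    case False
    then have "norm (h t) = t * exp ((Re a - 1) * ln t)" using that by (simp add: h_def norm_mult)
    also have "... = t * t powr (Re a - 1)" using False by (simp add: powr_def)
    also have "... = t powr Re a" using False that by (simp add: powr_mult_base)
    finally show ?thesis .
  qed (simp add: h_def)
  show "continuous_on {0..} h" unfolding continuous_on_eq_continuous_within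
  proof
    fix t :: real assume t: "t \<in> {0..}"
    show "continuous (at t within {0..}) h"
    proof (cases "t = 0")
      case True
      have "((%t. t powr Re a) \<longlongrightarrow> 0 powr Re a) (at 0 within {0..})"
        by (rule tendsto_powr'[OF tendsto_ident_at tendsto_const]) (use a in \<open>auto simp: eventually_at_filter\<close>)
      then have "((%t. norm (h t)) \<longlongrightarrow> 0) (at 0 within {0..})"
        using a by (auto intro!: Lim_transform_eventually[where f = "%t. t powr Re a"] simp: eventually_at_filter n)
      then have "(h \<longlongrightarrow> 0) (at 0 within {0..})" by (rule tendsto_norm_zero_cancel)
      then show ?thesis unfolding continuous_within True by (simp add: h_def)
    next
      case False
      then have "isCont h t" unfolding h_def using t by (intro continuous_intros) auto
      then show ?thesis by (rule continuous_at_imp_continuous_at_within)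
    qed
  qed
qed

lemma dpw_insert: "finite I ==> i \<notin> I ==> dpw (insert i I) s x = exp (s * of_real (ln (x i))) * dpw I s x"
  by (simp add: dpw_def distrib_left exp_add)

lemma dpw_upd: "i \<notin> I ==> dpw I s (x(i := t)) = dpw I s x"
  unfolding dpw_def by (intro arg_cong[where f = exp] arg_cong2[where f = "(*)"] arg_cong[where f = of_real] sum.cong) auto

lemma V_upd: "V (x(i := t)) = V (x(i := 0)) + of_real t *s axis i 1"
  by (simp add: vec_eq_iff axis_component)

text \<open>The sum of the two kernels is invariant under exchanging x_i and x_j, and x_i / (x_i -
  x_j) + x_j / (x_j - x_i) = 1. So S plus its exchanged copy is the sum of two regular integrands,
  whose integrals agree by \<open>lap_swapc\<close>.\<close>

lemma lap_singular:
  fixes z :: "complex^'n::{finite,linorder}" and i j :: 'n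
  assumes k: "0 < k" and a: "0 < Re a" and z: "HR z" and ij: "i ~= j"
  defines "S \<equiv> %x. (of_bool (pos UNIV x) * (vd k UNIV x / (x i - x j))) *\<^sub>R
      ((dk k (- V x) z + dk k (- V x) (swapc i j z)) * (of_real (x i) * dpw UNIV (a - 1) x))"
  shows "integrable (LM UNIV) S" "(\<integral>x. S x \<partial>LM UNIV) = lap k a (%_. 1) z"
proof -
  define I where "I = - {i}"
  have I: "finite I" "i \<notin> I" "j \<in> I" and U: "insert i I = UNIV" using ij by (auto simp: I_def)
  have k0: "0 <= k" using k by simp
  obtain c where c: "0 < c" "\<And>i. c <= Re (z $ i)" using HR_lower[OF z] by blast
  obtain D where D: "0 < D" "\<And>t. 0 <= t ==> (1 + t) powr Re a <= D * exp (c / 2 * t)"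
    using powr_le_exp[of "Re a" "c / 2"] a c by auto
  let ?F = "%x. (dk k (- V x) z + dk k (- V x) (swapc i j z)) * (of_real (x i) * dpw UNIV (a - 1) x)"
  let ?s = "sqrt (fact CARD('n)) :: real"
  show iS: "integrable (LM UNIV) S" unfolding S_def U[symmetric]
  proof (rule integrable_vd_singular[OF k I])
    show "(%x. (dk k (- V x) z + dk k (- V x) (swapc i j z)) * (of_real (x i) * dpw (insert i I) (a - 1) x)) \<in> borel_measurable (LM (insert i I))"
      unfolding U by (intro borel_measurable_times borel_measurable_add measurable_dk_V[OF k0] measurable_dpw
        measurable_compose[OF _ borel_measurable_of_real] measurable_LM_coord) auto
    show "0 < Re a" "0 < c / 2" using a c by auto
    fix x assume "pos (insert i I) x"
    then have x: "pos UNIV x" and x0: "\<And>l. 0 < x l" by (auto simp: U pos_def)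
    have e1: "norm (dk k (- V x) z) <= ?s * exp (- c * (\<Sum>l\<in>UNIV. x l))"
      by (rule dk_V_decay[OF k0 c(2)]) (use x0 less_imp_le in blast)
    have "c <= Re (swapc i j z $ l)" for l using c(2) by (simp add: swapc_nth)
    then have e2: "norm (dk k (- V x) (swapc i j z)) <= ?s * exp (- c * (\<Sum>l\<in>UNIV. x l))"
      by (rule dk_V_decay[OF k0]) (use x0 less_imp_le in blast)
    have e: "norm (dk k (- V x) z + dk k (- V x) (swapc i j z)) <= 2 * ?s * exp (- c * (\<Sum>l\<in>UNIV. x l))"
      using norm_triangle_ineq[of "dk k (- V x) z" "dk k (- V x) (swapc i j z)"] e1 e2 by linarith
    have es: "exp (- c * (\<Sum>l\<in>UNIV. x l)) = exp (- c * x i) * (\<Prod>l\<in>I. exp (- c * x l))"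
      unfolding U[symmetric] using I by (simp add: distrib_left exp_add exp_diff exp_minus exp_sum sum_distrib_left field_simps prod_inversef flip: prod_inversef)
    have n: "norm (of_real (x i) * dpw UNIV (a - 1) x) = x i powr Re a * (\<Prod>l\<in>I. x l powr (Re a - 1))"
    proof -
      have "norm (of_real (x i) * dpw UNIV (a - 1) x) = x i * (\<Prod>l\<in>UNIV. x l powr (Re a - 1))"
        using norm_dpw[OF _ x, of "a - 1"] x0[of i] by (simp add: norm_mult)
      also have "... = (x i * x i powr (Re a - 1)) * (\<Prod>l\<in>I. x l powr (Re a - 1))" unfolding U[symmetric] using I by simp
      finally show ?thesis using x0[of i] by (simp add: powr_mult_base)
    qed
    have xi: "x i powr Re a * exp (- c * x i) <= D * exp (- (c / 2) * x i)"
    proof -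
      have "x i powr Re a <= (1 + x i) powr Re a" using x0[of i] a by (intro powr_mono2) auto
      also have "... <= D * exp (c / 2 * x i)" using D(2) x0[of i] by simp
      finally have "x i powr Re a * exp (- c * x i) <= (D * exp (c / 2 * x i)) * exp (- c * x i)" by (rule mult_right_mono) simp
      also have "... = D * exp (c / 2 * x i + - c * x i)" by (simp only: exp_add mult.assoc)
      also have "c / 2 * x i + - c * x i = - (c / 2) * x i" by (simp add: field_simps)
      finally show ?thesis .
    qed
    have g: "(\<Prod>l\<in>I. exp (- c * x l)) * (\<Prod>l\<in>I. x l powr (Re a - 1)) <= (\<Prod>l\<in>I. gam (Re a) (c / 2) (x l))"
      unfolding prod.distrib[symmetric]
    proof (intro prod_mono conjI)
      fix l
      have "exp (- c * x l) <= exp (- (c / 2) * x l)" using c x0[of l] by simp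
      then have "exp (- c * x l) * x l powr (Re a - 1) <= exp (- (c / 2) * x l) * x l powr (Re a - 1)" by (rule mult_right_mono) simp
      then show "exp (- c * x l) * x l powr (Re a - 1) <= gam (Re a) (c / 2) (x l)" using x0[of l] by (simp add: gam_def mult_ac)
    qed simp
    have "norm (?F x) <= (2 * ?s * (exp (- c * x i) * (\<Prod>l\<in>I. exp (- c * x l)))) * (x i powr Re a * (\<Prod>l\<in>I. x l powr (Re a - 1)))"
      unfolding norm_mult[of "_ + _"] n using e unfolding es by (intro mult_right_mono mult_nonneg_nonneg prod_nonneg) auto
    also have "... = 2 * ?s * ((x i powr Re a * exp (- c * x i)) * ((\<Prod>l\<in>I. exp (- c * x l)) * (\<Prod>l\<in>I. x l powr (Re a - 1))))"
      by (simp only: mult_ac)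
    also have "... <= 2 * ?s * ((D * exp (- (c / 2) * x i)) * (\<Prod>l\<in>I. gam (Re a) (c / 2) (x l)))"
      by (intro mult_left_mono mult_mono xi g mult_nonneg_nonneg prod_nonneg) (use D in auto)
    finally show "norm ((dk k (- V x) z + dk k (- V x) (swapc i j z)) * (of_real (x i) * dpw (insert i I) (a - 1) x))
       <= (2 * ?s * D) * (exp (- (c / 2) * x i) * (\<Prod>l\<in>I. gam (Re a) (c / 2) (x l)))" unfolding U by (simp only: mult_ac)
  qed
  let ?\<tau> = "tsp i j"
  let ?M = "%z x. wv k x *\<^sub>R lapi k a (%_. 1) z x"
  have iM: "integrable (LM UNIV) (?M z)" "integrable (LM UNIV) (?M (swapc i j z))"
    by (rule integrable_lapi[OF k0 hom_const a z], rule integrable_lapi[OF k0 hom_const a HR_swapc[OF z]])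
  have iW: "integrable (LM UNIV) (%x. ?M z x + ?M (swapc i j z) x)" by (rule Bochner_Integration.integrable_add[OF iM])
  have sw: "S (x \<circ> ?\<tau>) = (?M z x + ?M (swapc i j z) x) - S x" for x
  proof -
    have d: "dk k (- swapc i j (V x)) z = dk k (- V x) (swapc i j z)" "dk k (- swapc i j (V x)) (swapc i j z) = dk k (- V x) z"
      using dk_swapc[OF k0, of i j "- V x" z] dk_swapc[OF k0, of i j "- V x" "swapc i j z"] by simp_all
    have A: "S (x \<circ> ?\<tau>) = (of_bool (pos UNIV x) * (vd k UNIV x / (x j - x i))) *\<^sub>R
      ((dk k (- V x) (swapc i j z) + dk k (- V x) z) * (of_real (x j) * dpw UNIV (a - 1) x))"
      unfolding S_def pos_swap dpw_swap V_swap d by (simp add: vd_swap)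
    have v0: "vd k UNIV x = 0" if "x i = x j" using vd_eq_0[of UNIV i j x k] that ij k by simp
    have "v / (b - c) * ((E' + E) * (b * P)) = v * (E * P) + v * (E' * P) - v / (c - b) * ((E + E') * (c * P))"
      if "c ~= b" for v b c E E' P :: complex
    proof -
      have "v / (b - c) * b = v - v / (c - b) * c" using that by (simp add: field_simps)
      then have "(v / (b - c) * b) * ((E' + E) * P) = (v - v / (c - b) * c) * ((E' + E) * P)" by (simp only:)
      then show ?thesis by (simp only: algebra_simps)
    qed
    from this[of "complex_of_real (x i)" "of_real (x j)" "of_real (wv k x)"]
    have K: "of_real (wv k x / (x j - x i)) * ((E' + E) * (of_real (x j) * P))
      = of_real (wv k x) * (E * P) + of_real (wv k x) * (E' * P)
       - of_real (wv k x / (x i - x j)) * ((E + E') * (of_real (x i) * P))"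
      if "x i ~= x j" for E E' P :: complex using that unfolding of_real_divide of_real_diff by (simp only: of_real_eq_iff not_False_eq_True)
    show ?thesis
    proof (cases "x i = x j")
      case True then show ?thesis unfolding A using v0 by (simp add: S_def lapi_def)
    next
      case False
      show ?thesis unfolding A unfolding S_def lapi_def scaleR_conv_of_real times_divide_eq_right mult_1_left K[OF False] ..
    qed
  qed
  have "(\<integral>x. S x \<partial>LM UNIV) = (\<integral>x. S (x \<circ> ?\<tau>) \<partial>LM UNIV)"
    using integral_LM_swap[of UNIV i j S] iS by (simp add: borel_measurable_integrable)
  also have "... = (\<integral>x. ?M z x + ?M (swapc i j z) x \<partial>LM UNIV) - (\<integral>x. S x \<partial>LM UNIV)"
    unfolding sw by (rule Bochner_Integration.integral_diff[OF iW iS])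
  also have "(\<integral>x. ?M z x + ?M (swapc i j z) x \<partial>LM UNIV) = lap k a (%_. 1) z + lap k a (%_. 1) (swapc i j z)"
    unfolding lap_def by (rule Bochner_Integration.integral_add[OF iM])
  also have "lap k a (%_. 1) (swapc i j z) = lap k a (%_. 1) z" using lap_swapc[OF k0 hom_const] .
  finally show "(\<integral>x. S x \<partial>LM UNIV) = lap k a (%_. 1) z" by simp
qed

text \<open>Integration by parts in \<open>x\<^sub>i\<close>: the difference part of the Dunkl operator and the logarithmic
  derivative of the weight combine to a singular term whose symmetrization contributes \<open>k (n - 1)\<close>.\<close>
lemma lap_coord:
  fixes z :: "complex^'n::{finite,linorder}" and i :: 'n
  assumes k: "0 <= k" and a: "0 < Re a" and z: "HR z"
  shows "z $ i * lap k a (%x. x $ i * 1) z = (a + of_real (k * (real CARD('n) - 1))) * lap k a (%_. 1) z"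
proof -
  define I where "I = - {i}"
  have I: "finite I" "i \<notin> I" and U: "insert i I = UNIV" by (auto simp: I_def)
  have cI: "card I = CARD('n) - 1" using card_insert_disjoint[OF I] unfolding U by simp
  define h where "h = (%t::real. of_real t * exp ((a - 1) * of_real (ln t)))"
  have hc: "continuous_on {0..} h" "\<And>t. 0 <= t ==> norm (h t) = t powr Re a"
    unfolding h_def by (rule continuous_pow_zero[OF a])+
  define B where "B x = dk k (- V x) z * (h (x i) * dpw I (a - 1) x)" for x
  define B' where "B' x = dderiv (dk k (- z)) (axis i 1) (V x) * (h (x i) * dpw I (a - 1) x)
    + dk k (- V x) z * (a * exp ((a - 1) * of_real (ln (x i))) * dpw I (a - 1) x)" for x
  let ?M = "%q x. wv k x *\<^sub>R lapi k a q z x"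
  define S where "S j x = (of_bool (pos UNIV x) * (vd k UNIV x / (x i - x j))) *\<^sub>R
      ((dk k (- V x) z + dk k (- V x) (swapc i j z)) * (of_real (x i) * dpw UNIV (a - 1) x))" for j x
  let ?H = "%x. wv k x *\<^sub>R (B' x + (\<Sum>j\<in>I. 2 * k / (x i - x j)) *\<^sub>R B x)"
  have H: "?H x = a * ?M (%_. 1) x - z $ i * ?M (%x. x $ i * 1) x + (\<Sum>j\<in>I. of_real k * S j x)" for x
  proof (cases "pos UNIV x \<and> vd k UNIV x ~= 0")
    case False
    then show ?thesis by (auto simp: S_def)
  next
    case True
    then have xi: "0 < x i" by (auto simp: pos_def)
    have ne: "x i ~= x j" if "j \<in> I" "k ~= 0" for j using True vd_eq_0[of UNIV i j x k] that k I by auto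
    define E where "E = dk k (- V x) z"
    define Ej where "Ej j = dk k (- V x) (swapc i j z)" for j
    define P where "P = dpw UNIV (a - 1) x"
    have P: "P = exp ((a - 1) * of_real (ln (x i))) * dpw I (a - 1) x" unfolding P_def U[symmetric] using I by (rule dpw_insert)
    have hP: "h (x i) * dpw I (a - 1) x = of_real (x i) * P" unfolding h_def P by simp
    have Ez: "dk k (- z) (V x) = E" "dk k (- z) (swapc i j (V x)) = Ej j" for j
      unfolding E_def Ej_def using dk_minus[of k z "V x"] dk_minus[of k z "swapc i j (V x)"] dk_swapc[OF k, of i j "- V x" "swapc i j z"] by simp_all
    \<comment> \<open>The Dunkl equation, now in the variable x, is solved for the ordinary partial
      derivative of the kernel.\<close>
    have "dT k i (dk k (- z)) (V x) = - z $ i * E" using dk_dunkl[OF k, of "axis i 1" "- z" "V x"] by (simp add: Ez)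
    then have T: "dderiv (dk k (- z)) (axis i 1) (V x) = - z $ i * E - (\<Sum>j\<in>I. of_real k * divdiff (dk k (- z)) i j (V x))"
      unfolding dunkl_axis[OF dk_cdiff[OF k]] I_def by (simp add: sum_distrib_left algebra_simps)
    \<comment> \<open>For k = 0 both sides are 0; for k > 0 the coordinates differ because the
      weight does not vanish at x.\<close>
    have dd: "of_real k * divdiff (dk k (- z)) i j (V x) = of_real k * ((E - Ej j) / (of_real (x i) - of_real (x j)))" if "j \<in> I" for j
      using ne[OF that] by (cases "k = 0") (simp_all add: divdiff_def Ez)
    have T': "dderiv (dk k (- z)) (axis i 1) (V x) = - z $ i * E - (\<Sum>j\<in>I. of_real k * ((E - Ej j) / (of_real (x i) - of_real (x j))))"
      unfolding T using dd by simp
    have "B' x + (\<Sum>j\<in>I. 2 * k / (x i - x j)) *\<^sub>R B x = a * (E * P) - z $ i * E * (of_real (x i) * P)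
       + (\<Sum>j\<in>I. (of_real (2 * k / (x i - x j)) * E - of_real k * ((E - Ej j) / (of_real (x i) - of_real (x j)))) * (of_real (x i) * P))"
      unfolding B_def B'_def hP T' E_def[symmetric] P scaleR_conv_of_real sum_subtractf left_diff_distrib sum_distrib_right[symmetric] of_real_sum
      by (simp add: algebra_simps)
    \<comment> \<open>The weight contributes 2 k E and the difference part - k (E - Ej), together k
      (E + Ej): the combination that \<open>lap_singular\<close> can symmetrise.\<close>
    also have "(\<Sum>j\<in>I. (of_real (2 * k / (x i - x j)) * E - of_real k * ((E - Ej j) / (of_real (x i) - of_real (x j)))) * (of_real (x i) * P))
      = (\<Sum>j\<in>I. of_real (k / (x i - x j)) * ((E + Ej j) * (of_real (x i) * P)))"
      by (intro sum.cong refl) (simp add: add_divide_distrib diff_divide_distrib algebra_simps)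
    finally have f: "B' x + (\<Sum>j\<in>I. 2 * k / (x i - x j)) *\<^sub>R B x = a * (E * P) - z $ i * E * (of_real (x i) * P)
       + (\<Sum>j\<in>I. of_real (k / (x i - x j)) * ((E + Ej j) * (of_real (x i) * P)))" .
    show ?thesis using True unfolding f unfolding S_def lapi_def E_def[symmetric] Ej_def[symmetric] P_def[symmetric] scaleR_conv_of_real
      by (simp add: algebra_simps sum_distrib_left)
  qed
  have im: "integrable (LM UNIV) (?M (%_. 1))" "integrable (LM UNIV) (?M (%x. x $ i * 1))"
    by (rule integrable_lapi[OF k hom_const a z], rule integrable_lapi[OF k hom_coord[OF hom_const] a z])
  have sj: "integrable (LM UNIV) (%x. of_real k * S j x) \<and> (\<integral>x. of_real k * S j x \<partial>LM UNIV) = of_real k * lap k a (%_. 1) z" if "j \<in> I" for j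
  proof (cases "k = 0")
    case False
    with k have "0 < k" by simp
    moreover have "i ~= j" using that I by auto
    ultimately have "integrable (LM UNIV) (S j)" "(\<integral>x. S j x \<partial>LM UNIV) = lap k a (%_. 1) z"
      using lap_singular[OF _ a z] unfolding S_def[abs_def] by blast+
    then show ?thesis by (simp only: integral_mult_right_zero integrable_mult_right simp_thms)
  qed simp
  have i1: "integrable (LM UNIV) (%x. a * ?M (%_. 1) x)" by (rule integrable_mult_right[OF im(1)])
  have i2: "integrable (LM UNIV) (%x. z $ i * ?M (%x. x $ i * 1) x)" by (rule integrable_mult_right[OF im(2)])
  have i3: "integrable (LM UNIV) (%x. \<Sum>j\<in>I. of_real k * S j x)" by (rule Bochner_Integration.integrable_sum) (use sj in blast)
  have i12: "integrable (LM UNIV) (%x. a * ?M (%_. 1) x - z $ i * ?M (%x. x $ i * 1) x)" by (rule Bochner_Integration.integrable_diff[OF i1 i2])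
  have iH: "integrable (LM UNIV) ?H" unfolding H by (rule Bochner_Integration.integrable_add[OF i12 i3])
  have "integral\<^sup>L (LM UNIV) ?H = a * lap k a (%_. 1) z - z $ i * lap k a (%x. x $ i * 1) z + (\<Sum>j\<in>I. of_real k * lap k a (%_. 1) z)"
  proof -
    have "(\<integral>x. (\<Sum>j\<in>I. of_real k * S j x) \<partial>LM UNIV) = (\<Sum>j\<in>I. \<integral>x. of_real k * S j x \<partial>LM UNIV)"
      by (rule Bochner_Integration.integral_sum) (use sj in blast)
    also have "... = (\<Sum>j\<in>I. of_real k * lap k a (%_. 1) z)" by (intro sum.cong refl) (use sj in blast)
    finally have s4: "(\<integral>x. (\<Sum>j\<in>I. of_real k * S j x) \<partial>LM UNIV) = (\<Sum>j\<in>I. of_real k * lap k a (%_. 1) z)" .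
    show ?thesis unfolding H Bochner_Integration.integral_add[OF i12 i3] Bochner_Integration.integral_diff[OF i1 i2] s4
      unfolding lap_def by (simp only: integral_mult_right_zero)
  qed
  moreover have "integral\<^sup>L (LM (insert i I)) (%x. (of_bool (pos (insert i I) x) * vd k (insert i I) x) *\<^sub>R (B' x + (\<Sum>j\<in>I. 2 * k / (x i - x j)) *\<^sub>R B x))
     = - (\<integral>x. (of_bool (pos I x) * vd k (insert i I) (x(i := 0))) *\<^sub>R B (x(i := 0)) \<partial>LM I)"
  proof (rule ibp_vd[OF k I])
    show "integrable (LM (insert i I)) (%x. (of_bool (pos (insert i I) x) * vd k (insert i I) x) *\<^sub>R (B' x + (\<Sum>j\<in>I. 2 * k / (x i - x j)) *\<^sub>R B x))"
      unfolding U by (rule iH)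
    show "(%x. (of_bool (pos I x) * vd k (insert i I) (x(i := 0))) *\<^sub>R B (x(i := 0))) \<in> borel_measurable (LM I)"
      by (simp add: B_def h_def)
    fix x :: "'n => real" and t :: real assume x: "x \<in> space (LM I)" "pos I x"
    have Bx: "B (x(i := t)) = dk k (- z) (V (x(i := 0)) + of_real t *s axis i 1) * (h t * dpw I (a - 1) x)" for t
      unfolding B_def V_upd[symmetric] dk_minus[of k z] dpw_upd[OF I(2)] by simp
    have line: "((%w. dk k (- z) (V (x(i := 0)) + w *s axis i 1)) has_field_derivative dderiv (dk k (- z)) (axis i 1) (V (x(i := 0)) + s *s axis i 1)) (at s)" for s
    proof -
      obtain e where "(dk k (- z) has_derivative bil e) (at (V (x(i := 0)) + s *s axis i 1))" "\<And>\<zeta>. dderiv (dk k (- z)) \<zeta> (V (x(i := 0)) + s *s axis i 1) = bil e \<zeta>"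
        using cdiff_dderiv[OF dk_cdiff[OF k, of "- z" "V (x(i := 0)) + s *s axis i 1"]] by blast
      then show ?thesis using has_field_derivative_line_at by metis
    qed
    show "continuous_on {0..} (%t. B (x(i := t)))" unfolding Bx
    proof (intro continuous_on_mult hc(1) continuous_on_const)
      have "continuous_on UNIV (%w. dk k (- z) (V (x(i := 0)) + w *s axis i 1))"
        using line by (intro continuous_at_imp_continuous_on ballI) (auto intro: DERIV_isCont)
      then show "continuous_on {0..} (%t. dk k (- z) (V (x(i := 0)) + of_real t *s axis i 1))"
        by (rule continuous_on_compose2) (auto intro!: continuous_intros)
    qed
    obtain c where c: "0 < c" "\<And>i. c <= Re (z $ i)" using HR_lower[OF z] by blast
    obtain D where D: "0 < D" "\<And>t. 0 <= t ==> (1 + t) powr Re a <= D * exp (c / 2 * t)"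
      using powr_le_exp[of "Re a" "c / 2"] a c by auto
    let ?s = "sqrt (fact CARD('n)) :: real"
    have "norm (B (x(i := t))) <= (?s * D * norm (dpw I (a - 1) x)) * exp (- (c / 2) * t)" if t: "0 <= t" for t
    proof -
      have y0: "0 <= (x(i := t)) l" for l using x(2) t U by (cases "l = i") (auto simp: pos_def I_def intro: less_imp_le)
      have "norm (dk k (- V (x(i := t))) z) <= ?s * exp (- c * (\<Sum>l\<in>UNIV. (x(i := t)) l))" by (rule dk_V_decay[OF k c(2) y0])
      also have "... <= ?s * exp (- c * t)"
      proof -
        have "t <= (\<Sum>l\<in>UNIV. (x(i := t)) l)" using member_le_sum[of i UNIV "x(i := t)", OF UNIV_I y0] by simp
        then show ?thesis using c by (intro mult_left_mono) auto
      qed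
      finally have 1: "norm (dk k (- V (x(i := t))) z) <= ?s * exp (- c * t)" .
      have 2: "norm (h t) <= D * exp (c / 2 * t)" using hc(2)[OF t] D(2)[OF t] powr_mono2[of "Re a" t "1 + t"] a t by simp
      have "norm (B (x(i := t))) <= (?s * exp (- c * t)) * ((D * exp (c / 2 * t)) * norm (dpw I (a - 1) x))"
        unfolding B_def norm_mult dpw_upd[OF I(2)] fun_upd_same by (intro mult_mono 1 2 order_refl mult_nonneg_nonneg) (use D in auto)
      also have "... = (?s * D * norm (dpw I (a - 1) x)) * (exp (- c * t) * exp (c / 2 * t))" by (simp only: mult_ac)
      also have "exp (- c * t) * exp (c / 2 * t) = exp (- (c / 2) * t)" unfolding exp_add[symmetric] by (simp add: field_simps)
      finally show ?thesis .
    qed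
    then show "\<exists>C c. 0 < c \<and> (\<forall>t\<ge>0. norm (B (x(i := t))) <= C * exp (- c * t))"
      using c by (intro exI[of _ "?s * D * norm (dpw I (a - 1) x)"] exI[of _ "c / 2"]) auto
    assume t: "0 < t"
    \<comment> \<open>A holomorphic extension of t \<mapsto> B (x(i := t)) off the negative axis;
      the real derivative is the restriction of its complex derivative.\<close>
    let ?Phi = "%w. dk k (- z) (V (x(i := 0)) + w *s axis i 1) * (w * exp ((a - 1) * Ln w) * dpw I (a - 1) x)"
    have tn: "complex_of_real t \<notin> \<real>\<^sub>\<le>\<^sub>0" "complex_of_real t ~= 0" using t by auto
    have "((%w. w * exp ((a - 1) * Ln w)) has_field_derivative a * exp ((a - 1) * Ln (of_real t))) (at (of_real t))"
      using tn by (auto intro!: derivative_eq_intros simp: field_simps)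
    then have "((%w. w * exp ((a - 1) * Ln w) * dpw I (a - 1) x) has_field_derivative a * exp ((a - 1) * Ln (of_real t)) * dpw I (a - 1) x) (at (of_real t))"
      by (rule DERIV_cmult_right)
    from DERIV_mult[OF line[of "of_real t"] this]
    have "((%t. ?Phi (of_real t)) has_vector_derivative
        dderiv (dk k (- z)) (axis i 1) (V (x(i := 0)) + of_real t *s axis i 1) * (of_real t * exp ((a - 1) * Ln (of_real t)) * dpw I (a - 1) x)
       + a * exp ((a - 1) * Ln (of_real t)) * dpw I (a - 1) x * dk k (- z) (V (x(i := 0)) + of_real t *s axis i 1)) (at t)"
      by (rule has_vector_derivative_real_field)
    also have "dderiv (dk k (- z)) (axis i 1) (V (x(i := 0)) + of_real t *s axis i 1) * (of_real t * exp ((a - 1) * Ln (of_real t)) * dpw I (a - 1) x)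
       + a * exp ((a - 1) * Ln (of_real t)) * dpw I (a - 1) x * dk k (- z) (V (x(i := 0)) + of_real t *s axis i 1) = B' (x(i := t))"
      unfolding B'_def V_upd[symmetric] dpw_upd[OF I(2)] fun_upd_same dk_minus[of k z] h_def using t by (simp add: Ln_of_real mult_ac)
    finally show "((%t. B (x(i := t))) has_vector_derivative B' (x(i := t))) (at t)"
    proof (rule has_vector_derivative_transform_within_open[of _ _ _ "{0<..}"])
      fix s :: real assume "s \<in> {0<..}"
      then show "?Phi (of_real s) = B (x(i := s))" unfolding Bx h_def by (simp add: Ln_of_real del: fun_upd_apply)
    qed (use t in auto)
  qed
  moreover have "B (x(i := 0)) = 0" for x by (simp add: B_def h_def)
  ultimately have "a * lap k a (%_. 1) z - z $ i * lap k a (%x. x $ i * 1) z + (\<Sum>j\<in>I. of_real k * lap k a (%_. 1) z) = 0"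
    unfolding U by simp
  moreover have c1: "real CARD('n) - 1 = real (card I)" unfolding cI by (simp add: of_nat_diff Suc_leI)
  ultimately show ?thesis unfolding c1 by (simp add: algebra_simps)
qed

lemma lap_sum:
  fixes z :: "complex^'n::{finite,linorder}"
  assumes "finite A" "\<And>i. i \<in> A ==> hom m (q i)" and k: "0 <= k" and a: "0 < Re a" and z: "HR z"
  shows "lap k a (%x. \<Sum>i\<in>A. c i * q i x) z = (\<Sum>i\<in>A. c i * lap k a (q i) z)"
  using assms(1,2)
proof (induction A rule: finite_induct)
  case empty then show ?case by (simp add: lap_def lapi_def)
next
  case (insert i A)
  have "hom m (%x. \<Sum>i\<in>A. c i * q i x)" by (rule hom_sum[OF insert.hyps(1)]) (rule hom_cmult, use insert in auto)
  then have "lap k a (%x. (\<Sum>i\<in>A. c i * q i x) + c i * q i x) z = (\<Sum>i\<in>A. c i * lap k a (q i) z) + c i * lap k a (q i) z"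
    using lap_add[OF k _ _ a z, of m "%x. \<Sum>i\<in>A. c i * q i x" "q i" "c i"] insert by simp
  moreover have "(%x. \<Sum>i\<in>insert i A. c i * q i x) = (%x. (\<Sum>i\<in>A. c i * q i x) + c i * q i x)"
    using insert by (simp add: add.commute)
  ultimately show ?case using insert by (simp add: add.commute)
qed

text \<open>The transform of 1 is symmetric in z. On the diagonal the divided difference is the
  derivative at 0 of an even function of t.\<close>

lemma lap_one_divdiff:
  fixes z :: "complex^'n::{finite,linorder}"
  assumes k: "0 <= k" and a: "0 < Re a" and z: "HR z"
  shows "divdiff (lap k a (%_. 1)) i j z = 0"
proof (cases "z $ i = z $ j")
  case False
  then show ?thesis using lap_swapc[OF k hom_const, of a 1 i j z] by (simp add: divdiff_def)
next
  case True
  let ?\<xi> = "axis i 1 - axis j 1 :: (complex, 'n) vec"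
  let ?g = "%t. lap k a (%_. 1) (z + t *s ?\<xi>)"
  have ev: "?g (- t) = ?g t" for t
  proof -
    have "swapc i j (z + t *s ?\<xi>) = z + (- t) *s ?\<xi>"
      using True by (auto simp: vec_eq_iff swapc_nth axis_component tsp_def)
    then show ?thesis using lap_swapc[OF k hom_const, of a 1 i j "z + t *s ?\<xi>"] by simp
  qed
  obtain D where D: "(?g has_field_derivative D) (at 0)" using lap_line(1)[OF k hom_const a z] by blast
  have "((%t. ?g (- t)) has_field_derivative D * (- 1)) (at 0)"
    using D by (intro DERIV_chain2[of ?g D "%t. - t" 0 "- 1"]) (auto intro!: derivative_eq_intros)
  then have "D * (- 1) = D" unfolding ev using D DERIV_unique by blast
  then have "D = 0" by simp
  then show ?thesis using D True by (simp add: divdiff_def dderiv_def DERIV_imp_deriv)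
qed

text \<open>The Dunkl operator acts on this symmetric function as an ordinary derivative, while
  \<open>lap_dunkl\<close> and \<open>lap_coord\<close> compute its value.\<close>

lemma lap_one_line:
  fixes z \<xi> :: "complex^'n::{finite,linorder}"
  assumes k: "0 <= k" and a: "0 < Re a" and z: "HR z"
  defines "\<mu> \<equiv> a + of_real (k * (real CARD('n) - 1))"
  shows "((%t. lap k a (%_. 1) (z + t *s \<xi>)) has_field_derivative - (\<mu> * (\<Sum>i\<in>UNIV. \<xi> $ i / z $ i) * lap k a (%_. 1) z)) (at 0)"
proof -
  note z0 = HR_nz[OF z]
  have "lap k a (%x. bil x \<xi> * 1) z = lap k a (%x. \<Sum>i\<in>UNIV. \<xi> $ i * (x $ i * 1)) z"
    by (simp add: bil_def mult.commute)
  also have "... = (\<Sum>i\<in>UNIV. \<xi> $ i * lap k a (%x. x $ i * 1) z)"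
    by (rule lap_sum[OF _ _ k a z]) (auto intro: hom_coord[OF hom_const, of _ 1, simplified] hom_coord[OF hom_const])
  also have "... = (\<Sum>i\<in>UNIV. \<xi> $ i / z $ i * (\<mu> * lap k a (%_. 1) z))"
  proof (intro sum.cong refl)
    fix i show "\<xi> $ i * lap k a (%x. x $ i * 1) z = \<xi> $ i / z $ i * (\<mu> * lap k a (%_. 1) z)"
      unfolding \<mu>_def lap_coord[OF k a z, of i, symmetric] using z0[of i] by simp
  qed
  also have "... = \<mu> * (\<Sum>i\<in>UNIV. \<xi> $ i / z $ i) * lap k a (%_. 1) z" unfolding sum_distrib_right[symmetric] by (simp add: mult_ac)
  finally have "dunkl_op k \<xi> (lap k a (%_. 1)) z = - (\<mu> * (\<Sum>i\<in>UNIV. \<xi> $ i / z $ i) * lap k a (%_. 1) z)"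
    unfolding lap_dunkl[OF k hom_const a z] by simp
  moreover have "dunkl_op k \<xi> (lap k a (%_. 1)) z = dderiv (lap k a (%_. 1)) \<xi> z"
    unfolding dunkl_op_def using lap_one_divdiff[OF k a z] by simp
  ultimately show ?thesis using lap_line(1)[OF k hom_const a z, of 1 \<xi>] lap_dderiv[OF k hom_const a z, of 1 \<xi>] by simp
qed

lemma lap_ones: "0 <= k ==> lap k a (%_. 1) (ones :: complex^'n::{finite,linorder}) = CS k (UNIV :: 'n set) a"
  unfolding lap_def CS_def
  by (intro Bochner_Integration.integral_cong refl)
     (simp add: lapi_def dk_sym[of k _ ones] dk_ones sum_negf exp_of_real[symmetric] mult.commute)

text \<open>By \<open>lap_one_line\<close> the product of the transform with the power \<mu> of
  \<Delta> has derivative 0 along the segment from \<open>ones\<close> to z, which stays in the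
  half-space. At \<open>ones\<close> the kernel is an exponential and the transform is the Selberg
  integral.\<close>

theorem lap_one:
  fixes z :: "complex^'n::{finite,linorder}"
  assumes k: "0 <= k" and a: "0 < Re a" and z: "HR z"
  defines "\<mu> \<equiv> a + of_real (k * (real CARD('n) - 1))"
  shows "lap k a (%_. 1) z = CS k (UNIV :: 'n set) a * Delta_pow z (- \<mu>)"
proof -
  define \<xi> where "\<xi> = z - ones"
  let ?S = "closed_segment 0 (1 :: complex)"
  let ?w = "%t. ones + t *s \<xi>"
  have w: "HR (?w s)" if sS: "s \<in> ?S" for s
  proof
    fix i
    obtain u where u: "0 <= u" "u <= 1" "s = of_real u" using sS unfolding in_segment(1) by (auto simp: scaleR_conv_of_real)
    have "?w s $ i = of_real (1 - u) + of_real u * z $ i" unfolding \<xi>_def u by (simp add: ones_def algebra_simps)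
    then have "Re (?w s $ i) = (1 - u) + u * Re (z $ i)" by simp
    moreover have "0 < (1 - u) + u * Re (z $ i)"
    proof -
      have p: "0 < Re (z $ i)" using z by blast
      have "0 <= u * Re (z $ i)" using u p by simp
      moreover have "u < 1" if "u ~= 1" using that u by simp
      ultimately show ?thesis using p by (cases "u = 1") (simp, linarith)
    qed
    ultimately show "0 < Re (?w s $ i)" by simp
  qed
  define f where "f t = lap k a (%_. 1) (?w t) * exp (\<mu> * (\<Sum>j\<in>UNIV. Ln (?w t $ j)))" for t
  have "(f has_field_derivative 0) (at s within ?S)" if s: "s \<in> ?S" for s
  proof -
    have nz: "?w s $ j \<notin> \<real>\<^sub>\<le>\<^sub>0" for j using w[OF s, rule_format, of j] unfolding complex_nonpos_Reals_iff by linarith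
    let ?D = "\<Sum>j\<in>UNIV. \<xi> $ j / ?w s $ j"
    have "(%t. lap k a (%_. 1) (?w (t + s))) = (%t. lap k a (%_. 1) (?w s + t *s \<xi>))"
      by (simp add: vector_sadd_rdistrib add_ac)
    then have "((%t. lap k a (%_. 1) (?w t)) has_field_derivative - (\<mu> * ?D * lap k a (%_. 1) (?w s))) (at (0 + s))"
      unfolding DERIV_shift using lap_one_line[OF k a w[OF s], of \<xi>] by (simp only: \<mu>_def)
    then have 1: "((%t. lap k a (%_. 1) (?w t)) has_field_derivative - (\<mu> * ?D * lap k a (%_. 1) (?w s))) (at s)" by simp
    have c: "((%t. ?w t $ j) has_field_derivative \<xi> $ j) (at s)" for j
      by (simp add: ones_def) (auto intro!: derivative_eq_intros)
    have "((%t. Ln (?w t $ j)) has_field_derivative inverse (?w s $ j) * \<xi> $ j) (at s)" for j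
      by (rule DERIV_chain2[of Ln, OF has_field_derivative_Ln[OF nz] c])
    then have "((%t. \<Sum>j\<in>UNIV. Ln (?w t $ j)) has_field_derivative ?D) (at s)"
      by (intro DERIV_sum) (simp add: field_simps)
    then have "((%t. \<mu> * (\<Sum>j\<in>UNIV. Ln (?w t $ j))) has_field_derivative \<mu> * ?D) (at s)" by (rule DERIV_cmult)
    then have 2: "((%t. exp (\<mu> * (\<Sum>j\<in>UNIV. Ln (?w t $ j)))) has_field_derivative exp (\<mu> * (\<Sum>j\<in>UNIV. Ln (?w s $ j))) * (\<mu> * ?D)) (at s)"
      by (rule DERIV_chain2[OF DERIV_exp])
    have "(f has_field_derivative 0) (at s)" unfolding f_def[abs_def] using DERIV_mult[OF 1 2] by (simp add: algebra_simps)
    then show ?thesis by (rule has_field_derivative_at_within)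
  qed
  then obtain C where "\<And>s. s \<in> ?S ==> f s = C" using has_field_derivative_zero_constant[of ?S f] by auto
  then have "f 1 = f 0" by simp
  moreover have "?w 1 = z" "?w 0 = ones" by (simp_all add: \<xi>_def)
  moreover have "(\<Sum>j\<in>(UNIV :: 'n set). Ln (ones $ j)) = 0" by (simp add: ones_def)
  ultimately have "lap k a (%_. 1) z * exp (\<mu> * (\<Sum>j\<in>UNIV. Ln (z $ j))) = CS k (UNIV :: 'n set) a"
    unfolding f_def lap_ones[OF k, symmetric] by (simp only: mult_zero_right exp_zero mult_1_right)
  then have "CS k (UNIV :: 'n set) a * Delta_pow z (- \<mu>) = lap k a (%_. 1) z * (exp (\<mu> * (\<Sum>j\<in>UNIV. Ln (z $ j))) * exp (- \<mu> * (\<Sum>j\<in>UNIV. Ln (z $ j))))"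
    by (simp add: Delta_pow_def mult.assoc[symmetric])
  also have "exp (\<mu> * (\<Sum>j\<in>UNIV. Ln (z $ j))) * exp (- \<mu> * (\<Sum>j\<in>UNIV. Ln (z $ j))) = 1" unfolding exp_add[symmetric] by simp
  finally show ?thesis by simp
qed

subsection \<open>Inversion of the argument\<close>

text \<open>The shape of the transforms: for an eigenpolynomial q of the recursion
  \<open>lap\<close> will be a constant multiple of \<open>gg \<mu> q\<close>.\<close>

definition gg :: "complex => (complex^('n::finite) => complex) => complex^('n::finite) => complex" where
  "gg \<mu> q z = Delta_pow z (- \<mu>) * q (cinv z)"

lemma has_derivative_Delta_pow:
  fixes z :: "complex^'n::finite"
  assumes z: "HR z"
  shows "((%z. Delta_pow z s) has_derivative bil (\<chi> l. s / z $ l * Delta_pow z s)) (at z)"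
proof -
  have nz: "z $ j \<notin> \<real>\<^sub>\<le>\<^sub>0" for j using z[rule_format, of j] by (auto simp: complex_nonpos_Reals_iff)
  have "((%z. Ln (z $ j)) has_derivative (%h. inverse (z $ j) * bil (axis j 1) h)) (at z)" for j
    by (rule has_derivative_compose[OF has_derivative_coord has_field_derivative_Ln[OF nz, unfolded has_field_derivative_def]])
  then have "((%z. s * (\<Sum>j\<in>UNIV. Ln (z $ j))) has_derivative (%h. s * (\<Sum>j\<in>UNIV. inverse (z $ j) * bil (axis j 1) h))) (at z)"
    by (intro has_derivative_mult_right has_derivative_sum)
  then have "((%z. Delta_pow z s) has_derivative (%h. Delta_pow z s * (s * (\<Sum>j\<in>UNIV. inverse (z $ j) * bil (axis j 1) h)))) (at z)"
    unfolding Delta_pow_def by (rule has_derivative_compose[OF _ DERIV_exp[unfolded has_field_derivative_def]])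
  also have "(%h. Delta_pow z s * (s * (\<Sum>j\<in>UNIV. inverse (z $ j) * bil (axis j 1) h))) = bil (\<chi> l. s / z $ l * Delta_pow z s)"
    by (rule ext) (simp add: bil_def[of "\<chi> l. _ l"] sum_distrib_left sum_distrib_right field_simps)
  finally show ?thesis .
qed

lemma has_derivative_cinv:
  fixes z :: "complex^'n::finite"
  assumes z: "\<And>l. z $ l ~= 0"
  shows "(cinv has_derivative (%h. \<chi> l. - (h $ l) / (z $ l)^2)) (at z)"
proof (rule iffD2[OF has_derivative_componentwise_within], rule ballI)
  fix u :: "complex^'n" assume "u \<in> Basis"
  then obtain i v where u: "u = axis i v" by (auto simp: Basis_vec_def)
  have "((%w. 1 / w) has_field_derivative - 1 / (z $ i)^2) (at (z $ i))"
    using z by (auto intro!: derivative_eq_intros simp: power2_eq_square)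
  from has_derivative_compose[OF has_derivative_coord this[unfolded has_field_derivative_def]]
  have "((%z. 1 / z $ i) has_derivative (%h. - (h $ i) / (z $ i)^2)) (at z)" by simp
  then have "((%z. (1 / z $ i) \<bullet> v) has_derivative (%h. (- (h $ i) / (z $ i)^2) \<bullet> v)) (at z)" by (rule has_derivative_inner_left)
  then show "((%x. cinv x \<bullet> u) has_derivative (%x. (\<chi> l. - (x $ l) / (z $ l)^2) \<bullet> u)) (at z)"
    by (simp add: u cinv_def inner_axis)
qed

lemma has_derivative_gg:
  fixes z :: "complex^'n::finite"
  assumes z: "HR z" and q: "(q has_derivative bil e) (at (cinv z))"
  shows "(gg \<mu> q has_derivative bil (\<chi> l. - Delta_pow z (- \<mu>) * (\<mu> / z $ l * q (cinv z) + e $ l / (z $ l)^2))) (at z)"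
proof -
  note z0 = HR_nz[OF z]
  have "((%z. q (cinv z)) has_derivative (%h. bil e (\<chi> l. - (h $ l) / (z $ l)^2))) (at z)"
    using has_derivative_compose[OF has_derivative_cinv[OF z0] q] .
  also have "(%h. bil e (\<chi> l. - (h $ l) / (z $ l)^2)) = bil (\<chi> l. - (e $ l) / (z $ l)^2)"
    by (rule ext) (simp add: bil_def)
  finally have "((%z. q (cinv z)) has_derivative bil (\<chi> l. - (e $ l) / (z $ l)^2)) (at z)" .
  from has_derivative_bil_mult[OF has_derivative_Delta_pow[OF z, of "- \<mu>"] this]
  have "(gg \<mu> q has_derivative bil (Delta_pow z (- \<mu>) *s (\<chi> l. - (e $ l) / (z $ l)^2) + q (cinv z) *s (\<chi> l. - \<mu> / z $ l * Delta_pow z (- \<mu>)))) (at z)"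
    by (simp add: gg_def[abs_def])
  moreover have "Delta_pow z (- \<mu>) *s (\<chi> l. - (e $ l) / (z $ l)^2) + q (cinv z) *s (\<chi> l. - \<mu> / z $ l * Delta_pow z (- \<mu>))
     = (\<chi> l. - Delta_pow z (- \<mu>) * (\<mu> / z $ l * q (cinv z) + e $ l / (z $ l)^2))"
    by (simp add: vec_eq_iff algebra_simps)
  ultimately show ?thesis by simp
qed

lemma cinv_swapc: "cinv (swapc a b z) = swapc a b (cinv z)"
  by (simp add: cinv_def swapc_def vec_eq_iff)

lemma Delta_pow_swapc: "Delta_pow (swapc a b z) s = Delta_pow z s"
proof -
  have "(\<Sum>l\<in>UNIV. Ln (swapc a b z $ l)) = (\<Sum>l\<in>UNIV. Ln (z $ l))" unfolding swapc_nth
    by (rule sum.reindex_bij_witness[of _ "tsp a b" "tsp a b"]) auto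
  then show ?thesis by (simp add: Delta_pow_def)
qed

lemma gg_swapc: "gg \<mu> q (swapc a b z) = gg \<mu> (%x. q (swapc a b x)) z"
  by (simp add: gg_def cinv_swapc Delta_pow_swapc)

lemma gg_divdiff:
  fixes z :: "complex^'n::finite"
  assumes z: "HR z" and q: "cdiff q (cinv z)" and ij: "i ~= j"
  shows "divdiff (gg \<mu> q) i j z = - Delta_pow z (- \<mu>) * (1 / (z $ i * z $ j)) * divdiff q i j (cinv z)"
proof -
  note z0 = HR_nz[OF z]
  show ?thesis
  proof (cases "z $ i = z $ j")
    case True
    obtain e where e: "(q has_derivative bil e) (at (cinv z))" "\<And>\<xi>. dderiv q \<xi> (cinv z) = bil e \<xi>" using cdiff_dderiv[OF q] by blast
    show ?thesis unfolding divdiff_def dderiv_eq[OF has_derivative_gg[OF z e(1)]] e(2) using True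
      by (simp add: cinv_def power2_eq_square algebra_simps diff_divide_distrib)
  next
    case False
    then have ne: "1 / z $ i ~= 1 / z $ j" by simp
    have A: "(1 / z $ i - 1 / z $ j) = - (z $ i - z $ j) / (z $ i * z $ j)" using z0 by (simp add: field_simps)
    have B: "divdiff (gg \<mu> q) i j z = Delta_pow z (- \<mu>) * (q (cinv z) - q (swapc i j (cinv z))) / (z $ i - z $ j)"
      using False by (simp add: divdiff_def gg_def cinv_swapc Delta_pow_swapc algebra_simps)
    have C: "divdiff q i j (cinv z) = (q (cinv z) - q (swapc i j (cinv z))) / (1 / z $ i - 1 / z $ j)"
      using ne by (simp add: divdiff_def cinv_def)
    have "z $ i - z $ j ~= 0" using False by simp
    then show ?thesis unfolding A B C using z0[of i] z0[of j] by (simp add: field_simps)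
  qed
qed

lemma divdiff_coord: "x $ i * divdiff q i j x = x $ j * divdiff q i j x + (q x - q (swapc i j x))"
  by (cases "x $ i = x $ j") (auto simp: divdiff_def swapc_eq_self divide_simps algebra_simps)

text \<open>Conjugating \<open>-z\<^sub>a T\<^sub>a\<close> by the inversion \<open>z \<mapsto> 1/z\<close> and by \<open>\<Delta>\<^bsup>-\<mu>\<^esup>\<close> gives back a Cherednik operator,
  the one for which \<open>a\<close> comes first in the order.\<close>
lemma gg_dunkl:
  fixes z :: "complex^'n::{finite,linorder}"
  assumes z: "HR z" and q: "\<And>x. cdiff q x"
  shows "- (z $ a) * dT k a (gg \<mu> q) z = gg \<mu> (%x. \<mu> * q x + (x $ a * dT k a q x + of_real (k * (1 - real CARD('n))) * q x
      + of_real k * (\<Sum>b\<in>-{a}. q (swapc b a x)))) z"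
proof -
  let ?y = "cinv z" and ?D = "Delta_pow z (- \<mu>)"
  note z0 = HR_nz[OF z]
  have y: "?y $ l = 1 / z $ l" for l by (simp add: cinv_def)
  obtain e where e: "(q has_derivative bil e) (at ?y)" "\<And>\<xi>. dderiv q \<xi> ?y = bil e \<xi>" using cdiff_dderiv[OF q] by blast
  have cg: "cdiff (gg \<mu> q) z" unfolding cdiff_def using has_derivative_gg[OF z e(1)] by blast
  have d: "dderiv (gg \<mu> q) (axis a 1) z = - ?D * (\<mu> / z $ a * q ?y + e $ a / (z $ a)^2)"
    unfolding dderiv_eq[OF has_derivative_gg[OF z e(1)]] by simp
  have 1: "- (z $ a) * dderiv (gg \<mu> q) (axis a 1) z = ?D * (\<mu> * q ?y + ?y $ a * dderiv q (axis a 1) ?y)"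
    unfolding d e(2) y using z0[of a] by (simp add: field_simps power2_eq_square)
  have 2: "- (z $ a) * divdiff (gg \<mu> q) a b z = ?D * (?y $ a * divdiff q a b ?y - (q ?y - q (swapc a b ?y)))" if "b \<in> -{a}" for b
  proof -
    have ab: "a ~= b" using that by auto
    have "- (z $ a) * divdiff (gg \<mu> q) a b z = ?D * (?y $ b * divdiff q a b ?y)"
      unfolding gg_divdiff[OF z q ab] y using z0[of a] by (simp add: field_simps)
    then show ?thesis using divdiff_coord[of ?y a q b] by (simp add: algebra_simps)
  qed
  have c: "of_nat (card (- {a})) = (of_nat CARD('n) - 1 :: complex)"
  proof -
    have "Suc (card (- {a})) = CARD('n)" 
    proof -
      have "insert a (- {a}) = UNIV" by auto
      then show ?thesis using card_insert_disjoint[of "- {a}" a] by simp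
    qed
    then have "of_nat CARD('n) = (1 + of_nat (card (- {a})) :: complex)" by (metis of_nat_Suc)
    then show ?thesis by simp
  qed
  have "- (z $ a) * dT k a (gg \<mu> q) z = - (z $ a) * dderiv (gg \<mu> q) (axis a 1) z + of_real k * (\<Sum>b\<in>-{a}. - (z $ a) * divdiff (gg \<mu> q) a b z)"
    unfolding dunkl_axis[OF cg] by (simp add: sum_distrib_left sum_negf algebra_simps)
  also have "... = ?D * (\<mu> * q ?y + ?y $ a * dderiv q (axis a 1) ?y) + of_real k * (\<Sum>b\<in>-{a}. ?D * (?y $ a * divdiff q a b ?y - (q ?y - q (swapc a b ?y))))"
    unfolding 1 using 2 by simp
  also have "(\<Sum>b\<in>-{a}. ?D * (?y $ a * divdiff q a b ?y - (q ?y - q (swapc a b ?y))))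
    = ?D * (?y $ a * (\<Sum>b\<in>-{a}. divdiff q a b ?y) - ((of_nat CARD('n) - 1) * q ?y - (\<Sum>b\<in>-{a}. q (swapc a b ?y))))"
    unfolding sum_distrib_left[symmetric] sum_subtractf c[symmetric] by simp
  also have "?D * (\<mu> * q ?y + ?y $ a * dderiv q (axis a 1) ?y)
     + of_real k * (?D * (?y $ a * (\<Sum>b\<in>-{a}. divdiff q a b ?y) - ((of_nat CARD('n) - 1) * q ?y - (\<Sum>b\<in>-{a}. q (swapc a b ?y)))))
    = gg \<mu> (%x. \<mu> * q x + (x $ a * dT k a q x + of_real (k * (1 - real CARD('n))) * q x + of_real k * (\<Sum>b\<in>-{a}. q (swapc b a x)))) z"
    unfolding gg_def dunkl_axis[OF q] swapc_commute[of _ a] by (simp add: algebra_simps)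
  finally show ?thesis .
qed

text \<open>The half-space is open and invariant under transpositions, so derivatives and reflected
  values at z use values there only. This makes the operator applicable to a formula for
  \<open>lap\<close> that is known only on the half-space.\<close>

lemma dunkl_cong:
  fixes z :: "complex^'n::{finite,linorder}"
  assumes z: "HR z" and eq: "\<And>z. HR z ==> f z = g z"
  shows "dunkl_op k \<xi> f z = dunkl_op k \<xi> g z"
proof -
  have "dderiv f \<zeta> z = dderiv g \<zeta> z" for \<zeta>
  proof -
    have "eventually (%t. 0 < Re ((z + t *s \<zeta>) $ i)) (nhds 0)" for i
    proof -
      have "open {t. 0 < Re (z $ i + t * \<zeta> $ i)}" by (intro open_Collect_less continuous_intros)
      from eventually_nhds_in_open[OF this, of 0] show ?thesis using z by simp
    qed
    then have "eventually (%t. HR (z + t *s \<zeta>)) (nhds 0)" by (simp add: eventually_all_finite)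
    then have "eventually (%t. f (z + t *s \<zeta>) = g (z + t *s \<zeta>)) (nhds 0)" by (rule eventually_mono) (rule eq)
    then show ?thesis unfolding dderiv_def by (intro deriv_cong_ev) auto
  qed
  then have "divdiff f i j z = divdiff g i j z" for i j using eq[OF z] eq[OF HR_swapc[OF z]] by (simp add: divdiff_def)
  then show ?thesis unfolding dunkl_op_def using \<open>\<And>\<zeta>. dderiv f \<zeta> z = dderiv g \<zeta> z\<close> by simp
qed

subsection \<open>Jack polynomials\<close>

text \<open>The generalized Pochhammer symbol of the decreasing rearrangement, expressed through the
  ranks in the order \<open>xs\<close>; in this form its change along the recursion can be
  followed.\<close>

definition bt :: "real => complex => 'n list => ('n::finite => nat) => complex" where
  "bt k \<mu> xs \<eta> = (\<Prod>j\<in>UNIV. pochhammer (\<mu> - of_real (k * real (rk xs \<eta> j))) (\<eta> j))"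

lemma rk_raise:
  assumes "cord (a # xs)"
  shows "rk (xs @ [a]) (\<eta>(a := Suc (\<eta> a))) j = rk (a # xs) \<eta> j"
proof -
  have d: "a \<notin> set xs" "set xs = - {a}" using assms by (auto simp: cord_def)
  have s: "aft xs j \<subseteq> - {a}" using aft_subset[of xs j] d by auto
  have "aft (a # xs) j = (if j = a then set xs else aft xs j)" using aft_append[of "[a]" xs j] by auto
  moreover have "aft (xs @ [a]) j = (if j = a then {} else insert a (aft xs j))"
    using aft_append[of xs "[a]" j] d by auto
  ultimately show ?thesis unfolding rk_def using d s by (intro arg_cong[where f = card] Collect_cong) auto
qed

theorem lap_jrec:
  fixes f :: "complex^'n::{finite,linorder} => complex"
  assumes k: "0 <= k" and a: "0 < Re s"
  defines "\<mu> \<equiv> s + of_real (k * (real CARD('n) - 1))"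
  assumes "jrec k xs \<eta> f" "HR z"
  shows "lap k s f z = CS k (UNIV :: 'n set) s * bt k \<mu> xs \<eta> * gg \<mu> f z"
  using assms(4,5)
proof (induction arbitrary: z rule: jrec.induct)
  case (jrec_one xs)
  then show ?case using lap_one[OF k a] by (simp add: bt_def gg_def \<mu>_def)
next
  case (jrec_raise b xs \<eta> f)
  note h = jrec_hom[OF jrec_raise.hyps]
  let ?A = "CS k (UNIV :: 'n set) s"
  have zb: "z $ b ~= 0" by (rule HR_nz[OF jrec_raise.prems])
  have co: "cord (b # xs)" by (rule jrec_cord[OF jrec_raise.hyps])
  have aft: "aft (b # xs) b = - {b}" using co aft_append[of "[b]" xs b] by (auto simp: cord_def)
  have "lap k s (%x. x $ b * f x) z = - dT k b (lap k s f) z" using lap_dunkl[OF k h a jrec_raise.prems, of "axis b 1"] by simp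
  also have "dT k b (lap k s f) z = dT k b (%z. ?A * bt k \<mu> (b # xs) \<eta> * gg \<mu> f z) z"
    by (rule dunkl_cong[OF jrec_raise.prems]) (rule jrec_raise.IH)
  also have "... = ?A * bt k \<mu> (b # xs) \<eta> * dT k b (gg \<mu> f) z"
  proof (rule dunkl_cmult)
    obtain e where "(f has_derivative bil e) (at (cinv z))" using cdiff_dderiv[OF hom_cdiff[OF h]] by blast
    then show "cdiff (gg \<mu> f) z" unfolding cdiff_def using has_derivative_gg[OF jrec_raise.prems] by blast
  qed
  also have "- ... = ?A * bt k \<mu> (b # xs) \<eta> * (1 / z $ b) * (- (z $ b) * dT k b (gg \<mu> f) z)" using zb by simp
  also have "- (z $ b) * dT k b (gg \<mu> f) z = gg \<mu> (%x. \<mu> * f x + DD k (b # xs) b f x) z"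
    unfolding gg_dunkl[OF jrec_raise.prems hom_cdiff[OF h]] DD_def aft ..
  also have "... = (\<mu> + of_real (ev k (b # xs) \<eta> b)) * gg \<mu> f z"
    unfolding jrec_DD[OF jrec_raise.hyps k] by (simp add: gg_def algebra_simps)
  also have "?A * bt k \<mu> (b # xs) \<eta> * (1 / z $ b) * ((\<mu> + of_real (ev k (b # xs) \<eta> b)) * gg \<mu> f z)
     = ?A * (bt k \<mu> (b # xs) \<eta> * (\<mu> + of_real (ev k (b # xs) \<eta> b))) * gg \<mu> (%x. x $ b * f x) z"
    by (simp add: gg_def cinv_def)
  \<comment> \<open>Raising leaves all ranks unchanged, and \<mu> + \<open>ev\<close> equals \<mu> -
    k \<open>rk\<close> + \<eta> b, precisely the next factor of the Pochhammer symbol belonging to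
    b.\<close>
  also have "bt k \<mu> (b # xs) \<eta> * (\<mu> + of_real (ev k (b # xs) \<eta> b)) = bt k \<mu> (xs @ [b]) (\<eta>(b := Suc (\<eta> b)))"
  proof -
    let ?p = "%\<eta>' j. pochhammer (\<mu> - of_real (k * real (rk (b # xs) \<eta> j))) (\<eta>' j)"
    have "bt k \<mu> (xs @ [b]) (\<eta>(b := Suc (\<eta> b))) = (\<Prod>j\<in>UNIV. ?p (\<eta>(b := Suc (\<eta> b))) j)" unfolding bt_def rk_raise[OF co] ..
    also have "... = ?p (\<eta>(b := Suc (\<eta> b))) b * (\<Prod>j\<in>UNIV - {b}. ?p (\<eta>(b := Suc (\<eta> b))) j)" by (rule prod.remove) auto
    also have "(\<Prod>j\<in>UNIV - {b}. ?p (\<eta>(b := Suc (\<eta> b))) j) = (\<Prod>j\<in>UNIV - {b}. ?p \<eta> j)" by (intro prod.cong) auto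
    also have "?p (\<eta>(b := Suc (\<eta> b))) b = ?p \<eta> b * (\<mu> + of_real (ev k (b # xs) \<eta> b))" by (simp add: pochhammer_Suc ev_def algebra_simps)
    also have "?p \<eta> b * (\<mu> + of_real (ev k (b # xs) \<eta> b)) * (\<Prod>j\<in>UNIV - {b}. ?p \<eta> j) = (\<mu> + of_real (ev k (b # xs) \<eta> b)) * (?p \<eta> b * (\<Prod>j\<in>UNIV - {b}. ?p \<eta> j))" by simp
    also have "?p \<eta> b * (\<Prod>j\<in>UNIV - {b}. ?p \<eta> j) = bt k \<mu> (b # xs) \<eta>" unfolding bt_def by (rule prod.remove[symmetric]) auto
    finally show ?thesis by (simp add: mult.commute del: fun_upd_apply)
  qed
  finally show ?case .
next
  case (jrec_eq ys b c zs \<eta> f)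
  note h = jrec_hom[OF jrec_eq.hyps(1)] and co = jrec_cord[OF jrec_eq.hyps(1)]
  \<comment> \<open>The ranks of the tied coordinates b and c are exchanged, but their entries
    agree, so the factors are merely permuted.\<close>
  have "bt k \<mu> (ys @ c # b # zs) \<eta> = bt k \<mu> (ys @ b # c # zs) \<eta>"
    unfolding bt_def rk_swap_eq[OF co jrec_eq.hyps(2)]
    by (rule prod.reindex_bij_witness[of _ "tsp b c" "tsp b c"])
       (use jrec_eq.hyps(2) in \<open>auto simp: tsp_def\<close>)
  then show ?case unfolding lap_swapc[OF k h, symmetric] gg_swapc[symmetric] using jrec_eq.IH[OF HR_swapc[OF jrec_eq.prems]] by simp
next
  case (jrec_neq ys b c zs \<eta> f d)
  note h = jrec_hom[OF jrec_neq.hyps(1)] and co = jrec_cord[OF jrec_neq.hyps(1)]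
  have bt: "bt k \<mu> (ys @ c # b # zs) \<eta> = bt k \<mu> (ys @ b # c # zs) \<eta>" unfolding bt_def rk_swap_neq[OF co jrec_neq.hyps(2)] ..
  have gg: "gg \<mu> (%x. f x + of_real d * f (swapc b c x)) z = gg \<mu> f z + of_real d * gg \<mu> f (swapc b c z)"
    unfolding gg_swapc by (simp add: gg_def algebra_simps)
  show ?case unfolding lap_add[OF k h hom_swapc[OF h] a jrec_neq.prems] lap_swapc[OF k h, symmetric] gg bt
    using jrec_neq.IH[OF jrec_neq.prems] jrec_neq.IH[OF HR_swapc[OF jrec_neq.prems, of b c]] by (simp add: algebra_simps)
qed

section \<open>Transfer to Lebesgue measure\<close>

lemma Basis_real_vec: "Basis = (%i. axis i 1 :: real^'n::finite) ` UNIV"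
  by (auto simp: Basis_vec_def)

lemma prod_Basis_vec: "(\<Prod>b\<in>Basis. f b) = (\<Prod>i\<in>UNIV. f (axis i 1 :: real^'n::finite))"
  unfolding Basis_real_vec by (subst prod.reindex) (auto simp: inj_on_def axis_eq_axis)

lemma measurable_vec_lambda: "(%x. \<chi> l. x l) \<in> measurable (LM UNIV) (borel :: (real^'n::finite) measure)"
proof (rule iffD2[OF borel_measurable_euclidean_space], rule ballI)
  fix u :: "real^'n" assume "u \<in> Basis"
  then obtain i where "u = axis i 1" by (auto simp: Basis_real_vec)
  then show "(%x. (\<chi> l. x l) \<bullet> u) \<in> borel_measurable (LM UNIV)" using measurable_LM_coord[of i UNIV] by (simp add: inner_axis)
qed

lemma lborel_vec: "lborel = distr (LM UNIV) borel (%x. \<chi> l. x l :: real^'n::finite)"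
proof (rule lborel_eqI)
  interpret product_sigma_finite "%_::'n. lborel :: real measure" by (rule product_sigma_finite_lborel)
  fix l u :: "real^'n" assume "\<And>b. b \<in> Basis ==> l \<bullet> b <= u \<bullet> b"
  then have le: "l $ i <= u $ i" for i using inner_axis[of l i 1] inner_axis[of u i 1] by (metis Basis_real_vec UNIV_I image_eqI inner_real_def mult.right_neutral)
  have "(%x. \<chi> l. x l) -` box l u \<inter> space (LM UNIV) = (\<Pi>\<^sub>E i\<in>UNIV. {l $ i <..< u $ i})"
    by (auto simp: mem_box_cart space_PiM PiE_iff)
  then have "emeasure (distr (LM UNIV) borel (%x. \<chi> l. x l)) (box l u) = emeasure (LM UNIV) (\<Pi>\<^sub>E i\<in>UNIV. {l $ i <..< u $ i})"
    by (subst emeasure_distr[OF measurable_vec_lambda]) auto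
  also have "... = (\<Prod>i\<in>UNIV. emeasure lborel {l $ i <..< u $ i})" by (rule emeasure_PiM) auto
  also have "... = (\<Prod>i\<in>UNIV. ennreal (u $ i - l $ i))" using le by simp
  also have "... = ennreal (\<Prod>i\<in>UNIV. u $ i - l $ i)" using le by (intro prod_ennreal) auto
  also have "(\<Prod>i\<in>UNIV. u $ i - l $ i) = (\<Prod>b\<in>Basis. (u - l) \<bullet> b)" unfolding prod_Basis_vec by (simp add: inner_axis)
  finally show "emeasure (distr (LM UNIV) borel (%x. \<chi> l. x l)) (box l u) = ennreal (\<Prod>b\<in>Basis. (u - l) \<bullet> b)" .
qed simp

lemma vd_weight: "vd k UNIV (($) x) = weight k (x :: real^'n::{finite,linorder})"
proof -
  let ?r = "%p q. rpow0 \<bar>x $ p - x $ q\<bar> k"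
  have "(\<Prod>q\<in>UNIV - {p}. ?r p q) = (\<Prod>q\<in>{q. p < q}. ?r p q) * (\<Prod>q\<in>{q. q < p}. ?r p q)" for p
  proof -
    have e: "UNIV - {p} = {q. p < q} \<union> {q. q < p}" by auto
    show ?thesis unfolding e by (rule prod.union_disjoint) auto
  qed
  then have "vd k UNIV (($) x) = (\<Prod>p\<in>UNIV. \<Prod>q\<in>{q. p < q}. ?r p q) * (\<Prod>p\<in>UNIV. \<Prod>q\<in>{q. q < p}. ?r p q)"
    unfolding vd_def by (simp add: prod.distrib)
  also have "(\<Prod>p\<in>UNIV. \<Prod>q\<in>{q. q < p}. ?r p q) = (\<Prod>q\<in>UNIV. \<Prod>p\<in>{p. q < p}. ?r p q)"
    using prod.swap_restrict[of "UNIV :: 'n set" "UNIV :: 'n set" ?r "%p q. q < p"] by simp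
  also have "... = (\<Prod>q\<in>UNIV. \<Prod>p\<in>{p. q < p}. ?r q p)" by (simp add: abs_minus_commute)
  finally show ?thesis unfolding weight_def prod.distrib[symmetric] by (simp add: rpow0_double)
qed

lemma transfer_lborel:
  fixes F :: "real^'n::{finite,linorder} => complex"
  assumes I: "integrable (LM UNIV) (%x. wv k x *\<^sub>R (F (\<chi> l. x l) * dpw UNIV s x))"
    and F: "F \<in> borel_measurable borel"
  shows "set_integrable lborel posorth (%x. F x * Delta_pow (cvec x) s * of_real (weight k x))"
    "(LINT x:posorth|lborel. F x * Delta_pow (cvec x) s * of_real (weight k x)) = (\<integral>x. wv k x *\<^sub>R (F (\<chi> l. x l) * dpw UNIV s x) \<partial>LM UNIV)"
proof -
  define G where "G x = wv k (($) x) *\<^sub>R (F x * dpw UNIV s (($) x))" for x :: "(real,'n) vec"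
  have pm: "(%x::(real,'n) vec. of_bool (pos UNIV (($) x)) :: real) \<in> borel_measurable borel"
  proof -
    have "(%x::(real,'n) vec. (\<Prod>i\<in>UNIV. of_bool (0 < x $ i)) :: real) \<in> borel_measurable borel" by measurable
    moreover have "(\<Prod>i\<in>UNIV. of_bool (0 < x $ i)) = (of_bool (pos UNIV (($) x)) :: real)" for x :: "(real,'n) vec"
      by (cases "pos UNIV (($) x)") (auto simp: pos_def)
    ultimately show ?thesis by simp
  qed
  have Gm: "G \<in> borel_measurable borel"
    unfolding G_def dpw_def vd_def using F pm by measurable
  have e: "indicator posorth x *\<^sub>R (F x * Delta_pow (cvec x) s * of_real (weight k x)) = G x" for x
  proof (cases "x \<in> posorth")
    case True
    then have p: "0 < x $ i" for i by (simp add: posorth_def)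
    have "(\<Sum>j\<in>UNIV. Ln (cvec x $ j)) = of_real (\<Sum>j\<in>UNIV. ln (x $ j))" using p by (simp add: cvec_def Ln_of_real)
    then have "Delta_pow (cvec x) s = dpw UNIV s (($) x)" by (simp add: Delta_pow_def dpw_def)
    then show ?thesis unfolding G_def vd_weight using True by (simp add: posorth_def pos_def scaleR_conv_of_real mult_ac)
  qed (auto simp: G_def posorth_def pos_def)
  have v: "G (\<chi> l. x l) = wv k x *\<^sub>R (F (\<chi> l. x l) * dpw UNIV s x)" for x
  proof -
    have x: "($) (\<chi> l. x l) = x" by (rule ext) simp
    show ?thesis unfolding G_def x ..
  qed
  show "set_integrable lborel posorth (%x. F x * Delta_pow (cvec x) s * of_real (weight k x))"
    unfolding set_integrable_def e lborel_vec using I integrable_distr_eq[OF measurable_vec_lambda Gm] by (simp add: v)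
  show "(LINT x:posorth|lborel. F x * Delta_pow (cvec x) s * of_real (weight k x)) = (\<integral>x. wv k x *\<^sub>R (F (\<chi> l. x l) * dpw UNIV s x) \<partial>LM UNIV)"
    unfolding set_lebesgue_integral_def e lborel_vec using integral_distr[OF measurable_vec_lambda Gm] by (simp add: v)
qed

text \<open>With a = \<mu> - k (n - 1) the Gamma factors of the Selberg integral, read in reverse
  order, are those of \<open>mGamma\<close>.\<close>

lemma CS_mGamma:
  fixes \<mu> :: complex
  assumes k: "0 <= k" and a: "k * (real CARD('n) - 1) < Re \<mu>"
  shows "CS k (UNIV :: 'n::{finite,linorder} set) (\<mu> - of_real (k * (real CARD('n) - 1))) = mGamma k \<mu> TYPE('n)"
proof -
  let ?n = "CARD('n)"
  have "(\<Prod>j<?n. Gamma (\<mu> - of_real (k * (real ?n - 1)) + of_real (k * real j))) = (\<Prod>j<?n. Gamma (\<mu> - of_real (k * real j)))"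
  proof (rule prod.reindex_bij_witness[of _ "%j. ?n - 1 - j" "%j. ?n - 1 - j"])
    fix j assume "j \<in> {..<?n}"
    then have "real (?n - 1 - j) = real ?n - 1 - real j" by (simp add: of_nat_diff)
    then show "Gamma (\<mu> - of_real (k * real (?n - 1 - j))) = Gamma (\<mu> - of_real (k * (real ?n - 1)) + of_real (k * real j))"
      by (simp add: algebra_simps)
  qed auto
  also have "... = (\<Prod>j\<in>(UNIV :: 'n set). Gamma (\<mu> - of_real (k * real (ipos j))))"
    unfolding ipos_range[symmetric] by (subst prod.reindex[OF inj_ipos]) simp
  finally have 1: "(\<Prod>j<?n. Gamma (\<mu> - of_real (k * (real ?n - 1)) + of_real (k * real j))) = (\<Prod>j\<in>(UNIV :: 'n set). Gamma (\<mu> - of_real (k * real (ipos j))))" .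
  have 2: "(\<Prod>j<?n. Gamma (of_real (1 + k * real (Suc j))) / Gamma (of_real (1 + k))) = (\<Prod>j\<in>{1..?n}. Gamma (of_real (1 + real j * k)) / Gamma (of_real (1 + k)) :: complex)"
    by (rule prod.reindex_bij_witness[of _ "%j. j - 1" Suc]) (auto simp: mult.commute)
  show ?thesis unfolding mGamma_def
    using selberg_laguerre[OF k, of "UNIV :: 'n set" "\<mu> - of_real (k * (real ?n - 1))"] a 1 2 by simp
qed

lemma bt_slist: "bt k \<mu> slist \<eta> = gpoch k \<mu> (dec_rearr \<eta>)"
proof -
  have "bt k \<mu> slist \<eta> = (\<Prod>j\<in>UNIV. pochhammer (\<mu> - of_real (k * real (ipos (srt \<eta> j)))) (dec_rearr \<eta> (srt \<eta> j)))"
    unfolding bt_def rk_slist dec_rearr_srt ..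
  also have "... = gpoch k \<mu> (dec_rearr \<eta>)" unfolding gpoch_def
    by (rule prod.reindex_bij_betw[OF bij_srt])
  finally show ?thesis .
qed

lemma lap_jf:
  fixes z :: "complex^'n::{finite,linorder}"
  assumes k: "0 <= k" and a: "k * (real CARD('n) - 1) < Re \<mu>" and z: "HR z"
  shows "lap k (\<mu> - of_real (k * (real CARD('n) - 1))) (jf k \<eta>) z = mGamma k \<mu> TYPE('n) * gpoch k \<mu> (dec_rearr \<eta>) * gg \<mu> (jf k \<eta>) z"
  using lap_jrec[OF k _ jf_jrec z, of "\<mu> - of_real (k * (real CARD('n) - 1))" \<eta>] a
  by (simp add: CS_mGamma[OF k a, symmetric] bt_slist[symmetric])

section \<open>Growth of the coefficients\<close>

text \<open>The finitely many factors above \<delta> are absorbed into C, as the maximum of the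
  first normalised products.\<close>

lemma prod_geometric_bound:
  fixes g :: "nat => complex"
  assumes d: "0 < \<delta>" and e: "eventually (%i. norm (g i) <= \<delta>) sequentially"
  shows "\<exists>C. 0 <= C \<and> (\<forall>l. norm (\<Prod>i<l. g i) <= C * \<delta> ^ l)"
proof -
  obtain N where N: "\<And>i. N <= i ==> norm (g i) <= \<delta>" using e by (auto simp: eventually_sequentially)
  define A where "A l = norm (\<Prod>i<l. g i) / \<delta> ^ l" for l
  define C where "C = Max (A ` {..N})"
  have C: "A l <= C" if "l <= N" for l unfolding C_def using that by (intro Max_ge) auto
  have A: "A l <= C" for l
  proof (induction l)
    case 0 then show ?case using C by simp
  next
    case (Suc l)
    show ?case
    proof (cases "Suc l <= N")
      case False
      have "A (Suc l) = A l * (norm (g l) / \<delta>)" by (simp add: A_def norm_mult)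
      also have "... <= A l * 1" using N[of l] False d by (intro mult_left_mono) (auto simp: A_def)
      finally show ?thesis using Suc by simp
    qed (rule C)
  qed
  have "0 <= C" using A[of 0] by (simp add: A_def)
  moreover have "norm (\<Prod>i<l. g i) <= C * \<delta> ^ l" for l using A[of l] d by (simp add: A_def field_simps)
  ultimately show ?thesis by blast
qed

lemma prod_list_monic_tendsto:
  fixes as :: "complex list"
  shows "(%i. prod_list (map (%a. a + of_nat i) as) / of_nat i ^ length as) \<longlonglongrightarrow> 1"
proof (induction as)
  case (Cons a as)
  have "(%i. a / of_nat i + 1) \<longlonglongrightarrow> 0 + 1" by (intro tendsto_add tendsto_const lim_const_over_n)
  from tendsto_mult[OF this Cons]
  have "(%i. (a / of_nat i + 1) * (prod_list (map (%a. a + of_nat i) as) / of_nat i ^ length as)) \<longlonglongrightarrow> 1" by simp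
  then show ?case
  proof (rule Lim_transform_eventually)
    show "\<forall>\<^sub>F i in sequentially. (a / of_nat i + 1) * (prod_list (map (%a. a + of_nat i) as) / of_nat i ^ length as)
       = prod_list (map (%a. a + of_nat i) (a # as)) / of_nat i ^ length (a # as)"
      using eventually_gt_at_top[of 0] by eventually_elim (simp add: field_simps)
  qed
qed simp

lemma monic_ratio_bound:
  fixes as bs :: "complex list"
  assumes d: "0 < \<delta>" and l: "length as < length bs \<or> length as = length bs \<and> 1 < \<delta>"
  shows "eventually (%i. norm (prod_list (map (%a. a + of_nat i) as) / prod_list (map (%a. a + of_nat i) bs)) <= \<delta>) sequentially"
proof -
  let ?P = "%as i. prod_list (map (%a. a + of_nat i) as) :: complex" and ?p = "length as" and ?q = "length bs"
  obtain L where L: "(%i. of_nat i ^ ?p / of_nat i ^ ?q :: complex) \<longlonglongrightarrow> L" "norm L < \<delta>"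
  proof (cases "?p < ?q")
    case True
    have "(%i. (1 / of_nat i) ^ (?q - ?p) :: complex) \<longlonglongrightarrow> 0 ^ (?q - ?p)" by (intro tendsto_power lim_const_over_n)
    then have "(%i. (1 / of_nat i) ^ (?q - ?p) :: complex) \<longlonglongrightarrow> 0" using True by (simp only: zero_power zero_less_diff)
    then have "(%i. of_nat i ^ ?p / of_nat i ^ ?q :: complex) \<longlonglongrightarrow> 0"
    proof (rule Lim_transform_eventually)
      show "\<forall>\<^sub>F i in sequentially. (1 / of_nat i) ^ (?q - ?p) = (of_nat i ^ ?p / of_nat i ^ ?q :: complex)"
        using eventually_gt_at_top[of 0]
        by eventually_elim (use True in \<open>simp add: power_diff power_one_over field_simps\<close>)
    qed
    then show ?thesis using that d by simp
  next
    case False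
    then have pq: "?p = ?q" "1 < \<delta>" using l by auto
    have "(%i. of_nat i ^ ?p / of_nat i ^ ?q :: complex) \<longlonglongrightarrow> 1"
      by (rule Lim_transform_eventually[OF tendsto_const]) (use eventually_gt_at_top[of 0] in \<open>eventually_elim, simp add: pq\<close>)
    then show ?thesis using that pq by simp
  qed
  have "(%i. (?P as i / of_nat i ^ ?p) / (?P bs i / of_nat i ^ ?q) * (of_nat i ^ ?p / of_nat i ^ ?q)) \<longlonglongrightarrow> 1 / 1 * L"
    by (intro tendsto_mult tendsto_divide prod_list_monic_tendsto L) simp
  then have "(%i. norm ((?P as i / of_nat i ^ ?p) / (?P bs i / of_nat i ^ ?q) * (of_nat i ^ ?p / of_nat i ^ ?q))) \<longlonglongrightarrow> norm L"
    using tendsto_norm by fastforce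
  then have "\<forall>\<^sub>F i in sequentially. norm ((?P as i / of_nat i ^ ?p) / (?P bs i / of_nat i ^ ?q) * (of_nat i ^ ?p / of_nat i ^ ?q)) < \<delta>"
    using L(2) by (rule order_tendstoD)
  then show ?thesis using eventually_gt_at_top[of 0]
  proof eventually_elim
    case (elim i)
    have "(?P as i / of_nat i ^ ?p) / (?P bs i / of_nat i ^ ?q) * (of_nat i ^ ?p / of_nat i ^ ?q) = ?P as i / ?P bs i"
      using elim(2) by simp
    then show ?case using elim(1) by simp
  qed
qed

lemma gpochs_prod:
  "gpochs k ms \<eta> = (\<Prod>j\<in>UNIV. \<Prod>i<\<eta> j. prod_list (map (%a. a + of_nat i) (map (%m. m - of_real (k * real (ipos j))) ms)))"
  unfolding gpochs_def
proof (induction ms)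
  case (Cons m ms)
  then show ?case by (simp add: gpoch_def pochhammer_prod prod.distrib atLeast0LessThan)
qed simp

text \<open>Factor by factor the quotient is a ratio of two products of linear terms in i, with p
  and q terms. It tends to 0 for p < q and to 1 for p = q, hence is eventually at most \<delta> in
  each coordinate.\<close>

lemma gpochs_ratio_bound:
  fixes ms ns :: "complex list"
  assumes d: "0 < \<delta>" and l: "length ms < length ns \<or> length ms = length ns \<and> 1 < \<delta>"
  shows "\<exists>C\<ge>0. \<forall>\<eta> :: 'n::{finite,linorder} => nat. norm (gpochs k ms \<eta> / gpochs k ns \<eta>) <= C * \<delta> ^ mdeg \<eta>"
proof -
  define g where "g j i = prod_list (map (%a. a + of_nat i) (map (%m. m - of_real (k * real (ipos j))) ms))
      / prod_list (map (%a. a + of_nat i) (map (%m. m - of_real (k * real (ipos j))) ns))" for j :: 'n and i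
  have "\<exists>C. 0 <= C \<and> (\<forall>l. norm (\<Prod>i<l. g j i) <= C * \<delta> ^ l)" for j
    unfolding g_def by (rule prod_geometric_bound[OF d monic_ratio_bound[OF d]]) (use l in simp)
  then obtain C where C: "\<And>j. 0 <= C j" "\<And>j l. norm (\<Prod>i<l. g j i) <= C j * \<delta> ^ l" by metis
  have "norm (gpochs k ms \<eta> / gpochs k ns \<eta>) <= (\<Prod>j\<in>UNIV. C j) * \<delta> ^ mdeg \<eta>" for \<eta> :: "'n => nat"
  proof -
    have "gpochs k ms \<eta> / gpochs k ns \<eta> = (\<Prod>j\<in>UNIV. \<Prod>i<\<eta> j. g j i)" unfolding gpochs_prod g_def prod_dividef ..
    then have "norm (gpochs k ms \<eta> / gpochs k ns \<eta>) = (\<Prod>j\<in>UNIV. norm (\<Prod>i<\<eta> j. g j i))" by (simp only: prod_norm)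
    also have "... <= (\<Prod>j\<in>UNIV. C j * \<delta> ^ \<eta> j)" by (intro prod_mono conjI norm_ge_zero C(2))
    also have "... = (\<Prod>j\<in>UNIV. C j) * \<delta> ^ mdeg \<eta>" by (simp add: prod.distrib mdeg_def power_sum)
    finally show ?thesis .
  qed
  moreover have "0 <= (\<Prod>j\<in>UNIV. C j)" using C(1) by (intro prod_nonneg) auto
  ultimately show ?thesis by blast
qed

section \<open>Hypergeometric series\<close>

lemma power_le_exp: "0 <= (t::real) ==> t ^ m / fact m <= exp t"
  using sum_le_suminf[OF summable_exp_generic[of t], of "{m}"] by (simp add: exp_def divide_inverse mult.commute)

lemma measurable_cvec: "(cvec :: real^'n::finite => _) \<in> borel_measurable borel"
  unfolding cvec_def[abs_def] by (intro borel_measurable_continuous_onI continuous_on_vec_lambda continuous_intros)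

text \<open>The bound on \<open>t\<close> and \<open>r\<close> makes the series converge under the integral, dominated by a multiple of
  \<open>exp (b * (\<Sum>l. x l))\<close> for some \<open>b\<close> below the real parts of \<open>z\<close>.\<close>
lemma laplace_series:
  fixes z :: "complex^'n::{finite,linorder}" and t :: "('n => nat) => complex^'n::{finite,linorder} => complex"
    and r :: "('n => nat) => complex" and A :: "nat => ('n => nat) set"
  assumes k: "0 <= k" and a: "k * (real CARD('n) - 1) < Re \<mu>" and z: "HR z"
    and fin: "\<And>m. finite (A m)" and ho: "\<And>m \<eta>. \<eta> \<in> A m ==> hom m (t \<eta>)"
    and la: "\<And>m \<eta>. \<eta> \<in> A m ==> lap k (\<mu> - of_real (k * (real CARD('n) - 1))) (t \<eta>) z
        = mGamma k \<mu> TYPE('n) * gpoch k \<mu> (dec_rearr \<eta>) * gg \<mu> (t \<eta>) z"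
    and bd: "\<And>m x. (\<Sum>\<eta>\<in>A m. norm (t \<eta> x)) <= (W * norm x) ^ m / fact m" and W: "0 <= W"
    and rb: "\<And>m \<eta>. \<eta> \<in> A m ==> norm (r \<eta>) <= C * \<delta> ^ m" and C: "0 <= C" "0 < \<delta>"
    and c: "\<And>i. c <= Re (z $ i)" "\<delta> * W < c"
  defines "H \<equiv> %x. \<Sum>m. \<Sum>\<eta>\<in>A m. r \<eta> * t \<eta> x"
  shows "set_integrable lborel posorth (%x. dunkl_kernel k (- z) (cvec x) * H (cvec x)
       * Delta_pow (cvec x) (\<mu> - of_real (k * (real CARD('n) - 1)) - 1) * of_real (weight k x))" (is ?I)
    and "(LINT x:posorth|lborel. dunkl_kernel k (- z) (cvec x) * H (cvec x)
       * Delta_pow (cvec x) (\<mu> - of_real (k * (real CARD('n) - 1)) - 1) * of_real (weight k x))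
     = mGamma k \<mu> TYPE('n) * Delta_pow z (- \<mu>) * (\<Sum>m. \<Sum>\<eta>\<in>A m. gpoch k \<mu> (dec_rearr \<eta>) * r \<eta> * t \<eta> (cinv z))" (is ?E)
proof -
  define s where "s = \<mu> - of_real (k * (real CARD('n) - 1))"
  have s: "0 < Re s" using a by (simp add: s_def)
  define q where "q m x = (\<Sum>\<eta>\<in>A m. r \<eta> * t \<eta> x)" for m x
  have hq: "hom m (q m)" for m unfolding q_def[abs_def] by (rule hom_sum[OF fin]) (rule hom_cmult, rule ho)
  have qb: "norm (q m x) <= C * ((\<delta> * W * norm x) ^ m / fact m)" for m x
  proof -
    have "norm (q m x) <= (\<Sum>\<eta>\<in>A m. norm (r \<eta>) * norm (t \<eta> x))" unfolding q_def by (rule order_trans[OF norm_sum]) (simp add: norm_mult)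
    also have "... <= (\<Sum>\<eta>\<in>A m. C * \<delta> ^ m * norm (t \<eta> x))" by (intro sum_mono mult_right_mono rb) auto
    also have "... = C * \<delta> ^ m * (\<Sum>\<eta>\<in>A m. norm (t \<eta> x))" by (simp add: sum_distrib_left)
    also have "... <= C * \<delta> ^ m * ((W * norm x) ^ m / fact m)" using C by (intro mult_left_mono bd) auto
    finally show ?thesis by (simp add: power_mult_distrib mult_ac)
  qed
  have qs: "summable (%m. q m x)" for x
  proof (rule summable_comparison_test'[of "%m. C * ((\<delta> * W * norm x) ^ m / fact m)" 0])
    have "summable (%m. (\<delta> * W * norm x) ^ m / fact m)" using summable_exp[of "\<delta> * W * norm x"] by (simp add: field_simps)
    then show "summable (%m. C * ((\<delta> * W * norm x) ^ m / fact m))" by (rule summable_mult)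
  qed (rule qb)
  have H: "H x = (\<Sum>m. q m x)" for x by (simp add: H_def q_def)
  \<comment> \<open>A rate strictly between the growth \<delta> W of the series and the decay c of
    the kernel. The ratio \<delta> W / b < 1 gives geometric decay in m, and c - b > 0 is left for
    the integral over x.\<close>
  define b where "b = (\<delta> * W + c) / 2"
  have dW: "0 <= \<delta> * W" using C W by simp
  have b: "\<delta> * W < b \<and> b < c \<and> 0 < b" 
  proof -
    have "e < (e + c) / 2 \<and> (e + c) / 2 < c \<and> 0 < (e + c) / 2" if "e < c" "0 <= e" for e using that by auto
    then show ?thesis unfolding b_def using c(2) dW by blast
  qed
  define \<rho> where "\<rho> = \<delta> * W / b"
  have \<rho>: "0 <= \<rho>" "\<rho> < 1" "\<delta> * W = \<rho> * b" using dW b by (auto simp: \<rho>_def)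
  let ?s = "sqrt (fact CARD('n)) :: real"
  let ?g = "%x::'n => real. wv k x *\<^sub>R (?s * C * (\<Prod>l\<in>UNIV. gam (Re s) (c - b) (x l)))"
  let ?f = "%m x. wv k x *\<^sub>R lapi k s (q m) z x"
  have gi: "integrable (LM (UNIV :: 'n set)) ?g" by (rule integrable_gam_UNIV[OF k s]) (use b in simp)
  have fb: "norm (?f m x) <= \<rho> ^ m * ?g x" for m x
  proof (cases "pos UNIV x")
    case True
    let ?S = "\<Sum>l\<in>UNIV. x l"
    have S: "0 <= ?S" using True by (intro sum_nonneg) (auto simp: pos_def less_imp_le)
    have "norm (q m (V x)) <= C * ((\<delta> * W * norm (V x)) ^ m / fact m)" by (rule qb)
    also have "... <= C * ((\<delta> * W * ?S) ^ m / fact m)"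
      by (intro mult_left_mono divide_right_mono power_mono norm_V_le_sum[OF True] dW C mult_nonneg_nonneg norm_ge_zero) auto
    also have "... = C * \<rho> ^ m * ((b * ?S) ^ m / fact m)" unfolding \<rho>(3) by (simp add: power_mult_distrib)
    also have "... <= C * \<rho> ^ m * exp (b * ?S)" using C \<rho> b S by (intro mult_left_mono power_le_exp) auto
    finally have 1: "norm (q m (V x)) <= C * \<rho> ^ m * exp (b * ?S)" .
    have 2: "norm (dk k (- V x) z) <= ?s * exp (- c * ?S)" using True by (intro dk_V_decay[OF k c(1)]) (auto simp: pos_def less_imp_le)
    have 3: "norm (dpw UNIV (s - 1) x) = (\<Prod>l\<in>UNIV. x l powr (Re s - 1))" using norm_dpw[OF _ True] by simp
    have "norm (lapi k s (q m) z x) <= (?s * exp (- c * ?S)) * ((C * \<rho> ^ m * exp (b * ?S)) * (\<Prod>l\<in>UNIV. x l powr (Re s - 1)))"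
      unfolding lapi_def norm_mult 3 by (intro mult_mono 1 2 order_refl mult_nonneg_nonneg prod_nonneg) (use C \<rho> in auto)
    also have "... = \<rho> ^ m * (?s * C * ((exp (- c * ?S) * exp (b * ?S)) * (\<Prod>l\<in>UNIV. x l powr (Re s - 1))))"
      by (simp only: mult_ac)
    also have "(exp (- c * ?S) * exp (b * ?S)) * (\<Prod>l\<in>UNIV. x l powr (Re s - 1)) = (\<Prod>l\<in>UNIV. gam (Re s) (c - b) (x l))"
    proof -
      have "exp (- c * ?S) * exp (b * ?S) = (\<Prod>l\<in>UNIV. exp (- (c - b) * x l))"
        unfolding exp_add[symmetric] exp_sum[OF finite, symmetric] sum_distrib_left[symmetric] by (simp add: algebra_simps)
      then show ?thesis unfolding gam_def using True by (simp add: prod.distrib[symmetric] pos_def mult.commute)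
    qed
    finally show ?thesis using True unfolding norm_scaleR
      by (simp add: mult.left_commute[of "\<rho> ^ m"] mult_left_mono)
  qed simp
  have fi: "integrable (LM UNIV) (?f m)" for m by (rule integrable_lapi[OF k hq s z])
  have sg: "summable (%m. \<rho> ^ m * B)" for B using \<rho> by (intro summable_mult2 summable_geometric) simp
  have s1: "AE x in LM UNIV. summable (%m. norm (?f m x))"
  proof (rule AE_I2)
    fix x show "summable (%m. norm (?f m x))" using fb by (intro summable_comparison_test'[OF sg[of "?g x"], of 0]) simp
  qed
  have s2: "summable (%m. \<integral>x. norm (?f m x) \<partial>LM UNIV)"
  proof (rule summable_comparison_test'[OF sg[of "integral\<^sup>L (LM UNIV) ?g"], of 0])
    fix m
    have "(\<integral>x. norm (?f m x) \<partial>LM UNIV) <= (\<integral>x. \<rho> ^ m * ?g x \<partial>LM UNIV)"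
      by (rule Bochner_Integration.integral_mono[OF integrable_norm[OF fi] integrable_mult_right[OF gi] fb])
    then show "norm (\<integral>x. norm (?f m x) \<partial>LM UNIV) <= \<rho> ^ m * integral\<^sup>L (LM UNIV) ?g"
      unfolding integral_mult_right_zero by (simp add: abs_of_nonneg Bochner_Integration.integral_nonneg)
  qed
  define F where "F x = dunkl_kernel k (- z) (cvec x) * H (cvec x)" for x
  have FV: "wv k x *\<^sub>R (F (\<chi> l. x l) * dpw UNIV (s - 1) x) = (\<Sum>m. ?f m x)" for x
  proof -
    have "?f m x = (of_real (wv k x) * dk k (- V x) z * dpw UNIV (s - 1) x) * q m (V x)" for m
      by (simp add: lapi_def scaleR_conv_of_real mult_ac)
    then have "(\<Sum>m. ?f m x) = (of_real (wv k x) * dk k (- V x) z * dpw UNIV (s - 1) x) * H (V x)"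
      unfolding H using suminf_mult[OF qs[of "V x"], of "of_real (wv k x) * dk k (- V x) z * dpw UNIV (s - 1) x"] by simp
    then show ?thesis unfolding F_def V_cvec[symmetric] dunkl_kernel_eq[OF k] dk_minus[of k z] by (simp add: scaleR_conv_of_real mult_ac)
  qed
  have Fm: "F \<in> borel_measurable borel"
  proof -
    have "(%x. dk k (- z) (cvec x)) \<in> borel_measurable borel"
      by (rule measurable_compose[OF measurable_cvec cdiff_measurable]) (rule dk_cdiff[OF k])
    moreover have "(%x. \<Sum>m. q m (cvec x)) \<in> borel_measurable borel"
      by (intro borel_measurable_suminf measurable_compose[OF measurable_cvec cdiff_measurable] hom_cdiff[OF hq])
    ultimately show ?thesis unfolding F_def H dunkl_kernel_eq[OF k] by simp
  qed
  note T = transfer_lborel[OF _ Fm, where k = k and s = "s - 1", unfolded FV, OF integrable_suminf[OF fi s1 s2]]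
  show ?I using T(1) unfolding F_def s_def .
  let ?c = "mGamma k \<mu> TYPE('n) * Delta_pow z (- \<mu>)"
  let ?y = "%m. \<Sum>\<eta>\<in>A m. gpoch k \<mu> (dec_rearr \<eta>) * r \<eta> * t \<eta> (cinv z)"
  have L: "integral\<^sup>L (LM UNIV) (?f m) = ?c * ?y m" for m
  proof -
    have "integral\<^sup>L (LM UNIV) (?f m) = (\<Sum>\<eta>\<in>A m. r \<eta> * lap k s (t \<eta>) z)"
      unfolding lap_def[symmetric] q_def[abs_def] by (rule lap_sum[OF fin ho k s z])
    also have "... = (\<Sum>\<eta>\<in>A m. ?c * (gpoch k \<mu> (dec_rearr \<eta>) * r \<eta> * t \<eta> (cinv z)))"
      using la unfolding s_def by (intro sum.cong refl) (simp add: gg_def)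
    finally show ?thesis by (simp only: sum_distrib_left)
  qed
  have "(\<Sum>m. integral\<^sup>L (LM UNIV) (?f m)) = ?c * (\<Sum>m. ?y m)"
  \<comment> \<open>Summability of the right-hand series is inherited from the integrals by
    cancelling the constant in front; for constant 0 both sides are 0.\<close>
  proof (cases "?c = 0")
    case True
    show ?thesis unfolding L True by simp
  next
    case False
    have "summable (%m. ?c * ?y m)" using summable_integral[OF fi s1 s2] unfolding L .
    then show ?thesis unfolding L using False by (intro suminf_mult) (simp only: summable_cmult_iff simp_thms)
  qed
  then show ?E using T(2) integral_suminf[OF fi s1 s2] unfolding F_def s_def by simp
qed

subsection \<open>The two families of kernels\<close>

definition jN :: "real => ('n::{finite,linorder} => nat) => complex^('n::{finite,linorder}) => real" where
  "jN k \<eta> x = (norm (jf k \<eta> x))\<^sup>2 / jn k \<eta>"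

lemma jN_nonneg: "0 <= k ==> 0 <= jN k \<eta> x"
  using jf_norm(2)[of k \<eta>] by (simp add: jN_def)

lemma norm_vcnj: "norm (vcnj x) = norm x"
  by (simp add: norm_vec_def vcnj_def)

text \<open>Because the \<open>jf\<close> have real coefficients, the kernel at x and its conjugate
  is this sum of squares, and \<open>Kd_bound\<close> estimates it.\<close>

lemma sum_jN:
  assumes k: "0 <= k"
  shows "(\<Sum>\<eta>\<in>mi m. jN k \<eta> x) <= (norm x ^ m)\<^sup>2 / fact m"
proof -
  have "Kd k m x (vcnj x) = of_real (\<Sum>\<eta>\<in>mi m. jN k \<eta> x)"
    unfolding Kd_def jf_vcnj jN_def of_real_sum of_real_divide complex_norm_square ..
  then have "\<bar>\<Sum>\<eta>\<in>mi m. jN k \<eta> x\<bar> <= (norm x * norm x) ^ m / fact m"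
    using Kd_bound[OF k, of m x "vcnj x"] unfolding norm_vcnj by (simp only: norm_of_real)
  then show ?thesis by (simp add: power_mult_distrib power2_eq_square)
qed

lemma sum_sqrt_le:
  fixes f g :: "'a => real"
  assumes "\<And>i. i \<in> A ==> 0 <= f i" "\<And>i. i \<in> A ==> 0 <= g i"
  shows "(\<Sum>i\<in>A. sqrt (f i) * sqrt (g i)) <= sqrt (\<Sum>i\<in>A. f i) * sqrt (\<Sum>i\<in>A. g i)"
proof -
  have "(\<Sum>i\<in>A. \<bar>sqrt (f i)\<bar> * \<bar>sqrt (g i)\<bar>) <= L2_set (%i. sqrt (f i)) A * L2_set (%i. sqrt (g i)) A" by (rule L2_set_mult_ineq)
  then show ?thesis using assms by (simp add: L2_set_def)
qed

lemma kernel_bound: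
  assumes t: "\<And>i. i \<in> A ==> norm (t i) <= sqrt (f i) * sqrt (g i)"
    and nn: "\<And>i. i \<in> A ==> 0 <= f i" "\<And>i. i \<in> A ==> 0 <= g i"
    and s: "(\<Sum>i\<in>A. f i) <= (u ^ m)\<^sup>2 / fact m" "(\<Sum>i\<in>A. g i) <= (v ^ m)\<^sup>2 / fact m" and uv: "0 <= u" "0 <= v"
  shows "(\<Sum>i\<in>A. norm (t i)) <= (u * v) ^ m / fact m"
proof -
  have "(\<Sum>i\<in>A. norm (t i)) <= (\<Sum>i\<in>A. sqrt (f i) * sqrt (g i))" by (intro sum_mono t)
  also have "... <= sqrt (\<Sum>i\<in>A. f i) * sqrt (\<Sum>i\<in>A. g i)" by (intro sum_sqrt_le nn)
  also have "... <= sqrt ((u ^ m)\<^sup>2 / fact m) * sqrt ((v ^ m)\<^sup>2 / fact m)"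
    by (intro mult_mono real_sqrt_le_mono s) (auto intro!: sum_nonneg nn)
  also have "... = (u * v) ^ m / fact m" using uv by (simp add: real_sqrt_divide power_mult_distrib)
  finally show ?thesis .
qed

definition tK :: "real => complex^('n::{finite,linorder}) => ('n => nat) => complex^('n::{finite,linorder}) => complex" where
  "tK k w \<eta> x = jackL k \<eta> w * jackL k \<eta> x / (fact (mdeg \<eta>) * jackL k \<eta> ones)"

definition tF :: "real => complex^('n::{finite,linorder}) => ('n => nat) => complex^('n::{finite,linorder}) => complex" where
  "tF k w \<eta> x = jackC k \<eta> w * jackC k \<eta> x / (fact (mdeg \<eta>) * jackC k \<eta> ones)"

text \<open>Shows that the term is a constant times \<open>jf\<close>, so the transform of
  \<open>jf\<close> applies. The case distinction mirrors the convention x / 0 = 0.\<close>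

lemma tK_eq:
  assumes k: "0 <= k"
  shows "tK k w \<eta> x = (if jf k \<eta> ones = 0 then 0 else jf k \<eta> w / of_real (jn k \<eta>)) * jf k \<eta> x"
  unfolding tK_def jackL_eq[OF k] using jf_norm(2)[OF k, of \<eta>] by (simp add: field_simps)

lemma tK_bound:
  assumes k: "0 <= k" shows "norm (tK k w \<eta> x) <= sqrt (jN k \<eta> w) * sqrt (jN k \<eta> x)"
proof -
  have "sqrt (jN k \<eta> w) * sqrt (jN k \<eta> x) = norm (jf k \<eta> w) * norm (jf k \<eta> x) / jn k \<eta>"
    using jf_norm(2)[OF k, of \<eta>] by (simp add: jN_def real_sqrt_divide)
  then show ?thesis unfolding tK_eq[OF k] using jf_norm(2)[OF k, of \<eta>] by (auto simp: norm_mult norm_divide)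
qed

lemma lap_cmult: "lap k a (%x. c * q x) z = c * lap k a q z"
  unfolding lap_def integral_mult_right_zero[symmetric] by (simp add: lapi_def scaleR_conv_of_real mult_ac)

lemma gg_cmult: "gg \<mu> (%x. c * q x) z = c * gg \<mu> q z"
  by (simp add: gg_def)

lemma ones_vcnj: "vcnj ones = ones"
  by (simp add: vcnj_def ones_def vec_eq_iff)

lemma rearrs_eq:
  fixes lam :: "'n::{finite,linorder} => nat"
  assumes "is_partition lam" shows "rearrs lam = {\<eta>. dec_rearr \<eta> = lam}"
proof -
  have "dec_rearr (lam \<circ> inv w) = lam" if "bij w" for w :: "'n => 'n"
    using dec_rearr_comp[OF bij_imp_bij_inv[OF that]] dec_rearr_partition[OF assms] by metis
  moreover have "\<exists>w. bij w \<and> \<eta> = dec_rearr \<eta> \<circ> inv w" for \<eta> :: "'n => nat"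
    by (intro exI[of _ "inv (srt \<eta>)"]) (auto simp: bij_srt bij_imp_bij_inv inv_inv_eq fun_eq_iff dec_rearr_srt)
  ultimately show ?thesis unfolding rearrs_def permutes_UNIV_bij pact_def by auto
qed

text \<open>Up to the factorial of the degree this is the symmetric Jack polynomial
  \<open>jackC\<close>.\<close>

definition jPhi :: "real => ('n::{finite,linorder} => nat) => complex^('n::{finite,linorder}) => complex" where
  "jPhi k lam x = (\<Sum>\<eta>\<in>rearrs lam. (jf k \<eta> ones / of_real (jn k \<eta>)) * jf k \<eta> x)"

lemma rearrs_props:
  fixes lam :: "'n::{finite,linorder} => nat"
  assumes lam: "is_partition lam"
  shows "finite (rearrs lam)" "\<And>\<eta>. \<eta> \<in> rearrs lam ==> mdeg \<eta> = mdeg lam" "\<And>\<eta>. \<eta> \<in> rearrs lam ==> dec_rearr \<eta> = lam"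
proof -
  show 2: "mdeg \<eta> = mdeg lam" if "\<eta> \<in> rearrs lam" for \<eta> using that mdeg_dec_rearr[of \<eta>] by (simp add: rearrs_eq[OF lam])
  show "finite (rearrs lam)" by (rule finite_subset[OF _ finite_mdeg[of "mdeg lam"]]) (use 2 in auto)
qed (simp add: rearrs_eq[OF lam])

lemma tF_eq:
  assumes k: "0 <= k" and lam: "is_partition lam"
  shows "tF k w lam x = jPhi k lam w / jPhi k lam ones * jPhi k lam x"
proof -
  have "jackC k lam x = fact (mdeg lam) * jPhi k lam x" for x
    unfolding jackC_def jPhi_def sum_distrib_left using rearrs_props(2)[OF lam] by (intro sum.cong refl) (simp add: jackL_eq[OF k])
  then show ?thesis by (simp add: tF_def)
qed

lemma jPhi_bound:
  assumes k: "0 <= k"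
  shows "norm (jPhi k lam x) <= sqrt (\<Sum>\<eta>\<in>rearrs lam. jN k \<eta> ones) * sqrt (\<Sum>\<eta>\<in>rearrs lam. jN k \<eta> x)"
proof -
  have "norm (jPhi k lam x) <= (\<Sum>\<eta>\<in>rearrs lam. sqrt (jN k \<eta> ones) * sqrt (jN k \<eta> x))" unfolding jPhi_def
  proof (rule sum_norm_le)
    fix \<eta>
    have "sqrt (jN k \<eta> ones) * sqrt (jN k \<eta> x) = norm (jf k \<eta> ones) * norm (jf k \<eta> x) / jn k \<eta>"
      using jf_norm(2)[OF k, of \<eta>] by (simp add: jN_def real_sqrt_divide)
    then show "norm (jf k \<eta> ones / of_real (jn k \<eta>) * jf k \<eta> x) <= sqrt (jN k \<eta> ones) * sqrt (jN k \<eta> x)"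
      using jf_norm(2)[OF k, of \<eta>] by (simp add: norm_mult norm_divide)
  qed
  also have "... <= sqrt (\<Sum>\<eta>\<in>rearrs lam. jN k \<eta> ones) * sqrt (\<Sum>\<eta>\<in>rearrs lam. jN k \<eta> x)" by (intro sum_sqrt_le jN_nonneg[OF k])
  finally show ?thesis .
qed

text \<open>The value of \<open>jPhi\<close> at \<open>ones\<close> is the sum of the
  \<open>jN\<close> there. Cauchy-Schwarz applied to both factors of the numerator produces its root
  twice, which cancels against the denominator.\<close>

lemma tF_bound:
  fixes lam :: "'n::{finite,linorder} => nat"
  assumes k: "0 <= k" and lam: "is_partition lam"
  shows "norm (tF k w lam x) <= sqrt (\<Sum>\<eta>\<in>rearrs lam. jN k \<eta> w) * sqrt (\<Sum>\<eta>\<in>rearrs lam. jN k \<eta> x)"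
proof -
  let ?o = "\<Sum>\<eta>\<in>rearrs lam. jN k \<eta> ones"
  have o: "0 <= ?o" by (intro sum_nonneg jN_nonneg[OF k])
  have r: "jf k \<eta> ones = cnj (jf k \<eta> ones)" for \<eta> :: "'n => nat" using jf_vcnj[of k \<eta> ones] unfolding ones_vcnj .
  have "jf k \<eta> ones / of_real (jn k \<eta>) * jf k \<eta> ones = of_real (jN k \<eta> ones)" for \<eta> :: "'n => nat"
    unfolding jN_def of_real_divide complex_norm_square using r[of \<eta>] by simp
  then have "jPhi k lam ones = of_real ?o" by (simp only: jPhi_def of_real_sum)
  then have "norm (tF k w lam x) = norm (jPhi k lam w) * norm (jPhi k lam x) / ?o"
    unfolding tF_eq[OF k lam] using o by (simp add: norm_mult norm_divide del: of_real_sum)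
  also have "... <= (sqrt ?o * sqrt (\<Sum>\<eta>\<in>rearrs lam. jN k \<eta> w)) * (sqrt ?o * sqrt (\<Sum>\<eta>\<in>rearrs lam. jN k \<eta> x)) / ?o"
    by (intro divide_right_mono mult_mono jPhi_bound[OF k] o) (use o in \<open>auto intro!: mult_nonneg_nonneg sum_nonneg jN_nonneg[OF k]\<close>)
  also have "... = (sqrt ?o * sqrt ?o / ?o) * (sqrt (\<Sum>\<eta>\<in>rearrs lam. jN k \<eta> w) * sqrt (\<Sum>\<eta>\<in>rearrs lam. jN k \<eta> x))"
    by (simp only: mult_ac times_divide_eq_left times_divide_eq_right)
  \<comment> \<open>The quotient is 1, or 0 if the denominator vanishes.\<close>
  also have "... <= 1 * (sqrt (\<Sum>\<eta>\<in>rearrs lam. jN k \<eta> w) * sqrt (\<Sum>\<eta>\<in>rearrs lam. jN k \<eta> x))"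
    by (intro mult_right_mono) (use o in \<open>auto intro!: mult_nonneg_nonneg sum_nonneg jN_nonneg[OF k]\<close>)
  finally show ?thesis by simp
qed

lemma tF_hom:
  assumes k: "0 <= k" and lam: "is_partition lam" shows "hom (mdeg lam) (tF k w lam)"
proof -
  have "hom (mdeg lam) (jPhi k lam)" unfolding jPhi_def[abs_def]
  proof (rule hom_sum[OF rearrs_props(1)[OF lam]], rule hom_cmult)
    fix \<eta> assume "\<eta> \<in> rearrs lam"
    then show "hom (mdeg lam) (jf k \<eta>)" using jf_hom[of \<eta> k] rearrs_props(2)[OF lam] by metis
  qed
  then show ?thesis unfolding tF_eq[OF k lam, abs_def] by (rule hom_cmult)
qed

lemma lap_tK:
  fixes z :: "complex^'n::{finite,linorder}"
  assumes k: "0 <= k" and a: "k * (real CARD('n) - 1) < Re \<mu>" and z: "HR z"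
  shows "lap k (\<mu> - of_real (k * (real CARD('n) - 1))) (tK k w \<eta>) z = mGamma k \<mu> TYPE('n) * gpoch k \<mu> (dec_rearr \<eta>) * gg \<mu> (tK k w \<eta>) z"
  unfolding tK_eq[OF k, abs_def] lap_cmult gg_cmult lap_jf[OF assms] by (simp only: mult_ac)

lemma lap_tF:
  fixes z :: "complex^'n::{finite,linorder}"
  assumes k: "0 <= k" and a: "k * (real CARD('n) - 1) < Re \<mu>" and z: "HR z" and lam: "is_partition lam"
  shows "lap k (\<mu> - of_real (k * (real CARD('n) - 1))) (tF k w lam) z = mGamma k \<mu> TYPE('n) * gpoch k \<mu> lam * gg \<mu> (tF k w lam) z"
proof -
  let ?s = "\<mu> - of_real (k * (real CARD('n) - 1))"
  let ?d = "%\<eta>. jf k \<eta> ones / of_real (jn k \<eta>)"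
  have s: "0 < Re ?s" using a by simp
  have h: "hom (mdeg lam) (jf k \<eta>)" if "\<eta> \<in> rearrs lam" for \<eta> using jf_hom[of \<eta> k] rearrs_props(2)[OF lam that] by simp
  have "lap k ?s (jPhi k lam) z = (\<Sum>\<eta>\<in>rearrs lam. ?d \<eta> * lap k ?s (jf k \<eta>) z)"
    unfolding jPhi_def[abs_def] by (rule lap_sum[OF rearrs_props(1)[OF lam] h k s z])
  also have "... = (\<Sum>\<eta>\<in>rearrs lam. mGamma k \<mu> TYPE('n) * gpoch k \<mu> lam * (Delta_pow z (- \<mu>) * (?d \<eta> * jf k \<eta> (cinv z))))"
  proof (intro sum.cong refl)
    fix \<eta> assume "\<eta> \<in> rearrs lam"
    then show "?d \<eta> * lap k ?s (jf k \<eta>) z = mGamma k \<mu> TYPE('n) * gpoch k \<mu> lam * (Delta_pow z (- \<mu>) * (?d \<eta> * jf k \<eta> (cinv z)))"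
      unfolding lap_jf[OF k a z] gg_def by (simp only: rearrs_props(3)[OF lam] mult_ac)
  qed
  also have "... = mGamma k \<mu> TYPE('n) * gpoch k \<mu> lam * gg \<mu> (jPhi k lam) z" by (simp only: gg_def jPhi_def sum_distrib_left)
  finally show ?thesis unfolding tF_eq[OF k lam, abs_def] lap_cmult gg_cmult by (simp only: mult_ac)
qed

lemma sum_tK:
  assumes k: "0 <= k"
  shows "(\<Sum>\<eta>\<in>mi m. norm (tK k w \<eta> x)) <= (norm w * norm x) ^ m / fact m"
  by (rule kernel_bound[OF tK_bound[OF k] jN_nonneg[OF k] jN_nonneg[OF k] sum_jN[OF k] sum_jN[OF k]]) auto

text \<open>The rearrangements of the partitions of degree m exhaust the multi-indices of degree m,
  so the sums of \<open>jN\<close> over partitions and rearrangements are those already bounded by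
  \<open>sum_jN\<close>.\<close>

lemma sum_tF:
  fixes w x :: "complex^'n::{finite,linorder}"
  assumes k: "0 <= k"
  shows "(\<Sum>lam\<in>{lam. is_partition lam \<and> mdeg lam = m}. norm (tF k w lam x)) <= (norm w * norm x) ^ m / fact m"
proof -
  let ?A = "{lam :: 'n => nat. is_partition lam \<and> mdeg lam = m}"
  have fA: "finite ?A" by (rule finite_subset[OF _ finite_mdeg[of m]]) auto
  have g: "(\<Sum>lam\<in>?A. \<Sum>\<eta>\<in>rearrs lam. jN k \<eta> y) <= (norm y ^ m)\<^sup>2 / fact m" for y :: "(complex, 'n) vec"
  proof -
    have "(\<Sum>lam\<in>?A. \<Sum>\<eta>\<in>rearrs lam. jN k \<eta> y) = (\<Sum>lam\<in>?A. \<Sum>\<eta>\<in>{\<eta> \<in> mi m. dec_rearr \<eta> = lam}. jN k \<eta> y)"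
      by (intro sum.cong refl) (auto simp: rearrs_eq mdeg_dec_rearr)
    also have "... = (\<Sum>\<eta>\<in>mi m. jN k \<eta> y)"
      by (rule sum.group[OF finite_mdeg fA]) (auto simp: is_partition_dec_rearr mdeg_dec_rearr)
    finally show ?thesis using sum_jN[OF k] by simp
  qed
  show ?thesis by (rule kernel_bound[OF tF_bound[OF k] _ _ g g]) (auto intro!: sum_nonneg jN_nonneg[OF k])
qed

lemma hypK_eq: "hypK k \<mu> \<nu> w x = (\<Sum>m. \<Sum>\<eta>\<in>mi m. gpochs k \<mu> (dec_rearr \<eta>) / gpochs k \<nu> (dec_rearr \<eta>) * tK k w \<eta> x)"
  unfolding hypK_def tK_def by (intro arg_cong[where f = suminf] ext sum.cong refl) auto

lemma hypF_eq: "hypF k \<mu> \<nu> w x = (\<Sum>m. \<Sum>\<eta>\<in>{\<eta>. is_partition \<eta> \<and> mdeg \<eta> = m}. gpochs k \<mu> (dec_rearr \<eta>) / gpochs k \<nu> (dec_rearr \<eta>) * tF k w \<eta> x)"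
  unfolding hypF_def tF_def by (intro arg_cong[where f = suminf] ext sum.cong refl) (auto simp: dec_rearr_partition)

section \<open>Both families of series and both ranges of convergence\<close>

lemma laplace_hyp:
  fixes z w :: "complex^'n::{finite,linorder}"
  assumes k: "0 <= k" and a: "k * (real CARD('n) - 1) < Re \<mu>'" and z: "HR z"
    and d: "0 < \<delta>" "length \<mu> < length \<nu> \<or> length \<mu> = length \<nu> \<and> 1 < \<delta>"
    and c: "\<And>i. c <= Re (z $ i)" "\<delta> * norm w < c" and Hyp: "Hyp \<in> {hypK k, hypF k}"
  defines "f \<equiv> %x. dunkl_kernel k (- z) (cvec x) * Hyp \<mu> \<nu> w (cvec x)
       * Delta_pow (cvec x) (\<mu>' - of_real (k * (real CARD('n) - 1)) - 1) * of_real (weight k x)"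
  shows "set_integrable lborel posorth f \<and>
     (LINT x:posorth|lborel. f x) = mGamma k \<mu>' TYPE('n) * Delta_pow z (- \<mu>') * Hyp (\<mu>' # \<mu>) \<nu> w (cinv z)"
proof -
  let ?r = "%\<eta> :: 'n => nat. gpochs k \<mu> (dec_rearr \<eta>) / gpochs k \<nu> (dec_rearr \<eta>)"
  obtain C where C: "0 <= C" "\<And>\<eta> :: 'n => nat. norm (gpochs k \<mu> \<eta> / gpochs k \<nu> \<eta>) <= C * \<delta> ^ mdeg \<eta>"
    using gpochs_ratio_bound[OF d, of k] by blast
  have rb: "norm (?r \<eta>) <= C * \<delta> ^ mdeg \<eta>" for \<eta> using C(2)[of "dec_rearr \<eta>"] by (simp only: mdeg_dec_rearr)
  have g: "gpochs k (\<mu>' # \<mu>) \<eta> / gpochs k \<nu> \<eta> = gpoch k \<mu>' \<eta> * (gpochs k \<mu> \<eta> / gpochs k \<nu> \<eta>)" for \<eta> :: "'n => nat"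
    by (simp add: gpochs_def)
  from Hyp consider "Hyp = hypK k" | "Hyp = hypF k" by blast
  then show ?thesis
  proof cases
    case 1
    have hom: "hom m (tK k w \<eta>)" if "\<eta> \<in> mi m" for m \<eta>
      unfolding tK_eq[OF k, abs_def] by (rule hom_cmult) (use jf_hom[of \<eta> k] that in simp)
    have rb': "norm (?r \<eta>) <= C * \<delta> ^ m" if "\<eta> \<in> mi m" for m \<eta> using rb[of \<eta>] that by simp
    note L = laplace_series[OF k a z finite_mdeg hom lap_tK[OF k a z] sum_tK[OF k] norm_ge_zero rb' C(1) d(1) c]
    show ?thesis unfolding f_def 1 hypK_eq g using L by simp
  next
    case 2
    let ?A = "%m. {lam :: 'n => nat. is_partition lam \<and> mdeg lam = m}"
    have fA: "finite (?A m)" for m by (rule finite_subset[OF _ finite_mdeg[of m]]) auto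
    have hom: "hom m (tF k w \<eta>)" if "\<eta> \<in> ?A m" for m \<eta> using tF_hom[OF k, of \<eta> w] that by simp
    have rb': "norm (?r \<eta>) <= C * \<delta> ^ m" if "\<eta> \<in> ?A m" for m \<eta> using rb[of \<eta>] that by simp
    have lt: "lap k (\<mu>' - of_real (k * (real CARD('n) - 1))) (tF k w \<eta>) z = mGamma k \<mu>' TYPE('n) * gpoch k \<mu>' (dec_rearr \<eta>) * gg \<mu>' (tF k w \<eta>) z"
      if "\<eta> \<in> ?A m" for m \<eta> using lap_tF[OF k a z, of \<eta> w] that by (simp add: dec_rearr_partition)
    note L = laplace_series[OF k a z fA hom lt sum_tF[OF k] norm_ge_zero rb' C(1) d(1) c]
    show ?thesis unfolding f_def 2 hypF_eq g using L by simp
  qed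
qed

lemma laplace_hyp_cases:
  fixes z w :: "complex^'n::{finite,linorder}"
  assumes k: "0 <= k" and a: "k * (real CARD('n) - 1) < Re \<mu>'" and z: "HR z" and Hyp: "Hyp \<in> {hypK k, hypF k}"
    and l: "length \<mu> < length \<nu> \<or> length \<mu> = length \<nu> \<and> (MAX i. norm (w$i)) * (MAX i. 1 / Re (z$i)) < 1 / real CARD('n)"
  defines "f \<equiv> %x. dunkl_kernel k (- z) (cvec x) * Hyp \<mu> \<nu> w (cvec x)
       * Delta_pow (cvec x) (\<mu>' - of_real (k * (real CARD('n) - 1)) - 1) * of_real (weight k x)"
  shows "set_integrable lborel posorth f \<and>
     (LINT x:posorth|lborel. f x) = mGamma k \<mu>' TYPE('n) * Delta_pow z (- \<mu>') * Hyp (\<mu>' # \<mu>) \<nu> w (cinv z)"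
proof -
  have "\<exists>c \<delta>. (\<forall>i. c <= Re (z $ i)) \<and> \<delta> * norm w < c \<and> 0 < \<delta> \<and> (length \<mu> < length \<nu> \<or> length \<mu> = length \<nu> \<and> 1 < \<delta>)"
    using l
  proof
    assume l: "length \<mu> < length \<nu>"
    obtain c where c: "0 < c" "\<And>i. c <= Re (z $ i)" using HR_lower[OF z] by blast
    \<comment> \<open>For p < q any positive \<delta> is admissible, so it is taken small enough for
      \<delta> |w| < c; the 1 in the denominator covers w = 0.\<close>
    define \<delta> where "\<delta> = c / (2 * (1 + norm w))"
    have w1: "0 < 1 + norm w" by (simp add: add_pos_nonneg)
    then have "norm w / (2 * (1 + norm w)) < 1" by (simp add: field_simps)
    then have "c * (norm w / (2 * (1 + norm w))) < c * 1" using c(1) by (intro mult_strict_left_mono)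
    moreover have "0 < \<delta>" using c(1) w1 by (simp add: \<delta>_def)
    ultimately show ?thesis using l c(2) by (intro exI[of _ c] exI[of _ \<delta>]) (simp add: \<delta>_def)
  next
    assume l: "length \<mu> = length \<nu> \<and> (MAX i. norm (w$i)) * (MAX i. 1 / Re (z$i)) < 1 / real CARD('n)"
    define M where "M = (MAX i. 1 / Re (z$i))"
    define m where "m = (MAX i. norm (w$i))"
    have M: "1 / Re (z $ i) <= M" for i unfolding M_def by (intro Max_ge) auto
    have m: "norm (w $ i) <= m" for i unfolding m_def by (intro Max_ge) auto
    have "0 < 1 / Re (z $ undefined)" using z by simp
    then have M0: "0 < M" using M[of undefined] by linarith
    \<comment> \<open>This is the minimum of the Re z_i, expressed through the maximum in the
      hypothesis.\<close>
    define c where "c = 1 / M"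
    have c: "c <= Re (z $ i)" for i using M[of i] M0 z[rule_format, of i] by (simp add: c_def field_simps)
    have "norm w <= (\<Sum>i\<in>UNIV. norm (w $ i))" unfolding norm_vec_def
      using L2_set_le_sum_abs[of "%i. norm (w $ i)" "UNIV :: 'n set"] by simp
    also have "... <= real CARD('n) * m" using m by (intro sum_bounded_above) auto
    also have "... < c" using l M0 unfolding m_def[symmetric] M_def[symmetric] c_def by (simp add: field_simps)
    finally have wc: "norm w < c" .
    have "\<exists>\<delta>>1. \<delta> * norm w < c"
    proof (cases "norm w = 0")
      case True
      then show ?thesis using wc by (intro exI[of _ 2]) auto
    next
      case False
      then have "0 < norm w" by simp
      \<comment> \<open>With this \<delta> the product \<delta> |w| is the midpoint of |w| and c, so
        \<delta> > 1.\<close>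
      then show ?thesis using wc by (intro exI[of _ "(c + norm w) / (2 * norm w)"]) (auto simp: field_simps)
    qed
    then obtain \<delta> where \<delta>: "1 < \<delta>" "\<delta> * norm w < c" by blast
    then show ?thesis using l c by (intro exI[of _ c] exI[of _ \<delta>]) auto
  qed
  then obtain c \<delta> where c: "\<And>i. c <= Re (z $ i)" "\<delta> * norm w < c" and \<delta>: "0 < \<delta>" "length \<mu> < length \<nu> \<or> length \<mu> = length \<nu> \<and> 1 < \<delta>" by blast
  show ?thesis unfolding f_def by (rule laplace_hyp[OF k a z \<delta> c Hyp])
qed

theorem theorem6p7:
  fixes k :: real and \<mu> \<nu> :: "complex list" and \<mu>' :: complex
    and nty :: "'n::{finite,linorder} itself"
  defines "n \<equiv> CARD('n::{finite,linorder})"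
  defines "\<mu>0 \<equiv> k * (real n - 1)"
  assumes k: "0 \<le> k"
    and \<nu>: "\<forall>i<length \<nu>. \<forall>j<n. \<forall>m::nat. \<nu> ! i \<noteq> of_real (k * real j) - of_nat m"
    and \<mu>': "Re \<mu>' > \<mu>0"
  shows
   "(\<forall>Hyp \<in> {hypK k, hypF k}.
      (length \<mu> < length \<nu> \<longrightarrow>
        (\<forall>z w :: complex^('n::{finite,linorder}). (\<forall>i. Re (z$i) > 0) \<longrightarrow>
           set_integrable lborel posorth
             (\<lambda>x. dunkl_kernel k (- z) (cvec x) * Hyp \<mu> \<nu> w (cvec x)
                  * Delta_pow (cvec x) (\<mu>' - of_real \<mu>0 - 1) * of_real (weight k x))
         \<and> (LINT x:posorth|lborel.
              dunkl_kernel k (- z) (cvec x) * Hyp \<mu> \<nu> w (cvec x)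
                  * Delta_pow (cvec x) (\<mu>' - of_real \<mu>0 - 1) * of_real (weight k x))
           = mGamma k \<mu>' TYPE('n::{finite,linorder}) * Delta_pow z (- \<mu>') * Hyp (\<mu>' # \<mu>) \<nu> w (cinv z)))
    \<and> (length \<mu> = length \<nu> \<longrightarrow>
        (\<forall>z w :: complex^('n::{finite,linorder}). (\<forall>i. Re (z$i) > 0)
           \<longrightarrow> (MAX i. norm (w$i)) * (MAX i. 1 / Re (z$i)) < 1 / real n \<longrightarrow>
           set_integrable lborel posorth
             (\<lambda>x. dunkl_kernel k (- z) (cvec x) * Hyp \<mu> \<nu> w (cvec x)
                  * Delta_pow (cvec x) (\<mu>' - of_real \<mu>0 - 1) * of_real (weight k x))
         \<and> (LINT x:posorth|lborel.
              dunkl_kernel k (- z) (cvec x) * Hyp \<mu> \<nu> w (cvec x)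
                  * Delta_pow (cvec x) (\<mu>' - of_real \<mu>0 - 1) * of_real (weight k x))
           = mGamma k \<mu>' TYPE('n::{finite,linorder}) * Delta_pow z (- \<mu>') * Hyp (\<mu>' # \<mu>) \<nu> w (cinv z))))"
proof -
  have "k * (real CARD('n) - 1) < Re \<mu>'" using \<mu>' by (simp add: \<mu>0_def n_def)
  note L = laplace_hyp_cases[OF k this]
  show ?thesis unfolding \<mu>0_def n_def using L by blast
qed

end
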